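(* For $\beta\in\{0,1\}$, the $L^2$-projection $\mathcal S_h^\beta$ is stable on $V_{x,h}$ with respect to the $H_h^1(\Omega_x)$-norm, that is, $$\|\mathcal S_h^\beta q_h\|_{H_h^1(\Omega_x)}\lesssim\|q_h\|_{H_h^1(\Omega_x)}\qquad\forall q_h\in V_{x,h}.$$
   Context: $\Omega_x\subset\mathbb R^3$ is a bounded Lipschitz domain such that the inverse Dirichlet Laplacian $S:L^2(\Omega_x)\to H_0^1(\Omega_x)$, defined by $(\nabla Sq,\nabla w)_{\Omega_x}=(q,w)_{\Omega_x}$ for all $w\in H_0^1(\Omega_x)$, satisfies $\|Sq\|_{H^2(\Omega_x)}\lesssim\|q\|_{L^2(\Omega_x)}$ for all $q\in L^2(\Omega_x)$ (standing assumption). $\mathcal T_{x,h}$ is a quasi-uniform, shape-regular mesh of $\Omega_x$ of open polyhedral cells of maximum diameter $h_x$; $\mathcal E^I_{x,h}$ is the set of interior faces. On an interior face $e=\partial K^+\cap\partial K^-$ with outward unit normals $n^\pm$, $[\![z]\!]=z|_{K^+}n^++z|_{K^-}n^-$. For an integer $k_x\ge0$, $V_{x,h}$ is the space of $L^2(\Omega_x)$ functions whose restriction to each cell is a polynomial of degree at most $k_x$ in each variable; $V_{x,h}^0=\{q_h\in V_{x,h}:q_h|_{\partial\Omega_x}=0\}$ and $S_{x,h}^0=V_{x,h}^0\cap C^0(\overline{\Omega_x})$. $\mathcal S_h^\beta$ is the $L^2(\Omega_x)$-orthogonal projection from $L^2(\Omega_x)$ onto $V_{x,h}^0$ if $\beta=1$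 and onto $S_{x,h}^0$ if $\beta=0$. With $\nabla_x$ taken cellwise, $$\|q_h\|_{H_h^1(\Omega_x)}^2=\|\nabla_xq_h\|_{L^2(\Omega_x)}^2+\frac1{h_x}\|[\![q_h]\!]\|_{L^2(\mathcal E^I_{x,h})}^2+\frac1{h_x}\|q_h\|_{L^2(\partial\Omega_x)}^2.$$ $a\lesssim b$ means $a\le Cb$ with $C>0$ independent of $h_x$ (and of the functions involved); $C$ may depend on $\Omega_x$, $k_x$ and $h_x$-independent mesh parameters (shape-regularity, quasi-uniformity).
   Formalization: For β=0, k_x≥1 it is also assumed that S⁰_{x,h} approximates H²∩H¹₀ functions in the H¹-seminorm to order h_x, uniformly (C depends on that constant): on sheared parallelepiped meshes with k_x=1 the claim fails. Shape-regularity includes a bound on face planes per cell. *)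

theory Defs
  imports "HOL-Analysis.Analysis"
begin

section \<open>Lipschitz domains\<close>

(* Near each boundary point, the set is the strict epigraph, in some unit direction e, of a
   Lipschitz function g of the component orthogonal to e. *)
definition bounded_lipschitz_domain :: "(real^3) set \<Rightarrow> bool" where
  "bounded_lipschitz_domain \<Omega> \<longleftrightarrow>
     open \<Omega> \<and> connected \<Omega> \<and> bounded \<Omega> \<and> \<Omega> \<noteq> {} \<and>
     (\<forall>x\<in>frontier \<Omega>. \<exists>e g L r. norm e = 1 \<and> 0 < r \<and> L-lipschitz_on {z. e \<bullet> z = 0} g \<and>
        (\<forall>y\<in>ball x r. y \<in> \<Omega> \<longleftrightarrow> g (y - (e \<bullet> y) *\<^sub>R e) < e \<bullet> y))"

section \<open>Sobolev spaces\<close>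

(* Elements of Lebesgue and Sobolev spaces are functions, not equivalence classes; only their
   values almost everywhere on the set matter. *)

definition L2_space :: "(real^3) set \<Rightarrow> (real^3 \<Rightarrow> real) set" where
  "L2_space \<Omega> = {f. f \<in> borel_measurable (lebesgue_on \<Omega>) \<and>
                    integrable (lebesgue_on \<Omega>) (\<lambda>x. (f x)\<^sup>2)}"

definition L2_inner :: "(real^3) set \<Rightarrow> (real^3 \<Rightarrow> real) \<Rightarrow> (real^3 \<Rightarrow> real) \<Rightarrow> real" where
  "L2_inner \<Omega> f g = (LINT x|lebesgue_on \<Omega>. f x * g x)"

definition L2_norm :: "(real^3) set \<Rightarrow> (real^3 \<Rightarrow> real) \<Rightarrow> real" where
  "L2_norm \<Omega> f = sqrt (L2_inner \<Omega> f f)"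

definition partial_deriv :: "3 \<Rightarrow> (real^3 \<Rightarrow> real) \<Rightarrow> real^3 \<Rightarrow> real" where
  "partial_deriv i f x = frechet_derivative f (at x) (axis i 1)"

definition gradient :: "(real^3 \<Rightarrow> real) \<Rightarrow> real^3 \<Rightarrow> real^3" where
  "gradient f x = (\<chi> i. partial_deriv i f x)"

(* Smoothness: all iterated partial derivatives are (totally) differentiable everywhere. *)
definition test_function :: "(real^3) set \<Rightarrow> (real^3 \<Rightarrow> real) \<Rightarrow> bool" where
  "test_function \<Omega> \<phi> \<longleftrightarrow>
     (\<forall>is x. foldr partial_deriv is \<phi> differentiable (at x)) \<and>
     (\<exists>D. compact D \<and> D \<subseteq> \<Omega> \<and> (\<forall>x. x \<notin> D \<longrightarrow> \<phi> x = 0))"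

definition has_weak_partial ::
    "(real^3) set \<Rightarrow> 3 \<Rightarrow> (real^3 \<Rightarrow> real) \<Rightarrow> (real^3 \<Rightarrow> real) \<Rightarrow> bool" where
  "has_weak_partial \<Omega> i u g \<longleftrightarrow>
     (\<forall>\<phi>. test_function \<Omega> \<phi> \<longrightarrow> L2_inner \<Omega> u (partial_deriv i \<phi>) = - L2_inner \<Omega> g \<phi>)"

(* Weak derivatives are unique up to null sets, so the choice is immaterial. *)
definition weak_partial :: "(real^3) set \<Rightarrow> 3 \<Rightarrow> (real^3 \<Rightarrow> real) \<Rightarrow> real^3 \<Rightarrow> real" where
  "weak_partial \<Omega> i u = (SOME g. g \<in> L2_space \<Omega> \<and> has_weak_partial \<Omega> i u g)"

definition weak_gradient :: "(real^3) set \<Rightarrow> (real^3 \<Rightarrow> real) \<Rightarrow> real^3 \<Rightarrow> real^3" where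
  "weak_gradient \<Omega> u x = (\<chi> i. weak_partial \<Omega> i u x)"

definition H1_space :: "(real^3) set \<Rightarrow> (real^3 \<Rightarrow> real) set" where
  "H1_space \<Omega> = {u \<in> L2_space \<Omega>. \<forall>i. \<exists>g\<in>L2_space \<Omega>. has_weak_partial \<Omega> i u g}"

definition H1_norm :: "(real^3) set \<Rightarrow> (real^3 \<Rightarrow> real) \<Rightarrow> real" where
  "H1_norm \<Omega> u = sqrt ((L2_norm \<Omega> u)\<^sup>2 + (\<Sum>i\<in>UNIV. (L2_norm \<Omega> (weak_partial \<Omega> i u))\<^sup>2))"

definition H1_0_space :: "(real^3) set \<Rightarrow> (real^3 \<Rightarrow> real) set" where
  "H1_0_space \<Omega> = {u \<in> H1_space \<Omega>. \<exists>\<phi> :: nat \<Rightarrow> real^3 \<Rightarrow> real.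
      (\<forall>n. test_function \<Omega> (\<phi> n)) \<and> (\<lambda>n. H1_norm \<Omega> (\<lambda>x. u x - \<phi> n x)) \<longlonglongrightarrow> 0}"

definition H2_space :: "(real^3) set \<Rightarrow> (real^3 \<Rightarrow> real) set" where
  "H2_space \<Omega> = {u \<in> H1_space \<Omega>. \<forall>i. weak_partial \<Omega> i u \<in> H1_space \<Omega>}"

definition H2_norm :: "(real^3) set \<Rightarrow> (real^3 \<Rightarrow> real) \<Rightarrow> real" where
  "H2_norm \<Omega> u = sqrt ((H1_norm \<Omega> u)\<^sup>2 +
     (\<Sum>i\<in>UNIV. \<Sum>j\<in>UNIV. (L2_norm \<Omega> (weak_partial \<Omega> j (weak_partial \<Omega> i u)))\<^sup>2))"

definition inverse_dirichlet_laplacian ::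
    "(real^3) set \<Rightarrow> ((real^3 \<Rightarrow> real) \<Rightarrow> real^3 \<Rightarrow> real) \<Rightarrow> bool" where
  "inverse_dirichlet_laplacian \<Omega> S \<longleftrightarrow>
     (\<forall>q\<in>L2_space \<Omega>. S q \<in> H1_0_space \<Omega> \<and>
        (\<forall>w\<in>H1_0_space \<Omega>.
           (LINT x|lebesgue_on \<Omega>. weak_gradient \<Omega> (S q) x \<bullet> weak_gradient \<Omega> w x)
             = L2_inner \<Omega> q w))"

definition H2_regular :: "(real^3) set \<Rightarrow> bool" where
  "H2_regular \<Omega> \<longleftrightarrow>
     (\<exists>S C. inverse_dirichlet_laplacian \<Omega> S \<and>
        (\<forall>q\<in>L2_space \<Omega>. S q \<in> H2_space \<Omega> \<and> H2_norm \<Omega> (S q) \<le> C * L2_norm \<Omega> q))"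

section \<open>Surface integrals over polyhedral surfaces\<close>

definition is_plane :: "(real^3) set \<Rightarrow> bool" where
  "is_plane P \<longleftrightarrow> (\<exists>n c. norm n = 1 \<and> P = {x. n \<bullet> x = c})"

(* Area on a plane, transported by an isometric parametrization; by invariance of Lebesgue
   measure under isometries, the choice of parametrization is immaterial. *)
definition plane_measure :: "(real^3) set \<Rightarrow> (real^3) measure" where
  "plane_measure P = distr lborel borel
     (SOME \<phi> :: real^2 \<Rightarrow> real^3. (\<forall>s t. dist (\<phi> s) (\<phi> t) = dist s t) \<and> range \<phi> = P)"

(* Meant for closed G contained in finitely many planes: then only finitely many planes meet G
   in positive area, and they cover G up to sets of area 0. *)
definition surface_integral :: "(real^3) set \<Rightarrow> (real^3 \<Rightarrow> real) \<Rightarrow> real" where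
  "surface_integral G f =
     (\<Sum>P | is_plane P \<and> 0 < emeasure (plane_measure P) (G \<inter> P).
        LINT x:G \<inter> P|plane_measure P. f x)"

definition surface_AE :: "(real^3) set \<Rightarrow> (real^3 \<Rightarrow> bool) \<Rightarrow> bool" where
  "surface_AE G Q \<longleftrightarrow> (\<forall>P. is_plane P \<longrightarrow> (AE x in plane_measure P. x \<in> G \<longrightarrow> Q x))"

section \<open>Polyhedral meshes\<close>

(* Cells need not be convex. *)
definition open_polyhedron :: "(real^3) set \<Rightarrow> bool" where
  "open_polyhedron K \<longleftrightarrow> K \<noteq> {} \<and> connected K \<and>
     (\<exists>\<P>. finite \<P> \<and> (\<forall>P\<in>\<P>. polytope P) \<and> K = interior (\<Union>\<P>))"

(* Hanging nodes are allowed. *)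
definition polyhedral_mesh :: "(real^3) set \<Rightarrow> (real^3) set set \<Rightarrow> bool" where
  "polyhedral_mesh \<Omega> T \<longleftrightarrow> finite T \<and> (\<forall>K\<in>T. open_polyhedron K \<and> K \<subseteq> \<Omega>) \<and>
     pairwise disjnt T \<and> closure \<Omega> = (\<Union>K\<in>T. closure K)"

definition mesh_size :: "(real^3) set set \<Rightarrow> real" where
  "mesh_size T = Max (diameter ` T)"

(* For tetrahedra the bound on the number N of face planes is automatic; for general polyhedra
   it is the usual part of shape regularity that controls the boundary area of a cell. *)
definition shape_regular :: "real \<Rightarrow> nat \<Rightarrow> (real^3) set set \<Rightarrow> bool" where
  "shape_regular \<rho> N T \<longleftrightarrow>
     (\<forall>K\<in>T. (\<exists>x. ball x (\<rho> * diameter K) \<subseteq> K) \<and>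
        (\<exists>\<H>. finite \<H> \<and> card \<H> \<le> N \<and> (\<forall>P\<in>\<H>. is_plane P) \<and> frontier K \<subseteq> \<Union>\<H>))"

definition quasi_uniform :: "real \<Rightarrow> (real^3) set set \<Rightarrow> bool" where
  "quasi_uniform \<rho> T \<longleftrightarrow> (\<forall>K\<in>T. \<rho> * mesh_size T \<le> diameter K)"

(* Well defined at points in the relative interior of the flat parts of the boundary, hence
   almost everywhere with respect to surface measure. *)
definition outward_normal :: "(real^3) set \<Rightarrow> real^3 \<Rightarrow> real^3" where
  "outward_normal K x = (SOME n. norm n = 1 \<and>
     (\<exists>r>0. \<forall>y\<in>ball x r. y \<in> K \<longleftrightarrow> n \<bullet> (y - x) < 0))"

section \<open>Discontinuous and continuous finite element spaces\<close>

definition Q_polys :: "nat \<Rightarrow> (real^3 \<Rightarrow> real) set" where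
  "Q_polys k = {p. \<exists>c :: nat \<Rightarrow> nat \<Rightarrow> nat \<Rightarrow> real.
     p = (\<lambda>x. \<Sum>i\<le>k. \<Sum>j\<le>k. \<Sum>l\<le>k. c i j l * (x$1)^i * (x$2)^j * (x$3)^l)}"

(* Each L2 class is represented by the function that vanishes off the open cells, so that
   equality of functions is equality of classes. *)
definition V_space :: "nat \<Rightarrow> (real^3) set set \<Rightarrow> (real^3 \<Rightarrow> real) set" where
  "V_space k T = {q. (\<forall>K\<in>T. \<exists>p\<in>Q_polys k. \<forall>x\<in>K. q x = p x) \<and> (\<forall>x. x \<notin> \<Union>T \<longrightarrow> q x = 0)}"

definition cell_trace :: "(real^3) set \<Rightarrow> (real^3 \<Rightarrow> real) \<Rightarrow> real^3 \<Rightarrow> real" where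
  "cell_trace K q x = Lim (at x within K) q"

definition jump ::
    "(real^3) set \<Rightarrow> (real^3) set \<Rightarrow> (real^3 \<Rightarrow> real) \<Rightarrow> real^3 \<Rightarrow> real^3" where
  "jump K K' q x = cell_trace K q x *\<^sub>R outward_normal K x + cell_trace K' q x *\<^sub>R outward_normal K' x"

definition V0_space ::
    "nat \<Rightarrow> (real^3) set \<Rightarrow> (real^3) set set \<Rightarrow> (real^3 \<Rightarrow> real) set" where
  "V0_space k \<Omega> T = {q \<in> V_space k T.
     \<forall>K\<in>T. surface_AE (frontier K \<inter> frontier \<Omega>) (\<lambda>x. cell_trace K q x = 0)}"

definition S0_space ::
    "nat \<Rightarrow> (real^3) set \<Rightarrow> (real^3) set set \<Rightarrow> (real^3 \<Rightarrow> real) set" where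
  "S0_space k \<Omega> T = {q \<in> V0_space k \<Omega> T.
     \<exists>f. continuous_on (closure \<Omega>) f \<and> (\<forall>x\<in>\<Union>T. q x = f x)}"

definition L2_projection ::
    "(real^3) set \<Rightarrow> (real^3 \<Rightarrow> real) set \<Rightarrow> (real^3 \<Rightarrow> real) \<Rightarrow> real^3 \<Rightarrow> real" where
  "L2_projection \<Omega> W q = (THE p. p \<in> W \<and> (\<forall>w\<in>W. L2_inner \<Omega> (\<lambda>x. q x - p x) w = 0))"

definition S_proj ::
    "nat \<Rightarrow> nat \<Rightarrow> (real^3) set \<Rightarrow> (real^3) set set \<Rightarrow> (real^3 \<Rightarrow> real) \<Rightarrow> real^3 \<Rightarrow> real" where
  "S_proj \<beta> k \<Omega> T = L2_projection \<Omega> (if \<beta> = 0 then S0_space k \<Omega> T else V0_space k \<Omega> T)"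

(* The interior faces are the sets frontier K \<inter> frontier K' of positive area for distinct
   cells K, K'.  The sum runs over ordered pairs and meets each face twice, whence the 1/2;
   pairs of cells that share no face contribute 0. *)
definition H1h_norm :: "(real^3) set \<Rightarrow> (real^3) set set \<Rightarrow> (real^3 \<Rightarrow> real) \<Rightarrow> real" where
  "H1h_norm \<Omega> T q = sqrt (
     (\<Sum>K\<in>T. LINT x|lebesgue_on K. (norm (gradient q x))\<^sup>2)
     + 1 / mesh_size T * (1/2 * (\<Sum>K\<in>T. \<Sum>K'\<in>T - {K}.
         surface_integral (frontier K \<inter> frontier K') (\<lambda>x. (norm (jump K K' q x))\<^sup>2)))
     + 1 / mesh_size T * (\<Sum>K\<in>T.
         surface_integral (frontier K \<inter> frontier \<Omega>) (\<lambda>x. (cell_trace K q x)\<^sup>2)))"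

(* The standard first-order approximation of H2 functions with zero trace by conforming finite
   element functions; it holds with fixed \<gamma> for k \<ge> 1 on shape-regular families of matching
   tetrahedral meshes or of axis-parallel box meshes.  For polynomials in the physical coordinates
   on arbitrary polyhedra it does not follow from shape regularity, and without it the projection
   onto S0_space need not be stable: glue a cube to sheared parallelepipeds; for k = 1, continuity
   forces S0_space to vanish on the sheared part, so projections of smooth functions develop a
   layer of width h along the faces of the cube. *)
definition conforming_approximation ::
    "real \<Rightarrow> nat \<Rightarrow> (real^3) set \<Rightarrow> (real^3) set set \<Rightarrow> bool" where
  "conforming_approximation \<gamma> k \<Omega> T \<longleftrightarrow>
     (\<forall>v\<in>H2_space \<Omega> \<inter> H1_0_space \<Omega>. \<exists>w\<in>S0_space k \<Omega> T.
        sqrt (LINT x|lebesgue_on \<Omega>. (norm (weak_gradient \<Omega> v x - gradient w x))\<^sup>2)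
          \<le> \<gamma> * mesh_size T * H2_norm \<Omega> v)"

end

theory Submission imports Defs begin

text \<open>
  The translation modulus of a finite element function at scale \<open>h\<close> is at most a constant times \<open>h\<close> times
  its \<open>H\<^sub>h\<^sup>1\<close> norm: along almost every line segment of length at most \<open>h\<close> the increment consists of an
  integral of the cellwise derivative and of boundedly many jumps.  By the
  inverse estimate it suffices to prove that the \<open>L\<^sup>2\<close> error of the projection of \<open>q\<close> is at most a constant times \<open>h\<close> times
  the \<open>H\<^sub>h\<^sup>1\<close> norm of \<open>q\<close>.

  For \<open>\<beta> = 1\<close>, compare with \<open>q\<close> set to zero on the boundary cells: translating by finitely many vectors
  that leave the Lipschitz domain bounds the \<open>L\<^sup>2\<close> norm of \<open>q\<close> near the boundary by its translation
  modulus.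

  For \<open>\<beta> = 0\<close>, the error \<open>r\<close> is orthogonal to the conforming space, so by duality the gradient of the
  solution \<open>v\<close> of the Poisson problem with right-hand side \<open>r\<close> is at most a constant times \<open>h\<close> times the
  norm of \<open>r\<close>.  The squared norm of \<open>r\<close> is \<open>(r, q)\<close>; mollifying \<open>q\<close> at scale \<open>h\<close> to a test function
  \<open>\<psi>\<close>, the term \<open>(r, \<psi>)\<close> becomes the inner product of the gradients of \<open>v\<close> and \<open>\<psi>\<close>, where the gradient of \<open>\<psi>\<close>
  is bounded by the \<open>H\<^sub>h\<^sup>1\<close> norm of \<open>q\<close>.
\<close>

section \<open>Semi-inner products and square integrable functions\<close>

text \<open>The constants must be uniform over meshes whose cells may be nonconvex and have hanging
  nodes, so no trace inequality or interpolation on single cells is used; pointwise bounds for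
  polynomials on inscribed balls take their place. The scale \<open>h\<close> is dictated by the
  norm: a shift by \<open>h\<close> costs \<open>h^2\<close> times the gradient part and
  \<open>h\<close> times the jump part, which together are \<open>h^2\<close> times the energy
  because jumps carry the weight 1/h. The boundary term of the norm pays for extending
  \<open>q\<close> by zero.

  For \<beta> = 1 setting \<open>q\<close> to zero on boundary cells stays in the space. A
  continuous function cannot be cut off cell by cell, and the approximation hypothesis for \<beta> =
  0 speaks only of H2 functions; the Poisson problem supplies such functions through elliptic
  regularity. \<open>H1_0_space\<close> is a closure of test functions, and the Green formula is
  extended to piecewise polynomials by weak limits instead of by showing membership
  (\<open>green_pw\<close>). For \<beta> = 0 and \<open>k = 0\<close> all conforming functions have
  norm zero.\<close>

definition lin_set :: "('a \<Rightarrow> real) set \<Rightarrow> bool" where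
  "lin_set W \<longleftrightarrow> (\<lambda>_. 0) \<in> W \<and> (\<forall>f\<in>W. \<forall>g\<in>W. \<forall>a. (\<lambda>x. f x + a * g x) \<in> W)"

definition semi_inner_on :: "('a \<Rightarrow> real) set \<Rightarrow> (('a \<Rightarrow> real) \<Rightarrow> ('a \<Rightarrow> real) \<Rightarrow> real) \<Rightarrow> bool" where
  "semi_inner_on W B \<longleftrightarrow> (\<forall>f\<in>W. \<forall>g\<in>W. B f g = B g f) \<and> (\<forall>f\<in>W. 0 \<le> B f f) \<and>
     (\<forall>f\<in>W. \<forall>g\<in>W. \<forall>h\<in>W. \<forall>a. B (\<lambda>x. f x + a * g x) h = B f h + a * B g h)"

definition linear_form_on :: "('a \<Rightarrow> real) set \<Rightarrow> (('a \<Rightarrow> real) \<Rightarrow> real) \<Rightarrow> bool" where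
  "linear_form_on W F \<longleftrightarrow> (\<forall>f\<in>W. \<forall>g\<in>W. \<forall>a. F (\<lambda>x. f x + a * g x) = F f + a * F g)"

lemma lin_set_zero: "lin_set W \<Longrightarrow> (\<lambda>_. 0) \<in> W"
  by (simp add: lin_set_def)

lemma lin_set_comb: "lin_set W \<Longrightarrow> f \<in> W \<Longrightarrow> g \<in> W \<Longrightarrow> (\<lambda>x. f x + a * g x) \<in> W"
  by (simp add: lin_set_def)

lemma lin_set_scale: "lin_set W \<Longrightarrow> g \<in> W \<Longrightarrow> (\<lambda>x. a * g x) \<in> W"
  using lin_set_comb[of W "\<lambda>_. 0" g a] by (simp add: lin_set_zero)

lemma lin_set_diff: "lin_set W \<Longrightarrow> f \<in> W \<Longrightarrow> g \<in> W \<Longrightarrow> (\<lambda>x. f x - g x) \<in> W"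
  using lin_set_comb[of W f g "-1"] by simp

lemma lin_set_add: "lin_set W \<Longrightarrow> f \<in> W \<Longrightarrow> g \<in> W \<Longrightarrow> (\<lambda>x. f x + g x) \<in> W"
  using lin_set_comb[of W f g "1"] by simp

lemma lin_set_sum:
  assumes "lin_set W" "\<And>i. i \<in> I \<Longrightarrow> f i \<in> W"
  shows "(\<lambda>x. \<Sum>i\<in>I. f i x) \<in> W"
  using assms(2)
proof (induction I rule: infinite_finite_induct)
  case (insert i F)
  then show ?case using lin_set_add[OF assms(1), of "f i" "\<lambda>x. \<Sum>i\<in>F. f i x"] by simp
qed (use lin_set_zero[OF assms(1)] in auto)

lemma semi_inner_sym: "semi_inner_on W B \<Longrightarrow> f \<in> W \<Longrightarrow> g \<in> W \<Longrightarrow> B f g = B g f"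
  and semi_inner_ge0: "semi_inner_on W B \<Longrightarrow> f \<in> W \<Longrightarrow> 0 \<le> B f f"
  and semi_inner_left: "semi_inner_on W B \<Longrightarrow> f \<in> W \<Longrightarrow> g \<in> W \<Longrightarrow> h \<in> W \<Longrightarrow>
     B (\<lambda>x. f x + a * g x) h = B f h + a * B g h"
  by (auto simp: semi_inner_on_def)

lemma semi_inner_right:
  "lin_set W \<Longrightarrow> semi_inner_on W B \<Longrightarrow> f \<in> W \<Longrightarrow> g \<in> W \<Longrightarrow> h \<in> W \<Longrightarrow>
     B h (\<lambda>x. f x + a * g x) = B h f + a * B h g"
proof -
  assume *: "lin_set W" "semi_inner_on W B" "f \<in> W" "g \<in> W" "h \<in> W"
  have "B h (\<lambda>x. f x + a * g x) = B (\<lambda>x. f x + a * g x) h"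
    by (rule semi_inner_sym[OF *(2,5) lin_set_comb[OF *(1,3,4)]])
  also have "\<dots> = B f h + a * B g h" by (rule semi_inner_left[OF *(2-5)])
  also have "\<dots> = B h f + a * B h g" using semi_inner_sym[OF *(2)] *(3-5) by auto
  finally show ?thesis .
qed

lemma semi_inner_expand:
  assumes "lin_set W" "semi_inner_on W B" "f \<in> W" "g \<in> W"
  shows "B (\<lambda>x. f x + a * g x) (\<lambda>x. f x + a * g x) = B f f + 2 * a * B f g + a\<^sup>2 * B g g"
proof -
  have fg: "(\<lambda>x. f x + a * g x) \<in> W" using assms lin_set_comb by blast
  have "B (\<lambda>x. f x + a * g x) (\<lambda>x. f x + a * g x) = B f (\<lambda>x. f x + a * g x) + a * B g (\<lambda>x. f x + a * g x)"
    by (rule semi_inner_left[OF assms(2,3,4) fg])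
  also have "\<dots> = B f f + a * B f g + a * (B g f + a * B g g)"
    using semi_inner_right[OF assms(1,2)] assms(3,4) by simp
  finally show ?thesis using semi_inner_sym[OF assms(2), of g f] assms(3,4)
    by (simp add: algebra_simps power2_eq_square)
qed

lemma semi_inner_Cauchy_Schwarz:
  assumes "lin_set W" "semi_inner_on W B" "f \<in> W" "g \<in> W"
  shows "(B f g)\<^sup>2 \<le> B f f * B g g"
proof -
  have q: "0 \<le> B f f + 2 * a * B f g + a\<^sup>2 * B g g" for a
    using semi_inner_expand[OF assms, of a] semi_inner_ge0[OF assms(2) lin_set_comb[OF assms(1,3,4), of a]] by simp
  show ?thesis
  proof (cases "B g g = 0")
    case True
    \<comment> \<open>With \<open>B g g = 0\<close> the quadratic in \<open>a\<close> is affine, and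
      it can stay nonnegative for all \<open>a\<close> only if its slope vanishes.\<close>
    have "B f g = 0"
    proof (rule ccontr)
      assume "B f g \<noteq> 0"
      then have "2 * (- (B f f + 1) / (2 * B f g)) * B f g = - (B f f + 1)" by simp
      then show False using q[of "- (B f f + 1) / (2 * B f g)"] True by simp
    qed
    then show ?thesis using True by simp
  next
    case False
    then have "B g g > 0" using semi_inner_ge0[OF assms(2,4)] by simp
    define b where "b = B f g"
    define c where "c = B g g"
    have c: "c > 0" using \<open>B g g > 0\<close> by (simp add: c_def)
    \<comment> \<open>The quadratic in \<open>a\<close> takes its minimum at
      \<open>- b / c\<close>.\<close>
    have "0 \<le> (B f f + 2 * (- b / c) * b + (- b / c)\<^sup>2 * c) * c"
      using q[of "- b / c"] c by (auto simp: b_def c_def)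
    also have "\<dots> = B f f * c - b\<^sup>2" using c by (simp add: field_simps power2_eq_square)
    finally show ?thesis by (simp add: b_def c_def)
  qed
qed

lemma linear_form_zero: "linear_form_on W F \<Longrightarrow> lin_set W \<Longrightarrow> F (\<lambda>_. 0) = 0"
proof -
  assume "linear_form_on W F" "lin_set W"
  then show ?thesis
    using bspec[OF bspec[OF \<open>linear_form_on W F\<close>[unfolded linear_form_on_def], of "\<lambda>_. 0"], of "\<lambda>_. 0", THEN spec, of 1]
      lin_set_zero[OF \<open>lin_set W\<close>] by simp
qed

text \<open>The finite set \<open>X\<close> of evaluation functionals bounds the dimension; the form \<open>B\<close> may be degenerate.\<close>
lemma finite_dim_riesz:
  assumes "finite X" "lin_set W" "\<And>w. w \<in> W \<Longrightarrow> (\<And>x. x \<in> X \<Longrightarrow> w x = 0) \<Longrightarrow> w = (\<lambda>_. 0)"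
    and B: "semi_inner_on W B" and F: "linear_form_on W F" "\<And>w. w \<in> W \<Longrightarrow> B w w = 0 \<Longrightarrow> F w = 0"
  shows "\<exists>p\<in>W. \<forall>w\<in>W. B p w = F w"
  using assms
proof (induction X arbitrary: W F rule: finite_induct)
  case empty
  let ?z = "\<lambda>_::'a. 0::real"
  have z: "?z \<in> W" using lin_set_zero[OF empty.prems(1)] .
  have W: "w = ?z" if "w \<in> W" for w using empty.prems(2)[OF that] by simp
  have "B (\<lambda>x. ?z x + 1 * ?z x) ?z = B ?z ?z + 1 * B ?z ?z"
    by (rule semi_inner_left[OF empty.prems(3) z z z])
  then have "B ?z ?z = 0" by simp
  moreover have "F ?z = 0" using linear_form_zero[OF empty.prems(4,1)] .
  ultimately have "B ?z w = F w" if "w \<in> W" for w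
    unfolding W[OF that] by (simp only:)
  then show ?case using z by blast
next
  case (insert x X)
  \<comment> \<open>The induction gives up one evaluation: on the functions vanishing at
    \<open>x\<close> the remaining points still separate.\<close>
  define W' where "W' = {w \<in> W. w x = 0}"
  have sub: "W' \<subseteq> W" by (auto simp: W'_def)
  have lin': "lin_set W'" using insert.prems(1) by (auto simp: W'_def lin_set_def)
  have sep': "w = (\<lambda>_. 0)" if "w \<in> W'" "\<And>y. y \<in> X \<Longrightarrow> w y = 0" for w
    using that insert.prems(2)[of w] by (auto simp: W'_def)
  have B': "semi_inner_on W' B" using insert.prems(3) sub unfolding semi_inner_on_def by blast
  have IH: "\<exists>p\<in>W'. \<forall>w\<in>W'. B p w = G w" if "linear_form_on W G" "\<And>w. w \<in> W \<Longrightarrow> B w w = 0 \<Longrightarrow> G w = 0" for G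
    using insert.IH[OF lin' sep' B', of G] that sub unfolding linear_form_on_def by blast
  note lin = insert.prems(1) and BW = insert.prems(3) and F = insert.prems(4,5)
  obtain p' where p': "p' \<in> W'" "\<And>w. w \<in> W' \<Longrightarrow> B p' w = F w" using IH[OF F] by blast
  show ?case
  proof (cases "\<exists>w0\<in>W. w0 x \<noteq> 0")
    case False
    then have "W' = W" by (auto simp: W'_def)
    then show ?thesis using p' by blast
  next
    case True
    then obtain w1 where w1: "w1 \<in> W" "w1 x \<noteq> 0" by blast
    define w0 where "w0 = (\<lambda>y. (1 / w1 x) * w1 y)"
    have w0: "w0 \<in> W" "w0 x = 1" using lin_set_scale[OF lin w1(1), of "1 / w1 x"] w1 by (auto simp: w0_def)
    have "linear_form_on W (B w0)"
      unfolding linear_form_on_def using semi_inner_right[OF lin BW] w0 by blast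
    moreover have "B w0 w = 0" if "w \<in> W" "B w w = 0" for w
      using semi_inner_Cauchy_Schwarz[OF lin BW w0(1) that(1)] that by simp
    ultimately obtain p0 where p0: "p0 \<in> W'" "\<And>w. w \<in> W' \<Longrightarrow> B p0 w = B w0 w" using IH by blast
    \<comment> \<open>Subtracting the representative \<open>p0\<close> of \<open>B w0\<close> makes
      \<open>u\<close> orthogonal to \<open>W'\<close> while keeping the value 1 at
      \<open>x\<close>, so \<open>W\<close> is the orthogonal sum of \<open>W'\<close> and the line
      through \<open>u\<close>.\<close>
    define u where "u = (\<lambda>y. w0 y + (-1) * p0 y)"
    have u: "u \<in> W" unfolding u_def by (rule lin_set_comb[OF lin w0(1)]) (use p0 sub in auto)
    have ux: "u x = 1" using p0 w0 by (auto simp: u_def W'_def)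
    have uorth: "B u w = 0" if "w \<in> W'" for w
    proof -
      have "B u w = B w0 w + (-1) * B p0 w"
        unfolding u_def by (rule semi_inner_left[OF BW]) (use w0 p0 that sub in auto)
      then show ?thesis using p0 that by simp
    qed
    have dec: "\<exists>w'\<in>W'. w = (\<lambda>y. w' y + w x * u y)" if "w \<in> W" for w
    proof
      show "(\<lambda>y. w y + (- w x) * u y) \<in> W'"
        using lin_set_comb[OF lin that u, of "- w x"] ux by (auto simp: W'_def)
    qed (auto simp: fun_eq_iff)
    \<comment> \<open>If \<open>B u u = 0\<close>, then \<open>F u = 0\<close> as well, so the
      default 0 also satisfies \<open>c * B u u = F u\<close>.\<close>
    define c where "c = (if B u u = 0 then 0 else F u / B u u)"
    have cu: "c * B u u = F u" using F(2)[OF u] by (auto simp: c_def)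
    define p where "p = (\<lambda>y. p' y + c * u y)"
    have p: "p \<in> W" unfolding p_def using lin_set_comb[OF lin _ u] p' sub by blast
    have "B p w = F w" if wW: "w \<in> W" for w
    proof -
      obtain w' where w': "w' \<in> W'" "w = (\<lambda>y. w' y + w x * u y)" using dec[OF wW] by blast
      define a where "a = w x"
      have we: "w = (\<lambda>y. w' y + a * u y)" using w' a_def by simp
      have w'W: "w' \<in> W" "p' \<in> W" using w' p' sub by auto
      have 1: "B p w = B p' w + c * B u w"
        unfolding p_def by (rule semi_inner_left[OF BW w'W(2) u that])
      have 2: "B p' w = B p' w' + a * B p' u"
        unfolding we by (rule semi_inner_right[OF lin BW w'W(1) u w'W(2)])
      have 3: "B u w = B u w' + a * B u u"
        unfolding we by (rule semi_inner_right[OF lin BW w'W(1) u u])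
      have 4: "F w = F w' + a * F u"
        unfolding we using F(1) w'W u unfolding linear_form_on_def by blast
      have "B p' u = 0" using uorth[OF p'(1)] semi_inner_sym[OF BW u w'W(2)] by simp
      then show ?thesis using 1 2 3 4 p'(2)[OF w'(1)] uorth[OF w'(1)] cu by (simp add: algebra_simps)
    qed
    then show ?thesis using p by blast
  qed
qed

text \<open>Replaces the compactness argument for equivalence of norms in finite dimension:
  Cauchy-Schwarz with the Riesz representative \<open>p\<close> of \<open>F\<close> gives the
  constant \<open>B p p\<close>.\<close>

lemma finite_dim_form_bounded:
  assumes "finite X" "lin_set W" "\<And>w. w \<in> W \<Longrightarrow> (\<And>x. x \<in> X \<Longrightarrow> w x = 0) \<Longrightarrow> w = (\<lambda>_. 0)"
    and B: "semi_inner_on W B" and F: "linear_form_on W F" "\<And>w. w \<in> W \<Longrightarrow> B w w = 0 \<Longrightarrow> F w = 0"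
  shows "\<exists>C\<ge>0. \<forall>w\<in>W. (F w)\<^sup>2 \<le> C * B w w"
proof -
  obtain p where p: "p \<in> W" "\<And>w. w \<in> W \<Longrightarrow> B p w = F w" using finite_dim_riesz[OF assms] by blast
  then have "\<forall>w\<in>W. (F w)\<^sup>2 \<le> B p p * B w w"
    using semi_inner_Cauchy_Schwarz[OF assms(2) B p(1)] by force
  then show ?thesis using semi_inner_ge0[OF B p(1)] by blast
qed

section \<open>Square integrable functions\<close>

definition sqint :: "'a measure \<Rightarrow> ('a \<Rightarrow> real) set" where
  "sqint M = {f \<in> borel_measurable M. integrable M (\<lambda>x. (f x)\<^sup>2)}"

lemma sqint_prod:
  assumes "f \<in> sqint M" "g \<in> sqint M"
  shows "integrable M (\<lambda>x. f x * g x)"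
proof (rule Bochner_Integration.integrable_bound)
  show "integrable M (\<lambda>x. (f x)\<^sup>2 + (g x)\<^sup>2)" using assms by (auto simp: sqint_def)
  show "(\<lambda>x. f x * g x) \<in> borel_measurable M" using assms by (auto simp: sqint_def)
  have "\<bar>a * b\<bar> \<le> a\<^sup>2 + b\<^sup>2" for a b :: real
  proof -
    have "0 \<le> (\<bar>a\<bar> - \<bar>b\<bar>)\<^sup>2" by simp
    then have "2 * \<bar>a * b\<bar> \<le> a\<^sup>2 + b\<^sup>2" by (simp add: power2_diff abs_mult)
    then show ?thesis by (smt (verit) abs_ge_zero)
  qed
  then show "AE x in M. norm (f x * g x) \<le> norm ((f x)\<^sup>2 + (g x)\<^sup>2)" by (auto intro!: AE_I2)
qed

lemma lin_set_sqint: "lin_set (sqint M)"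
  unfolding lin_set_def
proof (intro conjI ballI allI)
  show "(\<lambda>_. 0) \<in> sqint M" by (auto simp: sqint_def)
  fix f g a assume fg: "f \<in> sqint M" "g \<in> sqint M"
  have "integrable M (\<lambda>x. (f x)\<^sup>2 + 2 * a * (f x * g x) + a\<^sup>2 * (g x)\<^sup>2)"
    using fg sqint_prod[OF fg] by (auto simp: sqint_def)
  moreover have "(\<lambda>x. (f x)\<^sup>2 + 2 * a * (f x * g x) + a\<^sup>2 * (g x)\<^sup>2) = (\<lambda>x. (f x + a * g x)\<^sup>2)"
    by (auto simp: power2_eq_square algebra_simps)
  ultimately show "(\<lambda>x. f x + a * g x) \<in> sqint M" using fg by (auto simp: sqint_def)
qed

lemma semi_inner_sqint: "semi_inner_on (sqint M) (\<lambda>f g. LINT x|M. f x * g x)"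
  unfolding semi_inner_on_def
proof (intro conjI ballI allI)
  fix f g h a assume fg: "f \<in> sqint M" "g \<in> sqint M" "h \<in> sqint M"
  have "(LINT x|M. (f x + a * g x) * h x) = (LINT x|M. f x * h x + a * (g x * h x))"
    by (simp add: algebra_simps)
  also have "\<dots> = (LINT x|M. f x * h x) + a * (LINT x|M. g x * h x)"
    using sqint_prod fg by (subst Bochner_Integration.integral_add) auto
  finally show "(LINT x|M. (f x + a * g x) * h x) = (LINT x|M. f x * h x) + a * (LINT x|M. g x * h x)" .
qed (auto simp: mult.commute)

lemma sqint_Cauchy_Schwarz:
  "f \<in> sqint M \<Longrightarrow> g \<in> sqint M \<Longrightarrow>
    (LINT x|M. f x * g x)\<^sup>2 \<le> (LINT x|M. (f x)\<^sup>2) * (LINT x|M. (g x)\<^sup>2)"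
  using semi_inner_Cauchy_Schwarz[OF lin_set_sqint semi_inner_sqint] by (simp add: power2_eq_square)

lemma L2_space_sqint: "L2_space \<Omega> = sqint (lebesgue_on \<Omega>)"
  by (auto simp: L2_space_def sqint_def)

lemma L2_norm_sq: "(L2_norm \<Omega> f)\<^sup>2 = (LINT x|lebesgue_on \<Omega>. (f x)\<^sup>2)"
  by (simp add: L2_norm_def L2_inner_def power2_eq_square)

lemma L2_norm_nonneg [simp]: "0 \<le> L2_norm \<Omega> f"
  by (simp add: L2_norm_def L2_inner_def)

lemma L2_inner_le:
  assumes "f \<in> L2_space \<Omega>" "g \<in> L2_space \<Omega>"
  shows "\<bar>L2_inner \<Omega> f g\<bar> \<le> L2_norm \<Omega> f * L2_norm \<Omega> g"
proof (rule power2_le_imp_le)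
  show "\<bar>L2_inner \<Omega> f g\<bar>\<^sup>2 \<le> (L2_norm \<Omega> f * L2_norm \<Omega> g)\<^sup>2"
    using sqint_Cauchy_Schwarz[of f "lebesgue_on \<Omega>" g] assms
    by (simp add: power_mult_distrib L2_norm_sq L2_inner_def L2_space_sqint)
qed simp

lemma semi_inner_mono: "semi_inner_on W B \<Longrightarrow> V \<subseteq> W \<Longrightarrow> semi_inner_on V B"
  unfolding semi_inner_on_def by blast

lemma semi_inner_L2: "semi_inner_on (L2_space \<Omega>) (L2_inner \<Omega>)"
  using semi_inner_sqint[of "lebesgue_on \<Omega>"] by (simp add: L2_space_sqint L2_inner_def[abs_def])

lemma lin_set_L2: "lin_set (L2_space \<Omega>)"
  by (simp add: L2_space_sqint lin_set_sqint)

lemma L2_inner_comb: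
  assumes "f \<in> L2_space \<Omega>" "g \<in> L2_space \<Omega>" "h \<in> L2_space \<Omega>"
  shows "L2_inner \<Omega> (\<lambda>x. f x + a * g x) h = L2_inner \<Omega> f h + a * L2_inner \<Omega> g h"
    "L2_inner \<Omega> (\<lambda>x. f x + g x) h = L2_inner \<Omega> f h + L2_inner \<Omega> g h"
    "L2_inner \<Omega> (\<lambda>x. f x - g x) h = L2_inner \<Omega> f h - L2_inner \<Omega> g h"
  using semi_inner_left[OF semi_inner_L2 assms] semi_inner_left[OF semi_inner_L2 assms, of 1]
    semi_inner_left[OF semi_inner_L2 assms, of "-1"] by simp_all

lemma L2_inner_commute: "L2_inner \<Omega> f g = L2_inner \<Omega> g f"
  by (simp add: L2_inner_def mult.commute)

lemma L2_norm_sq_inner: "(L2_norm \<Omega> f)\<^sup>2 = L2_inner \<Omega> f f"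
  unfolding L2_norm_sq by (simp add: L2_inner_def power2_eq_square)

section \<open>Bounded functions with bounded support and polynomials\<close>

text \<open>The definitions integrate over restrictions of the completed measure, whereas Fubini,
  translations and affine substitutions are carried out in \<open>lborel\<close>. For Borel
  integrands the two sides agree.\<close>

lemma integral_lebesgue_on_borel:
  fixes f :: "'a::euclidean_space \<Rightarrow> real"
  assumes "S \<in> sets borel" "f \<in> borel_measurable borel"
  shows "(LINT x|lebesgue_on S. f x) = (LINT x|lborel. indicator S x * f x)"
    and "integrable (lebesgue_on S) f \<longleftrightarrow> integrable lborel (\<lambda>x. indicator S x * f x)"
proof -
  have m: "(\<lambda>x. indicator S x * f x) \<in> borel_measurable lborel" using assms by auto
  have S: "S \<in> sets lebesgue" using assms(1) by auto
  show "(LINT x|lebesgue_on S. f x) = (LINT x|lborel. indicator S x * f x)"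
    using S m by (subst integral_restrict_space) (auto simp: integral_completion)
  show "integrable (lebesgue_on S) f \<longleftrightarrow> integrable lborel (\<lambda>x. indicator S x * f x)"
    using S m by (subst integrable_restrict_space) (auto simp: integrable_completion)
qed

lemma bounded_subset_cball_0:
  fixes S :: "'a::real_normed_vector set"
  assumes "bounded S" obtains R where "S \<subseteq> cball 0 R"
  using assms unfolding bounded_iff by (metis mem_cball_0 subsetI)

text \<open>Borel, bounded, with bounded support. The class is stable under sums, products and
  shifts, so integrability becomes a syntactic check; piecewise continuous mesh functions and test
  functions all belong to it.\<close>

definition bcs :: "('a::euclidean_space \<Rightarrow> real) \<Rightarrow> bool" where
  "bcs f \<longleftrightarrow> f \<in> borel_measurable borel \<and> (\<exists>B. \<forall>x. \<bar>f x\<bar> \<le> B) \<and> bounded {x. f x \<noteq> 0}"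

lemma bcsI:
  assumes "f \<in> borel_measurable borel" "\<And>x. \<bar>f x\<bar> \<le> B" "bounded S" "\<And>x. x \<notin> S \<Longrightarrow> f x = 0"
  shows "bcs f"
  unfolding bcs_def using assms by (auto intro: bounded_subset)

lemma bcs_measurable [measurable_dest]: "bcs f \<Longrightarrow> f \<in> borel_measurable borel"
  by (simp add: bcs_def)

lemma integrable_bcs:
  fixes f :: "'a::euclidean_space \<Rightarrow> real"
  assumes "bcs f" shows "integrable lborel f"
proof -
  obtain B where B: "\<And>x. \<bar>f x\<bar> \<le> B" using assms by (auto simp: bcs_def)
  obtain R where R: "{x. f x \<noteq> 0} \<subseteq> cball 0 R"
    using assms bounded_subset_cball_0[of "{x. f x \<noteq> 0}"] by (auto simp: bcs_def)
  show ?thesis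
  proof (rule integrableI_bounded_set[where A = "cball 0 R" and B = B])
    show "emeasure lborel (cball (0::'a) R) < \<infinity>" using emeasure_bounded_finite[of "cball (0::'a) R"] by simp
  qed (use assms B R in \<open>auto simp: bcs_def intro!: AE_I2\<close>)
qed

lemma bcs_comb: "bcs f \<Longrightarrow> bcs g \<Longrightarrow> bcs (\<lambda>x. f x + a * g x)"
proof -
  assume f: "bcs f" and g: "bcs g"
  obtain B C where B: "\<And>x. \<bar>f x\<bar> \<le> B" and C: "\<And>x. \<bar>g x\<bar> \<le> C" using f g by (auto simp: bcs_def)
  show ?thesis
  proof (rule bcsI)
    show "bounded ({x. f x \<noteq> 0} \<union> {x. g x \<noteq> 0})" using f g by (simp add: bcs_def)
    show "(\<lambda>x. f x + a * g x) \<in> borel_measurable borel" using f g by (auto simp: bcs_def)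
    show "\<bar>f x + a * g x\<bar> \<le> B + \<bar>a\<bar> * C" for x
      using B[of x] C[of x] mult_left_mono[OF C[of x], of "\<bar>a\<bar>"] by (simp add: abs_mult[symmetric])
  qed auto
qed

lemma bcs_mult:
  assumes "bcs f" "g \<in> borel_measurable borel" "\<And>x. \<bar>g x\<bar> \<le> C"
  shows "bcs (\<lambda>x. f x * g x)" "bcs (\<lambda>x. g x * f x)"
proof -
  obtain B where B: "\<And>x. \<bar>f x\<bar> \<le> B" using assms by (auto simp: bcs_def)
  show "bcs (\<lambda>x. f x * g x)"
  proof (rule bcsI)
    show "bounded {x. f x \<noteq> 0}" using assms by (simp add: bcs_def)
    show "(\<lambda>x. f x * g x) \<in> borel_measurable borel" using assms by (auto simp: bcs_def)
    show "\<bar>f x * g x\<bar> \<le> B * C" for x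
      unfolding abs_mult using B[of x] assms(3)[of x] by (intro mult_mono) auto
  qed auto
  then show "bcs (\<lambda>x. g x * f x)" by (simp add: mult.commute)
qed

lemma bcs_diff: "bcs f \<Longrightarrow> bcs g \<Longrightarrow> bcs (\<lambda>x. f x - g x)"
  using bcs_comb[of f g "-1"] by simp

lemma bcs_add: "bcs f \<Longrightarrow> bcs g \<Longrightarrow> bcs (\<lambda>x. f x + g x)"
  using bcs_comb[of f g 1] by simp

lemma bcs_zero: "bcs (\<lambda>_. 0)"
  by (rule bcsI[where S = "{}" and B = 0]) auto

lemma bcs_sum: "(\<And>i. i \<in> I \<Longrightarrow> bcs (f i)) \<Longrightarrow> bcs (\<lambda>x. \<Sum>i\<in>I. f i x)"
  by (induction I rule: infinite_finite_induct) (auto intro: bcs_add bcs_zero)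

lemma bcs_prod: "bcs f \<Longrightarrow> bcs g \<Longrightarrow> bcs (\<lambda>x. f x * g x)"
  using bcs_mult[of f g] by (auto simp: bcs_def)

lemma bcs_power2: "bcs f \<Longrightarrow> bcs (\<lambda>x. (f x)\<^sup>2)"
  using bcs_prod[of f f] by (simp add: power2_eq_square)

lemma bcs_shift:
  assumes "bcs f" shows "bcs (\<lambda>x. f (x + a))"
proof -
  obtain B where B: "\<And>x. \<bar>f x\<bar> \<le> B" using assms by (auto simp: bcs_def)
  show ?thesis
  proof (rule bcsI)
    show "(\<lambda>x. f (x + a)) \<in> borel_measurable borel" using assms by (auto simp: bcs_def)
    show "bounded ((\<lambda>x. x - a) ` {x. f x \<noteq> 0})"
      using assms by (intro bounded_translation_minus) (simp add: bcs_def)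
    fix x assume "x \<notin> (\<lambda>x. x - a) ` {x. f x \<noteq> 0}"
    then show "f (x + a) = 0" by (metis (mono_tags, lifting) add_diff_cancel_right' image_eqI mem_Collect_eq)
  qed (use B in auto)
qed

lemma bcs_indicator_continuous:
  fixes f :: "'a::euclidean_space \<Rightarrow> real"
  assumes "continuous_on UNIV f" "bounded S" "S \<in> sets borel"
  shows "bcs (\<lambda>x. indicator S x * f x)"
proof -
  obtain R where R: "S \<subseteq> cball 0 R" using bounded_subset_cball_0[OF assms(2)] .
  have "bounded (f ` cball 0 R)"
    using compact_imp_bounded[OF compact_continuous_image[OF continuous_on_subset[OF assms(1)] compact_cball]] by simp
  then obtain B where B: "\<And>x. x \<in> cball 0 R \<Longrightarrow> \<bar>f x\<bar> \<le> B" by (metis bounded_iff imageI real_norm_def)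
  show ?thesis
  proof (rule bcsI[OF _ _ assms(2)])
    show "(\<lambda>x. indicator S x * f x) \<in> borel_measurable borel"
      using assms(3) borel_measurable_continuous_onI[OF assms(1)] by (intro borel_measurable_times borel_measurable_indicator) auto
    show "\<bar>indicator S x * f x\<bar> \<le> \<bar>B\<bar>" for x using B[of x] R by (auto simp: indicator_def)
  qed auto
qed

text \<open>The set where \<open>f\<close> does not vanish is open and null, and nonempty open sets
  are not null.\<close>

lemma continuous_square_integral_zero:
  fixes f :: "'a::euclidean_space \<Rightarrow> real"
  assumes "open U" "continuous_on U f" "integrable (lebesgue_on U) (\<lambda>x. (f x)\<^sup>2)"
    "(LINT x|lebesgue_on U. (f x)\<^sup>2) = 0" "x \<in> U"
  shows "f x = 0"
proof -
  have "AE x in lebesgue_on U. (f x)\<^sup>2 = 0"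
    using integral_nonneg_eq_0_iff_AE[OF assms(3)] assms(4) by simp
  then have "AE x in lebesgue. x \<in> U \<longrightarrow> f x = 0"
    using assms(1) by (simp add: AE_restrict_space_iff)
  moreover have op: "open {x \<in> U. f x \<noteq> 0}"
  proof -
    have "{x \<in> U. f x \<noteq> 0} = f -` (- {0}) \<inter> U" by auto
    then show ?thesis using continuous_open_preimage[OF assms(2,1), of "- {0}"] by (simp add: Int_commute open_Compl)
  qed
  then have "{x \<in> U. f x \<noteq> 0} \<in> sets lebesgue" by (intro sets_completionI_sets) auto
  ultimately have "{x \<in> U. f x \<noteq> 0} \<in> null_sets lebesgue"
    by (subst AE_iff_null_sets) (auto elim!: eventually_mono)
  then have "negligible {x \<in> U. f x \<noteq> 0}" by (simp add: negligible_iff_null_sets)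
  then have "{x \<in> U. f x \<noteq> 0} = {}" using open_not_negligible op by blast
  then show ?thesis using assms(5) by blast
qed

section \<open>Polynomials of bounded degree in each variable\<close>

definition qpoly :: "nat \<Rightarrow> (nat \<times> nat \<times> nat \<Rightarrow> real) \<Rightarrow> real^3 \<Rightarrow> real" where
  "qpoly k c x = (\<Sum>i\<le>k. \<Sum>j\<le>k. \<Sum>l\<le>k. c (i, j, l) * (x$1)^i * (x$2)^j * (x$3)^l)"

lemma Q_polys_eq: "Q_polys k = range (qpoly k)"
proof
  show "Q_polys k \<subseteq> range (qpoly k)"
  proof
    fix p assume "p \<in> Q_polys k"
    then obtain c where "p = (\<lambda>x. \<Sum>i\<le>k. \<Sum>j\<le>k. \<Sum>l\<le>k. c i j l * (x$1)^i * (x$2)^j * (x$3)^l)"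
      unfolding Q_polys_def by blast
    then have "p = qpoly k (\<lambda>(i, j, l). c i j l)" by (auto simp: qpoly_def)
    then show "p \<in> range (qpoly k)" by blast
  qed
  show "range (qpoly k) \<subseteq> Q_polys k"
  proof
    fix p assume "p \<in> range (qpoly k)"
    then obtain c where "p = qpoly k c" by blast
    then have "p = (\<lambda>x. \<Sum>i\<le>k. \<Sum>j\<le>k. \<Sum>l\<le>k. (\<lambda>i j l. c (i, j, l)) i j l * (x$1)^i * (x$2)^j * (x$3)^l)"
      by (auto simp: qpoly_def)
    then show "p \<in> Q_polys k" unfolding Q_polys_def by (intro CollectI exI)
  qed
qed

lemma qpoly_comb: "qpoly k (\<lambda>t. c t + a * d t) x = qpoly k c x + a * qpoly k d x"
  by (simp add: qpoly_def sum_distrib_left sum.distrib distrib_right mult.assoc)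

lemma lin_set_Q_polys: "lin_set (Q_polys k)"
  unfolding lin_set_def Q_polys_eq
proof (intro conjI ballI allI)
  show "(\<lambda>_. 0) \<in> range (qpoly k)"
    by (rule range_eqI[of _ _ "\<lambda>_. 0"]) (auto simp: qpoly_def)
  fix f g a assume "f \<in> range (qpoly k)" "g \<in> range (qpoly k)"
  then obtain c d where "f = qpoly k c" "g = qpoly k d" by blast
  then have "(\<lambda>x. f x + a * g x) = qpoly k (\<lambda>t. c t + a * d t)" by (auto simp: qpoly_comb)
  then show "(\<lambda>x. f x + a * g x) \<in> range (qpoly k)" by blast
qed

lemma has_derivative_qpoly:
  "(qpoly k c has_derivative (\<lambda>h. \<Sum>i\<le>k. \<Sum>j\<le>k. \<Sum>l\<le>k. c (i, j, l) *
      (real i * (x$1)^(i-1) * h$1 * (x$2)^j * (x$3)^l + (x$1)^i * (real j * (x$2)^(j-1) * h$2) * (x$3)^l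
        + (x$1)^i * (x$2)^j * (real l * (x$3)^(l-1) * h$3)))) (at x)"
  unfolding qpoly_def[abs_def]
  by (auto intro!: derivative_eq_intros bounded_linear.has_derivative[OF bounded_linear_vec_nth]
      has_derivative_sum sum.cong simp: algebra_simps)

lemma qpoly_differentiable: "qpoly k c differentiable (at x)"
  using has_derivative_qpoly unfolding differentiable_def by blast

lemma partial_deriv_qpoly:
  "partial_deriv m (qpoly k c) x = (\<Sum>i\<le>k. \<Sum>j\<le>k. \<Sum>l\<le>k. c (i, j, l) *
      (real i * (x$1)^(i-1) * axis m 1 $1 * (x$2)^j * (x$3)^l + (x$1)^i * (real j * (x$2)^(j-1) * axis m 1 $ 2) * (x$3)^l
        + (x$1)^i * (x$2)^j * (real l * (x$3)^(l-1) * axis m 1 $3)))"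
  unfolding partial_deriv_def frechet_derivative_at[OF has_derivative_qpoly, symmetric] ..

lemma continuous_qpoly: "continuous_on S (qpoly k c)"
  unfolding qpoly_def[abs_def] by (intro continuous_intros)

lemma continuous_partial_qpoly: "continuous_on S (partial_deriv m (qpoly k c))"
  unfolding partial_deriv_qpoly[abs_def] by (intro continuous_intros)

lemma Q_polys_continuous: "p \<in> Q_polys k \<Longrightarrow> continuous_on S p"
  and Q_polys_differentiable: "p \<in> Q_polys k \<Longrightarrow> p differentiable (at x)"
  and Q_polys_continuous_partial: "p \<in> Q_polys k \<Longrightarrow> continuous_on S (partial_deriv m p)"
  by (auto simp: Q_polys_eq continuous_qpoly qpoly_differentiable continuous_partial_qpoly)

text \<open>The coefficients come from the binomial theorem and do not depend on \<open>t\<close>;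
  padding with zeros up to \<open>k\<close> gives all exponents the same summation range.\<close>

lemma affine_power_expand:
  "i \<le> k \<Longrightarrow> \<exists>a. \<forall>t::real. (s + d * t)^i = (\<Sum>m\<le>k. a m * t^m)"
proof (intro exI allI)
  fix t assume i: "i \<le> k"
  have "(s + d * t)^i = (\<Sum>m\<le>i. (of_nat (i choose m) * (d * t)^m) * s^(i-m))"
    by (subst add.commute) (simp add: binomial_ring)
  also have "\<dots> = (\<Sum>m\<le>k. (if m \<le> i then of_nat (i choose m) * d^m * s^(i-m) else 0) * t^m)"
    using i by (intro sum.mono_neutral_cong_left) (auto simp: power_mult_distrib)
  finally show "(s + d * t)^i = (\<Sum>m\<le>k. (if m \<le> i then of_nat (i choose m) * d^m * s^(i-m) else 0) * t^m)" .
qed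

text \<open>A translation followed by a dilation acts on each coordinate separately and therefore
  preserves the degree in each variable, which a general linear map would not do.\<close>

lemma Q_polys_affine:
  assumes "p \<in> Q_polys k"
  shows "(\<lambda>x. p (a + d *\<^sub>R x)) \<in> Q_polys k"
proof -
  obtain c where c: "p = qpoly k c" using assms by (auto simp: Q_polys_eq)
  have mono: "(\<lambda>x. (a$1 + d * x$1)^i * (a$2 + d * x$2)^j * (a$3 + d * x$3)^l) \<in> Q_polys k"
    if ijl: "i \<le> k" "j \<le> k" "l \<le> k" for i j l
  proof -
    obtain u v w where uvw: "\<And>t. (a$1 + d * t)^i = (\<Sum>m\<le>k. u m * t^m)"
      "\<And>t. (a$2 + d * t)^j = (\<Sum>m\<le>k. v m * t^m)" "\<And>t. (a$3 + d * t)^l = (\<Sum>m\<le>k. w m * t^m)"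
      using affine_power_expand[OF ijl(1), of "a$1" d] affine_power_expand[OF ijl(2), of "a$2" d]
        affine_power_expand[OF ijl(3), of "a$3" d] by (elim exE) (rule that, auto)
    have "(\<lambda>x. (a$1 + d * x$1)^i * (a$2 + d * x$2)^j * (a$3 + d * x$3)^l) = qpoly k (\<lambda>(i, j, l). u i * v j * w l)"
    proof
      fix x :: "real^3"
      have "(\<Sum>m\<le>k. u m * x$1^m) * (\<Sum>m\<le>k. v m * x$2^m) * (\<Sum>m\<le>k. w m * x$3^m)
        = (\<Sum>i\<le>k. \<Sum>j\<le>k. \<Sum>l\<le>k. (u i * x$1^i) * (v j * x$2^j) * (w l * x$3^l))"
        unfolding sum_product by (simp add: sum_distrib_left sum_distrib_right) (intro sum.cong refl sum.swap)
      then show "(a$1 + d * x$1)^i * (a$2 + d * x$2)^j * (a$3 + d * x$3)^l = qpoly k (\<lambda>(i, j, l). u i * v j * w l) x"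
        unfolding uvw qpoly_def by (simp add: mult_ac)
    qed
    then show ?thesis by (auto simp: Q_polys_eq)
  qed
  have "(\<lambda>x. p (a + d *\<^sub>R x)) = (\<lambda>x. \<Sum>i\<le>k. \<Sum>j\<le>k. \<Sum>l\<le>k. c (i, j, l) *
      ((a$1 + d * x$1)^i * (a$2 + d * x$2)^j * (a$3 + d * x$3)^l))"
    by (simp add: c qpoly_def algebra_simps)
  also have "\<dots> \<in> Q_polys k"
    by (intro lin_set_sum[OF lin_set_Q_polys] lin_set_scale[OF lin_set_Q_polys] mono) auto
  finally show ?thesis .
qed

lemma polynomial_zero_near:
  fixes c :: "nat \<Rightarrow> real"
  assumes "0 < r" "\<And>t. \<bar>t\<bar> < r \<Longrightarrow> (\<Sum>i\<le>n. c i * t^i) = 0" "i \<le> n"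
  shows "c i = 0"
proof (rule ccontr)
  assume "c i \<noteq> 0"
  then have "finite {z. (\<Sum>i\<le>n. c i * z^i) = 0}" using polyfun_roots_finite assms(3) by blast
  then have "finite {- r<..<r}" by (rule rev_finite_subset) (auto simp: assms(2))
  then show False using assms(1) infinite_Ioo[of "-r" r] by simp
qed

lemma qpoly_zero_on_ball:
  assumes "0 < r" "\<And>x. x \<in> ball 0 r \<Longrightarrow> qpoly k c x = 0" "i \<le> k" "j \<le> k" "l \<le> k"
  shows "c (i, j, l) = 0"
proof -
  \<comment> \<open>The Euclidean norm is at most the sum of the absolute coordinates, so three
    coordinates below \<open>r / 3\<close> give a point of the ball; the coordinates may then be
    varied independently and eliminated one by one.\<close>
  have r: "0 < r / 3" using assms by simp
  have "(\<Sum>i\<le>k. \<Sum>j\<le>k. \<Sum>l\<le>k. c (i, j, l) * t1^i * t2^j * t3^l) = 0"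
    if "\<bar>t1\<bar> < r/3" "\<bar>t2\<bar> < r/3" "\<bar>t3\<bar> < r/3" for t1 t2 t3
  proof -
    define x :: "real^3" where "x = vector [t1, t2, t3]"
    have x: "x$1 = t1" "x$2 = t2" "x$3 = t3" by (auto simp: x_def)
    have "norm x \<le> \<bar>x$1\<bar> + \<bar>x$2\<bar> + \<bar>x$3\<bar>"
      using norm_le_l1_cart[of x] by (simp add: sum_3)
    then have "x \<in> ball 0 r" using that x by simp
    from assms(2)[OF this] show ?thesis unfolding qpoly_def x .
  qed
  then have "(\<Sum>i\<le>k. (\<Sum>j\<le>k. \<Sum>l\<le>k. c (i, j, l) * t2^j * t3^l) * t1^i) = 0"
    if "\<bar>t1\<bar> < r/3" "\<bar>t2\<bar> < r/3" "\<bar>t3\<bar> < r/3" for t1 t2 t3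
    using that by (simp add: sum_distrib_left sum_distrib_right mult.assoc mult.commute mult.left_commute)
  then have "(\<Sum>j\<le>k. \<Sum>l\<le>k. c (i, j, l) * t2^j * t3^l) = 0" if "\<bar>t2\<bar> < r/3" "\<bar>t3\<bar> < r/3" for t2 t3
    using polynomial_zero_near[OF r _ assms(3), of "\<lambda>i. \<Sum>j\<le>k. \<Sum>l\<le>k. c (i, j, l) * t2^j * t3^l"] that by blast
  then have "(\<Sum>j\<le>k. (\<Sum>l\<le>k. c (i, j, l) * t3^l) * t2^j) = 0" if "\<bar>t2\<bar> < r/3" "\<bar>t3\<bar> < r/3" for t2 t3
    using that by (simp add: sum_distrib_left sum_distrib_right mult.assoc mult.commute mult.left_commute)
  then have "(\<Sum>l\<le>k. c (i, j, l) * t3^l) = 0" if "\<bar>t3\<bar> < r/3" for t3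
    using polynomial_zero_near[OF r _ assms(4), of "\<lambda>j. \<Sum>l\<le>k. c (i, j, l) * t3^l"] that by blast
  then show ?thesis using polynomial_zero_near[OF r _ assms(5), of "\<lambda>l. c (i, j, l)"] by blast
qed

lemma continuous_sqint_ball:
  fixes f :: "real^3 \<Rightarrow> real"
  assumes "continuous_on UNIV f"
  shows "f \<in> sqint (lebesgue_on (ball a r))"
proof -
  have m: "f \<in> borel_measurable borel" using assms by (simp add: borel_measurable_continuous_onI)
  then have "f \<in> borel_measurable (lebesgue_on (ball a r))"
    by (simp add: measurable_completion measurable_restrict_space1)
  moreover have "integrable (lebesgue_on (ball a r)) (\<lambda>x. (f x)\<^sup>2)"
    using m integrable_bcs[OF bcs_indicator_continuous[of "\<lambda>x. (f x)\<^sup>2" "ball a r"]] assms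
    by (subst integral_lebesgue_on_borel) (auto intro!: continuous_intros)
  ultimately show ?thesis by (auto simp: sqint_def)
qed

text \<open>Equivalence of norms on the space of coefficients. The L2 form on the ball is definite
  there because a polynomial that vanishes on a ball has zero coefficients.\<close>

lemma qpoly_coeff_bound:
  assumes "0 < \<rho>"
  shows "\<exists>C\<ge>0. \<forall>c. \<forall>i\<le>k. \<forall>j\<le>k. \<forall>l\<le>k. (c (i, j, l))\<^sup>2 \<le> C * (LINT x|lebesgue_on (ball 0 \<rho>). (qpoly k c x)\<^sup>2)"
proof -
  define I where "I = {..k} \<times> {..k} \<times> {..k}"
  \<comment> \<open>Coefficients outside \<open>I\<close> do not influence \<open>qpoly k c\<close>;
    forcing them to vanish lets the evaluations at \<open>I\<close> separate
    \<open>W\<close>.\<close>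
  define W where "W = {c :: nat \<times> nat \<times> nat \<Rightarrow> real. \<forall>t. t \<notin> I \<longrightarrow> c t = 0}"
  define B where "B = (\<lambda>c d. LINT x|lebesgue_on (ball 0 \<rho>). qpoly k c x * qpoly k d x)"
  have finI: "finite I" by (simp add: I_def)
  have linW: "lin_set W" by (auto simp: lin_set_def W_def)
  have sq: "qpoly k c \<in> sqint (lebesgue_on (ball 0 \<rho>))" for c
    by (intro continuous_sqint_ball continuous_qpoly)
  have semi: "semi_inner_on W B"
    using semi_inner_sqint[of "lebesgue_on (ball (0::real^3) \<rho>)"] sq
    unfolding semi_inner_on_def B_def by (auto simp: qpoly_comb mult.commute)
  have zero: "c t = 0" if "c \<in> W" "B c c = 0" "t \<in> I" for c t
  proof -
    obtain i j l where t: "t = (i, j, l)" "i \<le> k" "j \<le> k" "l \<le> k" using \<open>t \<in> I\<close> by (auto simp: I_def)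
    have "qpoly k c x = 0" if x: "x \<in> ball 0 \<rho>" for x
      using continuous_square_integral_zero[of "ball 0 \<rho>" "qpoly k c" x] sq[of c] x \<open>B c c = 0\<close> continuous_qpoly
      by (auto simp: B_def sqint_def power2_eq_square)
    from qpoly_zero_on_ball[OF assms this t(2-4)] show ?thesis using t by simp
  qed
  have "\<exists>C\<ge>0. \<forall>c\<in>W. (c t)\<^sup>2 \<le> C * B c c" if "t \<in> I" for t
  proof (rule finite_dim_form_bounded[OF _ linW _ semi])
    show "finite I" by (simp add: I_def)
    show "linear_form_on W (\<lambda>c. c t)" by (simp add: linear_form_on_def)
    fix w assume "w \<in> W" "\<And>x. x \<in> I \<Longrightarrow> w x = 0"
    then show "w = (\<lambda>_. 0)" unfolding W_def by (intro ext) blast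
  qed (use zero that in auto)
  then obtain D where D: "\<And>t. t \<in> I \<Longrightarrow> D t \<ge> 0" "\<And>t c. t \<in> I \<Longrightarrow> c \<in> W \<Longrightarrow> (c t)\<^sup>2 \<le> D t * B c c"
    by metis
  have Bge: "0 \<le> B c c" for c by (simp add: B_def)
  show ?thesis
  proof (intro exI[of _ "\<Sum>t\<in>I. D t"] conjI allI impI)
    show "0 \<le> (\<Sum>t\<in>I. D t)" using D by (simp add: sum_nonneg)
    fix c :: "nat \<times> nat \<times> nat \<Rightarrow> real" and i j l assume ijl: "i \<le> k" "j \<le> k" "l \<le> k"
    define c' where "c' = (\<lambda>t. if t \<in> I then c t else 0)"
    have c': "c' \<in> W" by (auto simp: c'_def W_def)
    have eq: "qpoly k c' = qpoly k c" by (auto simp: qpoly_def c'_def I_def fun_eq_iff intro!: sum.cong)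
    have t: "(i, j, l) \<in> I" unfolding I_def using ijl by blast
    have "(c (i, j, l))\<^sup>2 \<le> D (i, j, l) * B c' c'" using D(2)[OF t c'] t by (simp add: c'_def)
    also have "\<dots> \<le> (\<Sum>t\<in>I. D t) * B c' c'"
      using finI by (intro mult_right_mono member_le_sum Bge t) (auto simp: D(1))
    finally show "(c (i, j, l))\<^sup>2 \<le> (\<Sum>t\<in>I. D t) * (LINT x|lebesgue_on (ball 0 \<rho>). (qpoly k c x)\<^sup>2)"
      by (simp add: B_def eq power2_eq_square)
  qed
qed

lemma qpoly_unit_bound:
  assumes "0 < \<rho>"
  shows "\<exists>C\<ge>0. \<forall>c x m. norm x \<le> 1 \<longrightarrow>
     (qpoly k c x)\<^sup>2 \<le> C * (LINT x|lebesgue_on (ball 0 \<rho>). (qpoly k c x)\<^sup>2) \<and>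
     (partial_deriv m (qpoly k c) x)\<^sup>2 \<le> C * (LINT x|lebesgue_on (ball 0 \<rho>). (qpoly k c x)\<^sup>2)"
proof -
  from qpoly_coeff_bound[OF assms, of k]
  obtain C where "C \<ge> 0" and C': "\<forall>c. \<forall>i\<le>k. \<forall>j\<le>k. \<forall>l\<le>k.
     (c (i, j, l))\<^sup>2 \<le> C * (LINT x|lebesgue_on (ball 0 \<rho>). (qpoly k c x)\<^sup>2)"
    by (elim exE conjE) (rule that)
  then have C: "C \<ge> 0" "\<And>c i j l. i \<le> k \<Longrightarrow> j \<le> k \<Longrightarrow> l \<le> k \<Longrightarrow>
     (c (i, j, l))\<^sup>2 \<le> C * (LINT x|lebesgue_on (ball 0 \<rho>). (qpoly k c x)\<^sup>2)"
    by simp_all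
  \<comment> \<open>There are \<open>(k + 1)^3\<close> monomials, and on the unit ball
    \<open>3 * k + 1\<close> bounds each monomial as well as each of its first partial
    derivatives.\<close>
  define K where "K = (real (Suc k))^3 * (3 * real k + 1)"
  have main: "A\<^sup>2 \<le> (K\<^sup>2 * C) * (LINT x|lebesgue_on (ball 0 \<rho>). (qpoly k c x)\<^sup>2)"
    if A: "A = (\<Sum>i\<le>k. \<Sum>j\<le>k. \<Sum>l\<le>k. c (i, j, l) * w i j l)"
      and w: "\<And>i j l. i \<le> k \<Longrightarrow> j \<le> k \<Longrightarrow> l \<le> k \<Longrightarrow> \<bar>w i j l\<bar> \<le> 3 * real k + 1" for A c w
  proof -
    define N where "N = C * (LINT x|lebesgue_on (ball 0 \<rho>). (qpoly k c x)\<^sup>2)"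
    have N: "0 \<le> N" using C(1) by (simp add: N_def)
    have cb: "\<bar>c (i, j, l)\<bar> \<le> sqrt N" if "i \<le> k" "j \<le> k" "l \<le> k" for i j l
      using real_sqrt_le_mono[OF C(2)[OF that, of c]] by (simp add: N_def)
    have "\<bar>A\<bar> \<le> (\<Sum>i\<le>k. \<Sum>j\<le>k. \<Sum>l\<le>k. \<bar>c (i, j, l) * w i j l\<bar>)"
      unfolding A by (intro order_trans[OF sum_abs] sum_mono order_refl)
    also have "\<dots> \<le> (\<Sum>i\<le>k. \<Sum>j\<le>k. \<Sum>l\<le>k. sqrt N * (3 * real k + 1))"
      unfolding abs_mult using cb w N by (intro sum_mono mult_mono) auto
    also have "\<dots> = K * sqrt N" by (simp add: K_def power3_eq_cube algebra_simps)
    finally have "A\<^sup>2 \<le> (K * sqrt N)\<^sup>2" by (rule abs_le_square_iff[THEN iffD1, OF order_trans[OF _ abs_ge_self]])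
    also have "\<dots> = K\<^sup>2 * N" using N by (simp add: power_mult_distrib)
    finally show ?thesis by (simp add: N_def mult.assoc)
  qed
  have pw: "\<bar>(x$s)^n\<bar> \<le> 1" if "norm x \<le> 1" for x :: "real^3" and s n
    using component_le_norm_cart[of x s] that by (simp add: power_abs power_le_one)
  have m3: "\<bar>a * b * c\<bar> \<le> 1" if "\<bar>a\<bar> \<le> 1" "\<bar>b\<bar> \<le> 1" "\<bar>c\<bar> \<le> 1" for a b c :: real
    using that by (simp add: abs_mult mult_le_one)
  have m5: "\<bar>real i * a * b * c * d\<bar> \<le> real k"
    if "i \<le> k" "\<bar>a\<bar> \<le> 1" "\<bar>b\<bar> \<le> 1" "\<bar>c\<bar> \<le> 1" "\<bar>d\<bar> \<le> 1" for a b c d i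
  proof -
    have "\<bar>real i * a * b * c * d\<bar> = real i * (\<bar>a * b * c\<bar> * \<bar>d\<bar>)" by (simp add: abs_mult)
    also have "\<dots> \<le> real k * 1" using that m3[of a b c] by (intro mult_mono mult_le_one) auto
    finally show ?thesis by simp
  qed
  have ax: "\<bar>axis m 1 $ s\<bar> \<le> (1::real)" for m s :: 3 by (simp add: axis_def)
  show ?thesis
  proof (intro exI[of _ "K\<^sup>2 * C"] conjI allI impI)
    show "0 \<le> K\<^sup>2 * C" using C by simp
    fix c m and x :: "real^3" assume x: "norm x \<le> 1"
    show "(qpoly k c x)\<^sup>2 \<le> K\<^sup>2 * C * (LINT x|lebesgue_on (ball 0 \<rho>). (qpoly k c x)\<^sup>2)"
    proof (rule main)
      show "qpoly k c x = (\<Sum>i\<le>k. \<Sum>j\<le>k. \<Sum>l\<le>k. c (i, j, l) * ((x$1)^i * (x$2)^j * (x$3)^l))"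
        by (simp add: qpoly_def mult.assoc)
      fix i j l show "\<bar>(x$1)^i * (x$2)^j * (x$3)^l\<bar> \<le> 3 * real k + 1"
        using m3[OF pw[OF x] pw[OF x] pw[OF x], of 1 i 2 j 3 l] by linarith
    qed
    show "(partial_deriv m (qpoly k c) x)\<^sup>2 \<le> K\<^sup>2 * C * (LINT x|lebesgue_on (ball 0 \<rho>). (qpoly k c x)\<^sup>2)"
    proof (rule main[OF partial_deriv_qpoly])
      fix i j l assume ijl: "i \<le> k" "j \<le> k" "l \<le> k"
      have "\<bar>real i * (x$1)^(i-1) * axis m 1 $1 * (x$2)^j * (x$3)^l\<bar> \<le> real k"
        by (intro m5 ijl pw x ax)
      moreover have "\<bar>(x$1)^i * (real j * (x$2)^(j-1) * axis m 1 $ 2) * (x$3)^l\<bar> \<le> real k"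
        using m5[OF ijl(2) pw[OF x, of 1 i] pw[OF x, of 2 "j-1"] ax[of m 2] pw[OF x, of 3 l]]
        by (simp only: mult.assoc mult.left_commute)
      moreover have "\<bar>(x$1)^i * (x$2)^j * (real l * (x$3)^(l-1) * axis m 1 $3)\<bar> \<le> real k"
        using m5[OF ijl(3) pw[OF x, of 1 i] pw[OF x, of 2 j] pw[OF x, of 3 "l-1"] ax[of m 3]]
        by (simp only: mult.assoc mult.left_commute)
      ultimately show "\<bar>real i * (x$1)^(i-1) * axis m 1 $1 * (x$2)^j * (x$3)^l + (x$1)^i * (real j * (x$2)^(j-1) * axis m 1 $ 2) * (x$3)^l
        + (x$1)^i * (x$2)^j * (real l * (x$3)^(l-1) * axis m 1 $3)\<bar> \<le> 3 * real k + 1" by linarith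
    qed
  qed
qed

lemma lborel_integral_affine:
  fixes f :: "real^3 \<Rightarrow> real"
  assumes "f \<in> borel_measurable borel" "0 < d"
  shows "(LINT x|lborel. f x) = d^3 * (LINT x|lborel. f (a + d *\<^sub>R x))"
proof -
  have "(LINT x|lborel. f x) = (LINT x|density (distr lborel borel (\<lambda>x. a + d *\<^sub>R x)) (\<lambda>_. \<bar>d\<bar>^DIM(real^3)). f x)"
    using lborel_affine[of d a] assms by simp
  also have "\<dots> = (LINT x|distr lborel borel (\<lambda>x. a + d *\<^sub>R x). d^3 *\<^sub>R f x)"
    using assms by (subst integral_density) auto
  also have "\<dots> = d^3 * (LINT x|lborel. f (a + d *\<^sub>R x))"
    using assms by (subst integral_distr) auto
  finally show ?thesis .
qed

lemma partial_deriv_affine: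
  assumes "p differentiable (at (a + d *\<^sub>R x))"
  shows "partial_deriv m (\<lambda>x. p (a + d *\<^sub>R x)) x = d * partial_deriv m p (a + d *\<^sub>R x)"
proof -
  have lin: "linear (frechet_derivative p (at (a + d *\<^sub>R x)))"
    using linear_frechet_derivative[OF assms] .
  have "((\<lambda>x. p (a + d *\<^sub>R x)) has_derivative (\<lambda>h. frechet_derivative p (at (a + d *\<^sub>R x)) (d *\<^sub>R h))) (at x)"
    by (rule has_derivative_compose[of "\<lambda>x. a + d *\<^sub>R x", OF _ assms[unfolded frechet_derivative_works]])
       (auto intro!: derivative_eq_intros)
  from frechet_derivative_at[OF this, symmetric] show ?thesis
    unfolding partial_deriv_def using linear_cmul[OF lin] by simp
qed

text \<open>Scaling \<open>x = a + d y\<close> to the unit ball: the integral contributes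
  \<open>d^3\<close>, and a squared derivative a further \<open>d^2\<close>. The point
  \<open>x\<close> may lie outside the ball of integration, which is how values on a whole cell are
  controlled by an inscribed ball, whatever the shape of the cell.\<close>

lemma Q_polys_inverse_estimate:
  assumes "0 < \<rho>"
  shows "\<exists>C\<ge>0. \<forall>p\<in>Q_polys k. \<forall>a d x m. 0 < d \<longrightarrow> x \<in> cball a d \<longrightarrow>
     (p x)\<^sup>2 \<le> C / d^3 * (LINT x|lebesgue_on (ball a (\<rho> * d)). (p x)\<^sup>2) \<and>
     (partial_deriv m p x)\<^sup>2 \<le> C / d^5 * (LINT x|lebesgue_on (ball a (\<rho> * d)). (p x)\<^sup>2)"
proof -
  from qpoly_unit_bound[OF assms, of k]
  obtain C where "C \<ge> 0" and C': "\<forall>c x m. norm x \<le> 1 \<longrightarrow>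
     (qpoly k c x)\<^sup>2 \<le> C * (LINT x|lebesgue_on (ball 0 \<rho>). (qpoly k c x)\<^sup>2) \<and>
     (partial_deriv m (qpoly k c) x)\<^sup>2 \<le> C * (LINT x|lebesgue_on (ball 0 \<rho>). (qpoly k c x)\<^sup>2)"
    by (elim exE conjE) (rule that)
  then have C: "C \<ge> 0" "\<And>c x m. norm x \<le> 1 \<Longrightarrow>
     (qpoly k c x)\<^sup>2 \<le> C * (LINT x|lebesgue_on (ball 0 \<rho>). (qpoly k c x)\<^sup>2) \<and>
     (partial_deriv m (qpoly k c) x)\<^sup>2 \<le> C * (LINT x|lebesgue_on (ball 0 \<rho>). (qpoly k c x)\<^sup>2)"
    by simp_all
  show ?thesis
  proof (intro exI[of _ C] conjI ballI allI impI C(1))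
    fix p a d m and x :: "real^3" assume p: "p \<in> Q_polys k" and d: "0 < d" and x: "x \<in> cball a d"
    define q where "q = (\<lambda>x. p (a + d *\<^sub>R x))"
    obtain c where c: "q = qpoly k c" using Q_polys_affine[OF p, of a d] by (auto simp: Q_polys_eq q_def)
    define y where "y = (1/d) *\<^sub>R (x - a)"
    have y: "norm y \<le> 1" "a + d *\<^sub>R y = x" using x d by (auto simp: y_def dist_norm norm_minus_commute)
    have meas: "p \<in> borel_measurable borel" using Q_polys_continuous[OF p] by (simp add: borel_measurable_continuous_onI)
    have "(LINT x|lebesgue_on (ball a (\<rho> * d)). (p x)\<^sup>2) = (LINT x|lborel. indicator (ball a (\<rho> * d)) x * (p x)\<^sup>2)"
      using meas by (intro integral_lebesgue_on_borel) auto
    also have "\<dots> = d^3 * (LINT x|lborel. indicator (ball a (\<rho> * d)) (a + d *\<^sub>R x) * (p (a + d *\<^sub>R x))\<^sup>2)"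
      using meas d by (intro lborel_integral_affine borel_measurable_times borel_measurable_power borel_measurable_indicator) auto
    also have "\<dots> = d^3 * (LINT x|lborel. indicator (ball 0 \<rho>) x * (q x)\<^sup>2)"
      using d by (simp add: q_def indicator_def dist_norm mult.commute)
    also have "\<dots> = d^3 * (LINT x|lebesgue_on (ball 0 \<rho>). (q x)\<^sup>2)"
      using continuous_qpoly[of UNIV k c] c
      by (subst integral_lebesgue_on_borel) (auto intro!: borel_measurable_continuous_onI continuous_intros)
    finally have I: "(LINT x|lebesgue_on (ball 0 \<rho>). (q x)\<^sup>2) = (LINT x|lebesgue_on (ball a (\<rho> * d)). (p x)\<^sup>2) / d^3"
      using d by simp
    have "(q y)\<^sup>2 \<le> C * (LINT x|lebesgue_on (ball 0 \<rho>). (q x)\<^sup>2)" using C(2)[OF y(1)] c by blast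
    then show "(p x)\<^sup>2 \<le> C / d^3 * (LINT x|lebesgue_on (ball a (\<rho> * d)). (p x)\<^sup>2)"
      using I y by (simp add: q_def)
    have "(partial_deriv m q y)\<^sup>2 \<le> C * (LINT x|lebesgue_on (ball 0 \<rho>). (q x)\<^sup>2)" using C(2)[OF y(1)] c by blast
    moreover have "partial_deriv m q y = d * partial_deriv m p x"
      unfolding q_def using partial_deriv_affine[OF Q_polys_differentiable[OF p]] y by metis
    ultimately have "d\<^sup>2 * (partial_deriv m p x)\<^sup>2 \<le> C * ((LINT x|lebesgue_on (ball a (\<rho> * d)). (p x)\<^sup>2) / d^3)"
      unfolding I by (simp add: power_mult_distrib)
    then have "(partial_deriv m p x)\<^sup>2 \<le> C * ((LINT x|lebesgue_on (ball a (\<rho> * d)). (p x)\<^sup>2) / d^3) / d\<^sup>2"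
      using d by (simp add: field_simps)
    also have "\<dots> = C / d^5 * (LINT x|lebesgue_on (ball a (\<rho> * d)). (p x)\<^sup>2)"
      by (simp flip: power_add)
    finally show "(partial_deriv m p x)\<^sup>2 \<le> C / d^5 * (LINT x|lebesgue_on (ball a (\<rho> * d)). (p x)\<^sup>2)" .
  qed
qed

section \<open>Partial derivatives and test functions\<close>

lemma partial_deriv_eq:
  "(f has_derivative D) (at x) \<Longrightarrow> partial_deriv m f x = D (axis m 1)"
  unfolding partial_deriv_def using frechet_derivative_at by metis

lemma differentiable_has_derivative:
  "f differentiable (at x) \<Longrightarrow> (f has_derivative frechet_derivative f (at x)) (at x)"
  by (simp add: frechet_derivative_works)

lemma partial_deriv_add:
  "f differentiable (at x) \<Longrightarrow> g differentiable (at x) \<Longrightarrow>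
    partial_deriv m (\<lambda>x. f x + g x) x = partial_deriv m f x + partial_deriv m g x"
  by (subst partial_deriv_eq[OF has_derivative_add[OF differentiable_has_derivative differentiable_has_derivative]])
     (auto simp: partial_deriv_def)

lemma partial_deriv_mult:
  "f differentiable (at x) \<Longrightarrow> g differentiable (at x) \<Longrightarrow>
    partial_deriv m (\<lambda>x. f x * g x) x = f x * partial_deriv m g x + partial_deriv m f x * g x"
  by (subst partial_deriv_eq[OF has_derivative_mult[OF differentiable_has_derivative differentiable_has_derivative]])
     (auto simp: partial_deriv_def)

lemma partial_deriv_const [simp]: "partial_deriv m (\<lambda>x. c) = (\<lambda>x. 0)"
  by (rule ext, subst partial_deriv_eq[OF has_derivative_const]) simp

lemma partial_deriv_cong_open:
  assumes "open S" "x \<in> S" "\<And>y. y \<in> S \<Longrightarrow> f y = g y"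
  shows "partial_deriv m f x = partial_deriv m g x"
proof -
  have "(f has_derivative D) (at x) \<longleftrightarrow> (g has_derivative D) (at x)" for D
    using has_derivative_transform_within_open[of f D x UNIV S g] has_derivative_transform_within_open[of g D x UNIV S f]
      assms by auto
  then show ?thesis by (simp add: partial_deriv_def frechet_derivative_def)
qed

lemma line_derivative:
  assumes "f differentiable (at (x + s *\<^sub>R axis m 1))"
  shows "((\<lambda>s. f (x + s *\<^sub>R axis m 1)) has_real_derivative partial_deriv m f (x + s *\<^sub>R axis m 1)) (at s)"
proof -
  let ?D = "frechet_derivative f (at (x + s *\<^sub>R axis m 1))"
  have "((\<lambda>s. f (x + s *\<^sub>R axis m 1)) has_derivative (\<lambda>h. ?D (h *\<^sub>R axis m 1))) (at s)"
    by (rule has_derivative_compose[of "\<lambda>s. x + s *\<^sub>R axis m 1" _ _ _ f, OF _ differentiable_has_derivative[OF assms]])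
       (auto intro!: derivative_eq_intros)
  moreover have "?D (h *\<^sub>R axis m 1) = partial_deriv m f (x + s *\<^sub>R axis m 1) * h" for h
    using linear_cmul[OF linear_frechet_derivative[OF assms]] by (simp add: partial_deriv_def)
  ultimately show ?thesis by (simp add: has_field_derivative_def)
qed

section \<open>Smooth functions built from exponential steps\<close>

text \<open>The smooth step functions \<open>t \<mapsto> exp (-1/t) / t^n\<close> (for \<open>t > 0\<close>) are closed under differentiation
  up to linear combinations.\<close>
definition expstep :: "nat \<Rightarrow> real \<Rightarrow> real" where
  "expstep n t = (if 0 < t then exp (- (1 / t)) / t^n else 0)"

lemma expstep_nonneg: "0 \<le> expstep n t"
  by (simp add: expstep_def)

lemma expstep_0_le: "expstep 0 t \<le> 1"
  by (simp add: expstep_def)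

text \<open>The term of order \<open>n + 2\<close> of the exponential series at \<open>1/t\<close>
  alone dominates \<open>t^n\<close> in the denominator and leaves a factor
  \<open>t^2\<close>.\<close>

lemma expstep_le: "expstep n t \<le> fact (n + 2) * t\<^sup>2"
proof (cases "0 < t")
  case True
  have "(1/t)^(n+2) / fact (n+2) \<le> exp (1/t)"
  proof -
    have "(1/t)^(n+2) /\<^sub>R fact (n+2) = (\<Sum>i\<in>{n+2}. (1/t)^i /\<^sub>R fact i)" by simp
    also have "\<dots> \<le> (\<Sum>i. (1/t)^i /\<^sub>R fact i)"
      using True by (intro sum_le_suminf summable_exp_generic) auto
    finally show ?thesis by (simp add: exp_def field_simps)
  qed
  then have "inverse (exp (1/t)) \<le> inverse ((1/t)^(n+2) / fact (n+2))"
    using True by (intro le_imp_inverse_le) auto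
  then have "exp (- (1/t)) \<le> fact (n+2) * t^(n+2)"
    by (simp only: exp_minus divide_inverse inverse_mult_distrib power_inverse inverse_inverse_eq mult_1 mult.commute)
  then have "exp (- (1/t)) / t^n \<le> fact (n+2) * t^(n+2) / t^n"
    using True by (intro divide_right_mono) auto
  also have "\<dots> = fact (n+2) * t\<^sup>2" using True by (simp add: power_add power2_eq_square)
  finally show ?thesis using True by (simp add: expstep_def)
qed (simp add: expstep_def)

text \<open>Away from 0 this is calculus; at 0 the quadratic bound \<open>expstep_le\<close> sends
  the difference quotient to 0.\<close>

lemma has_derivative_expstep:
  "(expstep n has_real_derivative expstep (n + 2) t - real n * expstep (n + 1) t) (at t)"
proof -
  consider "t > 0" | "t < 0" | "t = 0" by linarith
  then show ?thesis
  proof cases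
    case 1
    have "((\<lambda>t. exp (- (1 / t)) / t^n) has_real_derivative expstep (n + 2) t - real n * expstep (n + 1) t) (at t)"
      using 1 by (auto intro!: derivative_eq_intros simp: expstep_def field_simps power2_eq_square)
        (cases n; simp add: field_simps)
    then show ?thesis
      by (rule has_field_derivative_transform_within_open[of _ _ _ "{0<..}"]) (use 1 in \<open>auto simp: expstep_def\<close>)
  next
    case 2
    have "((\<lambda>t. 0) has_real_derivative 0) (at t)" by simp
    then have "(expstep n has_real_derivative 0) (at t)"
      by (rule has_field_derivative_transform_within_open[of _ _ _ "{..<0}"]) (use 2 in \<open>auto simp: expstep_def\<close>)
    then show ?thesis using 2 by (simp add: expstep_def)
  next
    case 3
    have "((\<lambda>h. (expstep n (0 + h) - expstep n 0) / h) \<longlongrightarrow> 0) (at 0)"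
    proof (rule Lim_null_comparison)
      have "norm ((expstep n (0 + h) - expstep n 0) / h) \<le> fact (n + 2) * \<bar>h\<bar>" if "h \<noteq> 0" for h
      proof -
        have "\<bar>expstep n h\<bar> / \<bar>h\<bar> \<le> (fact (n + 2) * h\<^sup>2) / \<bar>h\<bar>"
          using expstep_le[of n h] expstep_nonneg[of n h] by (intro divide_right_mono) auto
        also have "\<dots> = fact (n + 2) * \<bar>h\<bar>" using that by (simp add: power2_eq_square abs_if)
        finally show ?thesis by (simp add: expstep_def)
      qed
      then show "\<forall>\<^sub>F h in at 0. norm ((expstep n (0 + h) - expstep n 0) / h) \<le> fact (n + 2) * \<bar>h\<bar>"
        by (auto simp: eventually_at intro!: exI[of _ 1])
      have "((\<lambda>h. fact (n + 2) * \<bar>h\<bar>) \<longlongrightarrow> fact (n + 2) * \<bar>0\<bar>) (at (0::real))"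
        by (intro tendsto_intros)
      then show "((\<lambda>h. fact (n + 2) * \<bar>h\<bar>) \<longlongrightarrow> 0) (at (0::real))" by simp
    qed
    then show ?thesis using 3 by (simp add: DERIV_def expstep_def)
  qed
qed

text \<open>An algebra closed under partial derivatives, so that smoothness needs no calculation
  with higher derivatives. Products of steps over the coordinates give bumps on boxes.\<close>

inductive_set stepalg :: "(real^3 \<Rightarrow> real) set" where
  step: "(\<lambda>x. expstep n (a * x$i + c)) \<in> stepalg"
| const: "(\<lambda>x. c) \<in> stepalg"
| add: "f \<in> stepalg \<Longrightarrow> g \<in> stepalg \<Longrightarrow> (\<lambda>x. f x + g x) \<in> stepalg"
| mult: "f \<in> stepalg \<Longrightarrow> g \<in> stepalg \<Longrightarrow> (\<lambda>x. f x * g x) \<in> stepalg"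

lemma stepalg_prod: "(\<And>i. i \<in> I \<Longrightarrow> f i \<in> stepalg) \<Longrightarrow> (\<lambda>x. \<Prod>i\<in>I. f i x) \<in> stepalg"
  by (induction I rule: infinite_finite_induct) (auto intro: stepalg.intros)

lemma stepalg_derivative:
  "f \<in> stepalg \<Longrightarrow> (\<forall>x. f differentiable (at x)) \<and> (\<forall>m. partial_deriv m f \<in> stepalg)"
proof (induction rule: stepalg.induct)
  case (step n a i c)
  let ?u = "\<lambda>x::real^3. a * x$i + c"
  have D: "((\<lambda>x. expstep n (?u x)) has_derivative
      (\<lambda>h. (expstep (n + 2) (?u x) - real n * expstep (n + 1) (?u x)) * (a * h$i))) (at x)" for x
    by (rule has_derivative_compose[of ?u "\<lambda>h. a * h$i" x UNIV "expstep n", OF _ has_derivative_expstep[unfolded has_field_derivative_def]])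
      (auto intro!: derivative_eq_intros bounded_linear.has_derivative[OF bounded_linear_vec_nth])
  have "partial_deriv m (\<lambda>x. expstep n (?u x)) = (\<lambda>x. expstep (n + 2) (?u x) * (a * axis m 1 $ i)
      + (- real n * (a * axis m 1 $ i)) * expstep (n + 1) (?u x))" for m
    by (rule ext, subst partial_deriv_eq[OF D]) (simp add: algebra_simps)
  then have "partial_deriv m (\<lambda>x. expstep n (?u x)) \<in> stepalg" for m
    by (simp only:) (intro stepalg.intros)
  then show ?case using D unfolding differentiable_def by blast
next
  case (const c)
  then show ?case by (auto intro: stepalg.const)
next
  case (add f g)
  have "partial_deriv m (\<lambda>x. f x + g x) = (\<lambda>x. partial_deriv m f x + partial_deriv m g x)" for m
    using add by (auto simp: partial_deriv_add)
  then show ?case using add by (auto intro: stepalg.intros)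
next
  case (mult f g)
  have "partial_deriv m (\<lambda>x. f x * g x) = (\<lambda>x. f x * partial_deriv m g x + partial_deriv m f x * g x)" for m
    using mult by (auto simp: partial_deriv_mult)
  moreover have "(\<lambda>x. f x * partial_deriv m g x + partial_deriv m f x * g x) \<in> stepalg" for m
    using mult by (intro stepalg.intros) auto
  ultimately show ?case using mult by (auto intro: stepalg.intros)
qed

definition smooth :: "(real^3 \<Rightarrow> real) \<Rightarrow> bool" where
  "smooth f \<longleftrightarrow> (\<forall>is x. foldr partial_deriv is f differentiable (at x))"

text \<open>A coinductive style criterion: iterated partial derivatives never leave
  \<open>G\<close>. It serves for the step algebra, for rescaled functions and for
  convolutions.\<close>

lemma smooth_closedI:
  assumes "f \<in> G" "\<And>f x. f \<in> G \<Longrightarrow> f differentiable (at x)" "\<And>f m. f \<in> G \<Longrightarrow> partial_deriv m f \<in> G"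
  shows "smooth f"
proof -
  have "foldr partial_deriv is f \<in> G" for "is" by (induction "is") (use assms in auto)
  then show ?thesis using assms(2) by (auto simp: smooth_def)
qed

lemma smooth_stepalg: "f \<in> stepalg \<Longrightarrow> smooth f"
  by (rule smooth_closedI[of _ stepalg]) (auto simp: stepalg_derivative)

lemma smooth_differentiable: "smooth f \<Longrightarrow> f differentiable (at x)"
  unfolding smooth_def by (drule spec[of _ "[]"]) simp

lemma smooth_partial: "smooth f \<Longrightarrow> smooth (partial_deriv m f)"
  unfolding smooth_def
proof (intro allI)
  fix "is" x assume *: "\<forall>is x. foldr partial_deriv is f differentiable (at x)"
  show "foldr partial_deriv is (partial_deriv m f) differentiable (at x)"
    using *[rule_format, of "is @ [m]" x] by simp
qed

lemma smooth_continuous: "smooth f \<Longrightarrow> continuous_on S f"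
  by (intro continuous_at_imp_continuous_on ballI differentiable_imp_continuous_within smooth_differentiable)

lemma partial_deriv_zero_outside:
  assumes "closed D" "\<And>x. x \<notin> D \<Longrightarrow> f x = 0" "x \<notin> D"
  shows "partial_deriv m f x = 0"
  using partial_deriv_cong_open[of "-D" x f "\<lambda>_. 0" m] assms by auto

lemma test_function_smooth: "test_function \<Omega> \<phi> \<Longrightarrow> smooth \<phi>"
  by (simp add: test_function_def smooth_def)

lemma test_functionI:
  "smooth \<phi> \<Longrightarrow> compact D \<Longrightarrow> D \<subseteq> \<Omega> \<Longrightarrow> (\<And>x. x \<notin> D \<Longrightarrow> \<phi> x = 0) \<Longrightarrow> test_function \<Omega> \<phi>"
  by (auto simp: test_function_def smooth_def)

lemma test_function_partial: "test_function \<Omega> \<phi> \<Longrightarrow> test_function \<Omega> (partial_deriv m \<phi>)"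
proof -
  assume t: "test_function \<Omega> \<phi>"
  then obtain D where D: "compact D" "D \<subseteq> \<Omega>" "\<And>x. x \<notin> D \<Longrightarrow> \<phi> x = 0" by (auto simp: test_function_def)
  show ?thesis
    by (rule test_functionI[OF smooth_partial[OF test_function_smooth[OF t]] D(1,2)])
       (intro partial_deriv_zero_outside[OF compact_imp_closed[OF D(1)] D(3)])
qed

lemma bcs_continuous_compact:
  assumes "continuous_on UNIV f" "compact D" "\<And>x. x \<notin> D \<Longrightarrow> f x = 0"
  shows "bcs f"
proof -
  have "(\<lambda>x. indicator D x * f x) = f" by (intro ext) (auto simp: indicator_def assms(3))
  then show ?thesis
    using bcs_indicator_continuous[OF assms(1) compact_imp_bounded[OF assms(2)]] assms(2)
    by (simp add: borel_compact)
qed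

lemma test_function_bcs: "test_function \<Omega> \<phi> \<Longrightarrow> bcs \<phi>"
  using test_function_smooth smooth_continuous bcs_continuous_compact unfolding test_function_def by metis

lemma test_function_outside: "test_function \<Omega> \<phi> \<Longrightarrow> x \<notin> \<Omega> \<Longrightarrow> \<phi> x = 0"
  by (auto simp: test_function_def)

lemma test_function_continuous: "test_function \<Omega> \<phi> \<Longrightarrow> continuous_on S \<phi>"
  by (simp add: smooth_continuous test_function_smooth)

lemma lborel_integral_shift:
  fixes f :: "real^3 \<Rightarrow> real"
  assumes "f \<in> borel_measurable borel"
  shows "(LINT x|lborel. f (x + a)) = (LINT x|lborel. f x)"
  using lborel_integral_affine[OF assms, of 1 a] by (simp add: add.commute)

text \<open>Joint measurability and integrability in the position on the segment and its starting
  point, as Fubini requires.\<close>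

lemma bcs_line_product:
  fixes D :: "real^3 \<Rightarrow> real"
  assumes "bcs D"
  shows "bcs (\<lambda>(s, x). indicator {0..t::real} s * D (x + s *\<^sub>R e))" (is "bcs ?H")
proof -
  have mD: "D \<in> borel_measurable borel" using assms by (simp add: bcs_def)
  obtain B where B: "\<And>x. \<bar>D x\<bar> \<le> B" using assms by (auto simp: bcs_def)
  obtain R where R: "{x. D x \<noteq> 0} \<subseteq> cball 0 R" using assms bounded_subset_cball_0[of "{x. D x \<noteq> 0}"] by (auto simp: bcs_def)
  show ?thesis
  proof (rule bcsI)
    show "?H \<in> borel_measurable borel"
    proof -
      have "(\<lambda>y::real \<times> (real^3). snd y + fst y *\<^sub>R e) \<in> borel \<rightarrow>\<^sub>M borel" "(fst :: real \<times> (real^3) \<Rightarrow> real) \<in> borel \<rightarrow>\<^sub>M borel"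
        by (intro borel_measurable_continuous_onI continuous_intros)+
      then show ?thesis
        unfolding case_prod_beta
        by (intro borel_measurable_times measurable_compose[OF _ mD] measurable_compose[of fst _ _ "indicator {0..t}"]) auto
    qed
    show "\<bar>?H y\<bar> \<le> B" for y using B[of 0] B by (auto simp: case_prod_beta indicator_def intro: order_trans[OF abs_ge_zero])
    show "bounded (cbox 0 t \<times> cball (0::real^3) (R + \<bar>t\<bar> * norm e))" by (intro bounded_Times bounded_cbox bounded_cball)
    show "?H y = 0" if "y \<notin> cbox 0 t \<times> cball 0 (R + \<bar>t\<bar> * norm e)" for y
    proof (rule ccontr)
      assume "?H y \<noteq> 0"
      then have s: "fst y \<in> cbox 0 t" and "D (snd y + fst y *\<^sub>R e) \<noteq> 0"
        by (auto simp: case_prod_beta indicator_def split: if_splits)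
      then have "norm (snd y + fst y *\<^sub>R e) \<le> R" using R by auto
      moreover have "norm (fst y *\<^sub>R e) \<le> \<bar>t\<bar> * norm e" using s by (auto intro!: mult_right_mono)
      ultimately have "norm (snd y) \<le> R + \<bar>t\<bar> * norm e" using norm_triangle_ineq4[of "snd y + fst y *\<^sub>R e" "fst y *\<^sub>R e"] by simp
      then show False using that s by (cases y) auto
    qed
  qed
qed

text \<open>Integrating the increments \<open>F (x + e) - F x\<close> over the whole space yields 0.\<close>
lemma integral_zero_from_increments:
  fixes F D :: "real^3 \<Rightarrow> real"
  assumes "bcs F" "bcs D"
    "AE x in lborel. F (x + e) - F x = (LINT s|lborel. indicator {0..1} s * D (x + s *\<^sub>R e))"
  shows "(LINT x|lborel. D x) = 0"
proof -
  have mF: "F \<in> borel_measurable borel" and mD: "D \<in> borel_measurable borel" using assms by (auto simp: bcs_def)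
  define H where "H = (\<lambda>(s, x). indicator {0..1::real} s * D (x + s *\<^sub>R e))"
  have "bcs H" unfolding H_def by (rule bcs_line_product[OF assms(2)])
  then have iH: "integrable (lborel \<Otimes>\<^sub>M lborel) H" using integrable_bcs by (simp add: lborel_prod)
  have iF: "integrable lborel F" using integrable_bcs assms(1) .
  have iF': "integrable lborel (\<lambda>x. F (x + e))"
    by (intro integrable_bcs bcs_shift assms(1))
  have "0 = (LINT x|lborel. F (x + e)) - (LINT x|lborel. F x)" using lborel_integral_shift[OF mF] by simp
  also have "\<dots> = (LINT x|lborel. F (x + e) - F x)" using iF iF' by simp
  also have "\<dots> = (LINT x|lborel. LINT s|lborel. H (s, x))"
  proof (rule integral_cong_AE)
    show "(\<lambda>x. LINT s|lborel. H (s, x)) \<in> borel_measurable lborel"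
    proof -
      have "H \<in> borel_measurable (lborel \<Otimes>\<^sub>M lborel)" using \<open>bcs H\<close> by (simp add: bcs_def lborel_prod)
      from measurable_pair_swap[OF this] show ?thesis by (intro lborel.borel_measurable_lebesgue_integral)
    qed
  qed (use assms(3) mF in \<open>auto simp: H_def\<close>)
  also have "\<dots> = (LINT s|lborel. LINT x|lborel. H (s, x))"
    using lborel_pair.Fubini_integral[of "\<lambda>s x. H (s, x)"] iH by simp
  also have "\<dots> = (LINT s|lborel. indicator {0..1::real} s * (LINT x|lborel. D x))"
    using mD by (simp add: H_def lborel_integral_shift)
  also have "\<dots> = (LINT x|lborel. D x)" by simp
  finally show ?thesis by simp
qed

section \<open>Weak derivatives\<close>

text \<open>The positive and the negative part of \<open>f\<close> are densities of two measures
  that agree on boxes. Boxes are stable under intersection and generate the Borel sets, so the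
  measures and hence the densities coincide.\<close>

lemma integrable_lborel_box_zero_AE:
  fixes f :: "'a::euclidean_space \<Rightarrow> real"
  assumes f: "integrable lborel f" and z: "\<And>c d. (LINT x|lborel. indicator (box c d) x * f x) = 0"
  shows "AE x in lborel. f x = 0"
proof -
  have m [measurable]: "f \<in> borel_measurable borel" using f by auto
  let ?p = "\<lambda>x. ennreal (f x)" and ?n = "\<lambda>x. ennreal (- f x)"
  have "density lborel ?p = density lborel ?n"
  proof (rule measure_eqI_generator_eq[where E = "range (\<lambda>(a, b). box a b)" and \<Omega> = UNIV
        and A = "\<lambda>n::nat. box (- (real n *\<^sub>R One)) (real n *\<^sub>R One)"])
    show "Int_stable (range (\<lambda>(a, b). box a b) :: 'a set set)"
      by (auto simp: Int_stable_def box_Int_box)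
    show "(\<Union>n::nat. box (- (real n *\<^sub>R One)) (real n *\<^sub>R One)) = (UNIV :: 'a set)"
      by (rule UN_box_eq_UNIV)
    show "sets (density lborel ?p) = sigma_sets UNIV (range (\<lambda>(a, b). box a b))"
      "sets (density lborel ?n) = sigma_sets UNIV (range (\<lambda>(a, b). box a b))"
      by (simp_all add: borel_eq_box)
    have fin: "emeasure (density lborel (\<lambda>x. ennreal (g x))) X \<noteq> \<infinity>" if g: "integrable lborel g" and X: "X \<in> sets borel" for g X
    proof -
      have "emeasure (density lborel (\<lambda>x. ennreal (g x))) X \<le> (\<integral>\<^sup>+x. ennreal (norm (g x)) \<partial>lborel)"
        using g X by (subst emeasure_density) (auto intro!: nn_integral_mono simp: ennreal_leI split: split_indicator)
      also have "\<dots> < \<infinity>" using g by (simp add: integrable_iff_bounded)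
      finally show ?thesis by auto
    qed
    show "emeasure (density lborel ?p) (box (- (real n *\<^sub>R One)) (real n *\<^sub>R One)) \<noteq> \<infinity>" for n :: nat
      by (rule fin[OF f]) auto
    fix X :: "'a set" assume "X \<in> range (\<lambda>(a, b). box a b)"
    then obtain c d where X: "X = box c d" by auto
    have i: "integrable lborel (\<lambda>x. indicator X x * f x)"
      using integrable_real_mult_indicator[OF _ f, of X] X by (simp add: mult.commute)
    have "enn2real (emeasure (density lborel ?p) X) - enn2real (emeasure (density lborel ?n) X)
        = enn2real (\<integral>\<^sup>+x. ennreal (indicator X x * f x) \<partial>lborel) - enn2real (\<integral>\<^sup>+x. ennreal (- (indicator X x * f x)) \<partial>lborel)"
      using X by (subst (1 2) emeasure_density) (auto intro!: arg_cong2[where f = minus] arg_cong[where f = enn2real] nn_integral_cong split: split_indicator)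
    also have "\<dots> = (LINT x|lborel. indicator X x * f x)"
      using i by (subst real_lebesgue_integral_def) auto
    also have "\<dots> = 0" using z X by simp
    finally have "enn2real (emeasure (density lborel ?p) X) = enn2real (emeasure (density lborel ?n) X)" by simp
    moreover have "emeasure (density lborel ?p) X < top" "emeasure (density lborel ?n) X < top"
      using fin[OF f, of X] fin[of "\<lambda>x. - f x" X] f X by (auto simp: top.not_eq_extremum)
    ultimately show "emeasure (density lborel ?p) X = emeasure (density lborel ?n) X"
      by (metis ennreal_enn2real)
  qed auto
  then have "AE x in lborel. ?p x = ?n x"
    by (intro sigma_finite_measure.density_unique[OF lborel.sigma_finite_measure_axioms]) auto
  then show ?thesis
  proof (rule AE_mp, intro AE_I2 impI)
    fix x assume "?p x = ?n x"
    then show "f x = 0" by (cases "f x \<ge> 0") (auto simp: ennreal_neg ennreal_eq_0_iff)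
  qed
qed

text \<open>Smooth, between 0 and 1, zero off the open box, and convergent pointwise to its
  indicator as \<open>n\<close> grows.\<close>

definition box_bump :: "real^3 \<Rightarrow> real^3 \<Rightarrow> nat \<Rightarrow> real^3 \<Rightarrow> real" where
  "box_bump c d n x = (\<Prod>i\<in>UNIV. expstep 0 (real n * (x$i - c$i)) * expstep 0 (real n * (d$i - x$i)))"

lemma box_bump_stepalg: "box_bump c d n \<in> stepalg"
proof -
  have "(\<lambda>x. \<Prod>i\<in>UNIV. expstep 0 (real n * x$i + - (real n * c$i)) * expstep 0 ((- real n) * x$i + real n * d$i)) \<in> stepalg"
    by (intro stepalg_prod stepalg.mult stepalg.step)
  also have "(\<lambda>x. \<Prod>i\<in>UNIV. expstep 0 (real n * x$i + - (real n * c$i)) * expstep 0 ((- real n) * x$i + real n * d$i)) = box_bump c d n"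
    by (auto simp: box_bump_def algebra_simps)
  finally show ?thesis .
qed

lemma box_bump_bounds: "0 \<le> box_bump c d n x" "box_bump c d n x \<le> 1"
  unfolding box_bump_def
  by (auto intro!: prod_nonneg prod_le_1 mult_nonneg_nonneg mult_le_one expstep_nonneg expstep_0_le)

lemma box_bump_outside: "x \<notin> box c d \<Longrightarrow> box_bump c d n x = 0"
proof -
  assume "x \<notin> box c d"
  then obtain i where i: "x$i \<le> c$i \<or> d$i \<le> x$i" by (auto simp: mem_box_cart not_less)
  have np: "\<not> 0 < real n * t" if "t \<le> 0" for t :: real
    using that by (simp add: mult_nonneg_nonpos not_less)
  have "expstep 0 (real n * (x$i - c$i)) = 0 \<or> expstep 0 (real n * (d$i - x$i)) = 0"
    using i np[of "x$i - c$i"] np[of "d$i - x$i"] by (auto simp: expstep_def)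
  then show ?thesis unfolding box_bump_def by (intro prod_zero) auto
qed

lemma box_bump_tendsto: "(\<lambda>n. box_bump c d n x) \<longlonglongrightarrow> indicator (box c d) x"
proof (cases "x \<in> box c d")
  case True
  have *: "(\<lambda>n. expstep 0 (real n * t)) \<longlonglongrightarrow> 1" if "0 < t" for t
  proof -
    have "(\<lambda>n. exp (- (1 / (real n * t)))) \<longlonglongrightarrow> exp (- 0)"
      using that by (intro tendsto_exp tendsto_minus)
        (auto intro!: tendsto_divide_0[OF tendsto_const] filterlim_at_top_imp_at_infinity
          filterlim_at_top_mult_tendsto_pos[OF tendsto_const that filterlim_real_sequentially])
    moreover have "\<forall>\<^sub>F n in sequentially. exp (- (1 / (real n * t))) = expstep 0 (real n * t)"
      using eventually_gt_at_top[of 0] by eventually_elim (use that in \<open>auto simp: expstep_def\<close>)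
    ultimately show ?thesis by (auto elim: Lim_transform_eventually)
  qed
  have "(\<lambda>n. box_bump c d n x) \<longlonglongrightarrow> (\<Prod>i\<in>(UNIV::3 set). 1 * 1)"
    unfolding box_bump_def using True by (intro tendsto_prod tendsto_mult *) (auto simp: mem_box_cart)
  then show ?thesis using True by simp
qed (simp add: box_bump_outside)

lemma test_function_box_bump: "cbox c d \<subseteq> \<Omega> \<Longrightarrow> test_function \<Omega> (box_bump c d n)"
proof (rule test_functionI[OF smooth_stepalg[OF box_bump_stepalg] compact_cbox])
  show "x \<notin> cbox c d \<Longrightarrow> box_bump c d n x = 0" for x
    using box_bump_outside[of x c d n] box_subset_cbox by blast
qed

lemma bounded_measurable_L2:
  assumes "open \<Omega>" "bounded \<Omega>" "f \<in> borel_measurable borel" "\<And>x. x \<in> \<Omega> \<Longrightarrow> \<bar>f x\<bar> \<le> B"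
  shows "f \<in> L2_space \<Omega>"
proof -
  have "bcs (\<lambda>x. indicator \<Omega> x * f x)"
  proof (rule bcsI[OF _ _ assms(2)])
    show "(\<lambda>x. indicator \<Omega> x * f x) \<in> borel_measurable borel"
      using assms by (intro borel_measurable_times borel_measurable_indicator) auto
    show "\<bar>indicator \<Omega> x * f x\<bar> \<le> \<bar>B\<bar>" for x using assms(4)[of x] by (auto simp: indicator_def)
  qed auto
  then have "integrable lborel (\<lambda>x. (indicator \<Omega> x * f x)\<^sup>2)" by (intro integrable_bcs bcs_power2)
  also have "(\<lambda>x. (indicator \<Omega> x * f x)\<^sup>2) = (\<lambda>x. indicator \<Omega> x * (f x)\<^sup>2)"
    by (auto simp: indicator_def)
  finally have "integrable (lebesgue_on \<Omega>) (\<lambda>x. (f x)\<^sup>2)"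
    using assms by (subst integral_lebesgue_on_borel) auto
  moreover have "f \<in> borel_measurable (lebesgue_on \<Omega>)"
    using assms(3) by (simp add: measurable_completion measurable_restrict_space1)
  ultimately show ?thesis by (simp add: L2_space_def)
qed

lemma bcs_L2: "open \<Omega> \<Longrightarrow> bounded \<Omega> \<Longrightarrow> bcs f \<Longrightarrow> f \<in> L2_space \<Omega>"
  using bounded_measurable_L2 unfolding bcs_def by metis

lemma test_function_L2: "open \<Omega> \<Longrightarrow> bounded \<Omega> \<Longrightarrow> test_function \<Omega>' f \<Longrightarrow> f \<in> L2_space \<Omega>"
  by (intro bcs_L2 test_function_bcs)

lemma L2_inner_lborel:
  assumes "open \<Omega>" "f \<in> borel_measurable borel" "g \<in> borel_measurable borel"
  shows "L2_inner \<Omega> f g = (LINT x|lborel. indicator \<Omega> x * (f x * g x))"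
  unfolding L2_inner_def using assms by (intro integral_lebesgue_on_borel) auto

text \<open>The fundamental lemma of the calculus of variations: dominated convergence passes from
  bumps to indicators of boxes, and countably many boxes exhaust the open set.\<close>

lemma test_function_orthogonal_AE_zero:
  assumes "open \<Omega>" "bounded \<Omega>" "g \<in> L2_space \<Omega>"
    and orth: "\<And>\<phi>. test_function \<Omega> \<phi> \<Longrightarrow> L2_inner \<Omega> g \<phi> = 0"
  shows "AE x in lebesgue_on \<Omega>. g x = 0"
proof -
  have ms: "\<Omega> \<in> sets lebesgue" using assms(1) by auto
  have one: "(\<lambda>_. 1) \<in> L2_space \<Omega>"
    by (rule bounded_measurable_L2[OF assms(1,2)]) auto
  have ig: "integrable (lebesgue_on \<Omega>) g"
    using sqint_prod[of g "lebesgue_on \<Omega>" "\<lambda>_. 1"] assms(3) one by (simp add: L2_space_sqint)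
  then have ig': "integrable lebesgue (\<lambda>x. indicator \<Omega> x * g x)"
    using ms by (subst (asm) integrable_restrict_space) auto
  \<comment> \<open>\<open>g\<close> is only Lebesgue measurable; the argument by generators needs a
    Borel version.\<close>
  then obtain f where f: "f \<in> borel_measurable lborel" "AE x in lborel. indicator \<Omega> x * g x = f x"
    using completion_ex_borel_measurable_real[of "\<lambda>x. indicator \<Omega> x * g x" lborel] by auto
  have aef: "AE x in lebesgue. indicator \<Omega> x * g x = f x" using f(2) by (rule AE_completion)
  have if': "integrable lborel f"
    using ig' integrable_cong_AE[OF _ _ aef] f(1) by (auto simp: integrable_completion measurable_completion)
  have box0: "(LINT x|lborel. indicator (box c d) x * f x) = 0" if "cbox c d \<subseteq> \<Omega>" for c d
  proof -
    have "(\<lambda>n. LINT x|lebesgue_on \<Omega>. g x * box_bump c d n x) \<longlonglongrightarrow> (LINT x|lebesgue_on \<Omega>. g x * indicator (box c d) x)"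
    proof (rule integral_dominated_convergence[where w = "\<lambda>x. \<bar>g x\<bar>"])
      show "AE x in lebesgue_on \<Omega>. norm (g x * box_bump c d n x) \<le> \<bar>g x\<bar>" for n
        using box_bump_bounds[of c d n] by (auto simp: abs_mult mult_left_le)
      show "AE x in lebesgue_on \<Omega>. (\<lambda>n. g x * box_bump c d n x) \<longlonglongrightarrow> g x * indicator (box c d) x"
        by (auto intro!: tendsto_intros box_bump_tendsto)
      show "(\<lambda>x. g x * indicator (box c d) x) \<in> borel_measurable (lebesgue_on \<Omega>)"
      proof -
        have "indicator (box c d) \<in> borel_measurable (borel :: (real^3) measure)"
          by (intro borel_measurable_indicator) auto
        then have "indicator (box c d) \<in> borel_measurable (lebesgue_on \<Omega>)"
          by (simp add: measurable_completion measurable_restrict_space1)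
        then show ?thesis using ig by (intro borel_measurable_times) auto
      qed
      show "(\<lambda>x. g x * box_bump c d n x) \<in> borel_measurable (lebesgue_on \<Omega>)" for n
        using ig test_function_L2[OF assms(1,2) test_function_box_bump[OF that, of n]]
        by (intro borel_measurable_times) (auto simp: L2_space_def)
    qed (use ig in auto)
    moreover have "(LINT x|lebesgue_on \<Omega>. g x * box_bump c d n x) = 0" for n
      using orth[OF test_function_box_bump[OF that]] by (simp add: L2_inner_def)
    ultimately have "0 = (LINT x|lebesgue_on \<Omega>. g x * indicator (box c d) x)"
      by (simp add: LIMSEQ_const_iff)
    also have "\<dots> = (LINT x|lebesgue. indicator \<Omega> x * g x * indicator (box c d) x)"
      using ms by (subst integral_restrict_space) (auto simp: mult.assoc)
    also have "\<dots> = (LINT x|lebesgue. f x * indicator (box c d) x)"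
    proof (rule integral_cong_AE)
      show "(\<lambda>x. indicator \<Omega> x * g x * indicator (box c d) x) \<in> borel_measurable lebesgue"
        by (rule borel_measurable_times[OF borel_measurable_integrable[OF ig'] borel_measurable_indicator]) simp
      show "(\<lambda>x. f x * indicator (box c d) x) \<in> borel_measurable lebesgue"
        using f(1) by (intro borel_measurable_times borel_measurable_indicator measurable_completion) auto
    qed (use aef in auto)
    also have "\<dots> = (LINT x|lborel. indicator (box c d) x * f x)"
      using f(1) by (subst integral_completion) (auto simp: mult.commute)
    finally show ?thesis by simp
  qed
  \<comment> \<open>Inside a fixed box whose closure lies in \<Omega> every box may serve for
    testing: its intersection with \<open>box a b\<close> is again a box, and its closure stays in
    \<Omega>.\<close>
  have aebox: "AE x in lborel. x \<in> box a b \<longrightarrow> f x = 0" if ab: "cbox a b \<subseteq> \<Omega>" for a b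
  proof -
    have "AE x in lborel. indicator (box a b) x * f x = 0"
    proof (rule integrable_lborel_box_zero_AE)
      show "integrable lborel (\<lambda>x. indicator (box a b) x * f x)"
        using integrable_real_mult_indicator[OF _ if', of "box a b"] by (simp add: mult.commute)
      fix c d
      obtain u v where uv: "box c d \<inter> box a b = box u v" by (auto simp: box_Int_box)
      have "(LINT x|lborel. indicator (box c d) x * (indicator (box a b) x * f x)) = (LINT x|lborel. indicator (box u v) x * f x)"
        unfolding uv[symmetric] by (intro Bochner_Integration.integral_cong) (auto simp: indicator_def)
      also have "\<dots> = 0"
      proof (cases "box u v = {}")
        case False
        then have "cbox u v = closure (box u v)" by (simp add: closure_box)
        also have "\<dots> \<subseteq> closure (box a b)" using uv by (intro closure_mono) blast
        also have "\<dots> \<subseteq> cbox a b" by (rule closure_minimal) (auto simp: mem_box less_imp_le)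
        finally show ?thesis using box0 ab by blast
      qed auto
      finally show "(LINT x|lborel. indicator (box c d) x * (indicator (box a b) x * f x)) = 0" .
    qed
    then show ?thesis by (auto elim!: eventually_mono simp: indicator_def)
  qed
  \<comment> \<open>Closed boxes cover \<Omega>, while \<open>aebox\<close> speaks of open boxes;
    the difference is a null set for each of the countably many boxes.\<close>
  obtain \<D> where D1: "countable \<D>" "\<D> \<subseteq> Pow \<Omega>" and D2: "\<And>X. X \<in> \<D> \<Longrightarrow> \<exists>a b. X = cbox a b" and D3: "\<Union>\<D> = \<Omega>"
    by (rule open_countable_Union_open_cbox[OF assms(1)]) (rule that)
  have "AE x in lborel. x \<in> X \<longrightarrow> f x = 0" if X: "X \<in> \<D>" for X
  proof -
    obtain a b where ab: "X = cbox a b" "cbox a b \<subseteq> \<Omega>" using D2[OF X] D1(2) X by auto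
    have "cbox a b - box a b \<in> null_sets lborel"
      using negligible_frontier_interval[of a b] by (auto simp: negligible_iff_null_sets null_sets_completion_iff)
    then have "AE x in lborel. x \<notin> cbox a b - box a b" by (rule AE_not_in)
    with aebox[OF ab(2)] show ?thesis by eventually_elim (auto simp: ab)
  qed
  then have "AE x in lborel. \<forall>X\<in>\<D>. x \<in> X \<longrightarrow> f x = 0" unfolding AE_ball_countable[OF D1(1)] by blast
  then have "AE x in lborel. x \<in> \<Omega> \<longrightarrow> f x = 0" using D3 by (auto elim!: eventually_mono)
  then have "AE x in lebesgue. x \<in> \<Omega> \<longrightarrow> f x = 0" by (rule AE_completion)
  with aef have "AE x in lebesgue. x \<in> \<Omega> \<longrightarrow> g x = 0" by eventually_elim auto
  then show ?thesis using ms by (simp add: AE_restrict_space_iff)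
qed

lemma weak_partial_spec:
  "u \<in> H1_space \<Omega> \<Longrightarrow> weak_partial \<Omega> i u \<in> L2_space \<Omega> \<and> has_weak_partial \<Omega> i u (weak_partial \<Omega> i u)"
  unfolding weak_partial_def H1_space_def
  using someI_ex[of "\<lambda>g. g \<in> L2_space \<Omega> \<and> has_weak_partial \<Omega> i u g"] by auto

lemma weak_partial_unique:
  assumes "open \<Omega>" "bounded \<Omega>" "g \<in> L2_space \<Omega>" "has_weak_partial \<Omega> i u g" "h \<in> L2_space \<Omega>" "has_weak_partial \<Omega> i u h"
  shows "AE x in lebesgue_on \<Omega>. g x = h x"
proof -
  have "AE x in lebesgue_on \<Omega>. g x - h x = 0"
  proof (rule test_function_orthogonal_AE_zero[OF assms(1,2)])
    show "(\<lambda>x. g x - h x) \<in> L2_space \<Omega>" using lin_set_diff[OF lin_set_L2] assms by blast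
    fix \<phi> assume t: "test_function \<Omega> \<phi>"
    have "L2_inner \<Omega> (\<lambda>x. g x - h x) \<phi> = L2_inner \<Omega> g \<phi> - L2_inner \<Omega> h \<phi>"
      by (intro L2_inner_comb assms test_function_L2[OF assms(1,2) t])
    then show "L2_inner \<Omega> (\<lambda>x. g x - h x) \<phi> = 0" using assms t by (simp add: has_weak_partial_def)
  qed
  then show ?thesis by (auto elim: eventually_mono)
qed

lemma weak_partial_AE_eq:
  assumes "open \<Omega>" "bounded \<Omega>" "g \<in> L2_space \<Omega>" "has_weak_partial \<Omega> i u g"
  shows "AE x in lebesgue_on \<Omega>. weak_partial \<Omega> i u x = g x" "weak_partial \<Omega> i u \<in> L2_space \<Omega>"
proof -
  have *: "weak_partial \<Omega> i u \<in> L2_space \<Omega> \<and> has_weak_partial \<Omega> i u (weak_partial \<Omega> i u)"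
    unfolding weak_partial_def
    using someI_ex[of "\<lambda>g. g \<in> L2_space \<Omega> \<and> has_weak_partial \<Omega> i u g"] assms by auto
  then show "AE x in lebesgue_on \<Omega>. weak_partial \<Omega> i u x = g x" "weak_partial \<Omega> i u \<in> L2_space \<Omega>"
    using weak_partial_unique[OF assms(1,2) _ _ assms(3,4)] by auto
qed

text \<open>The fundamental theorem on unit segments parallel to an axis supplies the increments.
  This is integration by parts without a boundary.\<close>

lemma integral_partial_deriv_zero:
  assumes "bcs F" "\<And>x. F differentiable (at x)" "continuous_on UNIV (partial_deriv m F)" "bcs (partial_deriv m F)"
  shows "(LINT x|lborel. partial_deriv m F x) = 0"
proof (rule integral_zero_from_increments[OF assms(1,4)], intro AE_I2)
  fix x
  have "has_bochner_integral lborel (\<lambda>s. indicator {0..1} s *\<^sub>R partial_deriv m F (x + s *\<^sub>R axis m 1))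
     (F (x + 1 *\<^sub>R axis m 1) - F (x + 0 *\<^sub>R axis m 1))"
  proof (rule has_bochner_integral_FTC_Icc)
    show "((\<lambda>s. F (x + s *\<^sub>R axis m 1)) has_vector_derivative partial_deriv m F (x + s *\<^sub>R axis m 1)) (at s within {0..1})" for s
      using line_derivative[OF assms(2)] by (simp add: has_field_derivative_at_within has_real_derivative_iff_has_vector_derivative[symmetric])
    show "continuous_on {0..1} (\<lambda>s. partial_deriv m F (x + s *\<^sub>R axis m 1))"
      by (intro continuous_on_compose2[OF assms(3)] continuous_intros) auto
  qed simp
  then show "F (x + axis m 1) - F x = (LINT s|lborel. indicator {0..1} s * partial_deriv m F (x + s *\<^sub>R axis m 1))"
    by (simp add: has_bochner_integral_integral_eq)
qed

text \<open>Integrate the derivative of the product of the two test functions.\<close>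

lemma test_function_has_weak_partial:
  assumes "open \<Omega>" "bounded \<Omega>" "test_function \<Omega> \<phi>"
  shows "has_weak_partial \<Omega> i \<phi> (partial_deriv i \<phi>)"
  unfolding has_weak_partial_def
proof (intro allI impI)
  fix \<psi> assume \<psi>: "test_function \<Omega> \<psi>"
  note d = smooth_differentiable[OF test_function_smooth]
  let ?F = "\<lambda>x. \<phi> x * \<psi> x"
  have pd: "partial_deriv i ?F = (\<lambda>x. \<phi> x * partial_deriv i \<psi> x + partial_deriv i \<phi> x * \<psi> x)"
    using partial_deriv_mult[OF d[OF assms(3)] d[OF \<psi>]] by auto
  note b = test_function_bcs[OF assms(3)] test_function_bcs[OF \<psi>]
    test_function_bcs[OF test_function_partial[OF assms(3)], of i] test_function_bcs[OF test_function_partial[OF \<psi>], of i]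
  have "(LINT x|lborel. partial_deriv i ?F x) = 0"
  proof (rule integral_partial_deriv_zero)
    show "bcs ?F" by (intro bcs_prod b)
    show "?F differentiable (at x)" for x by (intro differentiable_mult d[OF assms(3)] d[OF \<psi>])
    show "continuous_on UNIV (partial_deriv i ?F)"
      unfolding pd by (intro continuous_intros test_function_continuous[OF assms(3)] test_function_continuous[OF \<psi>]
          test_function_continuous[OF test_function_partial[OF assms(3)]] test_function_continuous[OF test_function_partial[OF \<psi>]])
    show "bcs (partial_deriv i ?F)" unfolding pd by (intro bcs_add bcs_prod b)
  qed
  then have "(LINT x|lborel. \<phi> x * partial_deriv i \<psi> x) + (LINT x|lborel. partial_deriv i \<phi> x * \<psi> x) = 0"
    unfolding pd using b by (subst (asm) Bochner_Integration.integral_add) (auto intro!: integrable_bcs bcs_prod)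
  moreover have "L2_inner \<Omega> \<phi> (partial_deriv i \<psi>) = (LINT x|lborel. \<phi> x * partial_deriv i \<psi> x)"
    using b test_function_outside[OF assms(3)]
    by (subst L2_inner_lborel[OF assms(1)]) (auto simp: bcs_def indicator_def intro!: Bochner_Integration.integral_cong)
  moreover have "L2_inner \<Omega> (partial_deriv i \<phi>) \<psi> = (LINT x|lborel. partial_deriv i \<phi> x * \<psi> x)"
    using b test_function_outside[OF \<psi>]
    by (subst L2_inner_lborel[OF assms(1)]) (auto simp: bcs_def indicator_def intro!: Bochner_Integration.integral_cong)
  ultimately show "L2_inner \<Omega> \<phi> (partial_deriv i \<psi>) = - L2_inner \<Omega> (partial_deriv i \<phi>) \<psi>" by simp
qed

lemma L2_inner_cong_AE:
  assumes "AE x in lebesgue_on \<Omega>. f x = f' x" "AE x in lebesgue_on \<Omega>. g x = g' x"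
    "f \<in> borel_measurable (lebesgue_on \<Omega>)" "f' \<in> borel_measurable (lebesgue_on \<Omega>)"
    "g \<in> borel_measurable (lebesgue_on \<Omega>)" "g' \<in> borel_measurable (lebesgue_on \<Omega>)"
  shows "L2_inner \<Omega> f g = L2_inner \<Omega> f' g'"
  unfolding L2_inner_def using assms(3-)
proof (intro integral_cong_AE)
  show "AE x in lebesgue_on \<Omega>. f x * g x = f' x * g' x" using assms(1,2) by eventually_elim auto
qed auto

lemma L2_norm_cong_AE:
  assumes "AE x in lebesgue_on \<Omega>. f x = f' x" "f \<in> L2_space \<Omega>" "f' \<in> L2_space \<Omega>"
  shows "L2_norm \<Omega> f = L2_norm \<Omega> f'"
  unfolding L2_norm_def using assms by (subst L2_inner_cong_AE[OF assms(1,1)]) (auto simp: L2_space_def)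

lemma test_function_H1_0:
  assumes "open \<Omega>" "bounded \<Omega>" "test_function \<Omega> \<phi>"
  shows "\<phi> \<in> H1_0_space \<Omega>"
proof -
  have L2: "\<phi> \<in> L2_space \<Omega>" "partial_deriv i \<phi> \<in> L2_space \<Omega>" for i
    using test_function_L2[OF assms] test_function_L2[OF assms(1,2) test_function_partial[OF assms(3)]] by auto
  have z: "(\<lambda>_. 0) \<in> L2_space \<Omega>" using lin_set_zero[OF lin_set_L2] .
  \<comment> \<open>Even for the zero function \<open>weak_partial\<close> is an arbitrary choice,
    which is known to vanish only almost everywhere.\<close>
  have "L2_norm \<Omega> (weak_partial \<Omega> i (\<lambda>x. 0)) = 0" for i
  proof -
    have w: "has_weak_partial \<Omega> i (\<lambda>_. 0) (\<lambda>_. 0)" by (simp add: has_weak_partial_def L2_inner_def)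
    have "L2_norm \<Omega> (weak_partial \<Omega> i (\<lambda>x. 0)) = L2_norm \<Omega> (\<lambda>_. 0)"
      by (intro L2_norm_cong_AE weak_partial_AE_eq[OF assms(1,2) z w] z)
    then show ?thesis by (simp add: L2_norm_def L2_inner_def)
  qed
  then have "H1_norm \<Omega> (\<lambda>x. \<phi> x - \<phi> x) = 0"
    by (simp add: H1_norm_def) (simp add: L2_norm_def L2_inner_def)
  moreover have "\<phi> \<in> H1_space \<Omega>"
    using L2 test_function_has_weak_partial[OF assms] by (auto simp: H1_space_def)
  ultimately show ?thesis using assms(3) by (auto simp: H1_0_space_def intro!: exI[of _ "\<lambda>_. \<phi>"])
qed

lemma weak_partial_test_function:
  assumes "open \<Omega>" "bounded \<Omega>" "test_function \<Omega> \<phi>"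
  shows "AE x in lebesgue_on \<Omega>. weak_partial \<Omega> i \<phi> x = partial_deriv i \<phi> x"
  using weak_partial_AE_eq(1)[OF assms(1,2) test_function_L2[OF assms(1,2) test_function_partial[OF assms(3)]]
      test_function_has_weak_partial[OF assms]] .

lemma H1_0_space_approx:
  assumes "open \<Omega>" "bounded \<Omega>" "u \<in> H1_0_space \<Omega>" "0 < \<epsilon>"
  shows "\<exists>\<phi>. test_function \<Omega> \<phi> \<and> (\<forall>i. L2_norm \<Omega> (\<lambda>x. weak_partial \<Omega> i u x - partial_deriv i \<phi> x) < \<epsilon>)"
proof -
  obtain \<phi> where \<phi>: "\<And>n::nat. test_function \<Omega> (\<phi> n)" "(\<lambda>n. H1_norm \<Omega> (\<lambda>x. u x - \<phi> n x)) \<longlonglongrightarrow> 0"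
    and u: "u \<in> H1_space \<Omega>"
    using assms(3) by (auto simp: H1_0_space_def)
  obtain n where n: "H1_norm \<Omega> (\<lambda>x. u x - \<phi> n x) < \<epsilon>"
    using order_tendstoD(2)[OF \<phi>(2) assms(4)] by (auto simp: eventually_sequentially)
  have L2: "\<phi> n \<in> L2_space \<Omega>" "partial_deriv i (\<phi> n) \<in> L2_space \<Omega>" "weak_partial \<Omega> i u \<in> L2_space \<Omega>" "u \<in> L2_space \<Omega>" for i
    using test_function_L2[OF assms(1,2) \<phi>(1)] test_function_L2[OF assms(1,2) test_function_partial[OF \<phi>(1)]]
      weak_partial_spec[OF u] u by (auto simp: H1_space_def)
  have "L2_norm \<Omega> (\<lambda>x. weak_partial \<Omega> i u x - partial_deriv i (\<phi> n) x) < \<epsilon>" for i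
  proof -
    let ?g = "\<lambda>x. weak_partial \<Omega> i u x - partial_deriv i (\<phi> n) x"
    have g: "?g \<in> L2_space \<Omega>" using lin_set_diff[OF lin_set_L2] L2 by blast
    have w: "has_weak_partial \<Omega> i (\<lambda>x. u x - \<phi> n x) ?g"
      unfolding has_weak_partial_def
    proof (intro allI impI)
      fix \<psi> assume \<psi>: "test_function \<Omega> \<psi>"
      then have L: "\<psi> \<in> L2_space \<Omega>" "partial_deriv i \<psi> \<in> L2_space \<Omega>"
        using test_function_L2[OF assms(1,2) \<psi>] test_function_L2[OF assms(1,2) test_function_partial[OF \<psi>]] by auto
      show "L2_inner \<Omega> (\<lambda>x. u x - \<phi> n x) (partial_deriv i \<psi>) = - L2_inner \<Omega> ?g \<psi>"
        using weak_partial_spec[OF u, of i] test_function_has_weak_partial[OF assms(1,2) \<phi>(1), of i n] \<psi>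
          L2_inner_comb(3)[OF L2(4,1) L(2)] L2_inner_comb(3)[OF L2(3,2) L(1), of i i]
        by (simp add: has_weak_partial_def)
    qed
    have "(L2_norm \<Omega> ?g)\<^sup>2 = (L2_norm \<Omega> (weak_partial \<Omega> i (\<lambda>x. u x - \<phi> n x)))\<^sup>2"
      using L2_norm_cong_AE[OF weak_partial_AE_eq[OF assms(1,2) g w] g] by simp
    also have "\<dots> \<le> (\<Sum>i\<in>UNIV. (L2_norm \<Omega> (weak_partial \<Omega> i (\<lambda>x. u x - \<phi> n x)))\<^sup>2)"
      by (intro member_le_sum) auto
    also have "\<dots> \<le> (L2_norm \<Omega> (\<lambda>x. u x - \<phi> n x))\<^sup>2 + \<dots>" by simp
    finally have "L2_norm \<Omega> ?g \<le> H1_norm \<Omega> (\<lambda>x. u x - \<phi> n x)"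
      unfolding H1_norm_def by (rule real_le_rsqrt)
    then show ?thesis using n by simp
  qed
  then show ?thesis using \<phi>(1) by blast
qed

section \<open>Translation moduli and mollification\<close>

definition sqn :: "('a::euclidean_space \<Rightarrow> real) \<Rightarrow> real" where
  "sqn f = (LINT x|lborel. (f x)\<^sup>2)"

lemma sqn_nonneg [simp]: "0 \<le> sqn f"
  by (simp add: sqn_def)

lemma sqn_mono:
  assumes "bcs g" "\<And>x. (f x)\<^sup>2 \<le> (g x)\<^sup>2"
  shows "sqn f \<le> sqn g"
  unfolding sqn_def using assms integrable_bcs[OF bcs_power2[OF assms(1)]]
  by (intro integral_mono') auto

lemma sqn_sum_le:
  assumes "finite J" "\<And>j. j \<in> J \<Longrightarrow> bcs (f j)" "\<And>x. (g x)\<^sup>2 \<le> c * (\<Sum>j\<in>J. (f j x)\<^sup>2)"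
  shows "sqn g \<le> c * (\<Sum>j\<in>J. sqn (f j))"
proof -
  have i: "integrable lborel (\<lambda>x. (f j x)\<^sup>2)" if "j \<in> J" for j
    using that assms by (intro integrable_bcs bcs_power2)
  have "sqn g \<le> (LINT x|lborel. c * (\<Sum>j\<in>J. (f j x)\<^sup>2))"
    unfolding sqn_def
  proof (rule integral_mono')
    show "integrable lborel (\<lambda>x. c * (\<Sum>j\<in>J. (f j x)\<^sup>2))" using i by auto
    show "(g x)\<^sup>2 \<le> c * (\<Sum>j\<in>J. (f j x)\<^sup>2)" for x by (rule assms(3))
    show "0 \<le> c * (\<Sum>j\<in>J. (f j x)\<^sup>2)" for x using order_trans[OF zero_le_power2 assms(3)] .
  qed
  also have "\<dots> = c * (\<Sum>j\<in>J. sqn (f j))" using i by (simp add: sqn_def)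
  finally show ?thesis .
qed

lemma square_sum_le: "finite J \<Longrightarrow> (\<Sum>j\<in>J. a j)\<^sup>2 \<le> real (card J) * (\<Sum>j\<in>J. (a j)\<^sup>2)" for a :: "'b \<Rightarrow> real"
  using sum_squared_le_sum_of_squares[of a J] by (simp add: mult.commute)

lemma sqn_sum:
  assumes "finite J" "\<And>j. j \<in> J \<Longrightarrow> bcs (f j)"
  shows "sqn (\<lambda>x. \<Sum>j\<in>J. f j x) \<le> real (card J) * (\<Sum>j\<in>J. sqn (f j))"
  by (rule sqn_sum_le[OF assms]) (use square_sum_le[OF assms(1)] in auto)

lemma sqn_add:
  assumes "bcs f" "bcs g"
  shows "sqn (\<lambda>x. f x + g x) \<le> 2 * sqn f + 2 * sqn g"
proof -
  have "sqn (\<lambda>x. f x + g x) \<le> 2 * (\<Sum>j\<in>{True, False}. sqn (if j then f else g))"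
  proof (rule sqn_sum_le)
    fix x
    have "0 \<le> (f x - g x)\<^sup>2" by simp
    then show "(f x + g x)\<^sup>2 \<le> 2 * (\<Sum>j\<in>{True, False}. ((if j then f else g) x)\<^sup>2)"
      by (simp add: power2_eq_square algebra_simps)
  qed (use assms in auto)
  then show ?thesis by simp
qed

lemma sqn_shift:
  fixes f :: "real^3 \<Rightarrow> real"
  assumes "f \<in> borel_measurable borel"
  shows "sqn (\<lambda>x. f (x + a)) = sqn f"
  unfolding sqn_def using assms by (intro lborel_integral_shift) auto

text \<open>A modulus of continuity in squared L2 sense, as a predicate with an explicit bound
  instead of a supremum, and along the axes only, since increments are computed along axis-parallel
  lines.\<close>

definition tmod :: "(real^3 \<Rightarrow> real) \<Rightarrow> real \<Rightarrow> real \<Rightarrow> bool" where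
  "tmod f \<delta> A \<longleftrightarrow> (\<forall>i t. \<bar>t\<bar> \<le> \<delta> \<longrightarrow> sqn (\<lambda>x. f (x + t *\<^sub>R axis i 1) - f x) \<le> A)"

lemma tmod_nonneg: "tmod f \<delta> A \<Longrightarrow> 0 < \<delta> \<Longrightarrow> 0 \<le> A"
  unfolding tmod_def by (rule order_trans[OF sqn_nonneg], drule spec2[of _ 1 0]) simp

lemma tmod_axis_steps:
  assumes f: "bcs f" "tmod f \<delta> A" and t: "\<bar>t\<bar> \<le> real m * \<delta>"
  shows "sqn (\<lambda>x. f (x + t *\<^sub>R axis i 1) - f x) \<le> (real m)\<^sup>2 * A"
proof (cases "m = 0")
  case True
  then show ?thesis using t by (simp add: sqn_def)
next
  case False
  define s where "s = t / real m"
  have s: "\<bar>s\<bar> \<le> \<delta>" "t = real m * s" using False t by (auto simp: s_def field_simps)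
  let ?g = "\<lambda>j x. f (x + (real j * s) *\<^sub>R axis i 1)"
  let ?d = "\<lambda>j x. ?g (Suc j) x - ?g j x"
  have "(\<Sum>j<m. ?d j x) = f (x + t *\<^sub>R axis i 1) - f x" for x
    by (subst sum_lessThan_telescope) (simp add: s)
  then have "sqn (\<lambda>x. f (x + t *\<^sub>R axis i 1) - f x) = sqn (\<lambda>x. \<Sum>j\<in>{..<m}. ?d j x)" by simp
  also have "\<dots> \<le> real (card {..<m}) * (\<Sum>j<m. sqn (?d j))"
    by (intro sqn_sum bcs_diff bcs_shift f) auto
  also have "sqn (?d j) \<le> A" for j
  proof -
    have "?d j = (\<lambda>x. (\<lambda>y. f (y + s *\<^sub>R axis i 1) - f y) (x + (real j * s) *\<^sub>R axis i 1))"
      by (auto simp: algebra_simps)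
    then have "sqn (?d j) = sqn (\<lambda>y. f (y + s *\<^sub>R axis i 1) - f y)"
      using sqn_shift[OF bcs_measurable[OF bcs_diff[OF bcs_shift[OF f(1)] f(1)]]] by simp
    then show ?thesis using f(2) s(1) by (simp add: tmod_def)
  qed
  then have "real (card {..<m}) * (\<Sum>j<m. sqn (?d j)) \<le> real (card {..<m}) * (\<Sum>j<m. A)"
    by (intro mult_left_mono sum_mono) auto
  finally show ?thesis by (simp add: power2_eq_square mult.assoc)
qed

lemma vec3_expand: "(v::real^3) = v$1 *\<^sub>R axis 1 1 + v$2 *\<^sub>R axis 2 1 + v$3 *\<^sub>R axis 3 1"
  by (simp add: vec_eq_iff axis_def forall_3)

text \<open>The shift is carried out one coordinate after the other. Three increments give the
  factor 9 by Cauchy-Schwarz, and \<open>m\<close> steps of length at most \<delta> in each of them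
  give \<open>m^2\<close>.\<close>

lemma tmod_steps:
  assumes f: "bcs f" "tmod f \<delta> A" and v: "\<And>i. \<bar>v$i\<bar> \<le> real m * \<delta>"
  shows "sqn (\<lambda>x. f (x + v) - f x) \<le> 9 * (real m)\<^sup>2 * A"
proof -
  define w where "w = (\<lambda>j::nat. if j = 0 then 0 else if j = 1 then v$1 *\<^sub>R axis 1 1 else v$1 *\<^sub>R axis 1 1 + v$2 *\<^sub>R (axis 2 1 :: real^3))"
  define c where "c = (\<lambda>j::nat. if j = 0 then 1 else if j = 1 then 2 else (3::3))"
  let ?d = "\<lambda>j x. f ((x + w j) + v $ (c j) *\<^sub>R axis (c j) 1) - f (x + w j)"
  have "(\<Sum>j<3. ?d j x) = f (x + v) - f x" for x
    by (subst (5) vec3_expand) (simp add: eval_nat_numeral w_def c_def add.assoc)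
  then have "sqn (\<lambda>x. f (x + v) - f x) = sqn (\<lambda>x. \<Sum>j\<in>{..<3}. ?d j x)" by simp
  also have "\<dots> \<le> real (card {..<3::nat}) * (\<Sum>j<3. sqn (?d j))"
    by (intro sqn_sum bcs_diff bcs_shift f) (auto simp: add.assoc intro: bcs_shift f)
  also have "sqn (?d j) \<le> (real m)\<^sup>2 * A" for j
  proof -
    have "sqn (?d j) = sqn (\<lambda>x. f (x + v $ (c j) *\<^sub>R axis (c j) 1) - f x)"
      by (rule sqn_shift[of "\<lambda>x. f (x + v $ (c j) *\<^sub>R axis (c j) 1) - f x" "w j", OF bcs_measurable[OF bcs_diff[OF bcs_shift[OF f(1)] f(1)]]])
    also have "\<dots> \<le> (real m)\<^sup>2 * A" by (rule tmod_axis_steps[OF f v])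
    finally show ?thesis .
  qed
  then have "real (card {..<3::nat}) * (\<Sum>j<3. sqn (?d j)) \<le> real (card {..<3::nat}) * (\<Sum>j<3::nat. (real m)\<^sup>2 * A)"
    by (intro mult_left_mono sum_mono) auto
  finally show ?thesis by (simp add: mult.assoc)
qed

section \<open>Convolution and mollification\<close>

lemma lborel_integral_reflect:
  fixes f :: "real^3 \<Rightarrow> real"
  assumes "f \<in> borel_measurable borel"
  shows "(LINT x|lborel. f (a - x)) = (LINT x|lborel. f x)"
proof -
  have "(LINT x|lborel. f x) = (LINT x|distr lborel borel (\<lambda>x. a + (-1) *\<^sub>R x). f x)"
    using lborel_affine[of "-1" a] by (simp add: density_1)
  also have "\<dots> = (LINT x|lborel. f (a - x))"
    using assms by (subst integral_distr) auto
  finally show ?thesis by simp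
qed

lemma frechet_eq_partials:
  assumes "f differentiable (at x)"
  shows "frechet_derivative f (at x) h = (\<Sum>m\<in>UNIV. h$m * partial_deriv m f x)"
proof -
  have lin: "linear (frechet_derivative f (at x))" using linear_frechet_derivative[OF assms] .
  have "frechet_derivative f (at x) h = frechet_derivative f (at x) (h$1 *\<^sub>R axis 1 1 + h$2 *\<^sub>R axis 2 1 + h$3 *\<^sub>R axis 3 1)"
    using vec3_expand[of h] by simp
  also have "\<dots> = h$1 * partial_deriv 1 f x + h$2 * partial_deriv 2 f x + h$3 * partial_deriv 3 f x"
    by (simp add: linear_add[OF lin] linear_cmul[OF lin] partial_deriv_def)
  finally show ?thesis by (simp add: sum_3)
qed

lemma has_derivative_partials:
  "f differentiable (at x) \<Longrightarrow> (f has_derivative (\<lambda>h. \<Sum>m\<in>UNIV. h$m * partial_deriv m f x)) (at x)"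
proof -
  assume f: "f differentiable (at x)"
  have "frechet_derivative f (at x) = (\<lambda>h. \<Sum>m\<in>UNIV. h$m * partial_deriv m f x)"
    by (rule ext) (rule frechet_eq_partials[OF f])
  then show ?thesis using differentiable_has_derivative[OF f] by simp
qed

lemma onorm_partials_le:
  assumes "\<And>m. \<bar>c m\<bar> \<le> B"
  shows "onorm (\<lambda>h::real^3. \<Sum>m\<in>UNIV. h$m * c m) \<le> 3 * B"
proof (rule onorm_le)
  fix h :: "real^3"
  have "norm (\<Sum>m\<in>UNIV. h$m * c m) \<le> (\<Sum>m\<in>(UNIV::3 set). norm h * B)"
    using component_le_norm_cart[of h] assms
    by (intro order_trans[OF norm_sum] sum_mono) (auto simp: abs_mult intro!: mult_mono)
  then show "norm (\<Sum>m\<in>UNIV. h$m * c m) \<le> 3 * B * norm h" by (simp add: algebra_simps)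
qed

lemma test_function_Lipschitz:
  assumes "test_function UNIV f"
  shows "\<exists>B\<ge>0. \<forall>x y. \<bar>f x - f y\<bar> \<le> B * norm (x - y)"
proof -
  have "\<exists>B. \<forall>x. \<bar>partial_deriv m f x\<bar> \<le> B" for m
    using test_function_bcs[OF test_function_partial[OF assms]] by (simp add: bcs_def)
  then obtain B where B: "\<And>m x. \<bar>partial_deriv m f x\<bar> \<le> B m" by metis
  define C where "C = (\<Sum>m\<in>UNIV. \<bar>B m\<bar>)"
  have C: "\<bar>partial_deriv m f x\<bar> \<le> C" for m x
    using B[of m x] member_le_sum[of m UNIV "\<lambda>m. \<bar>B m\<bar>"] by (simp add: C_def)
  have "norm (f x - f y) \<le> 3 * C * norm (x - y)" for x y
    by (rule differentiable_bound[of UNIV f "\<lambda>x h. \<Sum>m\<in>UNIV. h$m * partial_deriv m f x"])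
      (auto intro!: has_derivative_partials smooth_differentiable test_function_smooth[OF assms] onorm_partials_le C)
  moreover have "C \<ge> 0" by (simp add: C_def sum_nonneg)
  ultimately show ?thesis by (intro exI[of _ "3 * C"]) auto
qed

text \<open>Apply the mean value inequality to \<open>f\<close> minus its linearization at
  \<open>x\<close>, whose derivative grows at most linearly. The uniform quadratic remainder permits
  differentiation of a convolution under the integral by a direct estimate.\<close>

lemma test_function_second_order:
  assumes "test_function UNIV f"
  shows "\<exists>B\<ge>0. \<forall>x h. \<bar>f (x + h) - f x - (\<Sum>m\<in>UNIV. h$m * partial_deriv m f x)\<bar> \<le> B * (norm h)\<^sup>2"
proof -
  have "\<exists>B\<ge>0. \<forall>x y. \<bar>partial_deriv m f x - partial_deriv m f y\<bar> \<le> B * norm (x - y)" for m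
    by (intro test_function_Lipschitz test_function_partial assms)
  then obtain B where B: "\<And>m. B m \<ge> 0" "\<And>m x y. \<bar>partial_deriv m f x - partial_deriv m f y\<bar> \<le> B m * norm (x - y)" by metis
  define C where "C = (\<Sum>m\<in>UNIV. B m)"
  have C0: "C \<ge> 0" using B by (simp add: C_def sum_nonneg)
  have C: "\<bar>partial_deriv m f x - partial_deriv m f y\<bar> \<le> C * norm (x - y)" for m x y
    using B(2)[of m x y] mult_right_mono[of "B m" C "norm (x - y)"] member_le_sum[of m UNIV B] B(1) by (auto simp: C_def)
  have "\<bar>f (x + h) - f x - (\<Sum>m\<in>UNIV. h$m * partial_deriv m f x)\<bar> \<le> 3 * C * (norm h)\<^sup>2" for x h
  proof -
    let ?g = "\<lambda>y. f y - (\<Sum>m\<in>UNIV. y$m * partial_deriv m f x)"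
    have "norm (?g (x + h) - ?g x) \<le> 3 * (C * norm h) * norm (x + h - x)"
    proof (rule differentiable_bound[of "cball x (norm h)" ?g "\<lambda>y k. \<Sum>m\<in>UNIV. k$m * (partial_deriv m f y - partial_deriv m f x)"])
      fix y assume y: "y \<in> cball x (norm h)"
      show "(?g has_derivative (\<lambda>k. \<Sum>m\<in>UNIV. k$m * (partial_deriv m f y - partial_deriv m f x))) (at y within cball x (norm h))"
        by (rule has_derivative_at_withinI, rule has_derivative_eq_rhs[OF has_derivative_diff[OF
              has_derivative_partials[OF smooth_differentiable[OF test_function_smooth[OF assms]]]
              has_derivative_sum[OF has_derivative_mult_left[OF bounded_linear.has_derivative[OF bounded_linear_vec_nth has_derivative_ident]]]]])
          (simp add: right_diff_distrib sum_subtractf)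
      have "\<bar>partial_deriv m f y - partial_deriv m f x\<bar> \<le> C * norm h" for m
        using C[of m y x] mult_left_mono[of "norm (y - x)" "norm h" C] y C0 by (auto simp: dist_norm norm_minus_commute)
      then show "onorm (\<lambda>k. \<Sum>m\<in>UNIV. k$m * (partial_deriv m f y - partial_deriv m f x)) \<le> 3 * (C * norm h)"
        by (rule onorm_partials_le)
    qed (auto simp: dist_norm)
    then show ?thesis by (simp add: power2_eq_square algebra_simps sum.distrib sum_subtractf)
  qed
  then show ?thesis using C0 by (intro exI[of _ "3 * C"]) auto
qed

definition conv :: "(real^3 \<Rightarrow> real) \<Rightarrow> (real^3 \<Rightarrow> real) \<Rightarrow> real^3 \<Rightarrow> real" where
  "conv f \<kappa> x = (LINT y|lborel. f y * \<kappa> (x - y))"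

lemma bcs_reflect_mult:
  assumes "bcs f" "bcs \<kappa>"
  shows "bcs (\<lambda>y. f y * \<kappa> (x - y))"
proof -
  obtain B where B: "\<And>x. \<bar>\<kappa> x\<bar> \<le> B" using assms(2) by (auto simp: bcs_def)
  show ?thesis
    by (rule bcs_mult(1)[OF assms(1), where C = B]) (use assms(2) B in \<open>auto simp: bcs_def\<close>)
qed

lemma conv_has_derivative:
  assumes f: "bcs f" and \<kappa>: "test_function UNIV \<kappa>"
  shows "(conv f \<kappa> has_derivative (\<lambda>h. \<Sum>m\<in>UNIV. h$m * conv f (partial_deriv m \<kappa>) x)) (at x)"
proof -
  obtain B where B: "B \<ge> 0" "\<And>x h. \<bar>\<kappa> (x + h) - \<kappa> x - (\<Sum>m\<in>UNIV. h$m * partial_deriv m \<kappa> x)\<bar> \<le> B * (norm h)\<^sup>2"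
    using test_function_second_order[OF \<kappa>] by blast
  define L where "L = (LINT y|lborel. \<bar>f y\<bar>)"
  have if': "integrable lborel f" using integrable_bcs[OF f] .
  have L0: "L \<ge> 0" by (simp add: L_def)
  note k = test_function_bcs[OF \<kappa>] test_function_bcs[OF test_function_partial[OF \<kappa>]]
  have i: "integrable lborel (\<lambda>y. f y * \<kappa> (z - y))" "integrable lborel (\<lambda>y. f y * partial_deriv m \<kappa> (z - y))" for z m
    by (intro integrable_bcs bcs_reflect_mult f k)+
  have est: "\<bar>conv f \<kappa> (x + h) - conv f \<kappa> x - (\<Sum>m\<in>UNIV. h$m * conv f (partial_deriv m \<kappa>) x)\<bar> \<le> L * B * (norm h)\<^sup>2" for h
  proof -
    have "conv f \<kappa> (x + h) - conv f \<kappa> x - (\<Sum>m\<in>UNIV. h$m * conv f (partial_deriv m \<kappa>) x)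
      = (LINT y|lborel. f y * \<kappa> (x + h - y) - f y * \<kappa> (x - y) - (\<Sum>m\<in>UNIV. h$m * (f y * partial_deriv m \<kappa> (x - y))))"
      unfolding conv_def using i by simp
    also have "\<dots> = (LINT y|lborel. f y * (\<kappa> ((x - y) + h) - \<kappa> (x - y) - (\<Sum>m\<in>UNIV. h$m * partial_deriv m \<kappa> (x - y))))"
      by (simp add: algebra_simps sum_distrib_left)
    also have "\<bar>\<dots>\<bar> \<le> (LINT y|lborel. \<bar>f y\<bar> * (B * (norm h)\<^sup>2))"
    proof (rule order_trans[OF integral_abs_bound integral_mono'])
      show "integrable lborel (\<lambda>y. \<bar>f y\<bar> * (B * (norm h)\<^sup>2))" using if' by auto
      show "\<bar>f y * (\<kappa> ((x - y) + h) - \<kappa> (x - y) - (\<Sum>m\<in>UNIV. h$m * partial_deriv m \<kappa> (x - y)))\<bar> \<le> \<bar>f y\<bar> * (B * (norm h)\<^sup>2)" for y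
        unfolding abs_mult by (intro mult_left_mono B) auto
      show "0 \<le> \<bar>f y\<bar> * (B * (norm h)\<^sup>2)" for y using B by auto
    qed
    also have "\<dots> = L * B * (norm h)\<^sup>2" by (simp add: L_def)
    finally show ?thesis .
  qed
  show ?thesis
  proof (rule has_derivativeI_sandwich[where e = 1 and H = "\<lambda>y. L * B * norm (y - x)"])
    show "bounded_linear (\<lambda>h. \<Sum>m\<in>UNIV. h$m * conv f (partial_deriv m \<kappa>) x)"
      by (intro bounded_linear_sum bounded_linear_mult_const bounded_linear_vec_nth)
    have "((\<lambda>y. L * B * norm (y - x)) \<longlongrightarrow> L * B * norm (x - x)) (at x)" by (intro tendsto_intros)
    then show "((\<lambda>y. L * B * norm (y - x)) \<longlongrightarrow> 0) (at x)" by simp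
    fix y assume "y \<noteq> x"
    have "norm (conv f \<kappa> y - conv f \<kappa> x - (\<Sum>m\<in>UNIV. (y - x)$m * conv f (partial_deriv m \<kappa>) x)) / norm (y - x)
       \<le> L * B * (norm (y - x))\<^sup>2 / norm (y - x)"
      using est[of "y - x"] by (intro divide_right_mono) auto
    then show "norm (conv f \<kappa> y - conv f \<kappa> x - (\<Sum>m\<in>UNIV. (y - x)$m * conv f (partial_deriv m \<kappa>) x)) / norm (y - x) \<le> L * B * norm (y - x)"
      using \<open>y \<noteq> x\<close> by (simp add: power2_eq_square)
  qed auto
qed

lemma partial_deriv_conv:
  assumes "bcs f" "test_function UNIV \<kappa>"
  shows "partial_deriv m (conv f \<kappa>) = conv f (partial_deriv m \<kappa>)"
proof
  fix x
  have "partial_deriv m (conv f \<kappa>) x = (\<Sum>j\<in>UNIV. axis m 1 $ j * conv f (partial_deriv j \<kappa>) x)"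
    by (rule partial_deriv_eq[OF conv_has_derivative[OF assms]])
  also have "\<dots> = (\<Sum>j\<in>UNIV. if j = m then conv f (partial_deriv j \<kappa>) x else 0)"
    by (intro sum.cong) (auto simp: axis_def)
  finally show "partial_deriv m (conv f \<kappa>) x = conv f (partial_deriv m \<kappa>) x" by simp
qed

lemma smooth_conv:
  assumes "bcs f" "test_function UNIV \<kappa>"
  shows "smooth (conv f \<kappa>)"
proof (rule smooth_closedI[of _ "conv f ` {\<kappa>. test_function UNIV \<kappa>}"])
  show "conv f \<kappa> \<in> conv f ` {\<kappa>. test_function UNIV \<kappa>}" using assms by blast
  fix g assume "g \<in> conv f ` {\<kappa>. test_function UNIV \<kappa>}"
  then obtain \<kappa> where k: "g = conv f \<kappa>" "test_function UNIV \<kappa>" by blast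
  show "g differentiable (at x)" for x
    using conv_has_derivative[OF assms(1) k(2)] k(1) unfolding differentiable_def by blast
  show "partial_deriv m g \<in> conv f ` {\<kappa>. test_function UNIV \<kappa>}" for m
    using partial_deriv_conv[OF assms(1) k(2)] k test_function_partial[OF k(2)] by auto
qed

text \<open>The difference is the integral of \<mu> against increments of \<open>f\<close>; use
  Cauchy-Schwarz over the cube carrying \<mu>, then Fubini. For a kernel of integral 1 this is the
  mollification error; for its partial derivatives, of integral 0, it bounds the gradient. The
  constant is 8 * 8 * 9, twice the volume factor of the cube and once that of
  \<open>tmod_steps\<close>.\<close>

lemma conv_estimate:
  assumes f: "bcs f" "tmod f \<delta> A" and \<delta>: "0 < \<delta>"
    and \<mu>: "bcs \<mu>" "\<And>x. \<bar>\<mu> x\<bar> \<le> M" "\<And>z i. \<mu> z \<noteq> 0 \<Longrightarrow> \<bar>z$i\<bar> \<le> \<delta>"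
  shows "sqn (\<lambda>x. conv f \<mu> x - (LINT z|lborel. \<mu> z) * f x) \<le> 576 * M\<^sup>2 * \<delta>^6 * A"
proof -
  define Q where "Q = {z::real^3. \<forall>i. \<bar>z$i\<bar> \<le> \<delta>}"
  have Qc: "Q = cbox (\<chi> i. - \<delta>) (\<chi> i. \<delta>)" by (auto simp: Q_def mem_box_cart abs_le_iff) (simp_all add: minus_le_iff)
  have Qm: "measure lborel Q = 8 * \<delta>^3"
  proof -
    have "measure lborel Q = (\<Prod>i\<in>(UNIV::3 set). 2 * \<delta>)"
      unfolding Qc using \<delta> by (subst content_cbox_cart) (auto simp: interval_ne_empty_cart intro!: prod.cong)
    then show ?thesis by (simp add: power3_eq_cube algebra_simps)
  qed
  have Qs: "Q \<in> sets borel" "bounded Q" unfolding Qc by auto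
  have M0: "0 \<le> M" using \<mu>(2)[of 0] by simp
  have mu2: "(LINT z|lborel. (\<mu> z)\<^sup>2) \<le> M\<^sup>2 * (8 * \<delta>^3)"
  proof -
    have "(LINT z|lborel. (\<mu> z)\<^sup>2) \<le> (LINT z|lborel. M\<^sup>2 * indicator Q z)"
    proof (rule integral_mono')
      have "integrable lborel (\<lambda>z. indicator Q z * 1 :: real)"
        by (intro integrable_bcs bcs_indicator_continuous Qs continuous_on_const)
      then show "integrable lborel (\<lambda>z. M\<^sup>2 * indicator Q z)" by simp
      fix z
      show "(\<mu> z)\<^sup>2 \<le> M\<^sup>2 * indicator Q z"
      proof (cases "\<mu> z = 0")
        case False
        then have "z \<in> Q" using \<mu>(3) by (auto simp: Q_def)
        then show ?thesis using power_mono[OF \<mu>(2)[of z], of 2] by simp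
      qed auto
    qed auto
    then show ?thesis using Qs Qm by simp
  qed
  \<comment> \<open>Cutting the increments off to the cube gives them bounded support in both
    variables, so that Fubini applies.\<close>
  define H where "H = (\<lambda>(z, x). indicator Q z * (f (x - z) - f x))"
  obtain B where B: "\<And>x. \<bar>f x\<bar> \<le> B" using f by (auto simp: bcs_def)
  obtain R where R: "{x. f x \<noteq> 0} \<subseteq> cball 0 R" using f bounded_subset_cball_0[of "{x. f x \<noteq> 0}"] by (auto simp: bcs_def)
  obtain R' where R': "Q \<subseteq> cball 0 R'" using bounded_subset_cball_0[OF Qs(2)] .
  have bH: "bcs H"
  proof (rule bcsI)
    show "H \<in> borel_measurable borel"
    proof -
      have m: "(\<lambda>y::(real^3) \<times> (real^3). snd y - fst y) \<in> borel \<rightarrow>\<^sub>M borel" "(snd :: (real^3) \<times> (real^3) \<Rightarrow> _) \<in> borel \<rightarrow>\<^sub>M borel"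
        "(fst :: (real^3) \<times> (real^3) \<Rightarrow> _) \<in> borel \<rightarrow>\<^sub>M borel"
        by (intro borel_measurable_continuous_onI continuous_intros)+
      show ?thesis
        unfolding H_def case_prod_beta using Qs
        by (intro borel_measurable_times borel_measurable_diff measurable_compose[OF m(1) bcs_measurable[OF f(1)]]
            measurable_compose[OF m(2) bcs_measurable[OF f(1)]] measurable_compose[OF m(3), of "indicator Q"]) auto
    qed
    show "\<bar>H y\<bar> \<le> 2 * B" for y
    proof (cases y)
      case (Pair z x)
      have "\<bar>f (x - z) - f x\<bar> \<le> 2 * B" using B[of "x - z"] B[of x] by linarith
      then show ?thesis using B[of 0] by (auto simp: H_def Pair indicator_def)
    qed
    show "bounded (cball (0::real^3) R' \<times> cball (0::real^3) (R + R'))" by (intro bounded_Times bounded_cball)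
    fix y assume y: "y \<notin> cball (0::real^3) R' \<times> cball (0::real^3) (R + R')"
    obtain z x where zx: "y = (z, x)" by (cases y)
    show "H y = 0"
    proof (rule ccontr)
      assume "H y \<noteq> 0"
      then have z: "z \<in> Q" and "f (x - z) \<noteq> 0 \<or> f x \<noteq> 0" by (auto simp: H_def zx indicator_def split: if_splits)
      then have "norm (x - z) \<le> R \<or> norm x \<le> R" using R by auto
      moreover have "norm z \<le> R'" using z R' by auto
      ultimately have "norm x \<le> R + R'" using norm_triangle_ineq[of "x - z" z] order_trans[OF norm_ge_zero \<open>norm z \<le> R'\<close>] by auto
      then show False using y zx \<open>norm z \<le> R'\<close> by auto
    qed
  qed
  have bHx: "bcs (\<lambda>z. H (z, x))" for x
  proof (rule bcsI[OF _ _ Qs(2)])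
    show "(\<lambda>z. H (z, x)) \<in> borel_measurable borel"
      unfolding H_def case_prod_conv using Qs bcs_measurable[OF f(1)] by (intro borel_measurable_times borel_measurable_diff) auto
    show "\<bar>H (z, x)\<bar> \<le> 2 * B" for z
    proof -
      have "\<bar>f (x - z) - f x\<bar> \<le> 2 * B" using B[of "x - z"] B[of x] by linarith
      then show ?thesis using B[of 0] by (auto simp: H_def indicator_def)
    qed
  qed (auto simp: H_def)
  have point: "(conv f \<mu> x - (LINT z|lborel. \<mu> z) * f x)\<^sup>2 \<le> M\<^sup>2 * (8 * \<delta>^3) * (LINT z|lborel. (H (z, x))\<^sup>2)" for x
  proof -
    have "conv f \<mu> x = (LINT y|lborel. f (x - y) * \<mu> (x - (x - y)))"
      unfolding conv_def
      using lborel_integral_reflect[OF bcs_measurable[OF bcs_reflect_mult[OF f(1) \<mu>(1)]], of x x] by simp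
    then have c: "conv f \<mu> x = (LINT z|lborel. f (x - z) * \<mu> z)" by simp
    have i1: "integrable lborel (\<lambda>z. f (x - z) * \<mu> z)"
      using integrable_bcs[OF bcs_mult(1)[OF \<mu>(1), of "\<lambda>z. f (x - z)" B]] bcs_measurable[OF f(1)] B by (simp add: mult.commute)
    have "conv f \<mu> x - (LINT z|lborel. \<mu> z) * f x = (LINT z|lborel. f (x - z) * \<mu> z - \<mu> z * f x)"
      unfolding c using i1 integrable_bcs[OF \<mu>(1)] by simp
    also have "\<dots> = (LINT z|lborel. H (z, x) * \<mu> z)"
      using \<mu>(3) by (intro Bochner_Integration.integral_cong) (auto simp: H_def indicator_def Q_def algebra_simps)
    finally have "(conv f \<mu> x - (LINT z|lborel. \<mu> z) * f x)\<^sup>2 = (LINT z|lborel. H (z, x) * \<mu> z)\<^sup>2" by simp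
    also have "\<dots> \<le> (LINT z|lborel. (H (z, x))\<^sup>2) * (LINT z|lborel. (\<mu> z)\<^sup>2)"
      by (rule sqint_Cauchy_Schwarz) (auto simp: sqint_def bcs_measurable[OF bHx] bcs_measurable[OF \<mu>(1)]
          intro!: integrable_bcs bcs_power2 bHx \<mu>)
    also have "\<dots> \<le> (LINT z|lborel. (H (z, x))\<^sup>2) * (M\<^sup>2 * (8 * \<delta>^3))"
      by (intro mult_left_mono mu2) auto
    finally show ?thesis by (simp add: mult.commute)
  qed
  have iH: "integrable (lborel \<Otimes>\<^sub>M lborel) (\<lambda>y. (H y)\<^sup>2)"
    using integrable_bcs[OF bcs_power2[OF bH]] by (simp add: lborel_prod)
  moreover have "(\<lambda>y. (H y)\<^sup>2) = (\<lambda>(z, x). (H (z, x))\<^sup>2)" by auto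
  ultimately have iH': "integrable (lborel \<Otimes>\<^sub>M lborel) (\<lambda>(z, x). (H (z, x))\<^sup>2)" by simp
  have iHx: "integrable lborel (\<lambda>x. LINT z|lborel. (H (z, x))\<^sup>2)"
    by (rule lborel_pair.integrable_snd[OF iH'])
  have "sqn (\<lambda>x. conv f \<mu> x - (LINT z|lborel. \<mu> z) * f x) \<le> (LINT x|lborel. M\<^sup>2 * (8 * \<delta>^3) * (LINT z|lborel. (H (z, x))\<^sup>2))"
    unfolding sqn_def using \<delta> iHx by (intro integral_mono') (auto simp: point)
  also have "\<dots> = M\<^sup>2 * (8 * \<delta>^3) * (LINT x|lborel. LINT z|lborel. (H (z, x))\<^sup>2)" by simp
  finally have outer: "sqn (\<lambda>x. conv f \<mu> x - (LINT z|lborel. \<mu> z) * f x)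
      \<le> M\<^sup>2 * (8 * \<delta>^3) * (LINT x|lborel. LINT z|lborel. (H (z, x))\<^sup>2)" .
  have "(LINT x|lborel. LINT z|lborel. (H (z, x))\<^sup>2) = (LINT z|lborel. LINT x|lborel. (H (z, x))\<^sup>2)"
    by (rule lborel_pair.Fubini_integral[OF iH'])
  also have "\<dots> \<le> (LINT z|lborel. 9 * A * indicator Q z)"
  proof (rule integral_mono')
    have "integrable lborel (\<lambda>z. indicator Q z * 1 :: real)"
      by (intro integrable_bcs bcs_indicator_continuous Qs continuous_on_const)
    then show "integrable lborel (\<lambda>z. 9 * A * indicator Q z)" by simp
    show "(LINT x|lborel. (H (z, x))\<^sup>2) \<le> 9 * A * indicator Q z" for z
    proof (cases "z \<in> Q")
      case True
      then have "sqn (\<lambda>x. f (x + (- z)) - f x) \<le> 9 * (real 1)\<^sup>2 * A"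
        by (intro tmod_steps[OF f]) (auto simp: Q_def)
      then show ?thesis using True by (simp add: H_def sqn_def)
    qed (simp add: H_def)
    have "0 \<le> A" using tmod_nonneg[OF f(2) \<delta>] .
    then show "0 \<le> 9 * A * indicator Q z" for z by auto
  qed
  also have "\<dots> = 9 * A * (8 * \<delta>^3)" using Qs Qm by simp
  finally have "M\<^sup>2 * (8 * \<delta>^3) * (LINT x|lborel. LINT z|lborel. (H (z, x))\<^sup>2) \<le> M\<^sup>2 * (8 * \<delta>^3) * (9 * A * (8 * \<delta>^3))"
    using \<delta> by (intro mult_left_mono) auto
  with outer have "sqn (\<lambda>x. conv f \<mu> x - (LINT z|lborel. \<mu> z) * f x) \<le> M\<^sup>2 * (8 * \<delta>^3) * (9 * A * (8 * \<delta>^3))"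
    by (rule order_trans)
  also have "\<dots> = 576 * M\<^sup>2 * \<delta>^6 * A" by (simp flip: power_add add: algebra_simps)
  finally show ?thesis .
qed

definition kern0 :: "real^3 \<Rightarrow> real" where
  "kern0 = box_bump (\<chi> i. -1) (\<chi> i. 1) 1"

lemma kern0_test: "test_function UNIV kern0"
  unfolding kern0_def by (rule test_function_box_bump) simp

lemma kern0_bounds: "\<bar>kern0 x\<bar> \<le> 1"
  using box_bump_bounds unfolding kern0_def by simp

lemma kern0_support: "kern0 x \<noteq> 0 \<Longrightarrow> \<bar>x$i\<bar> \<le> 1"
proof -
  assume "kern0 x \<noteq> 0"
  then have "x \<in> box (\<chi> i. -1) (\<chi> i. 1)" using box_bump_outside unfolding kern0_def by blast
  then have "-1 < x$i \<and> x$i < 1" by (simp add: mem_box_cart)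
  then show ?thesis by auto
qed

lemma kern0_partial_support: "partial_deriv m kern0 x \<noteq> 0 \<Longrightarrow> \<bar>x$i\<bar> \<le> 1"
proof -
  assume nz: "partial_deriv m kern0 x \<noteq> 0"
  have "x \<in> cbox (\<chi> i. -1) (\<chi> i. 1)"
  proof (rule ccontr)
    assume "x \<notin> cbox (\<chi> i. -1) (\<chi> i. 1)"
    moreover have "kern0 y = 0" if "y \<notin> cbox (\<chi> i. -1) (\<chi> i. 1)" for y
      using that box_bump_outside[of y] box_subset_cbox unfolding kern0_def by blast
    ultimately show False using nz partial_deriv_zero_outside[OF closed_cbox] by blast
  qed
  then have "-1 \<le> x$i \<and> x$i \<le> 1" by (simp add: mem_box_cart)
  then show ?thesis by auto
qed

lemma kern0_integral_pos: "0 < (LINT x|lborel. kern0 x)"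
proof -
  have nn: "0 \<le> kern0 x" for x unfolding kern0_def by (rule box_bump_bounds)
  have int: "integrable lborel kern0" by (intro integrable_bcs test_function_bcs[OF kern0_test])
  have "(LINT x|lborel. kern0 x) \<noteq> 0"
  proof
    assume "(LINT x|lborel. kern0 x) = 0"
    then have "AE x in lborel. kern0 x = 0" using integral_nonneg_eq_0_iff_AE[OF int] nn by simp
    moreover have "kern0 x > 0" if "x \<in> box (\<chi> i. -1) (\<chi> i. 1)" for x
    proof -
      have b: "-1 < x$i \<and> x$i < 1" for i using that by (simp add: mem_box_cart)
      have "0 < x$i + 1" "0 < 1 - x$i" for i using b[of i] by linarith+
      then show ?thesis
        unfolding kern0_def box_bump_def by (intro prod_pos mult_pos_pos ballI) (auto simp: expstep_def)
    qed
    ultimately have "AE x in lborel. x \<notin> (box (\<chi> i. -1) (\<chi> i. 1) :: (real^3) set)"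
      by (elim eventually_mono) force
    then have "box (\<chi> i. -1) (\<chi> i. 1) \<in> null_sets (lborel :: (real^3) measure)"
      by (subst AE_iff_null_sets) auto
    then have "negligible (box (\<chi> i. -1) (\<chi> i. 1) :: (real^3) set)"
      by (simp add: negligible_iff_null_sets null_sets_completionI)
    moreover have "(0::real^3) \<in> box (\<chi> i. -1) (\<chi> i. 1)" by (simp add: mem_box_cart)
    ultimately show False using open_not_negligible[OF open_box] by blast
  qed
  moreover have "0 \<le> (LINT x|lborel. kern0 x)" using nn by simp
  ultimately show ?thesis by simp
qed

lemma partial_deriv_scaled:
  assumes "f differentiable (at (d *\<^sub>R x))"
  shows "partial_deriv m (\<lambda>x. a * f (d *\<^sub>R x)) x = a * d * partial_deriv m f (d *\<^sub>R x)"
    "(\<lambda>x. a * f (d *\<^sub>R x)) differentiable (at x)"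
proof -
  have d: "(\<lambda>x. f (d *\<^sub>R x)) differentiable (at x)"
    using differentiable_compose[of f "\<lambda>x. d *\<^sub>R x" x UNIV] assms
      differentiable_scaleR[OF differentiable_const differentiable_ident, of d x UNIV] by simp
  then show "(\<lambda>x. a * f (d *\<^sub>R x)) differentiable (at x)" by (intro differentiable_mult) auto
  show "partial_deriv m (\<lambda>x. a * f (d *\<^sub>R x)) x = a * d * partial_deriv m f (d *\<^sub>R x)"
    using partial_deriv_mult[of "\<lambda>_. a" x "\<lambda>x. f (d *\<^sub>R x)" m] d partial_deriv_affine[of f 0 d x m] assms by simp
qed

lemma smooth_scaled: "smooth f \<Longrightarrow> smooth (\<lambda>x. a * f (d *\<^sub>R x))"
proof -
  assume f: "smooth f"
  let ?G = "{g. \<exists>a f. smooth f \<and> g = (\<lambda>x. a * f (d *\<^sub>R x))}"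
  show ?thesis
  proof (rule smooth_closedI[of _ ?G])
    show "(\<lambda>x. a * f (d *\<^sub>R x)) \<in> ?G" using f by blast
    fix g assume "g \<in> ?G"
    then obtain a f where g: "smooth f" "g = (\<lambda>x. a * f (d *\<^sub>R x))" by blast
    show "g differentiable (at x)" for x
      unfolding g by (rule partial_deriv_scaled(2)[OF smooth_differentiable[OF g(1)]])
    have "partial_deriv m g = (\<lambda>x. (a * d) * partial_deriv m f (d *\<^sub>R x))" for m
      unfolding g by (rule ext) (rule partial_deriv_scaled(1)[OF smooth_differentiable[OF g(1)]])
    then show "partial_deriv m g \<in> ?G" for m using smooth_partial[OF g(1)] by blast
  qed
qed

lemma mollify:
  "\<exists>C\<ge>0. \<forall>f \<delta> A. bcs f \<longrightarrow> 0 < \<delta> \<longrightarrow> tmod f \<delta> A \<longrightarrow>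
     (\<exists>\<psi>. smooth \<psi> \<and> (\<forall>x. \<psi> x \<noteq> 0 \<longrightarrow> (\<exists>y. f y \<noteq> 0 \<and> norm (x - y) \<le> 2 * \<delta>)) \<and>
        sqn (\<lambda>x. \<psi> x - f x) \<le> C * A \<and> (\<forall>m. sqn (partial_deriv m \<psi>) \<le> C * A / \<delta>\<^sup>2))"
proof -
  define I where "I = (LINT x|lborel. kern0 x)"
  have I: "I > 0" using kern0_integral_pos by (simp add: I_def)
  have "\<exists>B. \<forall>x. \<bar>partial_deriv m kern0 x\<bar> \<le> B" for m
    using test_function_bcs[OF test_function_partial[OF kern0_test]] by (simp add: bcs_def)
  then obtain B where B: "\<And>m x. \<bar>partial_deriv m kern0 x\<bar> \<le> B m" by metis
  \<comment> \<open>The summand 1 makes \<open>N\<close> dominate \<open>kern0\<close> as well as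
    its derivatives, so that one \<open>C\<close> serves for both conclusions.\<close>
  define N where "N = 1 + (\<Sum>m\<in>UNIV. \<bar>B m\<bar>)"
  have N: "\<bar>partial_deriv m kern0 x\<bar> \<le> N" for m x
    using B[of m x] member_le_sum[of m UNIV "\<lambda>m. \<bar>B m\<bar>"] by (simp add: N_def)
  have N1: "1 \<le> N" by (simp add: N_def sum_nonneg)
  define C where "C = 576 * N\<^sup>2 / I\<^sup>2"
  show ?thesis
  proof (intro exI[of _ C] conjI allI impI)
    show "0 \<le> C" by (simp add: C_def)
    fix f \<delta> A assume f: "bcs f" "tmod f \<delta> A" and \<delta>: "0 < \<delta>"
    \<comment> \<open>This normalizes \<kappa> to integral 1; the cube of half side \<delta>
      contributes \<open>\<delta>^3\<close>.\<close>
    define a where "a = 1 / (\<delta>^3 * I)"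
    have a: "a > 0" using \<delta> I by (simp add: a_def)
    define \<kappa> where "\<kappa> = (\<lambda>x. a * kern0 ((1 / \<delta>) *\<^sub>R x))"
    have Q: "\<bar>z$i\<bar> \<le> \<delta>" if "\<bar>((1 / \<delta>) *\<^sub>R z)$i\<bar> \<le> 1" for z :: "real^3" and i
      using that \<delta> by (simp add: abs_mult field_simps)
    have \<kappa>s: "\<bar>z$i\<bar> \<le> \<delta>" if "\<kappa> z \<noteq> 0" for z i
      using that by (intro Q kern0_support) (auto simp: \<kappa>_def)
    have \<kappa>t: "test_function UNIV \<kappa>"
    proof (rule test_functionI[of _ "cbox (\<chi> i. - \<delta>) (\<chi> i. \<delta>)"])
      show "smooth \<kappa>" unfolding \<kappa>_def by (intro smooth_scaled test_function_smooth[OF kern0_test])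
      show "\<kappa> x = 0" if "x \<notin> cbox (\<chi> i. - \<delta>) (\<chi> i. \<delta>)" for x
        using that \<kappa>s[of x] by (auto simp: mem_box_cart abs_le_iff minus_le_iff)
    qed auto
    have pk: "partial_deriv m \<kappa> = (\<lambda>x. (a / \<delta>) * partial_deriv m kern0 ((1 / \<delta>) *\<^sub>R x))" for m
      unfolding \<kappa>_def by (rule ext, subst partial_deriv_scaled(1)) (simp_all add: smooth_differentiable test_function_smooth[OF kern0_test])
    have bk: "bcs \<kappa>" "bcs (partial_deriv m \<kappa>)" for m
      by (intro test_function_bcs[OF \<kappa>t] test_function_bcs[OF test_function_partial[OF \<kappa>t]])+
    have int1: "(LINT x|lborel. \<kappa> x) = 1"
    proof -
      have "(LINT x|lborel. \<kappa> x) = \<delta>^3 * (LINT x|lborel. \<kappa> (0 + \<delta> *\<^sub>R x))"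
        by (rule lborel_integral_affine[OF bcs_measurable[OF bk(1)] \<delta>])
      also have "(LINT x|lborel. \<kappa> (0 + \<delta> *\<^sub>R x)) = a * I"
        using \<delta> by (simp add: \<kappa>_def I_def)
      finally show ?thesis using \<delta> I by (simp add: a_def)
    qed
    \<comment> \<open>Mean zero removes the term with \<open>f x\<close> from
      \<open>conv_estimate\<close>, so the gradient of \<psi> is bounded by the modulus alone and
      not by the size of \<open>f\<close>.\<close>
    have int0: "(LINT x|lborel. partial_deriv m \<kappa> x) = 0" for m
      by (intro integral_partial_deriv_zero bk smooth_differentiable test_function_smooth[OF \<kappa>t]
          test_function_continuous[OF test_function_partial[OF \<kappa>t]])
    define \<psi> where "\<psi> = conv f \<kappa>"
    have "sqn (\<lambda>x. conv f \<kappa> x - (LINT z|lborel. \<kappa> z) * f x) \<le> 576 * a\<^sup>2 * \<delta>^6 * A"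
      by (rule conv_estimate[OF f \<delta> bk(1) _ \<kappa>s])
        (use kern0_bounds a in \<open>auto simp: \<kappa>_def abs_mult intro!: mult_left_le\<close>)
    moreover have "576 * a\<^sup>2 * \<delta>^6 = 576 / I\<^sup>2"
    proof -
      have "a\<^sup>2 * \<delta>^6 = (a * \<delta>^3)\<^sup>2" by (simp add: power_mult_distrib flip: power_mult)
      also have "a * \<delta>^3 = 1 / I" using \<delta> by (simp add: a_def)
      finally show ?thesis by (simp add: power_divide)
    qed
    moreover have A0: "0 \<le> A"
      using tmod_nonneg[OF f(2) \<delta>] .
    moreover have "576 / I\<^sup>2 \<le> C" using N1 I by (simp add: C_def divide_right_mono)
    ultimately have est1: "sqn (\<lambda>x. \<psi> x - f x) \<le> C * A"
      using mult_right_mono[of "576 / I\<^sup>2" C A] int1 by (simp add: \<psi>_def)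
    have est2: "sqn (partial_deriv m \<psi>) \<le> C * A / \<delta>\<^sup>2" for m
    proof -
      have "sqn (\<lambda>x. conv f (partial_deriv m \<kappa>) x - (LINT z|lborel. partial_deriv m \<kappa> z) * f x)
          \<le> 576 * (a * N / \<delta>)\<^sup>2 * \<delta>^6 * A"
      proof (rule conv_estimate[OF f \<delta> bk(2)])
        show "\<bar>partial_deriv m \<kappa> x\<bar> \<le> a * N / \<delta>" for x
          using N[of m "(1/\<delta>) *\<^sub>R x"] \<delta> a by (simp add: pk abs_mult divide_right_mono)
        show "\<bar>z$i\<bar> \<le> \<delta>" if "partial_deriv m \<kappa> z \<noteq> 0" for z i
          using that by (intro Q kern0_partial_support[of m]) (auto simp: pk)
      qed
      moreover have "576 * (a * N / \<delta>)\<^sup>2 * \<delta>^6 * A = C * A / \<delta>\<^sup>2"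
      proof -
        have "(a * N / \<delta>)\<^sup>2 * \<delta>^6 = (a * \<delta>^3)\<^sup>2 * N\<^sup>2 / \<delta>\<^sup>2" by (simp add: power_mult_distrib power_divide flip: power_mult)
        also have "a * \<delta>^3 = 1 / I" using \<delta> by (simp add: a_def)
        finally have "(a * N / \<delta>)\<^sup>2 * \<delta>^6 = N\<^sup>2 / I\<^sup>2 / \<delta>\<^sup>2" by (simp add: power_divide)
        then show ?thesis by (simp add: C_def mult.assoc)
      qed
      ultimately show ?thesis using int0 by (simp add: \<psi>_def partial_deriv_conv[OF f(1) \<kappa>t])
    qed
    have supp: "\<exists>y. f y \<noteq> 0 \<and> norm (x - y) \<le> 2 * \<delta>" if "\<psi> x \<noteq> 0" for x
    proof -
      have "\<exists>y. f y * \<kappa> (x - y) \<noteq> 0"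
      proof (rule ccontr)
        assume "\<nexists>y. f y * \<kappa> (x - y) \<noteq> 0"
        then have "(\<lambda>y. f y * \<kappa> (x - y)) = (\<lambda>_. 0)" by blast
        then have "\<psi> x = 0" by (simp add: \<psi>_def conv_def)
        then show False using that by simp
      qed
      then obtain y where y: "f y \<noteq> 0" "\<kappa> (x - y) \<noteq> 0" by auto
      \<comment> \<open>The kernel lives on a cube of half side \<delta>, so points interact up to
        distance sqrt 3 times \<delta>, rounded up to \<open>2 * \<delta>\<close>.\<close>
      have sq: "((x - y)$i)\<^sup>2 \<le> \<delta>\<^sup>2" for i
        using \<kappa>s[OF y(2), of i] \<delta> by (metis abs_le_square_iff abs_of_pos)
      have "(norm (x - y))\<^sup>2 \<le> 3 * \<delta>\<^sup>2"
        using sq[of 1] sq[of 2] sq[of 3] unfolding power2_norm_eq_inner by (simp add: inner_vec_def sum_3 power2_eq_square)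
      also have "\<dots> \<le> (2 * \<delta>)\<^sup>2" by (simp add: power_mult_distrib)
      finally have "norm (x - y) \<le> 2 * \<delta>" by (rule power2_le_imp_le) (use \<delta> in simp)
      then show ?thesis using y by blast
    qed
    show "\<exists>\<psi>. smooth \<psi> \<and> (\<forall>x. \<psi> x \<noteq> 0 \<longrightarrow> (\<exists>y. f y \<noteq> 0 \<and> norm (x - y) \<le> 2 * \<delta>)) \<and>
        sqn (\<lambda>x. \<psi> x - f x) \<le> C * A \<and> (\<forall>m. sqn (partial_deriv m \<psi>) \<le> C * A / \<delta>\<^sup>2)"
      using est1 est2 supp smooth_conv[OF f(1) \<kappa>t] unfolding \<psi>_def by blast
  qed
qed

text \<open>What matters is homogeneity: the same finitely many vectors, scaled by \<delta>, work at
  every scale. The mesh does not enter.\<close>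

definition escape_vectors :: "(real^3) set \<Rightarrow> (real^3) set \<Rightarrow> bool" where
  "escape_vectors \<Omega> V \<longleftrightarrow> finite V \<and>
     (\<forall>\<delta>>0. \<forall>x\<in>\<Omega>. infdist x (- \<Omega>) < \<delta> \<longrightarrow> (\<exists>v\<in>V. x - \<delta> *\<^sub>R v \<notin> \<Omega>))"

lemma open_infdist_less: "{x. infdist x A < c} \<in> sets borel"
  by (intro borel_open open_Collect_less continuous_intros)

text \<open>Translating by an escape vector moves a point near the boundary to a zero of \<open>f\<close>.\<close>
lemma strip_bound:
  assumes "escape_vectors \<Omega> V"
  shows "\<exists>C\<ge>0. \<forall>f \<delta> A. bcs f \<longrightarrow> (\<forall>x. x \<notin> \<Omega> \<longrightarrow> f x = 0) \<longrightarrow> 0 < \<delta> \<longrightarrow> tmod f \<delta> A \<longrightarrow>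
      sqn (\<lambda>x. indicator {x. infdist x (- \<Omega>) < 4 * \<delta>} x * f x) \<le> C * A"
\<comment> \<open>A shift by \<open>(4 * \<delta>) *\<^sub>R v\<close> takes at most the rounded-up
  value of \<open>4 * norm v\<close> steps of length \<delta> along each axis; 9 is the constant of
  \<open>tmod_steps\<close>.\<close>
proof (intro exI[of _ "\<Sum>v\<in>V. 9 * (real (nat \<lceil>4 * norm v\<rceil>))\<^sup>2"] conjI allI impI)
  show "0 \<le> (\<Sum>v\<in>V. 9 * (real (nat \<lceil>4 * norm v\<rceil>))\<^sup>2)" by (intro sum_nonneg) auto
  fix f \<delta> A assume f: "bcs f" "tmod f \<delta> A" and off: "\<forall>x. x \<notin> \<Omega> \<longrightarrow> f x = 0" and \<delta>: "0 < \<delta>"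
  have V: "finite V" using assms by (simp add: escape_vectors_def)
  let ?d = "\<lambda>v x. f (x + (- ((4 * \<delta>) *\<^sub>R v))) - f x"
  have "sqn (\<lambda>x. indicator {x. infdist x (- \<Omega>) < 4 * \<delta>} x * f x) \<le> 1 * (\<Sum>v\<in>V. sqn (?d v))"
  proof (rule sqn_sum_le[OF V])
    show "bcs (?d v)" for v by (intro bcs_diff bcs_shift f)
    fix x
    show "(indicator {x. infdist x (- \<Omega>) < 4 * \<delta>} x * f x)\<^sup>2 \<le> 1 * (\<Sum>v\<in>V. (?d v x)\<^sup>2)"
    proof (cases "infdist x (- \<Omega>) < 4 * \<delta> \<and> x \<in> \<Omega>")
      case True
      then obtain v where v: "v \<in> V" "x - (4 * \<delta>) *\<^sub>R v \<notin> \<Omega>"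
        using assms \<delta> unfolding escape_vectors_def by (metis mult_pos_pos zero_less_numeral)
      then have "(f x)\<^sup>2 = (?d v x)\<^sup>2" using off by simp
      also have "\<dots> \<le> (\<Sum>v\<in>V. (?d v x)\<^sup>2)" using v V by (intro member_le_sum) auto
      finally show ?thesis using True by simp
    qed (use off in \<open>auto simp: indicator_def intro: sum_nonneg\<close>)
  qed
  also have "\<dots> \<le> 1 * (\<Sum>v\<in>V. 9 * (real (nat \<lceil>4 * norm v\<rceil>))\<^sup>2 * A)"
  proof (intro mult_left_mono sum_mono)
    fix v
    show "sqn (?d v) \<le> 9 * (real (nat \<lceil>4 * norm v\<rceil>))\<^sup>2 * A"
    proof (rule tmod_steps[OF f])
      fix i
      have "\<bar>(- ((4 * \<delta>) *\<^sub>R v)) $ i\<bar> = 4 * \<bar>v$i\<bar> * \<delta>" using \<delta> by (simp add: abs_mult)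
      also have "\<dots> \<le> 4 * norm v * \<delta>" using component_le_norm_cart[of v i] \<delta> by (intro mult_right_mono) auto
      also have "\<dots> \<le> real (nat \<lceil>4 * norm v\<rceil>) * \<delta>" using \<delta> by (intro mult_right_mono real_nat_ceiling_ge) auto
      finally show "\<bar>(- ((4 * \<delta>) *\<^sub>R v)) $ i\<bar> \<le> real (nat \<lceil>4 * norm v\<rceil>) * \<delta>" .
    qed
  qed auto
  finally show "sqn (\<lambda>x. indicator {x. infdist x (- \<Omega>) < 4 * \<delta>} x * f x) \<le> (\<Sum>v\<in>V. 9 * (real (nat \<lceil>4 * norm v\<rceil>))\<^sup>2) * A"
    by (simp add: sum_distrib_right)
qed

text \<open>Mollifying \<open>f\<close> directly would spread it over the boundary. The strip of
  width \<open>4 * \<delta>\<close> is cut away first; by \<open>strip_bound\<close> the removed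
  part is as small as the modulus, so the sharp cut keeps the modulus up to a constant.
  Mollification then moves the support by at most \<open>2 * \<delta>\<close> and leaves a margin of
  \<open>2 * \<delta>\<close>.\<close>

lemma test_function_approx:
  assumes "escape_vectors \<Omega> V" "open \<Omega>" "bounded \<Omega>"
  shows "\<exists>C\<ge>0. \<forall>f \<delta> A. bcs f \<longrightarrow> (\<forall>x. x \<notin> \<Omega> \<longrightarrow> f x = 0) \<longrightarrow> 0 < \<delta> \<longrightarrow> tmod f \<delta> A \<longrightarrow>
      (\<exists>\<psi>. test_function \<Omega> \<psi> \<and> sqn (\<lambda>x. \<psi> x - f x) \<le> C * A \<and> (\<forall>m. sqn (partial_deriv m \<psi>) \<le> C * A / \<delta>\<^sup>2))"
proof -
  obtain C1 where "C1 \<ge> 0" and C1': "\<forall>f \<delta> A. bcs f \<longrightarrow> (\<forall>x. x \<notin> \<Omega> \<longrightarrow> f x = 0) \<longrightarrow> 0 < \<delta> \<longrightarrow> tmod f \<delta> A \<longrightarrow>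
      sqn (\<lambda>x. indicator {x. infdist x (- \<Omega>) < 4 * \<delta>} x * f x) \<le> C1 * A"
    using strip_bound[OF assms(1)] by (elim exE conjE) (rule that)
  note C1 = \<open>C1 \<ge> 0\<close> C1'[rule_format]
  obtain C2 where "C2 \<ge> 0" and C2': "\<forall>f \<delta> A. bcs f \<longrightarrow> 0 < \<delta> \<longrightarrow> tmod f \<delta> A \<longrightarrow>
     (\<exists>\<psi>. smooth \<psi> \<and> (\<forall>x. \<psi> x \<noteq> 0 \<longrightarrow> (\<exists>y. f y \<noteq> 0 \<and> norm (x - y) \<le> 2 * \<delta>)) \<and>
        sqn (\<lambda>x. \<psi> x - f x) \<le> C2 * A \<and> (\<forall>m. sqn (partial_deriv m \<psi>) \<le> C2 * A / \<delta>\<^sup>2))"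
    using mollify by (elim exE conjE) (rule that)
  note C2 = \<open>C2 \<ge> 0\<close> C2'[rule_format]
  \<comment> \<open>Doubling for a sum of two terms: 2 comes from the increment of \<open>f\<close>,
    and 8 is 2 times the 4 from the two values of \<open>g\<close> in its increment.\<close>
  define C3 where "C3 = 2 + 8 * C1"
  define C where "C = 2 * (C2 * C3) + 2 * C1"
  have C: "C2 * C3 \<le> C" "0 \<le> C2 * C3" using C1 C2 by (auto simp: C_def C3_def)
  show ?thesis
  proof (intro exI[of _ C] conjI allI impI)
    show "0 \<le> C" using C1 C2 by (simp add: C_def C3_def)
    fix f \<delta> A assume f: "bcs f" "tmod f \<delta> A" and off: "\<forall>x. x \<notin> \<Omega> \<longrightarrow> f x = 0" and \<delta>: "0 < \<delta>"
    have A0: "0 \<le> A" using tmod_nonneg[OF f(2) \<delta>] .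
    define g where "g = (\<lambda>x. indicator {x. infdist x (- \<Omega>) < 4 * \<delta>} x * f x)"
    have bg: "bcs g" unfolding g_def
    proof (rule bcs_mult(2)[OF f(1), where C = 1])
      show "indicator {x. infdist x (- \<Omega>) < 4 * \<delta>} \<in> borel_measurable borel"
        by (intro borel_measurable_indicator open_infdist_less)
    qed (auto simp: indicator_def)
    define f1 where "f1 = (\<lambda>x. f x - g x)"
    have b1: "bcs f1" unfolding f1_def by (intro bcs_diff f bg)
    have sg: "sqn g \<le> C1 * A" unfolding g_def using C1(2)[OF f(1) _ \<delta> f(2)] off by blast
    have "tmod f1 \<delta> (C3 * A)"
      unfolding tmod_def
    proof (intro allI impI)
      fix i t assume t: "\<bar>t\<bar> \<le> \<delta>"
      let ?e = "t *\<^sub>R (axis i 1 :: real^3)"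
      have s1: "sqn (\<lambda>x. g (x + ?e) + (-1) * g x) \<le> 2 * sqn (\<lambda>x. g (x + ?e)) + 2 * sqn (\<lambda>x. (-1) * g x)"
        using bcs_comb[OF bcs_zero bg, of "-1"] by (intro sqn_add bcs_shift bg) simp
      have s2: "sqn (\<lambda>x. g (x + ?e)) = sqn g" "sqn (\<lambda>x. (-1) * g x) = sqn g"
        using sqn_shift[OF bcs_measurable[OF bg]] by (auto simp: sqn_def)
      have s3: "sqn (\<lambda>x. (-1) * (g (x + ?e) + (-1) * g x)) = sqn (\<lambda>x. g (x + ?e) + (-1) * g x)"
        by (simp add: sqn_def power2_commute)
      have "sqn (\<lambda>x. f1 (x + ?e) - f1 x) = sqn (\<lambda>x. (f (x + ?e) - f x) + (-1) * (g (x + ?e) + (-1) * g x))"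
        by (simp add: f1_def algebra_simps)
      also have "\<dots> \<le> 2 * sqn (\<lambda>x. f (x + ?e) - f x) + 2 * sqn (\<lambda>x. (-1) * (g (x + ?e) + (-1) * g x))"
        using bcs_comb[OF bcs_zero bcs_comb[OF bcs_shift[OF bg] bg, of ?e "-1"], of "-1"]
        by (intro sqn_add bcs_diff bcs_shift f) simp
      also have "\<dots> \<le> 2 * A + 2 * (4 * (C1 * A))"
        using f(2) t s1 s2 s3 sg unfolding tmod_def by (intro add_mono mult_left_mono) auto
      finally show "sqn (\<lambda>x. f1 (x + ?e) - f1 x) \<le> C3 * A" by (simp add: C3_def algebra_simps)
    qed
    from C2(2)[OF b1 \<delta> this] obtain \<psi> where \<psi>: "smooth \<psi>" "\<And>x. \<psi> x \<noteq> 0 \<Longrightarrow> \<exists>y. f1 y \<noteq> 0 \<and> norm (x - y) \<le> 2 * \<delta>"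
        "sqn (\<lambda>x. \<psi> x - f1 x) \<le> C2 * (C3 * A)" "\<And>m. sqn (partial_deriv m \<psi>) \<le> C2 * (C3 * A) / \<delta>\<^sup>2" by blast
    have test: "test_function \<Omega> \<psi>"
    proof (rule test_functionI[OF \<psi>(1), of "{x. 2 * \<delta> \<le> infdist x (- \<Omega>)}"])
      show sub: "{x. 2 * \<delta> \<le> infdist x (- \<Omega>)} \<subseteq> \<Omega>"
      proof
        fix x assume "x \<in> {x. 2 * \<delta> \<le> infdist x (- \<Omega>)}"
        then have "infdist x (- \<Omega>) \<noteq> 0" using \<delta> by auto
        then show "x \<in> \<Omega>" by (metis ComplI infdist_zero)
      qed
      have "closed {x. 2 * \<delta> \<le> infdist x (- \<Omega>)}" by (intro closed_Collect_le continuous_intros)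
      then show "compact {x. 2 * \<delta> \<le> infdist x (- \<Omega>)}"
        using bounded_subset[OF assms(3) sub] by (simp add: compact_eq_bounded_closed)
      fix x assume x: "x \<notin> {x. 2 * \<delta> \<le> infdist x (- \<Omega>)}"
      show "\<psi> x = 0"
      proof (rule ccontr)
        assume "\<psi> x \<noteq> 0"
        then obtain y where y: "f1 y \<noteq> 0" "norm (x - y) \<le> 2 * \<delta>" using \<psi>(2) by blast
        then have "4 * \<delta> \<le> infdist y (- \<Omega>)" by (auto simp: f1_def g_def indicator_def split: if_splits)
        moreover have "infdist y (- \<Omega>) \<le> infdist x (- \<Omega>) + dist y x" by (rule infdist_triangle)
        ultimately show False using x y by (simp add: dist_norm norm_minus_commute)
      qed
    qed
    have "sqn (\<lambda>x. \<psi> x - f x) = sqn (\<lambda>x. (\<psi> x - f1 x) + (-1) * g x)" by (simp add: f1_def algebra_simps)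
    also have "\<dots> \<le> 2 * sqn (\<lambda>x. \<psi> x - f1 x) + 2 * sqn (\<lambda>x. (-1) * g x)"
      using bcs_comb[OF bcs_zero bg, of "-1"] by (intro sqn_add bcs_diff b1 test_function_bcs[OF test]) simp
    also have "sqn (\<lambda>x. (-1) * g x) = sqn g" by (simp add: sqn_def)
    finally have e1: "sqn (\<lambda>x. \<psi> x - f x) \<le> C * A" using \<psi>(3) sg by (simp add: C_def algebra_simps)
    have "sqn (partial_deriv m \<psi>) \<le> C * A / \<delta>\<^sup>2" for m
    proof -
      have "C2 * (C3 * A) \<le> C * A" using mult_right_mono[OF C(1) A0] by (simp add: mult.assoc)
      then have "C2 * (C3 * A) / \<delta>\<^sup>2 \<le> C * A / \<delta>\<^sup>2" by (intro divide_right_mono) auto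
      then show ?thesis using \<psi>(4)[of m] by linarith
    qed
    then show "\<exists>\<psi>. test_function \<Omega> \<psi> \<and> sqn (\<lambda>x. \<psi> x - f x) \<le> C * A \<and> (\<forall>m. sqn (partial_deriv m \<psi>) \<le> C * A / \<delta>\<^sup>2)"
      using test e1 by blast
  qed
qed

section \<open>Planes and lines\<close>

lemma plane_param_exists:
  assumes "is_plane P"
  shows "\<exists>\<phi> :: real^2 \<Rightarrow> real^3. (\<forall>s t. dist (\<phi> s) (\<phi> t) = dist s t) \<and> range \<phi> = P"
proof -
  obtain n c where n: "norm n = 1" and P: "P = {x. n \<bullet> x = c}" using assms by (auto simp: is_plane_def)
  have nn: "n \<bullet> n = 1" using n by (simp add: norm_eq_1)
  have "n \<noteq> 0" using n by auto
  have dim: "dim (UNIV :: (real^2) set) = dim {x. n \<bullet> x = 0}"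
    using dim_hyperplane[OF \<open>n \<noteq> 0\<close>] by simp
  obtain f g where f: "linear f" "f ` (UNIV :: (real^2) set) = {x. n \<bullet> x = 0}" "\<And>s. norm (f s) = norm s"
    by (rule isometries_subspaces[OF subspace_UNIV subspace_hyperplane dim]) auto
  define \<phi> where "\<phi> = (\<lambda>s. c *\<^sub>R n + f s)"
  have "dist (\<phi> s) (\<phi> t) = dist s t" for s t
    using f(3)[of "s - t"] linear_diff[OF f(1)] by (simp add: \<phi>_def dist_norm)
  moreover have "range \<phi> = P"
  proof
    have "n \<bullet> f s = 0" for s using f(2) by blast
    then show "range \<phi> \<subseteq> P" using nn by (auto simp: \<phi>_def P inner_add_right)
    show "P \<subseteq> range \<phi>"
    proof
      fix x assume "x \<in> P"
      then have "x - c *\<^sub>R n \<in> {x. n \<bullet> x = 0}" using nn by (auto simp: P inner_diff_right)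
      then obtain s where "x - c *\<^sub>R n = f s" using f(2) by blast
      then have "x = \<phi> s" by (simp add: \<phi>_def algebra_simps)
      then show "x \<in> range \<phi>" by blast
    qed
  qed
  ultimately show ?thesis by blast
qed

text \<open>Names the parametrization chosen inside \<open>plane_measure\<close>, so that facts
  about that very choice can be stated.\<close>

definition plane_param :: "(real^3) set \<Rightarrow> real^2 \<Rightarrow> real^3" where
  "plane_param P = (SOME \<phi> :: real^2 \<Rightarrow> real^3. (\<forall>s t. dist (\<phi> s) (\<phi> t) = dist s t) \<and> range \<phi> = P)"

lemma plane_measure_eq: "plane_measure P = distr lborel borel (plane_param P)"
  by (simp add: plane_measure_def plane_param_def)

lemma plane_param_dist: "is_plane P \<Longrightarrow> dist (plane_param P s) (plane_param P t) = dist s t"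
  and plane_param_range: "is_plane P \<Longrightarrow> range (plane_param P) = P"
  using someI_ex[OF plane_param_exists[of P]] unfolding plane_param_def by auto

lemma plane_param_in: "is_plane P \<Longrightarrow> plane_param P s \<in> P"
  using plane_param_range by blast

definition plane_dir :: "(real^3) set \<Rightarrow> real^2 \<Rightarrow> real^3" where
  "plane_dir P s = plane_param P s - plane_param P 0"

lemma plane_param_eq: "plane_param P s = plane_param P 0 + plane_dir P s"
  by (simp add: plane_dir_def)

lemma plane_dir_inner:
  assumes "is_plane P"
  shows "plane_dir P s \<bullet> plane_dir P t = s \<bullet> t"
proof -
  have n: "norm (plane_dir P s) = norm s" for s
    using plane_param_dist[OF assms, of s 0] by (simp add: plane_dir_def dist_norm)
  have d: "norm (plane_dir P s - plane_dir P t) = norm (s - t)"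
    using plane_param_dist[OF assms, of s t] by (simp add: plane_dir_def dist_norm)
  have "2 * (a \<bullet> b) = (norm a)\<^sup>2 + (norm b)\<^sup>2 - (norm (a - b))\<^sup>2" for a b :: "'x::real_inner"
    by (simp add: power2_norm_eq_inner inner_diff inner_commute algebra_simps)
  from this[of "plane_dir P s" "plane_dir P t"] this[of s t] show ?thesis by (simp add: n d)
qed

text \<open>Preservation of inner products suffices: the squared norm of each defect of linearity
  expands to 0.\<close>

lemma plane_dir_linear:
  assumes "is_plane P" shows "linear (plane_dir P)"
proof (rule linearI)
  note i = plane_dir_inner[OF assms]
  fix s t
  have "(plane_dir P (s + t) - plane_dir P s - plane_dir P t) \<bullet> (plane_dir P (s + t) - plane_dir P s - plane_dir P t) = 0"
    by (simp add: inner_diff inner_commute i) (simp add: inner_add inner_commute algebra_simps)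
  then have "plane_dir P (s + t) - plane_dir P s - plane_dir P t = 0" by (simp only: inner_eq_zero_iff)
  then show "plane_dir P (s + t) = plane_dir P s + plane_dir P t" by (simp add: algebra_simps)
  fix c
  have "(plane_dir P (c *\<^sub>R s) - c *\<^sub>R plane_dir P s) \<bullet> (plane_dir P (c *\<^sub>R s) - c *\<^sub>R plane_dir P s) = 0"
    by (simp add: inner_diff inner_commute i)
  then have "plane_dir P (c *\<^sub>R s) - c *\<^sub>R plane_dir P s = 0" by (simp only: inner_eq_zero_iff)
  then show "plane_dir P (c *\<^sub>R s) = c *\<^sub>R plane_dir P s" by simp
qed

lemma continuous_plane_param: "is_plane P \<Longrightarrow> continuous_on S (plane_param P)"
  unfolding continuous_on_iff by (metis plane_param_dist)

lemma plane_param_measurable: "is_plane P \<Longrightarrow> plane_param P \<in> borel \<rightarrow>\<^sub>M borel"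
  by (intro borel_measurable_continuous_onI continuous_plane_param)

lemma plane_subset_eq:
  assumes "is_plane P" "is_plane Q" "P \<subseteq> Q" shows "P = Q"
proof -
  obtain n c where n: "norm n = 1" "P = {x. n \<bullet> x = c}" using assms by (auto simp: is_plane_def)
  obtain m d where m: "norm m = 1" "Q = {x. m \<bullet> x = d}" using assms by (auto simp: is_plane_def)
  have nn: "n \<bullet> n = 1" "m \<bullet> m = 1" using n m by (auto simp: norm_eq_1)
  define v where "v = m - (m \<bullet> n) *\<^sub>R n"
  have vn: "n \<bullet> v = 0" using nn by (simp add: v_def inner_diff_right inner_commute)
  have "c *\<^sub>R n \<in> P" "c *\<^sub>R n + v \<in> P" using nn vn n by (auto simp: inner_add_right)
  then have "m \<bullet> (c *\<^sub>R n) = d" "m \<bullet> (c *\<^sub>R n + v) = d" using assms(3) m by auto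
  then have "m \<bullet> v = 0" by (simp add: inner_add_right)
  then have vv: "v \<bullet> v = 0" using vn by (simp add: v_def inner_diff_left)
  then have mn: "m = (m \<bullet> n) *\<^sub>R n" by (simp add: v_def)
  then obtain k where k: "m = k *\<^sub>R n" by blast
  have "k \<noteq> 0" using k m(1) by auto
  moreover have "d = k * c" using \<open>m \<bullet> (c *\<^sub>R n) = d\<close> nn(1) by (simp add: k mult.commute)
  ultimately show ?thesis by (simp add: n(2) m(2) k)
qed

lemma closed_plane: "is_plane P \<Longrightarrow> closed P"
  by (auto simp: is_plane_def closed_hyperplane)

text \<open>In the parameter plane the intersection is given by one linear equation. It is trivial
  only if one plane contains the other, and then the two are equal.\<close>

lemma plane_param_negligible:
  assumes "is_plane P" "is_plane Q" "P \<noteq> Q"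
  shows "{s. plane_param P s \<in> Q} \<in> null_sets lborel"
proof -
  obtain m d where m: "norm m = 1" "Q = {x. m \<bullet> x = d}" using assms by (auto simp: is_plane_def)
  define a where "a = adjoint (plane_dir P) m"
  have eq: "{s. plane_param P s \<in> Q} = {s. a \<bullet> s = d - m \<bullet> plane_param P 0}"
  proof -
    have adj: "m \<bullet> plane_dir P s = a \<bullet> s" for s
      using adjoint_works[OF plane_dir_linear[OF assms(1)], of s m] by (simp add: a_def inner_commute)
    have "m \<bullet> plane_param P s = d \<longleftrightarrow> a \<bullet> s = d - m \<bullet> plane_param P 0" for s
      using adj[of s] unfolding plane_dir_def inner_diff_right by linarith
    then show ?thesis unfolding m(2) by simp
  qed
  have "negligible {s. plane_param P s \<in> Q}"
  proof (cases "a = 0 \<and> d = m \<bullet> plane_param P 0")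
    case True
    then have "plane_param P s \<in> Q" for s using eq by auto
    then have "P \<subseteq> Q" using plane_param_range[OF assms(1)] by (metis imageE subsetI)
    then show ?thesis using plane_subset_eq assms by blast
  next
    case False
    then show ?thesis unfolding eq by (intro negligible_hyperplane) auto
  qed
  moreover have "closed {s. plane_param P s \<in> Q}" unfolding eq by (rule closed_hyperplane)
  ultimately show ?thesis
    by (simp add: negligible_iff_null_sets null_sets_completion_iff borel_closed)
qed

text \<open>By isometry all parameters lie within \<open>2 * d\<close> of any one of them, hence in
  a square of side \<open>4 * d\<close>.\<close>

lemma plane_param_ball_measure:
  assumes "is_plane P"
  shows "emeasure lborel {s. plane_param P s \<in> cball x d} \<le> ennreal (16 * d\<^sup>2)"
proof (cases "\<exists>s0. plane_param P s0 \<in> cball x d")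
  case True
  then obtain s0 where s0: "plane_param P s0 \<in> cball x d" by blast
  have d0: "0 \<le> d" using s0 by (auto intro: order_trans[OF zero_le_dist])
  have "{s. plane_param P s \<in> cball x d} \<subseteq> cbox (\<chi> i. s0$i - 2 * d) (\<chi> i. s0$i + 2 * d)"
  proof
    fix s assume "s \<in> {s. plane_param P s \<in> cball x d}"
    then have "dist (plane_param P s) (plane_param P s0) \<le> 2 * d"
      using s0 dist_triangle3[of "plane_param P s" "plane_param P s0" x] by (auto simp: dist_commute)
    then have "norm (s - s0) \<le> 2 * d" using plane_param_dist[OF assms] by (simp add: dist_norm)
    then have "\<bar>s$i - s0$i\<bar> \<le> 2 * d" for i using component_le_norm_cart[of "s - s0" i] by simp
    then show "s \<in> cbox (\<chi> i. s0$i - 2 * d) (\<chi> i. s0$i + 2 * d)"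
      by (auto simp: mem_box_cart abs_le_iff) (smt (verit))+
  qed
  then have "emeasure lborel {s. plane_param P s \<in> cball x d} \<le> emeasure lborel (cbox (\<chi> i. s0$i - 2 * d) (\<chi> i. s0$i + 2 * d) :: (real^2) set)"
    by (intro emeasure_mono) auto
  also have "\<dots> = ennreal (measure lborel (cbox (\<chi> i. s0$i - 2 * d) (\<chi> i. s0$i + 2 * d) :: (real^2) set))"
    by (rule emeasure_eq_measure2) (use emeasure_lborel_cbox_finite in auto)
  also have "measure lborel (cbox (\<chi> i. s0$i - 2 * d) (\<chi> i. s0$i + 2 * d) :: (real^2) set) = (\<Prod>i\<in>(UNIV::2 set). 4 * d)"
    using d0 by (subst content_cbox_cart) (auto simp: interval_ne_empty_cart)
  also have "\<dots> = 16 * d\<^sup>2" by (simp add: power_mult_distrib)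
  finally show ?thesis .
qed auto

section \<open>Volume of the points whose segments cross a plane\<close>

definition split3 :: "(real^2) \<times> real \<Rightarrow> real^3" where
  "split3 y = vector [fst y $ 1, fst y $ 2, snd y]"

lemma split3_simps [simp]: "split3 (s, t) $ 1 = s $ 1" "split3 (s, t) $ 2 = s $ 2" "split3 (s, t) $ 3 = t"
  by (auto simp: split3_def)

lemma split3_measurable: "split3 \<in> borel \<rightarrow>\<^sub>M borel"
proof (rule borel_measurable_continuous_onI)
  show "continuous_on UNIV split3"
  proof -
    have "split3 = (\<lambda>y. (fst y $ 1) *\<^sub>R axis 1 1 + (fst y $ 2) *\<^sub>R axis 2 1 + snd y *\<^sub>R axis 3 1)"
      by (auto simp: split3_def vec_eq_iff forall_3 axis_def)
    then show ?thesis by (rule ssubst) (intro continuous_intros)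
  qed
qed

lemma prod_Basis_vec: "(\<Prod>b\<in>(Basis :: (real^'n) set). f b) = (\<Prod>i\<in>UNIV. f (axis i 1))"
proof -
  have B: "(Basis :: (real^'n) set) = (\<lambda>i. axis i 1) ` UNIV" by (auto simp: Basis_vec_def)
  have "inj (\<lambda>i. axis i 1 :: real^'n)" by (auto simp: inj_on_def axis_eq_axis)
  then show ?thesis unfolding B by (subst prod.reindex) (simp_all add: o_def)
qed

lemma prod_UNIV_3: "(\<Prod>i\<in>(UNIV :: 3 set). f i) = f 1 * f 2 * f 3"
  unfolding UNIV_3 by (simp add: mult.assoc)

lemma lborel_split3: "lborel = distr (lborel \<Otimes>\<^sub>M lborel) borel split3"
proof (rule lborel_eqI)
  fix l u :: "real^3" assume lu: "\<And>b. b \<in> Basis \<Longrightarrow> l \<bullet> b \<le> u \<bullet> b"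
  have le: "l$i \<le> u$i" for i using lu[of "axis i 1"] by (simp add: inner_axis)
  define l' u' :: "real^2" where "l' = vector [l$1, l$2]" and "u' = vector [u$1, u$2]"
  have pre: "split3 -` box l u \<inter> space (lborel \<Otimes>\<^sub>M lborel) = box l' u' \<times> box (l$3) (u$3)"
    by (auto simp: mem_box_cart forall_3 forall_2 l'_def u'_def space_pair_measure)
  have "emeasure (distr (lborel \<Otimes>\<^sub>M lborel) borel split3) (box l u) = emeasure (lborel \<Otimes>\<^sub>M lborel) (box l' u' \<times> box (l$3) (u$3))"
    unfolding pre[symmetric] by (rule emeasure_distr) (use split3_measurable in \<open>auto simp: lborel_prod\<close>)
  also have "\<dots> = emeasure lborel (box l' u') * emeasure lborel (box (l$3) (u$3))"
    by (intro lborel.emeasure_pair_measure_Times) auto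
  also have "emeasure lborel (box l' u') = ennreal ((u$1 - l$1) * (u$2 - l$2))"
  proof -
    have "\<forall>b\<in>Basis. l' \<bullet> b \<le> u' \<bullet> b"
      using le by (auto simp: Basis_vec_def inner_axis l'_def u'_def UNIV_2)
    then show ?thesis
      by (simp add: emeasure_lborel_box_eq prod_Basis_vec inner_axis UNIV_2) (simp add: l'_def u'_def mult.commute)
  qed
  also have "emeasure lborel (box (l$3) (u$3)) = ennreal (u$3 - l$3)" using le by (simp add: emeasure_lborel_box_eq)
  also have "ennreal ((u$1 - l$1) * (u$2 - l$2)) * ennreal (u$3 - l$3) = ennreal (((u$1 - l$1) * (u$2 - l$2)) * (u$3 - l$3))"
    using le[of 1] le[of 2] le[of 3] by (intro ennreal_mult[symmetric] mult_nonneg_nonneg) auto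
  also have "((u$1 - l$1) * (u$2 - l$2)) * (u$3 - l$3) = (\<Prod>b\<in>Basis. (u - l) \<bullet> b)"
    unfolding prod_Basis_vec prod_UNIV_3 by (simp add: inner_axis)
  finally show "emeasure (distr (lborel \<Otimes>\<^sub>M lborel) borel split3) (box l u) = ennreal (\<Prod>b\<in>Basis. (u - l) \<bullet> b)" .
qed simp

text \<open>The parameter at which the line through \<open>x\<close> in direction \<open>e\<close> meets the plane \<open>n \<bullet> y = c\<close>
  (junk value 0 if the line is parallel to the plane).\<close>
definition crossing :: "real^3 \<Rightarrow> real \<Rightarrow> real^3 \<Rightarrow> real^3 \<Rightarrow> real" where
  "crossing n c e x = (c - n \<bullet> x) / (n \<bullet> e)"

lemma det_columns_le_1:
  fixes a b c :: "real^3"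
  assumes "norm a = 1" "norm b = 1" "norm c = 1"
  shows "\<bar>det (transpose (vector [a, b, c]))\<bar> \<le> 1"
proof -
  have "(norm (cross3 b c))\<^sup>2 = 1 - (b \<bullet> c)\<^sup>2" using norm_cross_dot[of b c] assms by simp
  then have "(norm (cross3 b c))\<^sup>2 \<le> 1" by simp
  then have "norm (cross3 b c) \<le> 1" by (simp add: abs_square_le_1)
  then have "\<bar>a \<bullet> cross3 b c\<bar> \<le> 1 * 1"
    using assms Cauchy_Schwarz_ineq2[of a "cross3 b c"] by (intro order_trans[OF _ mult_mono[of "norm a" 1]]) auto
  then show ?thesis by (simp add: det_transpose dot_cross_det)
qed

text \<open>Write \<open>x\<close> as a point of the plane minus \<open>\<tau> e\<close>, where
  \<tau> is the time of crossing. The Jacobian is the determinant of two orthonormal directions of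
  the plane and the unit vector \<open>- e\<close>, hence at most 1 however flat the crossing; the
  times in question fill an interval of length \<open>t\<close>. This replaces a trace
  inequality.\<close>

lemma nn_integral_crossing_le:
  assumes P: "is_plane P" "norm n = 1" "P = {x. n \<bullet> x = c}" and e: "norm e = 1" "n \<bullet> e \<noteq> 0"
    and F: "F \<in> borel_measurable borel" and t: "0 \<le> t"
  shows "(\<integral>\<^sup>+x. indicator {0<..<t} (crossing n c e x) * F (x + crossing n c e x *\<^sub>R e) \<partial>lborel)
    \<le> ennreal t * (\<integral>\<^sup>+s. F (plane_param P s) \<partial>lborel)"
proof -
  define M where "M = (\<lambda>u::real^3. plane_dir P (vector [u$1, u$2]) - (u$3) *\<^sub>R e)"
  define A where "A = (\<lambda>u. plane_param P 0 + M u)"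
  have lv: "linear (\<lambda>u::real^3. vector [u$1, u$2] :: real^2)"
    by (rule linearI) (auto simp: vec_eq_iff forall_2)
  have M: "linear M"
    unfolding M_def by (intro linear_compose_sub linear_compose[OF lv plane_dir_linear[OF P(1)], unfolded o_def] linearI)
      (auto simp: algebra_simps)
  have Au: "A u = plane_param P (vector [u$1, u$2]) - (u$3) *\<^sub>R e" for u
    unfolding A_def M_def by (subst (2) plane_param_eq) simp
  have cr: "crossing n c e (A u) = u$3" for u
    using plane_param_in[OF P(1), of "vector [u$1, u$2]"] e(2) P(3) by (simp add: crossing_def Au inner_diff_right)
  have surj: "\<exists>u. A u = x" for x
  proof -
    have "x + crossing n c e x *\<^sub>R e \<in> P" using e(2) by (simp add: P(3) crossing_def inner_add_right)
    then obtain s where s: "plane_param P s = x + crossing n c e x *\<^sub>R e" using plane_param_range[OF P(1)] by (metis imageE)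
    have "vector [s$1, s$2] = s" by (simp add: vec_eq_iff forall_2)
    then have "A (vector [s$1, s$2, crossing n c e x]) = x" by (simp add: Au s)
    then show ?thesis by blast
  qed
  have contA: "continuous_on S A" for S
    unfolding A_def by (intro continuous_intros linear_continuous_on linear_conv_bounded_linear[THEN iffD1] M)
  have mA: "A \<in> borel \<rightarrow>\<^sub>M borel" by (intro borel_measurable_continuous_onI contA)
  \<comment> \<open>The Jacobian of the change of coordinates; geometrically it is the absolute
    value of \<open>n \<bullet> e\<close>.\<close>
  define D where "D = \<bar>det (matrix M)\<bar>"
  have ax2: "vector [0, 1] = (axis 2 1 :: real^2)"
    "vector [1, 0] = (axis 1 1 :: real^2)"
    by (auto simp: vec_eq_iff forall_2 axis_def)
  have z2: "vector [0, 0] = (0 :: real^2)" by (simp add: vec_eq_iff forall_2)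
  have pd0: "plane_dir P 0 = 0" by (simp add: plane_dir_def)
  have nd: "norm (plane_dir P (axis i 1)) = 1" for i
    using plane_dir_inner[OF P(1), of "axis i 1" "axis i 1"] by (simp add: norm_eq_1 inner_axis)
  have "matrix M = transpose (vector [plane_dir P (axis 1 1), plane_dir P (axis 2 1), - e])"
    by (simp add: vec_eq_iff forall_3 matrix_def transpose_def M_def axis_def ax2 z2 pd0)
  then have D1: "D \<le> 1" using det_columns_le_1[OF nd nd, of "- e"] e(1) by (simp add: D_def)
  have lb: "lborel = density (distr lborel borel A) (\<lambda>_. ennreal D)"
  proof (rule lborel_eqI)
    fix l u :: "real^3" assume lu: "\<And>b. b \<in> Basis \<Longrightarrow> l \<bullet> b \<le> u \<bullet> b"
    define S where "S = A -` box l u"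
    have "open S" unfolding S_def by (intro open_vimage open_box contA)
    \<comment> \<open>Needed for finite measure. The crossing time bounds the third coordinate; the
      other two then follow because the parametrization is isometric.\<close>
    have "bounded S"
    proof -
      obtain R where R: "\<And>x. x \<in> box l u \<Longrightarrow> norm x \<le> R" using bounded_box[of l u] unfolding bounded_iff by blast
      define K where "K = (\<bar>c\<bar> + R) / \<bar>n \<bullet> e\<bar>"
      have "norm w \<le> R + K + norm (plane_param P 0) + K" if "w \<in> S" for w
      proof -
        have Aw: "norm (A w) \<le> R" using that R by (simp add: S_def)
        have "\<bar>n \<bullet> A w\<bar> \<le> R" using Cauchy_Schwarz_ineq2[of n "A w"] P(2) Aw by simp
        then have "\<bar>c - n \<bullet> A w\<bar> \<le> \<bar>c\<bar> + R" by linarith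
        then have w3: "\<bar>w$3\<bar> \<le> K"
          unfolding cr[of w, symmetric] crossing_def K_def abs_divide by (intro divide_right_mono) auto
        have "norm (vector [w$1, w$2] :: real^2) = norm (plane_dir P (vector [w$1, w$2]))"
          using plane_dir_inner[OF P(1)] by (simp add: norm_eq_sqrt_inner)
        also have "plane_dir P (vector [w$1, w$2]) = A w + (w$3) *\<^sub>R e - plane_param P 0"
          by (simp add: A_def M_def)
        also have "norm \<dots> \<le> R + K + norm (plane_param P 0)"
          using Aw w3 e(1) by (intro order_trans[OF norm_triangle_ineq4 add_mono] order_trans[OF norm_triangle_ineq add_mono]) auto
        finally have w12: "norm (vector [w$1, w$2] :: real^2) \<le> R + K + norm (plane_param P 0)" .
        have "w = split3 (vector [w$1, w$2], 0) + (w$3) *\<^sub>R axis 3 1"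
          by (simp add: vec_eq_iff forall_3 axis_def)
        then have "norm w \<le> norm (split3 (vector [w$1, w$2] :: real^2, 0)) + norm ((w$3) *\<^sub>R (axis 3 1 :: real^3))"
          by (metis norm_triangle_ineq)
        moreover have "norm (split3 (vector [w$1, w$2] :: real^2, 0)) = norm (vector [w$1, w$2] :: real^2)"
          by (simp add: norm_eq_sqrt_inner inner_vec_def sum_3 sum_2)
        ultimately show ?thesis using w12 w3 by simp
      qed
      then show ?thesis unfolding bounded_iff by blast
    qed
    then have Sl: "S \<in> lmeasurable" using \<open>open S\<close> by (intro lmeasurable_open)
    have img: "A ` S = box l u"
    proof
      show "box l u \<subseteq> A ` S"
      proof
        fix x assume x: "x \<in> box l u"
        obtain w where "A w = x" using surj by blast
        then show "x \<in> A ` S" using x by (auto simp: S_def)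
      qed
    qed (auto simp: S_def)
    have "box l u = (+) (plane_param P 0) ` (M ` S)" unfolding img[symmetric] A_def by (auto simp: image_image)
    then have "measure lebesgue (box l u) = measure lebesgue (M ` S)" by (simp add: measure_translation)
    also have "\<dots> = D * measure lebesgue S" unfolding D_def by (rule measure_linear_image[OF M Sl])
    finally have ms: "measure lebesgue (box l u) = D * measure lebesgue S" .
    have "emeasure (density (distr lborel borel A) (\<lambda>_. ennreal D)) (box l u) = ennreal D * emeasure lborel S"
      using mA by (simp add: emeasure_density nn_integral_cmult_indicator emeasure_distr S_def)
    also have "emeasure lborel S = ennreal (measure lborel S)"
      using emeasure_bounded_finite[OF \<open>bounded S\<close>] by (intro emeasure_eq_ennreal_measure) auto
    also have "ennreal D * ennreal (measure lborel S) = ennreal (measure lebesgue (box l u))"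
      using ms \<open>open S\<close> by (simp add: ennreal_mult D_def measure_completion)
    also have "\<dots> = ennreal (\<Prod>b\<in>Basis. (u - l) \<bullet> b)" using lu by (simp add: measure_lborel_box_eq)
    finally show "emeasure (density (distr lborel borel A) (\<lambda>_. ennreal D)) (box l u) = ennreal (\<Prod>b\<in>Basis. (u - l) \<bullet> b)" .
  qed simp
  have mc: "crossing n c e \<in> borel_measurable borel"
    unfolding crossing_def[abs_def] by (intro borel_measurable_continuous_onI continuous_intros e) (auto simp: e)
  define G where "G = (\<lambda>x. indicator {0<..<t} (crossing n c e x) * F (x + crossing n c e x *\<^sub>R e))"
  have mG: "G \<in> borel_measurable borel"
    unfolding G_def using mc
    by (intro borel_measurable_times_ennreal measurable_compose[OF _ F] measurable_compose[OF mc, of "indicator {0<..<t}"]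
        borel_measurable_add borel_measurable_scaleR) auto
  have "(\<integral>\<^sup>+x. G x \<partial>lborel) = (\<integral>\<^sup>+x. G x \<partial>density (distr lborel borel A) (\<lambda>_. ennreal D))" using lb by simp
  also have "\<dots> = ennreal D * (\<integral>\<^sup>+u. G (A u) \<partial>lborel)"
    using mG mA by (simp add: nn_integral_density nn_integral_cmult nn_integral_distr)
  also have "\<dots> \<le> 1 * (\<integral>\<^sup>+u. G (A u) \<partial>lborel)" using D1 by (intro mult_right_mono) (auto simp: ennreal_le_1)
  also have "\<dots> = (\<integral>\<^sup>+u. G (A u) \<partial>distr (lborel \<Otimes>\<^sub>M lborel) borel split3)" using lborel_split3 by simp
  also have "\<dots> = (\<integral>\<^sup>+y. G (A (split3 y)) \<partial>(lborel \<Otimes>\<^sub>M lborel))"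
    using mG mA split3_measurable by (subst nn_integral_distr) (auto simp: lborel_prod)
  also have "\<dots> = (\<integral>\<^sup>+\<tau>. \<integral>\<^sup>+s. G (A (split3 (s, \<tau>))) \<partial>lborel \<partial>lborel)"
    using mG mA split3_measurable by (subst lborel_pair.nn_integral_snd) (auto simp: lborel_prod)
  also have "\<dots> = (\<integral>\<^sup>+\<tau>. \<integral>\<^sup>+s. indicator {0<..<t} \<tau> * F (plane_param P s) \<partial>lborel \<partial>lborel)"
  proof -
    have v2: "vector [s$1, s$2] = s" for s :: "real^2" by (simp add: vec_eq_iff forall_2)
    show ?thesis by (simp add: G_def cr) (simp add: Au v2)
  qed
  also have "\<dots> = (\<integral>\<^sup>+\<tau>. indicator {0<..<t} \<tau> * (\<integral>\<^sup>+s. F (plane_param P s) \<partial>lborel) \<partial>lborel)"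
    using F plane_param_measurable[OF P(1)] by (simp add: nn_integral_cmult)
  also have "\<dots> = ennreal t * (\<integral>\<^sup>+s. F (plane_param P s) \<partial>lborel)"
    using t by (simp add: nn_integral_multc)
  finally show ?thesis unfolding G_def .
qed

section \<open>Piecewise functions on polyhedral meshes\<close>

text \<open>If \<open>n\<close> and \<open>m\<close> differ, a short step in direction
  \<open>m - n\<close> leads into \<open>K\<close> according to \<open>n\<close> and out of it
  according to \<open>m\<close>.\<close>

lemma outward_normal_unique:
  assumes "norm n = 1" "0 < r" "\<forall>y\<in>ball x r. y \<in> K \<longleftrightarrow> n \<bullet> (y - x) < 0"
    "norm m = 1" "0 < s" "\<forall>y\<in>ball x s. y \<in> K \<longleftrightarrow> m \<bullet> (y - x) < 0"
  shows "n = m"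
proof (rule ccontr)
  assume ne: "n \<noteq> m"
  have nn: "n \<bullet> n = 1" "m \<bullet> m = 1" using assms by (auto simp: norm_eq_1)
  have "0 < (n - m) \<bullet> (n - m)" using ne by simp
  then have nm: "n \<bullet> m < 1" using nn by (simp add: inner_diff inner_commute)
  define t where "t = min r s / (2 * norm (m - n))"
  have pos: "0 < norm (m - n)" using ne by simp
  have t: "0 < t" using assms pos by (simp add: t_def)
  define y where "y = x + t *\<^sub>R (m - n)"
  have "dist x y = t * norm (m - n)" using t by (simp add: y_def dist_norm norm_minus_commute)
  also have "\<dots> = min r s / 2" using pos by (simp add: t_def)
  finally have "y \<in> ball x r" "y \<in> ball x s" using assms by auto
  moreover have "n \<bullet> (y - x) < 0" using t nm nn by (simp add: y_def inner_diff_right mult_pos_neg)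
  moreover have "m \<bullet> (y - x) > 0" using t nm nn by (simp add: y_def inner_diff_right inner_commute)
  ultimately show False using assms by force
qed

lemma outward_normal_eq:
  assumes "norm n = 1" "0 < r" "\<forall>y\<in>ball x r. y \<in> K \<longleftrightarrow> n \<bullet> (y - x) < 0"
  shows "outward_normal K x = n"
  unfolding outward_normal_def
proof (rule some_equality)
  show "norm n = 1 \<and> (\<exists>r>0. \<forall>y\<in>ball x r. y \<in> K \<longleftrightarrow> n \<bullet> (y - x) < 0)" using assms by blast
  show "m = n" if "norm m = 1 \<and> (\<exists>r>0. \<forall>y\<in>ball x r. y \<in> K \<longleftrightarrow> m \<bullet> (y - x) < 0)" for m
    using that outward_normal_unique[OF _ _ _ assms] by blast
qed

text \<open>Points without a normal all receive the same junk vector, and the points with a given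
  normal form a relatively open part of the frontier.\<close>
lemma outward_normal_measurable:
  "(\<lambda>z. indicator (frontier K) z *\<^sub>R outward_normal K z) \<in> borel_measurable borel"
proof -
  define valid where "valid = (\<lambda>v z. norm v = 1 \<and> (\<exists>r>0. \<forall>y\<in>ball z r. y \<in> K \<longleftrightarrow> v \<bullet> (y - z) < 0))"
  define v0 :: "real^3" where "v0 = (SOME v. False)"
  define U where "U = (\<lambda>B. {z \<in> frontier K. \<exists>v\<in>B. valid v z})"
  have on1: "outward_normal K z = v" if "valid v z" for v z
    using that outward_normal_eq unfolding valid_def by blast
  have on2: "outward_normal K z = v0" if "\<nexists>v. valid v z" for z
    using that unfolding outward_normal_def v0_def valid_def by (intro arg_cong[where f = Eps] ext) auto
  have bU: "U B \<in> sets borel" for B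
  proof -
    have "openin (top_of_set (frontier K)) (U B)"
      unfolding openin_contains_ball
    proof (intro conjI ballI)
      show "U B \<subseteq> frontier K" by (auto simp: U_def)
      fix z assume "z \<in> U B"
      then obtain v r where v: "v \<in> B" "norm v = 1" "r > 0" "\<forall>y\<in>ball z r. y \<in> K \<longleftrightarrow> v \<bullet> (y - z) < 0" and z: "z \<in> frontier K"
        by (auto simp: U_def valid_def)
      show "\<exists>e>0. ball z e \<inter> frontier K \<subseteq> U B"
      proof (intro exI[of _ r] conjI subsetI v)
        fix w assume w: "w \<in> ball z r \<inter> frontier K"
        \<comment> \<open>Off the tangent plane a neighbourhood of \<open>w\<close> lies entirely
          inside or entirely outside \<open>K\<close>, so \<open>w\<close> would not be a frontier
          point.\<close>
        have "v \<bullet> (w - z) = 0"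
        proof (rule ccontr)
          assume nz: "v \<bullet> (w - z) \<noteq> 0"
          define N where "N = ball z r \<inter> {y. if v \<bullet> (w - z) < 0 then v \<bullet> (y - z) < 0 else 0 < v \<bullet> (y - z)}"
          have "open N" unfolding N_def
            by (cases "v \<bullet> (w - z) < 0") (auto intro!: open_Int open_Collect_less continuous_intros)
          moreover have "w \<in> N" using w nz by (auto simp: N_def)
          moreover have "N \<subseteq> K \<or> N \<inter> K = {}"
          proof (cases "v \<bullet> (w - z) < 0")
            case True
            have "y \<in> K" if "y \<in> N" for y using v(4)[rule_format, of y] that True by (simp add: N_def)
            then show ?thesis by blast
          next
            case False
            have "y \<notin> K" if "y \<in> N" for y using v(4)[rule_format, of y] that False by (simp add: N_def)
            then show ?thesis by blast
          qed
          moreover have "w \<in> closure K" "w \<notin> interior K" using w by (auto simp: frontier_def)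
          ultimately show False
            using interior_maximal[of N K] open_Int_closure_eq_empty[of N K] by blast
        qed
        then have "v \<bullet> (y - z) = v \<bullet> (y - w)" for y by (simp add: inner_diff_right)
        moreover have "ball w (r - dist z w) \<subseteq> ball z r" by (simp add: ball_subset_ball_iff dist_commute)
        ultimately have "valid v w"
          unfolding valid_def using v w by (intro conjI exI[of _ "r - dist z w"]) auto
        then show "w \<in> U B" using w v by (auto simp: U_def)
      qed
    qed
    then obtain O' where "open O'" "U B = frontier K \<inter> O'" by (auto simp: openin_open)
    then show ?thesis by (simp add: borel_open borel_closed)
  qed
  show ?thesis
  proof (rule measurableI)
    fix B :: "(real^3) set" assume "B \<in> sets borel"
    have "(\<lambda>z. indicator (frontier K) z *\<^sub>R outward_normal K z) -` B =
      U B \<union> (if v0 \<in> B then frontier K - U UNIV else {}) \<union> (if 0 \<in> B then - frontier K else {})" (is "?L = ?R")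
    proof (rule set_eqI)
      fix z
      show "z \<in> ?L \<longleftrightarrow> z \<in> ?R"
      proof (cases "z \<in> frontier K")
        case True
        show ?thesis
        proof (cases "\<exists>v. valid v z")
          case ex: True
          then obtain v where v: "valid v z" by blast
          have "v' = v" if "valid v' z" for v' using on1[OF v] on1[OF that] by simp
          then have "(\<exists>u\<in>B. valid u z) \<longleftrightarrow> v \<in> B" using v by blast
          then show ?thesis using True ex by (simp add: U_def on1[OF v])
        next
          case False
          then show ?thesis using True on2[OF False] by (auto simp: U_def)
        qed
      qed (auto simp: U_def)
    qed
    then show "(\<lambda>z. indicator (frontier K) z *\<^sub>R outward_normal K z) -` B \<inter> space borel \<in> sets borel"
      using bU by (auto intro!: sets.Un sets.Diff borel_closed)
  qed simp
qed

text \<open>\<open>H\<close> selects a family of planes for each cell, so that planes can later be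
  counted through the cells to which they belong.\<close>

locale poly_mesh =
  fixes \<Omega> :: "(real^3) set" and T :: "(real^3) set set" and H :: "(real^3) set \<Rightarrow> (real^3) set set"
  assumes open_dom: "open \<Omega>" and bounded_dom: "bounded \<Omega>" and dom_ne: "\<Omega> \<noteq> {}"
    and mesh: "polyhedral_mesh \<Omega> T"
    and finite_H: "K \<in> T \<Longrightarrow> finite (H K)"
    and plane_H: "K \<in> T \<Longrightarrow> P \<in> H K \<Longrightarrow> is_plane P"
    and frontier_H: "K \<in> T \<Longrightarrow> frontier K \<subseteq> \<Union>(H K)"
begin

definition planes :: "(real^3) set set" where "planes = (\<Union>K\<in>T. H K)"

lemma finite_T: "finite T" using mesh by (simp add: polyhedral_mesh_def)

lemma cell_subset: "K \<in> T \<Longrightarrow> K \<subseteq> \<Omega>" using mesh by (simp add: polyhedral_mesh_def)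

lemma cell_nonempty: "K \<in> T \<Longrightarrow> K \<noteq> {}" using mesh by (simp add: polyhedral_mesh_def open_polyhedron_def)

lemma cell_bounded: "K \<in> T \<Longrightarrow> bounded K" using cell_subset bounded_dom bounded_subset by blast

lemma closure_dom: "closure \<Omega> = (\<Union>K\<in>T. closure K)" using mesh by (simp add: polyhedral_mesh_def)

lemma cells_disjoint: "K \<in> T \<Longrightarrow> K' \<in> T \<Longrightarrow> K \<noteq> K' \<Longrightarrow> K \<inter> K' = {}"
  using mesh by (auto simp: polyhedral_mesh_def pairwise_def disjnt_def)

lemma cell_eqI: "K \<in> T \<Longrightarrow> K' \<in> T \<Longrightarrow> x \<in> K \<Longrightarrow> x \<in> K' \<Longrightarrow> K = K'"
  using cells_disjoint by blast

lemma T_nonempty: "T \<noteq> {}" using closure_dom dom_ne by auto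

lemma cell_polytopes: "K \<in> T \<Longrightarrow> \<exists>\<P>. finite \<P> \<and> (\<forall>P\<in>\<P>. polytope P) \<and> K = interior (\<Union>\<P>)"
  using mesh by (simp add: polyhedral_mesh_def open_polyhedron_def)

lemma cell_open: "K \<in> T \<Longrightarrow> open K" using cell_polytopes by blast

text \<open>A cell is the interior of a finite union of polytopes, which is closed. This excludes
  slits: a face piece with the same cell on both sides cannot occur.\<close>

lemma cell_regular: assumes "K \<in> T" shows "interior (closure K) \<subseteq> K"
proof -
  obtain \<P> where P: "finite \<P>" "\<forall>P\<in>\<P>. polytope P" "K = interior (\<Union>\<P>)" using cell_polytopes[OF assms] by blast
  have "closed (\<Union>\<P>)" using P by (intro closed_Union) (auto simp: polytope_imp_closed)
  then have "closure K \<subseteq> \<Union>\<P>" using P(3) by (simp add: closure_minimal interior_subset)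
  then show ?thesis using P(3) interior_mono by blast
qed

lemma frontier_cell: "K \<in> T \<Longrightarrow> frontier K = closure K - K"
  by (simp add: frontier_def interior_open cell_open)

lemma finite_planes: "finite planes" using finite_T finite_H by (auto simp: planes_def)

lemma plane_planes: "P \<in> planes \<Longrightarrow> is_plane P" using plane_H by (auto simp: planes_def)

lemma frontier_planes: "K \<in> T \<Longrightarrow> frontier K \<subseteq> \<Union>planes" using frontier_H by (fastforce simp: planes_def)

lemma off_skeleton_cases:
  assumes "\<And>K. K \<in> T \<Longrightarrow> x \<notin> frontier K"
  shows "x \<in> \<Union>T \<or> x \<notin> closure \<Omega>"
  using assms closure_dom frontier_cell by auto

text \<open>Generic points avoid edges and vertices: near them the skeleton is contained in a single
  plane. Almost all points of a mesh plane are of this kind.\<close>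

definition generic :: "(real^3) set \<Rightarrow> real^3 \<Rightarrow> bool" where
  "generic P z \<longleftrightarrow> z \<in> P \<and> (\<forall>Q\<in>planes - {P}. z \<notin> Q)"

text \<open>A small open half ball on either side of \<open>P\<close> is connected and misses every
  mesh plane, so it cannot cross the frontier of a cell. The sign of \<open>s\<close> selects the
  side.\<close>

lemma generic_half_balls:
  assumes P: "P \<in> planes" "P = {x. n \<bullet> x = c}" and z: "generic P z"
  shows "\<exists>r>0. \<forall>s. s \<noteq> (0::real) \<longrightarrow>
      (let D = {y \<in> ball z r. 0 < s * (n \<bullet> y - c)} in
         (\<forall>K\<in>T. D \<subseteq> K \<or> D \<inter> K = {}) \<and> ((\<exists>K\<in>T. D \<subseteq> K) \<or> D \<inter> closure \<Omega> = {}))"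
proof -
  have "closed (\<Union>(planes - {P}))" using finite_planes plane_planes closed_plane by (intro closed_Union) auto
  then have "open (- \<Union>(planes - {P}))" by (simp add: open_Compl)
  moreover have "z \<in> - \<Union>(planes - {P})" using z by (auto simp: generic_def)
  ultimately obtain r where r: "r > 0" "ball z r \<subseteq> - \<Union>(planes - {P})" using open_contains_ball by blast
  have "(let D = {y \<in> ball z r. 0 < s * (n \<bullet> y - c)} in
         (\<forall>K\<in>T. D \<subseteq> K \<or> D \<inter> K = {}) \<and> ((\<exists>K\<in>T. D \<subseteq> K) \<or> D \<inter> closure \<Omega> = {}))" if "s \<noteq> 0" for s
  proof -
    define D where "D = {y \<in> ball z r. 0 < s * (n \<bullet> y - c)}"
    have Deq: "D = ball z r \<inter> {y. (s *\<^sub>R n) \<bullet> y > s * c}" by (auto simp: D_def algebra_simps)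
    have conn: "connected D" unfolding Deq by (intro convex_connected convex_Int convex_ball convex_halfspace_gt)
    have off: "D \<inter> frontier K = {}" if "K \<in> T" for K
    proof -
      have "y \<notin> Q" if "y \<in> D" "Q \<in> planes" for y Q
        using that r P by (cases "Q = P") (auto simp: D_def)
      then show ?thesis using frontier_planes[OF that] by fastforce
    qed
    have 1: "D \<subseteq> K \<or> D \<inter> K = {}" if "K \<in> T" for K
      using connected_Int_frontier[OF conn, of K] off[OF that] by blast
    have 2: "D \<inter> closure \<Omega> = {}" if "\<forall>K\<in>T. D \<inter> K = {}"
      using off_skeleton_cases off that by fastforce
    show ?thesis unfolding Let_def D_def[symmetric] using 1 2 by blast
  qed
  then show ?thesis using r(1) by blast
qed

lemma normal_at_generic:
  assumes P: "P \<in> planes" "P = {x. n \<bullet> x = c}" "norm n = 1" and z: "generic P z" and K: "K \<in> T" "z \<in> frontier K"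
  shows "\<exists>s\<in>{1,-1}. \<exists>r>0. (\<forall>y\<in>ball z r. y \<in> K \<longleftrightarrow> 0 < s * (n \<bullet> y - c)) \<and> outward_normal K z = (- s) *\<^sub>R n"
proof -
  obtain r where r: "r > 0" and h: "\<And>s. s \<noteq> (0::real) \<Longrightarrow> {y \<in> ball z r. 0 < s * (n \<bullet> y - c)} \<subseteq> K \<or> {y \<in> ball z r. 0 < s * (n \<bullet> y - c)} \<inter> K = {}"
    using generic_half_balls[OF P(1,2) z] K(1) unfolding Let_def by blast
  define D where "D = (\<lambda>s::real. {y \<in> ball z r. 0 < s * (n \<bullet> y - c)})"
  have h: "D s \<subseteq> K \<or> D s \<inter> K = {}" if "s \<noteq> 0" for s using h[OF that] by (simp add: D_def)
  have zP: "n \<bullet> z = c" using z P(2) by (auto simp: generic_def)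
  have nn: "n \<bullet> n = 1" using P(3) by (simp add: norm_eq_1)
  \<comment> \<open>Every open set around a point of the plane has points strictly on the side
    selected by \<open>s\<close>; so neither \<open>K\<close> nor the complement of its closure can
    hide inside the plane.\<close>
  have near: "\<exists>w\<in>N. 0 < s * (n \<bullet> w - c)" if "open N" "y \<in> N" "n \<bullet> y = c" "s \<noteq> 0" for N y s
  proof -
    obtain e where e: "e > 0" "ball y e \<subseteq> N" using \<open>open N\<close> \<open>y \<in> N\<close> open_contains_ball by blast
    define w where "w = y + (e / 2 * sgn s) *\<^sub>R n"
    have "w \<in> ball y e" using e that(4) P(3) by (simp add: w_def dist_norm abs_mult abs_sgn_eq)
    moreover have "s * (n \<bullet> w - c) = e / 2 * \<bar>s\<bar>" using nn that(3) by (simp add: w_def inner_add_right abs_sgn)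
    moreover have "0 < e / 2 * \<bar>s\<bar>" using e that(4) by simp
    ultimately show ?thesis using e(2) by (intro bexI[of _ w]) (simp_all only: subsetD)
  qed
  have zK: "z \<in> closure K" "z \<notin> K" using K frontier_cell by auto
  have "K \<inter> ball z r \<noteq> {}" using zK(1) r open_Int_closure_eq_empty[OF open_ball, of z r K] by (auto simp: Int_commute)
  then obtain y where y: "y \<in> K" "y \<in> ball z r" by blast
  have "\<exists>s\<in>{1,-1}. D s \<inter> K \<noteq> {}"
  proof (cases "n \<bullet> y = c")
    case True
    obtain w where "w \<in> K \<inter> ball z r" "0 < 1 * (n \<bullet> w - c)"
      using near[of "K \<inter> ball z r" y 1] True y open_Int[OF cell_open[OF K(1)] open_ball[of z r]] by auto
    then show ?thesis by (intro bexI[of _ 1]) (auto simp: D_def)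
  next
    case False
    then have "0 < 1 * (n \<bullet> y - c) \<or> 0 < (-1) * (n \<bullet> y - c)" by auto
    then show ?thesis using y by (auto simp: D_def)
  qed
  then obtain s where s1: "s \<in> {1,-1}" "D s \<inter> K \<noteq> {}" by blast
  then have s: "s \<in> {1,-1}" "D s \<subseteq> K" using h[of s] by auto
  \<comment> \<open>If both half balls lay in \<open>K\<close>, then \<open>z\<close> would be
    interior to the closure of \<open>K\<close>, which \<open>cell_regular\<close> forbids.\<close>
  have s': "D (- s) \<inter> K = {}"
  proof (rule ccontr)
    assume "D (- s) \<inter> K \<noteq> {}"
    then have "D (- s) \<subseteq> K" using h[of "- s"] s by auto
    have "ball z r \<subseteq> closure K"
    proof
      fix y assume y: "y \<in> ball z r"
      show "y \<in> closure K"
      proof (cases "n \<bullet> y = c")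
        case True
        show ?thesis
        proof (rule ccontr)
          assume "y \<notin> closure K"
          then obtain w where "w \<in> - closure K \<inter> ball z r" "0 < s * (n \<bullet> w - c)"
            using near[of "- closure K \<inter> ball z r" y s] True y s(1)
              open_Int[OF open_Compl[OF closed_closure[of K]] open_ball[of z r]] by auto
          then have "w \<in> K" "w \<notin> closure K" using s(2) by (auto simp: D_def)
          then show False using closure_subset by blast
        qed
      next
        case False
        then have "0 < s * (n \<bullet> y - c) \<or> 0 < (- s) * (n \<bullet> y - c)" using s(1) by auto
        then have "y \<in> K" using y s(2) \<open>D (- s) \<subseteq> K\<close> by (auto simp: D_def)
        then show ?thesis using closure_subset by blast
      qed
    qed
    then have "z \<in> interior (closure K)" using r by (metis centre_in_ball interior_maximal open_ball subsetD)
    then show False using cell_regular[OF K(1)] zK by blast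
  qed
  have iff: "y \<in> K \<longleftrightarrow> 0 < s * (n \<bullet> y - c)" if y: "y \<in> ball z r" for y
  proof
    assume yK: "y \<in> K"
    show "0 < s * (n \<bullet> y - c)"
    proof (rule ccontr)
      assume neg: "\<not> 0 < s * (n \<bullet> y - c)"
      show False
      proof (cases "n \<bullet> y = c")
        case True
        obtain w where "w \<in> K \<inter> ball z r" "0 < (- s) * (n \<bullet> w - c)"
          using near[of "K \<inter> ball z r" y "- s"] True y yK open_Int[OF cell_open[OF K(1)] open_ball[of z r]] s(1) by auto
        then show False using s' by (auto simp: D_def)
      next
        case False
        then have "0 < (- s) * (n \<bullet> y - c)" using neg s(1) by auto
        then show False using s' y yK by (auto simp: D_def)
      qed
    qed
  qed (use s(2) y in \<open>auto simp: D_def\<close>)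
  have "outward_normal K z = (- s) *\<^sub>R n"
  proof (rule outward_normal_eq[OF _ r])
    show "norm ((- s) *\<^sub>R n) = 1" using s(1) P(3) by auto
    show "\<forall>y\<in>ball z r. y \<in> K \<longleftrightarrow> ((- s) *\<^sub>R n) \<bullet> (y - z) < 0"
      using iff zP by (simp add: inner_diff_right right_diff_distrib)
  qed
  then show ?thesis using s(1) r iff by blast
qed

text \<open>Two disjoint cells cannot occupy the same side of the plane. Hence the norm of the
  vector jump is the absolute difference of the two traces.\<close>

lemma normals_opposite:
  assumes "P \<in> planes" "generic P z" "K \<in> T" "K' \<in> T" "K \<noteq> K'" "z \<in> frontier K" "z \<in> frontier K'"
  shows "outward_normal K' z = - outward_normal K z" "norm (outward_normal K z) = 1"
proof -
  obtain n c where n: "norm n = 1" "P = {x. n \<bullet> x = c}" using plane_planes[OF assms(1)] by (auto simp: is_plane_def)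
  obtain s r where s: "s \<in> {1,-1}" "r > 0" "\<forall>y\<in>ball z r. y \<in> K \<longleftrightarrow> 0 < s * (n \<bullet> y - c)" "outward_normal K z = (- s) *\<^sub>R n"
    using normal_at_generic[OF assms(1) n(2,1) assms(2,3,6)] by blast
  obtain s' r' where s': "s' \<in> {1,-1}" "r' > 0" "\<forall>y\<in>ball z r'. y \<in> K' \<longleftrightarrow> 0 < s' * (n \<bullet> y - c)" "outward_normal K' z = (- s') *\<^sub>R n"
    using normal_at_generic[OF assms(1) n(2,1) assms(2,4,7)] by blast
  have nn: "n \<bullet> n = 1" using n by (simp add: norm_eq_1)
  have zP: "n \<bullet> z = c" using assms(2) n by (auto simp: generic_def)
  have "s' \<noteq> s"
  proof
    assume eq: "s' = s"
    define y where "y = z + (min r r' / 2 * s) *\<^sub>R n"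
    have "dist z y = min r r' / 2" using n s s' by (auto simp: y_def dist_norm abs_mult)
    then have "y \<in> ball z r" "y \<in> ball z r'" using s s' by auto
    moreover have "0 < s * (n \<bullet> y - c)" using nn zP s s' by (auto simp: y_def inner_add_right)
    ultimately have "y \<in> K \<inter> K'" using s s' eq by auto
    then show False using cells_disjoint assms by blast
  qed
  then have "s' = - s" using s s' by auto
  then show "outward_normal K' z = - outward_normal K z" "norm (outward_normal K z) = 1" using s s' n by auto
qed

text \<open>Pieces are functions on the whole space: traces become plain values of pieces, and
  \<open>pw p\<close> is the extension by zero of a mesh function.\<close>

definition pw :: "((real^3) set \<Rightarrow> real^3 \<Rightarrow> real) \<Rightarrow> real^3 \<Rightarrow> real" where
  "pw p x = (\<Sum>K\<in>T. indicator K x * p K x)"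

lemma pw_cell: "K \<in> T \<Longrightarrow> x \<in> K \<Longrightarrow> pw p x = p K x"
proof -
  assume K: "K \<in> T" "x \<in> K"
  have "pw p x = (\<Sum>K'\<in>T. if K' = K then p K x else 0)"
    unfolding pw_def using K cell_eqI by (intro sum.cong) (auto simp: indicator_def)
  then show ?thesis using K finite_T by simp
qed

lemma pw_outside: "x \<notin> \<Union>T \<Longrightarrow> pw p x = 0"
  unfolding pw_def by (intro sum.neutral) auto

lemma pw_off_dom: "x \<notin> \<Omega> \<Longrightarrow> pw p x = 0"
  using pw_outside cell_subset by blast

lemma pw_comb: "pw (\<lambda>K x. p K x + a * q K x) x = pw p x + a * pw q x"
  by (simp add: pw_def algebra_simps sum.distrib sum_distrib_left)

lemma bcs_pw: "(\<And>K. K \<in> T \<Longrightarrow> continuous_on UNIV (p K)) \<Longrightarrow> bcs (pw p)"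
  unfolding pw_def using cell_bounded cell_open by (intro bcs_sum bcs_indicator_continuous) auto

lemma cell_trace_pw:
  assumes "K \<in> T" "continuous_on UNIV (p K)" "z \<in> closure K"
  shows "cell_trace K (pw p) z = p K z"
  unfolding cell_trace_def
proof (rule tendsto_Lim)
  show "at z within K \<noteq> bot"
    using assms cell_open[OF assms(1)] interior_limit_point[of z K]
    by (metis closure_def Un_iff interior_open mem_Collect_eq trivial_limit_within)
  have "(p K \<longlongrightarrow> p K z) (at z within K)"
    using assms(2) continuous_on_subset[of UNIV "p K" "insert z K"] continuous_within_subset
    by (metis continuous_on_eq_continuous_within continuous_within iso_tuple_UNIV_I subset_UNIV)
  moreover have "eventually (\<lambda>x. p K x = pw p x) (at z within K)"
    using pw_cell[OF assms(1)] by (auto simp: eventually_at_filter)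
  ultimately show "(pw p \<longlongrightarrow> p K z) (at z within K)" by (rule Lim_transform_eventually)
qed

text \<open>The squared interior jumps and boundary traces as one function of a point, independent
  of any enumeration of faces; 1/2 compensates for ordered pairs of cells.\<close>

definition face_energy :: "((real^3) set \<Rightarrow> real^3 \<Rightarrow> real) \<Rightarrow> real^3 \<Rightarrow> real" where
  "face_energy p z = 1/2 * (\<Sum>K\<in>T. \<Sum>K'\<in>T - {K}. indicator (frontier K \<inter> frontier K') z * (p K z - p K' z)\<^sup>2)
     + (\<Sum>K\<in>T. indicator (frontier K \<inter> frontier \<Omega>) z * (p K z)\<^sup>2)"

lemma face_energy_nonneg: "0 \<le> face_energy p z"
  by (auto simp: face_energy_def intro!: add_nonneg_nonneg sum_nonneg)

definition jump_energy :: "((real^3) set \<Rightarrow> real^3 \<Rightarrow> real) \<Rightarrow> real" where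
  "jump_energy p = (\<Sum>P\<in>planes. LINT s|lborel. face_energy p (plane_param P s))"

lemma jump_energy_nonneg: "0 \<le> jump_energy p"
  by (auto simp: jump_energy_def face_energy_nonneg intro!: sum_nonneg)

lemma bcs_plane_param:
  assumes "bcs f" "is_plane P" shows "bcs (\<lambda>s. f (plane_param P s))"
proof -
  obtain B where B: "\<And>x. \<bar>f x\<bar> \<le> B" using assms by (auto simp: bcs_def)
  obtain R where R: "{x. f x \<noteq> 0} \<subseteq> cball 0 R" using assms bounded_subset_cball_0[of "{x. f x \<noteq> 0}"] by (auto simp: bcs_def)
  show ?thesis
  proof (rule bcsI)
    show "(\<lambda>s. f (plane_param P s)) \<in> borel_measurable borel"
      by (rule measurable_compose[OF plane_param_measurable[OF assms(2)] bcs_measurable[OF assms(1)]])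
    show "bounded (cball (0::real^2) (R + norm (plane_param P 0)))" by simp
    fix s assume s: "s \<notin> cball (0::real^2) (R + norm (plane_param P 0))"
    have "norm s = norm (plane_param P s - plane_param P 0)"
      using plane_param_dist[OF assms(2), of s 0] by (simp add: dist_norm)
    also have "\<dots> \<le> norm (plane_param P s) + norm (plane_param P 0)" by (rule norm_triangle_ineq4)
    finally have "R < norm (plane_param P s)" using s by simp
    then show "f (plane_param P s) = 0" using R by fastforce
  qed (use B in auto)
qed

lemma frontier_bounded: "K \<in> T \<Longrightarrow> bounded (frontier K \<inter> X)"
  by (rule bounded_subset[OF bounded_closure[OF cell_bounded]]) (auto simp: frontier_def)

lemma bcs_face_piece:
  assumes "K \<in> T" "closed X" "continuous_on UNIV f"
  shows "bcs (\<lambda>z. indicator (frontier K \<inter> X) z * f z)"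
  using assms frontier_bounded by (intro bcs_indicator_continuous) (auto intro: borel_closed)

lemma bcs_cmult: "bcs f \<Longrightarrow> bcs (\<lambda>x. a * f x)"
  using bcs_comb[OF bcs_zero, of f a] by simp

lemma bcs_face_energy:
  assumes "\<And>K. K \<in> T \<Longrightarrow> continuous_on UNIV (p K)"
  shows "bcs (face_energy p)"
  unfolding face_energy_def using assms
  by (intro bcs_add bcs_cmult bcs_sum bcs_face_piece continuous_intros) auto

lemma generic_AE:
  assumes "P \<in> planes"
  shows "AE s in lborel. generic P (plane_param P s)"
proof -
  have "AE s in lborel. \<forall>Q\<in>planes - {P}. plane_param P s \<notin> Q"
  proof (subst AE_finite_all)
    show "\<forall>Q\<in>planes - {P}. AE s in lborel. plane_param P s \<notin> Q"
    proof
      fix Q assume "Q \<in> planes - {P}"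
      then have "{s. plane_param P s \<in> Q} \<in> null_sets lborel"
        using plane_param_negligible[of P Q] plane_planes assms by auto
      from AE_not_in[OF this] show "AE s in lborel. plane_param P s \<notin> Q" by simp
    qed
  qed (use finite_planes in auto)
  then show ?thesis using plane_param_in[OF plane_planes[OF assms]] by (auto simp: generic_def)
qed

text \<open>Planes of positive area must be mesh planes, since any other plane meets the mesh planes
  in null sets; mesh planes of area zero contribute 0. Therefore only generic points matter for the
  integrand.\<close>

lemma surface_integral_planes:
  assumes K: "K \<in> T" and X: "closed X"
    and mf: "(\<lambda>z. indicator (frontier K \<inter> X) z * f z) \<in> borel_measurable borel"
    and g: "continuous_on UNIV g"
    and eq: "\<And>P z. P \<in> planes \<Longrightarrow> generic P z \<Longrightarrow> z \<in> frontier K \<Longrightarrow> z \<in> X \<Longrightarrow> f z = g z"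
  shows "surface_integral (frontier K \<inter> X) f =
    (\<Sum>P\<in>planes. LINT s|lborel. indicator (frontier K \<inter> X) (plane_param P s) * g (plane_param P s))"
proof -
  define G where "G = frontier K \<inter> X"
  have Gc: "G \<in> sets borel" using X by (auto simp: G_def intro!: borel_closed)
  have em: "emeasure (plane_measure P) (G \<inter> P) = emeasure lborel {s. plane_param P s \<in> G}" if P: "is_plane P" for P
  proof -
    have "emeasure (plane_measure P) (G \<inter> P) = emeasure lborel (plane_param P -` (G \<inter> P) \<inter> space lborel)"
      unfolding plane_measure_eq using plane_param_measurable[OF P] Gc closed_plane[OF P]
      by (intro emeasure_distr) (auto intro: borel_closed)
    also have "plane_param P -` (G \<inter> P) \<inter> space lborel = {s. plane_param P s \<in> G}" using plane_param_in[OF P] by auto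
    finally show ?thesis .
  qed
  have sG: "{s. plane_param P s \<in> G} \<in> sets borel" if P: "is_plane P" for P
    using measurable_sets_borel[OF plane_param_measurable[OF P] Gc] by (simp add: vimage_def)
  have sub: "P \<in> planes" if P: "is_plane P" "0 < emeasure (plane_measure P) (G \<inter> P)" for P
  proof (rule ccontr)
    assume "P \<notin> planes"
    then have "{s. plane_param P s \<in> Q} \<in> null_sets lborel" if "Q \<in> H K" for Q
      using plane_param_negligible[OF P(1) plane_H[OF K that]] that K by (auto simp: planes_def)
    then have "(\<Union>Q\<in>H K. {s. plane_param P s \<in> Q}) \<in> null_sets lborel"
      using finite_H[OF K] by (intro null_sets_UN') (auto intro: countable_finite)
    moreover have "{s. plane_param P s \<in> G} \<subseteq> (\<Union>Q\<in>H K. {s. plane_param P s \<in> Q})"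
      using frontier_H[OF K] by (auto simp: G_def)
    ultimately have "{s. plane_param P s \<in> G} \<in> null_sets lborel" using sG[OF P(1)] by (auto intro: null_sets_subset)
    then show False using P em by auto
  qed
  have int: "(LINT x:G \<inter> P|plane_measure P. f x) = (LINT s|lborel. indicator G (plane_param P s) * g (plane_param P s))"
    if P: "P \<in> planes" for P
  proof -
    note Pp = plane_planes[OF P]
    have "(LINT x:G \<inter> P|plane_measure P. f x) = (LINT x|plane_measure P. indicator P x * (indicator G x * f x))"
      unfolding set_lebesgue_integral_def by (intro Bochner_Integration.integral_cong) (auto simp: indicator_def)
    also have "\<dots> = (LINT s|lborel. indicator P (plane_param P s) * (indicator G (plane_param P s) * f (plane_param P s)))"
      unfolding plane_measure_eq using mf closed_plane[OF Pp] plane_param_measurable[OF Pp]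
      by (intro integral_distr) (auto simp: G_def intro!: borel_measurable_times borel_measurable_indicator borel_closed)
    also have "\<dots> = (LINT s|lborel. indicator G (plane_param P s) * f (plane_param P s))"
      using plane_param_in[OF Pp] by simp
    also have "\<dots> = (LINT s|lborel. indicator G (plane_param P s) * g (plane_param P s))"
    proof (rule integral_cong_AE)
      show "(\<lambda>s. indicator G (plane_param P s) * f (plane_param P s)) \<in> borel_measurable lborel"
        using measurable_compose[OF plane_param_measurable[OF Pp] mf] by (simp add: G_def)
      have "(\<lambda>z. indicator G z * g z) \<in> borel_measurable borel"
        using Gc g by (intro borel_measurable_times borel_measurable_indicator borel_measurable_continuous_onI)
      then show "(\<lambda>s. indicator G (plane_param P s) * g (plane_param P s)) \<in> borel_measurable lborel"
        using measurable_compose[OF plane_param_measurable[OF Pp]] by simp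
      show "AE s in lborel. indicator G (plane_param P s) * f (plane_param P s) = indicator G (plane_param P s) * g (plane_param P s)"
        using generic_AE[OF P] by eventually_elim (use eq[OF P] in \<open>auto simp: G_def indicator_def\<close>)
    qed
    finally show ?thesis .
  qed
  define I where "I = {P. is_plane P \<and> 0 < emeasure (plane_measure P) (G \<inter> P)}"
  have "surface_integral G f = (\<Sum>P\<in>I. LINT x:G \<inter> P|plane_measure P. f x)" by (simp add: surface_integral_def I_def)
  also have "\<dots> = (\<Sum>P\<in>I. LINT s|lborel. indicator G (plane_param P s) * g (plane_param P s))"
    using int sub by (intro sum.cong) (auto simp: I_def)
  also have "\<dots> = (\<Sum>P\<in>planes. LINT s|lborel. indicator G (plane_param P s) * g (plane_param P s))"
  proof (rule sum.mono_neutral_left[OF finite_planes])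
    show "I \<subseteq> planes" using sub by (auto simp: I_def)
    show "\<forall>P\<in>planes - I. (LINT s|lborel. indicator G (plane_param P s) * g (plane_param P s)) = 0"
    proof
      fix P assume P: "P \<in> planes - I"
      then have "emeasure lborel {s. plane_param P s \<in> G} = 0" using plane_planes em by (auto simp: I_def)
      then have "{s. plane_param P s \<in> G} \<in> null_sets lborel" using sG plane_planes P by auto
      from AE_not_in[OF this] have "AE s in lborel. indicator G (plane_param P s) * g (plane_param P s) = 0"
        by eventually_elim auto
      then show "(LINT s|lborel. indicator G (plane_param P s) * g (plane_param P s)) = 0" by (rule integral_eq_zero_AE)
    qed
  qed
  finally show ?thesis by (simp add: G_def)
qed

lemma jump_surface_integral:
  assumes p: "\<And>K. K \<in> T \<Longrightarrow> continuous_on UNIV (p K)" and K: "K \<in> T" "K' \<in> T" "K \<noteq> K'"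
  shows "surface_integral (frontier K \<inter> frontier K') (\<lambda>x. (norm (jump K K' (pw p) x))\<^sup>2) =
    (\<Sum>P\<in>planes. LINT s|lborel. indicator (frontier K \<inter> frontier K') (plane_param P s) * (p K (plane_param P s) - p K' (plane_param P s))\<^sup>2)"
proof (rule surface_integral_planes[OF K(1)])
  have tr: "cell_trace K (pw p) z = p K z" if "K \<in> T" "z \<in> frontier K" for K z
    using cell_trace_pw[OF that(1), of p z] p[OF that(1)] that frontier_cell by auto
  \<comment> \<open>The integrand contains normals with unspecified values at some points, so its
    measurability rests on \<open>outward_normal_measurable\<close>.\<close>
  have "(\<lambda>z. indicator (frontier K \<inter> frontier K') z * (norm (jump K K' (pw p) z))\<^sup>2) =
    (\<lambda>z. indicator (frontier K \<inter> frontier K') z * (norm (p K z *\<^sub>R (indicator (frontier K) z *\<^sub>R outward_normal K z)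
       + p K' z *\<^sub>R (indicator (frontier K') z *\<^sub>R outward_normal K' z)))\<^sup>2)"
    using tr K by (auto simp: fun_eq_iff jump_def indicator_def)
  also have "\<dots> \<in> borel_measurable borel"
  proof -
    have "(\<lambda>z. p K z *\<^sub>R (indicator (frontier K) z *\<^sub>R outward_normal K z)
       + p K' z *\<^sub>R (indicator (frontier K') z *\<^sub>R outward_normal K' z)) \<in> borel_measurable borel"
      by (intro borel_measurable_add borel_measurable_scaleR outward_normal_measurable borel_measurable_continuous_onI p K)
    then have "(\<lambda>z. norm (p K z *\<^sub>R (indicator (frontier K) z *\<^sub>R outward_normal K z)
       + p K' z *\<^sub>R (indicator (frontier K') z *\<^sub>R outward_normal K' z))) \<in> borel_measurable borel"
      by (rule measurable_compose) (intro borel_measurable_continuous_onI continuous_intros)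
    then show ?thesis
      by (intro borel_measurable_times borel_measurable_indicator borel_measurable_power) (auto intro!: borel_closed)
  qed
  finally show "(\<lambda>z. indicator (frontier K \<inter> frontier K') z * (norm (jump K K' (pw p) z))\<^sup>2) \<in> borel_measurable borel" .
  show "continuous_on UNIV (\<lambda>z. (p K z - p K' z)\<^sup>2)" using p K by (intro continuous_intros)
  fix P z assume "P \<in> planes" "generic P z" "z \<in> frontier K" "z \<in> frontier K'"
  then show "(norm (jump K K' (pw p) z))\<^sup>2 = (p K z - p K' z)\<^sup>2"
    using normals_opposite[of P z K K'] tr K
    by (simp add: jump_def) (simp flip: scaleR_left_diff_distrib)
qed auto

lemma trace_surface_integral:
  assumes p: "\<And>K. K \<in> T \<Longrightarrow> continuous_on UNIV (p K)" and K: "K \<in> T"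
  shows "surface_integral (frontier K \<inter> frontier \<Omega>) (\<lambda>x. (cell_trace K (pw p) x)\<^sup>2) =
    (\<Sum>P\<in>planes. LINT s|lborel. indicator (frontier K \<inter> frontier \<Omega>) (plane_param P s) * (p K (plane_param P s))\<^sup>2)"
proof (rule surface_integral_planes[OF K])
  have tr: "cell_trace K (pw p) z = p K z" if "z \<in> frontier K" for z
    using cell_trace_pw[OF K, of p z] p[OF K] that frontier_cell K by auto
  then have "(\<lambda>z. indicator (frontier K \<inter> frontier \<Omega>) z * (cell_trace K (pw p) z)\<^sup>2) =
    (\<lambda>z. indicator (frontier K \<inter> frontier \<Omega>) z * (p K z)\<^sup>2)"
    by (auto simp: fun_eq_iff indicator_def)
  also have "\<dots> \<in> borel_measurable borel"
    using borel_measurable_continuous_onI[OF p[OF K]]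
    by (intro borel_measurable_times borel_measurable_indicator borel_measurable_power) (auto intro!: borel_closed)
  finally show "(\<lambda>z. indicator (frontier K \<inter> frontier \<Omega>) z * (cell_trace K (pw p) z)\<^sup>2) \<in> borel_measurable borel" .
  show "continuous_on UNIV (\<lambda>z. (p K z)\<^sup>2)" using p K by (intro continuous_intros)
  show "(cell_trace K (pw p) z)\<^sup>2 = (p K z)\<^sup>2" if "z \<in> frontier K" for z using tr that by simp
qed auto

section \<open>The norm expressed through the pieces\<close>

definition C1_pieces :: "((real^3) set \<Rightarrow> real^3 \<Rightarrow> real) \<Rightarrow> bool" where
  "C1_pieces p \<longleftrightarrow> (\<forall>K\<in>T. (\<forall>x. p K differentiable (at x)) \<and> (\<forall>i. continuous_on UNIV (partial_deriv i (p K))))"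

lemma C1_pieces_continuous: "C1_pieces p \<Longrightarrow> K \<in> T \<Longrightarrow> continuous_on UNIV (p K)"
  unfolding C1_pieces_def
  by (intro continuous_at_imp_continuous_on ballI differentiable_imp_continuous_within) auto

definition dpw :: "3 \<Rightarrow> ((real^3) set \<Rightarrow> real^3 \<Rightarrow> real) \<Rightarrow> real^3 \<Rightarrow> real" where
  "dpw i p = pw (\<lambda>K. partial_deriv i (p K))"

lemma bcs_dpw: "C1_pieces p \<Longrightarrow> bcs (dpw i p)"
  unfolding dpw_def by (rule bcs_pw) (simp add: C1_pieces_def)

lemma partial_deriv_pw: "K \<in> T \<Longrightarrow> x \<in> K \<Longrightarrow> partial_deriv i (pw p) x = dpw i p x"
  using partial_deriv_cong_open[OF cell_open, of K x "pw p" "p K" i] by (simp add: dpw_def pw_cell)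

lemma norm_vec3_sq: "(norm (v::real^3))\<^sup>2 = (\<Sum>i\<in>UNIV. (v$i)\<^sup>2)"
  unfolding power2_norm_eq_inner by (simp add: inner_vec_def power2_eq_square)

lemma gradient_energy:
  assumes "C1_pieces p"
  shows "(\<Sum>K\<in>T. LINT x|lebesgue_on K. (norm (gradient (pw p) x))\<^sup>2) = (\<Sum>i\<in>UNIV. sqn (dpw i p))"
proof -
  define D where "D = (\<lambda>x. \<Sum>i\<in>UNIV. (dpw i p x)\<^sup>2)"
  have bD: "bcs D" unfolding D_def by (intro bcs_sum bcs_power2 bcs_dpw assms)
  have "(LINT x|lebesgue_on K. (norm (gradient (pw p) x))\<^sup>2) = (LINT x|lborel. indicator K x * D x)" if K: "K \<in> T" for K
  proof -
    have "(LINT x|lebesgue_on K. (norm (gradient (pw p) x))\<^sup>2) = (LINT x|lebesgue_on K. D x)"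
      using partial_deriv_pw[OF K] by (intro Bochner_Integration.integral_cong) (auto simp: D_def norm_vec3_sq gradient_def)
    also have "\<dots> = (LINT x|lborel. indicator K x * D x)"
      using cell_open[OF K] bcs_measurable[OF bD] by (intro integral_lebesgue_on_borel) auto
    finally show ?thesis .
  qed
  then have "(\<Sum>K\<in>T. LINT x|lebesgue_on K. (norm (gradient (pw p) x))\<^sup>2) = (\<Sum>K\<in>T. (LINT x|lborel. indicator K x * D x))" by simp
  also have "\<dots> = (LINT x|lborel. (\<Sum>K\<in>T. indicator K x * D x))"
    using cell_open
    by (intro Bochner_Integration.integral_sum[symmetric] integrable_bcs bcs_mult(2)[OF bD, where C = 1] borel_measurable_indicator)
      (auto simp: indicator_def)
  also have "\<dots> = (LINT x|lborel. D x)"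
  proof (intro Bochner_Integration.integral_cong refl)
    fix x
    show "(\<Sum>K\<in>T. indicator K x * D x) = D x"
    proof (cases "x \<in> \<Union>T")
      case True
      then obtain K where K: "K \<in> T" "x \<in> K" by blast
      have "(\<Sum>K\<in>T. indicator K x * D x) = pw (\<lambda>_. D) x" by (simp add: pw_def)
      then show ?thesis using pw_cell[OF K] by simp
    next
      case False
      then show ?thesis by (auto simp: D_def dpw_def pw_outside intro!: sum.neutral)
    qed
  qed
  also have "\<dots> = (\<Sum>i\<in>UNIV. sqn (dpw i p))"
    unfolding sqn_def D_def by (intro Bochner_Integration.integral_sum integrable_bcs bcs_power2 bcs_dpw assms)
  finally show ?thesis .
qed

lemma jump_energy_eq:
  assumes p: "\<And>K. K \<in> T \<Longrightarrow> continuous_on UNIV (p K)"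
  shows "jump_energy p = 1/2 * (\<Sum>K\<in>T. \<Sum>K'\<in>T - {K}.
         surface_integral (frontier K \<inter> frontier K') (\<lambda>x. (norm (jump K K' (pw p) x))\<^sup>2))
     + (\<Sum>K\<in>T. surface_integral (frontier K \<inter> frontier \<Omega>) (\<lambda>x. (cell_trace K (pw p) x)\<^sup>2))"
proof -
  let ?a = "\<lambda>K K' P s. indicator (frontier K \<inter> frontier K') (plane_param P s) * (p K (plane_param P s) - p K' (plane_param P s))\<^sup>2"
  let ?b = "\<lambda>K P s. indicator (frontier K \<inter> frontier \<Omega>) (plane_param P s) * (p K (plane_param P s))\<^sup>2"
  have ia: "integrable lborel (?a K K' P)" if "K \<in> T" "K' \<in> T" "P \<in> planes" for K K' P
    using that p by (intro integrable_bcs bcs_plane_param[OF _ plane_planes] bcs_face_piece continuous_intros) auto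
  have ib: "integrable lborel (?b K P)" if "K \<in> T" "P \<in> planes" for K P
    using that p by (intro integrable_bcs bcs_plane_param[OF _ plane_planes] bcs_face_piece continuous_intros) auto
  have "jump_energy p = (\<Sum>P\<in>planes. 1/2 * (\<Sum>K\<in>T. \<Sum>K'\<in>T - {K}. LINT s|lborel. ?a K K' P s) + (\<Sum>K\<in>T. LINT s|lborel. ?b K P s))"
    unfolding jump_energy_def face_energy_def
  proof (intro sum.cong refl)
    fix P assume P: "P \<in> planes"
    have ia2: "integrable lborel (\<lambda>s. \<Sum>K'\<in>T - {K}. ?a K K' P s)" if "K \<in> T" for K
      using that P ia by (intro Bochner_Integration.integrable_sum) auto
    have "(LINT s|lborel. (\<Sum>K\<in>T. \<Sum>K'\<in>T - {K}. ?a K K' P s)) = (\<Sum>K\<in>T. LINT s|lborel. (\<Sum>K'\<in>T - {K}. ?a K K' P s))"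
      by (rule Bochner_Integration.integral_sum) (rule ia2)
    also have "\<dots> = (\<Sum>K\<in>T. \<Sum>K'\<in>T - {K}. LINT s|lborel. ?a K K' P s)"
      using P ia by (intro sum.cong refl Bochner_Integration.integral_sum) auto
    finally have A: "(LINT s|lborel. (\<Sum>K\<in>T. \<Sum>K'\<in>T - {K}. ?a K K' P s)) = (\<Sum>K\<in>T. \<Sum>K'\<in>T - {K}. LINT s|lborel. ?a K K' P s)" .
    have B: "(LINT s|lborel. (\<Sum>K\<in>T. ?b K P s)) = (\<Sum>K\<in>T. LINT s|lborel. ?b K P s)"
      using P ib by (intro Bochner_Integration.integral_sum) auto
    have "(LINT s|lborel. 1/2 * (\<Sum>K\<in>T. \<Sum>K'\<in>T - {K}. ?a K K' P s) + (\<Sum>K\<in>T. ?b K P s))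
      = 1/2 * (LINT s|lborel. (\<Sum>K\<in>T. \<Sum>K'\<in>T - {K}. ?a K K' P s)) + (LINT s|lborel. (\<Sum>K\<in>T. ?b K P s))"
      using P ia2 ib by (subst Bochner_Integration.integral_add) (auto intro!: Bochner_Integration.integrable_sum)
    then show "(LINT s|lborel. 1/2 * (\<Sum>K\<in>T. \<Sum>K'\<in>T - {K}. ?a K K' P s) + (\<Sum>K\<in>T. ?b K P s))
      = 1/2 * (\<Sum>K\<in>T. \<Sum>K'\<in>T - {K}. LINT s|lborel. ?a K K' P s) + (\<Sum>K\<in>T. LINT s|lborel. ?b K P s)"
      unfolding A B .
  qed
  also have "\<dots> = 1/2 * (\<Sum>K\<in>T. \<Sum>K'\<in>T - {K}. \<Sum>P\<in>planes. LINT s|lborel. ?a K K' P s) + (\<Sum>K\<in>T. \<Sum>P\<in>planes. LINT s|lborel. ?b K P s)"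
  proof -
    have "(\<Sum>P\<in>planes. \<Sum>K\<in>T. \<Sum>K'\<in>T - {K}. LINT s|lborel. ?a K K' P s) = (\<Sum>K\<in>T. \<Sum>P\<in>planes. \<Sum>K'\<in>T - {K}. LINT s|lborel. ?a K K' P s)"
      by (rule sum.swap)
    also have "\<dots> = (\<Sum>K\<in>T. \<Sum>K'\<in>T - {K}. \<Sum>P\<in>planes. LINT s|lborel. ?a K K' P s)"
      by (intro sum.cong refl sum.swap)
    finally have A: "(\<Sum>P\<in>planes. \<Sum>K\<in>T. \<Sum>K'\<in>T - {K}. LINT s|lborel. ?a K K' P s) = (\<Sum>K\<in>T. \<Sum>K'\<in>T - {K}. \<Sum>P\<in>planes. LINT s|lborel. ?a K K' P s)" .
    have B: "(\<Sum>P\<in>planes. \<Sum>K\<in>T. LINT s|lborel. ?b K P s) = (\<Sum>K\<in>T. \<Sum>P\<in>planes. LINT s|lborel. ?b K P s)"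
      by (rule sum.swap)
    show ?thesis unfolding A[symmetric] B[symmetric] by (simp only: sum.distrib sum_distrib_left)
  qed
  also have "\<dots> = 1/2 * (\<Sum>K\<in>T. \<Sum>K'\<in>T - {K}.
         surface_integral (frontier K \<inter> frontier K') (\<lambda>x. (norm (jump K K' (pw p) x))\<^sup>2))
     + (\<Sum>K\<in>T. surface_integral (frontier K \<inter> frontier \<Omega>) (\<lambda>x. (cell_trace K (pw p) x)\<^sup>2))"
  proof -
    have js: "surface_integral (frontier K \<inter> frontier K') (\<lambda>x. (norm (jump K K' (pw p) x))\<^sup>2) = (\<Sum>P\<in>planes. LINT s|lborel. ?a K K' P s)"
      if "K \<in> T" "K' \<in> T - {K}" for K K'
      by (rule jump_surface_integral) (use p that in auto)
    have ts: "surface_integral (frontier K \<inter> frontier \<Omega>) (\<lambda>x. (cell_trace K (pw p) x)\<^sup>2) = (\<Sum>P\<in>planes. LINT s|lborel. ?b K P s)"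
      if "K \<in> T" for K
      by (rule trace_surface_integral) (use p that in auto)
    show ?thesis by (simp only: js ts cong: sum.cong)
  qed
  finally show ?thesis .
qed

lemma H1h_norm_sq:
  assumes "C1_pieces p" "0 \<le> mesh_size T"
  shows "(H1h_norm \<Omega> T (pw p))\<^sup>2 = (\<Sum>i\<in>UNIV. sqn (dpw i p)) + jump_energy p / mesh_size T"
    "0 \<le> H1h_norm \<Omega> T (pw p)"
proof -
  have J: "jump_energy p = 1/2 * (\<Sum>K\<in>T. \<Sum>K'\<in>T - {K}.
         surface_integral (frontier K \<inter> frontier K') (\<lambda>x. (norm (jump K K' (pw p) x))\<^sup>2))
     + (\<Sum>K\<in>T. surface_integral (frontier K \<inter> frontier \<Omega>) (\<lambda>x. (cell_trace K (pw p) x)\<^sup>2))"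
    by (rule jump_energy_eq) (rule C1_pieces_continuous[OF assms(1)])
  have "H1h_norm \<Omega> T (pw p) = sqrt ((\<Sum>i\<in>UNIV. sqn (dpw i p)) + 1 / mesh_size T * jump_energy p)"
    unfolding H1h_norm_def gradient_energy[OF assms(1)] J
    by (simp add: distrib_left add.assoc)
  then show "(H1h_norm \<Omega> T (pw p))\<^sup>2 = (\<Sum>i\<in>UNIV. sqn (dpw i p)) + jump_energy p / mesh_size T"
    "0 \<le> H1h_norm \<Omega> T (pw p)"
    using assms(2) jump_energy_nonneg[of p] by (auto simp: sum_nonneg)
qed

end

section \<open>Increments along lines\<close>

text \<open>Subtracting the accumulated jumps leaves a continuous function with the same derivative
  off \<open>Z\<close>. The values of \<open>g\<close> on \<open>Z\<close> are replaced by the left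
  limits, as those of a mesh function on the skeleton carry no information.\<close>

lemma jump_fundamental_theorem:
  fixes g g' J lo :: "real \<Rightarrow> real"
  assumes ab: "a \<le> b" and Z: "finite Z" "Z \<subseteq> {a<..<b}"
    and d: "\<And>s. s \<in> {a..b} \<Longrightarrow> s \<notin> Z \<Longrightarrow> (g has_real_derivative g' s) (at s)"
    and l: "\<And>z. z \<in> Z \<Longrightarrow> (g \<longlongrightarrow> lo z) (at_left z)" "\<And>z. z \<in> Z \<Longrightarrow> (g \<longlongrightarrow> lo z + J z) (at_right z)"
  shows "(g' has_integral (g b - g a - (\<Sum>z\<in>Z. J z))) {a..b}"
proof -
  \<comment> \<open>Counting only \<open>z < s\<close> makes \<open>j\<close> continuous from the
    left, which matches the use of the left limit \<open>lo s\<close> in \<open>G\<close>; to the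
    right of \<open>s\<close> both \<open>g\<close> and \<open>j\<close> gain
    \<open>J s\<close>.\<close>
  define j where "j = (\<lambda>s. \<Sum>z\<in>{z\<in>Z. z < s}. J z)"
  define G where "G = (\<lambda>s. (if s \<in> Z then lo s else g s) - j s)"
  have near: "\<exists>e>0. \<forall>y. \<bar>y - s\<bar> < e \<longrightarrow> y \<noteq> s \<longrightarrow> y \<notin> Z" for s
  proof -
    have "open (- (Z - {s}))" by (intro open_Compl finite_imp_closed finite_Diff Z(1))
    then obtain e where "e > 0" "ball s e \<subseteq> - (Z - {s})" using open_contains_ball by blast
    moreover have "y \<in> ball s e" if "\<bar>y - s\<bar> < e" for y using that by (simp add: dist_real_def abs_minus_commute)
    ultimately show ?thesis by (intro exI[of _ e]) blast
  qed
  have jl: "j y = j s" if "\<forall>w. \<bar>w - s\<bar> < e \<longrightarrow> w \<noteq> s \<longrightarrow> w \<notin> Z" "\<bar>y - s\<bar> < e" "y \<le> s \<or> s \<notin> Z" for y s e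
  proof -
    have "{z\<in>Z. z < y} = {z\<in>Z. z < s}"
    proof (rule Collect_cong, rule conj_cong[OF refl])
      fix z assume z: "z \<in> Z"
      show "z < y \<longleftrightarrow> z < s"
      proof (rule ccontr)
        assume c: "\<not> (z < y \<longleftrightarrow> z < s)"
        show False
        proof (cases "z = s")
          case True
          then show False using c that(3) z by auto
        next
          case False
          then have "\<bar>z - s\<bar> < e" using c that(2) by auto
          then show False using that(1) False z by blast
        qed
      qed
    qed
    then show ?thesis by (simp add: j_def)
  qed
  have jr: "j y = j s + J s" if "\<forall>w. \<bar>w - s\<bar> < e \<longrightarrow> w \<noteq> s \<longrightarrow> w \<notin> Z" "\<bar>y - s\<bar> < e" "s < y" "s \<in> Z" for y s e
  proof -
    have "{z\<in>Z. z < y} = insert s {z\<in>Z. z < s}"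
    proof (intro set_eqI iffI)
      fix z assume z: "z \<in> {z\<in>Z. z < y}"
      show "z \<in> insert s {z\<in>Z. z < s}"
      proof (rule ccontr)
        assume "z \<notin> insert s {z\<in>Z. z < s}"
        then have "s < z" using z by auto
        then have "\<bar>z - s\<bar> < e" "z \<noteq> s" using z that(2) by auto
        then show False using that(1) z by blast
      qed
    qed (use that in auto)
    then show ?thesis using Z(1) by (simp add: j_def)
  qed
  have dG: "(G has_real_derivative g' s) (at s)" if s: "s \<in> {a..b}" "s \<notin> Z" for s
  proof -
    obtain e where e: "e > 0" "\<forall>w. \<bar>w - s\<bar> < e \<longrightarrow> w \<noteq> s \<longrightarrow> w \<notin> Z" using near by blast
    have "((\<lambda>y. g y - j s) has_real_derivative g' s) (at s)" using d[OF s] by (auto intro!: derivative_eq_intros)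
    then show ?thesis
    proof (rule has_field_derivative_transform_within_open[of _ _ _ "ball s e"])
      fix y assume "y \<in> ball s e"
      then have y: "\<bar>y - s\<bar> < e" by (simp add: dist_real_def abs_minus_commute)
      have "y \<notin> Z" using e(2) y s(2) by (cases "y = s") auto
      then show "g y - j s = G y" using jl[OF e(2) y] s(2) by (simp add: G_def)
    qed (use e in auto)
  qed
  have cG: "isCont G s" if s: "s \<in> {a..b}" for s
  proof (cases "s \<in> Z")
    case False
    then show ?thesis using dG[OF s] DERIV_isCont by blast
  next
    case True
    obtain e where e: "e > 0" "\<forall>w. \<bar>w - s\<bar> < e \<longrightarrow> w \<noteq> s \<longrightarrow> w \<notin> Z" using near by blast
    have "((\<lambda>y. g y - j s) \<longlongrightarrow> lo s - j s) (at_left s)" using l(1)[OF True] by (intro tendsto_intros)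
    moreover have "eventually (\<lambda>y. g y - j s = G y) (at_left s)"
      unfolding eventually_at_left_field
    proof (intro exI[of _ "s - e"] conjI allI impI)
      fix y assume y: "s - e < y" "y < s"
      then have ye: "\<bar>y - s\<bar> < e" "y \<noteq> s" "y \<le> s \<or> s \<notin> Z" by auto
      then have "y \<notin> Z" using e(2) by blast
      then show "g y - j s = G y" using jl[OF e(2) ye(1,3)] by (simp add: G_def)
    qed (use e in auto)
    ultimately have L: "(G \<longlongrightarrow> lo s - j s) (at_left s)" by (rule Lim_transform_eventually)
    have "((\<lambda>y. g y - (j s + J s)) \<longlongrightarrow> lo s + J s - (j s + J s)) (at_right s)" using l(2)[OF True] by (intro tendsto_intros)
    moreover have "eventually (\<lambda>y. g y - (j s + J s) = G y) (at_right s)"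
      unfolding eventually_at_right_field
    proof (intro exI[of _ "s + e"] conjI allI impI)
      fix y assume y: "s < y" "y < s + e"
      then have ye: "\<bar>y - s\<bar> < e" "y \<noteq> s" by auto
      then have "y \<notin> Z" using e(2) by blast
      then show "g y - (j s + J s) = G y" using jr[OF e(2) ye(1) y(1) True] by (simp add: G_def)
    qed (use e in auto)
    ultimately have "(G \<longlongrightarrow> lo s + J s - (j s + J s)) (at_right s)" by (rule Lim_transform_eventually)
    then have R: "(G \<longlongrightarrow> lo s - j s) (at_right s)" by simp
    show ?thesis unfolding isCont_def using filterlim_split_at[OF L R] True by (simp add: G_def)
  qed
  have "(g' has_integral (G b - G a)) {a..b}"
  proof (rule fundamental_theorem_of_calculus_interior_strong[OF Z(1) ab])
    show "(G has_vector_derivative g' x) (at x)" if "x \<in> {a<..<b} - Z" for x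
      using dG[of x] that by (simp add: has_real_derivative_iff_has_vector_derivative)
    show "continuous_on {a..b} G" using cG by (simp add: continuous_at_imp_continuous_on)
  qed
  moreover have "G b - G a = g b - g a - (\<Sum>z\<in>Z. J z)"
  proof -
    have f: "{z\<in>Z. z < b} = Z" "{z\<in>Z. z < a} = {}" "a \<notin> Z" "b \<notin> Z" using Z(2) by force+
    have "j b = (\<Sum>z\<in>Z. J z)" "j a = 0" unfolding j_def f(1,2) by simp_all
    then show ?thesis using f(3,4) by (simp add: G_def)
  qed
  ultimately show ?thesis by simp
qed

definition plane_normal :: "(real^3) set \<Rightarrow> real^3" where
  "plane_normal P = (SOME n. norm n = 1 \<and> (\<exists>c. P = {x. n \<bullet> x = c}))"

definition plane_offset :: "(real^3) set \<Rightarrow> real" where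
  "plane_offset P = (SOME c. P = {x. plane_normal P \<bullet> x = c})"

lemma plane_repr:
  assumes "is_plane P"
  shows "norm (plane_normal P) = 1" "P = {x. plane_normal P \<bullet> x = plane_offset P}"
proof -
  have "norm (plane_normal P) = 1 \<and> (\<exists>c. P = {x. plane_normal P \<bullet> x = c})"
    unfolding plane_normal_def using assms unfolding is_plane_def by (intro someI_ex[of "\<lambda>n. norm n = 1 \<and> (\<exists>c. P = {x. n \<bullet> x = c})"]) blast
  then show "norm (plane_normal P) = 1" "P = {x. plane_normal P \<bullet> x = plane_offset P}"
    unfolding plane_offset_def using someI_ex[of "\<lambda>c. P = {x. plane_normal P \<bullet> x = c}"] by auto
qed

section \<open>Almost every axis-parallel segment\<close>

context poly_mesh begin

definition transversal :: "3 \<Rightarrow> (real^3) set set" where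
  "transversal i = {P \<in> planes. plane_normal P \<bullet> axis i 1 \<noteq> 0}"

definition hit :: "3 \<Rightarrow> (real^3) set \<Rightarrow> real^3 \<Rightarrow> real" where
  "hit i P = crossing (plane_normal P) (plane_offset P) (axis i 1)"

lemma finite_transversal: "finite (transversal i)"
  using finite_planes by (simp add: transversal_def)

lemma hit_iff:
  assumes "P \<in> transversal i"
  shows "x + s *\<^sub>R axis i 1 \<in> P \<longleftrightarrow> s = hit i P x"
proof -
  have P: "is_plane P" "plane_normal P \<bullet> axis i 1 \<noteq> 0" using assms plane_planes by (auto simp: transversal_def)
  have "x + s *\<^sub>R axis i 1 \<in> P \<longleftrightarrow> plane_normal P \<bullet> x + s * (plane_normal P \<bullet> axis i 1) = plane_offset P"
    by (subst plane_repr(2)[OF P(1)]) (simp add: inner_add_right)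
  also have "\<dots> \<longleftrightarrow> s = hit i P x" using P(2) by (auto simp: hit_def crossing_def field_simps)
  finally show ?thesis .
qed

lemma parallel_iff:
  assumes "P \<in> planes" "P \<notin> transversal i"
  shows "x + s *\<^sub>R axis i 1 \<in> P \<longleftrightarrow> x \<in> P"
proof -
  have P: "is_plane P" "plane_normal P \<bullet> axis i 1 = 0" using assms plane_planes by (auto simp: transversal_def)
  have "y \<in> P \<longleftrightarrow> plane_normal P \<bullet> y = plane_offset P" for y using plane_repr(2)[OF P(1)] by blast
  then show ?thesis using P(2) by (simp add: inner_add_right)
qed

text \<open>Such a segment has its ends off the skeleton, meets the planes one at a time and hence
  at generic points, and never runs inside a plane parallel to it.\<close>

definition generic_line :: "3 \<Rightarrow> real \<Rightarrow> real^3 \<Rightarrow> bool" where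
  "generic_line i t x \<longleftrightarrow> (\<forall>P\<in>planes. x \<notin> P \<and> x + t *\<^sub>R axis i 1 \<notin> P) \<and>
     (\<forall>P\<in>transversal i. \<forall>Q\<in>transversal i - {P}. hit i P x \<noteq> hit i Q x)"

lemma plane_AE: "is_plane P \<Longrightarrow> AE x in lborel. x + a \<notin> P"
proof -
  assume P: "is_plane P"
  have eq: "{x. x + a \<in> P} = {x. plane_normal P \<bullet> x = plane_offset P - plane_normal P \<bullet> a}"
    by (subst plane_repr(2)[OF P]) (auto simp: inner_add_right algebra_simps)
  have "plane_normal P \<noteq> 0" using plane_repr(1)[OF P] by auto
  then have "{x. x + a \<in> P} \<in> null_sets lborel"
    unfolding eq using negligible_hyperplane[of "plane_normal P"]
    by (auto simp: negligible_iff_null_sets null_sets_completion_iff closed_hyperplane borel_closed)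
  from AE_not_in[OF this] show ?thesis by simp
qed

lemma generic_line_AE: "AE x in lborel. generic_line i t x"
proof -
  have 1: "AE x in lborel. \<forall>P\<in>planes. x \<notin> P \<and> x + t *\<^sub>R axis i 1 \<notin> P"
    using finite_planes plane_AE[OF plane_planes, of _ 0] plane_AE[OF plane_planes] by (subst AE_finite_all) auto
  have 2: "AE x in lborel. hit i P x \<noteq> hit i Q x" if P: "P \<in> transversal i" "Q \<in> transversal i" "P \<noteq> Q" for P Q
  proof -
    have pl: "is_plane P" "is_plane Q" using P plane_planes by (auto simp: transversal_def)
    let ?n = "\<lambda>P. plane_normal P" and ?c = "\<lambda>P. plane_offset P" and ?e = "axis i 1 :: real^3"
    have nz: "?n P \<bullet> ?e \<noteq> 0" "?n Q \<bullet> ?e \<noteq> 0" using P by (auto simp: transversal_def)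
    \<comment> \<open>Simultaneous crossing of two planes is the linear equation
      \<open>a \<bullet> x = b\<close>; if it were trivial, the planes would be equal.\<close>
    define a where "a = (?n Q \<bullet> ?e) *\<^sub>R ?n P - (?n P \<bullet> ?e) *\<^sub>R ?n Q"
    define b where "b = (?n Q \<bullet> ?e) * ?c P - (?n P \<bullet> ?e) * ?c Q"
    have eq: "hit i P x = hit i Q x \<longleftrightarrow> a \<bullet> x = b" for x
      using nz by (auto simp: hit_def crossing_def a_def b_def field_simps inner_diff_left)
    have ab: "a \<noteq> 0 \<or> b \<noteq> 0"
    proof (rule ccontr)
      assume "\<not> (a \<noteq> 0 \<or> b \<noteq> 0)"
      then have all: "hit i P x = hit i Q x" for x using eq by simp
      have "P \<subseteq> Q"
      proof
        fix x assume "x \<in> P"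
        then have "0 = hit i P x" using hit_iff[OF P(1), of x 0] by simp
        then show "x \<in> Q" using hit_iff[OF P(2), of x 0] all by simp
      qed
      then show False using plane_subset_eq[OF pl] P(3) by blast
    qed
    have "{x. a \<bullet> x = b} \<in> null_sets lborel"
      using ab negligible_hyperplane[of a b]
      by (auto simp: negligible_iff_null_sets null_sets_completion_iff closed_hyperplane borel_closed)
    from AE_not_in[OF this] show ?thesis by eventually_elim (simp add: eq)
  qed
  have 3: "AE x in lborel. \<forall>P\<in>transversal i. \<forall>Q\<in>transversal i - {P}. hit i P x \<noteq> hit i Q x"
  proof (subst AE_finite_all[OF finite_transversal], rule ballI)
    fix P assume "P \<in> transversal i"
    then show "AE x in lborel. \<forall>Q\<in>transversal i - {P}. hit i P x \<noteq> hit i Q x"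
      using 2[of P] by (subst AE_finite_all[OF finite_Diff[OF finite_transversal]]) blast
  qed
  from 1 3 show ?thesis by eventually_elim (simp add: generic_line_def)
qed

lemma generic_at_hit:
  assumes "generic_line i t x" "P \<in> transversal i"
  shows "generic P (x + hit i P x *\<^sub>R axis i 1)"
  unfolding generic_def
proof (intro conjI ballI)
  show "x + hit i P x *\<^sub>R axis i 1 \<in> P" using hit_iff[OF assms(2)] by simp
  fix Q assume Q: "Q \<in> planes - {P}"
  show "x + hit i P x *\<^sub>R axis i 1 \<notin> Q"
  proof (cases "Q \<in> transversal i")
    case True
    then show ?thesis using hit_iff[OF True, of x] assms Q unfolding generic_line_def by auto
  next
    case False
    then show ?thesis using parallel_iff[of Q i x] assms Q unfolding generic_line_def by auto
  qed
qed

lemma face_energy_interior: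
  assumes "K \<in> T" "K' \<in> T" "K \<noteq> K'" "w \<in> frontier K" "w \<in> frontier K'"
  shows "(p K w - p K' w)\<^sup>2 \<le> face_energy p w"
proof -
  define S where "S = (\<lambda>K. \<Sum>K'\<in>T - {K}. indicator (frontier K \<inter> frontier K') w * (p K w - p K' w)\<^sup>2)"
  have S: "(p K w - p K' w)\<^sup>2 \<le> S K" if "K \<in> T" "K' \<in> T" "K \<noteq> K'" "w \<in> frontier K" "w \<in> frontier K'" for K K'
  proof -
    have "indicator (frontier K \<inter> frontier K') w * (p K w - p K' w)\<^sup>2 \<le> S K"
      unfolding S_def using that finite_T by (intro member_le_sum) auto
    then show ?thesis using that by simp
  qed
  have S0: "0 \<le> S K" for K unfolding S_def by (intro sum_nonneg) auto
  \<comment> \<open>Both orders of the pair occur in the double sum, which absorbs the factor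
    1/2.\<close>
  have "(p K w - p K' w)\<^sup>2 + (p K' w - p K w)\<^sup>2 \<le> S K + S K'"
    using S assms by (intro add_mono) auto
  also have "\<dots> = (\<Sum>A\<in>{K, K'}. S A)" using assms by simp
  also have "\<dots> \<le> (\<Sum>A\<in>T. S A)" using assms S0 finite_T by (intro sum_mono2) auto
  finally have "(p K w - p K' w)\<^sup>2 \<le> 1/2 * (\<Sum>A\<in>T. S A)" by (simp add: power2_commute)
  moreover have "0 \<le> (\<Sum>K\<in>T. indicator (frontier K \<inter> frontier \<Omega>) w * (p K w)\<^sup>2)" by (intro sum_nonneg) auto
  ultimately show ?thesis unfolding face_energy_def S_def by linarith
qed

lemma face_energy_boundary:
  assumes "K \<in> T" "w \<in> frontier K" "w \<in> frontier \<Omega>"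
  shows "(p K w)\<^sup>2 \<le> face_energy p w"
proof -
  have "indicator (frontier K \<inter> frontier \<Omega>) w * (p K w)\<^sup>2 \<le> (\<Sum>K\<in>T. indicator (frontier K \<inter> frontier \<Omega>) w * (p K w)\<^sup>2)"
    using assms finite_T by (intro member_le_sum) auto
  moreover have "0 \<le> 1/2 * (\<Sum>K\<in>T. \<Sum>K'\<in>T - {K}. indicator (frontier K \<inter> frontier K') w * (p K w - p K' w)\<^sup>2)"
    by (intro mult_nonneg_nonneg sum_nonneg) auto
  ultimately show ?thesis using assms unfolding face_energy_def by simp
qed

text \<open>Each side belongs to a cell or to the exterior, where the value is 0. The difference is
  accordingly 0, an interior jump or a boundary trace; this is where the boundary term of the norm
  pays for the extension by zero.\<close>

lemma values_across_face:
  assumes p: "\<And>K. K \<in> T \<Longrightarrow> continuous_on UNIV (p K)"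
    and P: "P \<in> planes" "P = {x. n \<bullet> x = c}" "norm n = 1" and w: "generic P w"
  shows "\<exists>r>0. \<exists>f1 f2. continuous_on UNIV f1 \<and> continuous_on UNIV f2 \<and>
     (\<forall>y\<in>ball w r. 0 < n \<bullet> y - c \<longrightarrow> pw p y = f1 y) \<and> (\<forall>y\<in>ball w r. n \<bullet> y - c < 0 \<longrightarrow> pw p y = f2 y) \<and>
     (f1 w - f2 w)\<^sup>2 \<le> face_energy p w \<and> (f1 w \<noteq> f2 w \<longrightarrow> (\<exists>K\<in>T. w \<in> frontier K))"
proof -
  obtain r where r: "r > 0" and h0: "\<forall>s. s \<noteq> (0::real) \<longrightarrow>
      (let D = {y \<in> ball w r. 0 < s * (n \<bullet> y - c)} in
         (\<forall>K\<in>T. D \<subseteq> K \<or> D \<inter> K = {}) \<and> ((\<exists>K\<in>T. D \<subseteq> K) \<or> D \<inter> closure \<Omega> = {}))"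
    using generic_half_balls[OF P(1,2) w] by blast
  define D where "D = (\<lambda>s::real. {y \<in> ball w r. 0 < s * (n \<bullet> y - c)})"
  have h: "(\<exists>K\<in>T. D s \<subseteq> K) \<or> D s \<inter> closure \<Omega> = {}" if "s \<noteq> 0" for s
    using h0[rule_format, OF that, unfolded Let_def, THEN conjunct2] unfolding D_def .
  have wP: "n \<bullet> w = c" using w P(2) by (auto simp: generic_def)
  have nn: "n \<bullet> n = 1" using P(3) by (simp add: norm_eq_1)
  have near: "N \<inter> D s \<noteq> {}" if N: "open N" "w \<in> N" and s: "s \<noteq> 0" for N s
  proof -
    have "open (N \<inter> ball w r)" "w \<in> N \<inter> ball w r" using N r by auto
    then obtain e where e: "e > 0" "ball w e \<subseteq> N \<inter> ball w r" using open_contains_ball by metis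
    define v where "v = w + (e / 2 * sgn s) *\<^sub>R n"
    have vb: "v \<in> ball w e" using e s P(3) by (simp add: v_def dist_norm abs_mult abs_sgn_eq)
    have "s * (n \<bullet> v - c) = e / 2 * \<bar>s\<bar>" using nn wP by (simp add: v_def inner_add_right abs_sgn)
    moreover have "0 < e / 2 * \<bar>s\<bar>" using e s by simp
    ultimately have "0 < s * (n \<bullet> v - c)" by (simp only:)
    moreover have "v \<in> N" "v \<in> ball w r" using e(2) vb by auto
    ultimately show ?thesis by (auto simp: D_def)
  qed
  have clos: "w \<in> closure K" if "D s \<subseteq> K" "s \<noteq> 0" for K s
  proof (rule ccontr)
    assume "w \<notin> closure K"
    then have "- closure K \<inter> D s \<noteq> {}" using that(2) by (intro near) auto
    then show False using that(1) closure_subset by blast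
  qed
  \<comment> \<open>\<open>None\<close> stands for the exterior of the domain.\<close>
  define side where "side = (\<lambda>s. if \<exists>K\<in>T. D s \<subseteq> K then Some (SOME K. K \<in> T \<and> D s \<subseteq> K) else None)"
  define val where "val = (\<lambda>s. case side s of None \<Rightarrow> (\<lambda>_. 0) | Some K \<Rightarrow> p K)"
  have side_Some: "K \<in> T \<and> D s \<subseteq> K" if "side s = Some K" for s K
    using that someI_ex[of "\<lambda>K. K \<in> T \<and> D s \<subseteq> K"] by (auto simp: side_def split: if_splits)
  have side_None: "D s \<inter> closure \<Omega> = {}" if "side s = None" "s \<noteq> 0" for s
    using that h[of s] by (auto simp: side_def split: if_splits)
  have cont: "continuous_on UNIV (val s)" for s
    using p side_Some[of s] by (cases "side s") (auto simp: val_def)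
  have val: "pw p y = val s y" if "y \<in> D s" "s \<noteq> 0" for s y
  proof (cases "side s")
    case None
    then have "y \<notin> \<Omega>" using side_None[OF None that(2)] that(1) closure_subset by blast
    then show ?thesis using None by (simp add: val_def pw_off_dom)
  next
    case (Some K)
    then show ?thesis using side_Some[OF Some] that pw_cell by (auto simp: val_def)
  qed
  have bd: "w \<in> frontier \<Omega> \<and> w \<in> frontier K" if "side s = Some K" "side s' = None" "s \<noteq> 0" "s' \<noteq> 0" for s s' K
  proof -
    have K: "K \<in> T" "D s \<subseteq> K" using side_Some that by auto
    have "w \<notin> \<Omega>"
    proof
      assume "w \<in> \<Omega>"
      then have "\<Omega> \<inter> D s' \<noteq> {}" using open_dom that by (intro near) auto
      then show False using side_None[OF that(2,4)] closure_subset by blast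
    qed
    moreover have "w \<in> closure K" using clos[OF K(2) that(3)] .
    moreover have "closure K \<subseteq> closure \<Omega>" using cell_subset[OF K(1)] by (rule closure_mono)
    ultimately show ?thesis
      using frontier_cell[OF K(1)] cell_subset[OF K(1)] open_dom by (auto simp: frontier_def interior_open)
  qed
  have fr: "w \<in> frontier K" if "side s = Some K" "side s' = Some K'" "K \<noteq> K'" "s \<noteq> 0" "s' \<noteq> 0" for s s' K K'
  proof -
    have K: "K \<in> T" "D s \<subseteq> K" "K' \<in> T" "D s' \<subseteq> K'" using side_Some that by auto
    have "w \<notin> K"
    proof
      assume "w \<in> K"
      then have "K \<inter> D s' \<noteq> {}" using cell_open[OF K(1)] that by (intro near) auto
      then show False using K cells_disjoint[OF K(1,3) that(3)] by blast
    qed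
    then show ?thesis using clos[OF K(2) that(4)] frontier_cell[OF K(1)] by blast
  qed
  have jump: "(val 1 w - val (-1) w)\<^sup>2 \<le> face_energy p w \<and> (val 1 w \<noteq> val (-1) w \<longrightarrow> (\<exists>K\<in>T. w \<in> frontier K))"
  proof (cases "side 1")
    case N1: None
    show ?thesis
    proof (cases "side (-1)")
      case None
      then show ?thesis using N1 face_energy_nonneg by (simp add: val_def)
    next
      case (Some K)
      have "w \<in> frontier \<Omega> \<and> w \<in> frontier K" using bd[OF Some N1] by simp
      then show ?thesis using N1 Some side_Some[OF Some] face_energy_boundary[of K w p] by (auto simp: val_def)
    qed
  next
    case S1: (Some K)
    show ?thesis
    proof (cases "side (-1)")
      case None
      have "w \<in> frontier \<Omega> \<and> w \<in> frontier K" using bd[OF S1 None] by simp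
      then show ?thesis using S1 None side_Some[OF S1] face_energy_boundary[of K w p] by (auto simp: val_def)
    next
      case (Some K')
      show ?thesis
      proof (cases "K = K'")
        case True
        then show ?thesis using S1 Some face_energy_nonneg by (simp add: val_def)
      next
        case False
        then have "w \<in> frontier K" "w \<in> frontier K'" using fr[OF S1 Some] fr[OF Some S1] by auto
        then show ?thesis using S1 Some side_Some[OF S1] side_Some[OF Some] face_energy_interior[of K K' w p] False
          by (auto simp: val_def)
      qed
    qed
  qed
  show ?thesis
  proof (rule exI[of _ r], rule conjI[OF r], rule exI[of _ "val 1"], rule exI[of _ "val (-1)"], intro conjI cont)
    show "\<forall>y\<in>ball w r. 0 < n \<bullet> y - c \<longrightarrow> pw p y = val 1 y" using val[of _ 1] by (auto simp: D_def)
    show "\<forall>y\<in>ball w r. n \<bullet> y - c < 0 \<longrightarrow> pw p y = val (-1) y" using val[of _ "-1"] by (auto simp: D_def)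
  qed (use jump in auto)
qed

lemma pw_differentiable:
  assumes p: "C1_pieces p" and x: "\<And>K. K \<in> T \<Longrightarrow> x \<notin> frontier K"
  shows "pw p differentiable (at x)" "partial_deriv i (pw p) x = dpw i p x"
proof -
  have "pw p differentiable (at x) \<and> partial_deriv i (pw p) x = dpw i p x"
  proof (cases "x \<in> \<Union>T")
    case True
    then obtain K where K: "K \<in> T" "x \<in> K" by blast
    have "p K differentiable (at x)" using p K by (simp add: C1_pieces_def)
    then obtain D where "(p K has_derivative D) (at x)" by (auto simp: differentiable_def)
    then have "(pw p has_derivative D) (at x)"
      by (rule has_derivative_transform_within_open[OF _ cell_open[OF K(1)] K(2)]) (simp add: pw_cell[OF K(1)])
    then show ?thesis using partial_deriv_pw[OF K] by (auto simp: differentiable_def)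
  next
    case False
    then have c: "x \<in> - closure \<Omega>" using off_skeleton_cases[OF x] by auto
    have z: "y \<notin> \<Omega>" if "y \<in> - closure \<Omega>" for y using that closure_subset by blast
    have "((\<lambda>_. 0) has_derivative (\<lambda>_. 0)) (at x)" by simp
    then have "(pw p has_derivative (\<lambda>_. 0)) (at x)"
      by (rule has_derivative_transform_within_open[OF _ _ c]) (auto simp: pw_off_dom z)
    then show ?thesis using pw_off_dom[OF z[OF c]] partial_deriv_eq by (auto simp: differentiable_def dpw_def)
  qed
  then show "pw p differentiable (at x)" "partial_deriv i (pw p) x = dpw i p x" by auto
qed

lemma off_planes_off_skeleton: "(\<And>P. P \<in> planes \<Longrightarrow> x \<notin> P) \<Longrightarrow> K \<in> T \<Longrightarrow> x \<notin> frontier K"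
  using frontier_planes by blast

lemma line_integrand:
  assumes "bcs D"
  shows "bcs (\<lambda>s. indicator {0..t} s * D (x + s *\<^sub>R axis i 1))"
proof -
  obtain B where B: "\<And>x. \<bar>D x\<bar> \<le> B" using assms by (auto simp: bcs_def)
  show ?thesis
  proof (rule bcsI)
    have "(\<lambda>s::real. x + s *\<^sub>R axis i 1) \<in> borel \<rightarrow>\<^sub>M borel" by (intro borel_measurable_continuous_onI continuous_intros)
    from measurable_compose[OF this bcs_measurable[OF assms]]
    show "(\<lambda>s. indicator {0..t} s * D (x + s *\<^sub>R axis i 1)) \<in> borel_measurable borel"
      by (intro borel_measurable_times borel_measurable_indicator) auto
    show "\<bar>indicator {0..t} s * D (x + s *\<^sub>R axis i 1)\<bar> \<le> B" for s
      using B[of 0] B[of "x + s *\<^sub>R axis i 1"] by (auto simp: indicator_def)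
    show "bounded (cbox 0 t)" by (rule bounded_cbox)
  qed (auto simp: indicator_def)
qed

text \<open>The fundamental theorem with jumps along the segment. The link between a nonzero jump
  and a cell with \<open>P \<in> H K\<close> is recorded because it makes the number of effective
  crossings countable.\<close>

lemma increment_identity:
  assumes p: "C1_pieces p" and g: "generic_line i t x" and t: "0 < t"
  shows "\<exists>J. (\<forall>P\<in>transversal i. (J P)\<^sup>2 \<le> face_energy p (x + hit i P x *\<^sub>R axis i 1) \<and>
       (J P \<noteq> 0 \<longrightarrow> (\<exists>K\<in>T. P \<in> H K \<and> x + hit i P x *\<^sub>R axis i 1 \<in> frontier K))) \<and>
     pw p (x + t *\<^sub>R axis i 1) - pw p x
       = (LINT s|lborel. indicator {0..t} s * dpw i p (x + s *\<^sub>R axis i 1))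
         + (\<Sum>P\<in>{P\<in>transversal i. 0 < hit i P x \<and> hit i P x < t}. J P)"
proof -
  let ?e = "axis i 1 :: real^3"
  have pc: "continuous_on UNIV (p K)" if "K \<in> T" for K using C1_pieces_continuous[OF p that] .
  have ex: "\<exists>lo j. ((\<lambda>s. pw p (x + s *\<^sub>R ?e)) \<longlongrightarrow> lo) (at_left (hit i P x)) \<and>
     ((\<lambda>s. pw p (x + s *\<^sub>R ?e)) \<longlongrightarrow> lo + j) (at_right (hit i P x)) \<and>
     j\<^sup>2 \<le> face_energy p (x + hit i P x *\<^sub>R ?e) \<and> (j \<noteq> 0 \<longrightarrow> (\<exists>K\<in>T. P \<in> H K \<and> x + hit i P x *\<^sub>R ?e \<in> frontier K))"
    if P: "P \<in> transversal i" for P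
  proof -
    define z where "z = hit i P x"
    define w where "w = x + z *\<^sub>R ?e"
    have Pp: "P \<in> planes" "is_plane P" using P plane_planes by (auto simp: transversal_def)
    define n c where "n = plane_normal P" and "c = plane_offset P"
    have n: "norm n = 1" "P = {x. n \<bullet> x = c}" using plane_repr[OF Pp(2)] by (simp_all add: n_def c_def)
    have ne: "n \<bullet> ?e \<noteq> 0" using P by (simp add: transversal_def n_def)
    have gw: "generic P w" using generic_at_hit[OF g P] by (simp add: w_def z_def)
    have wc: "n \<bullet> w = c" using gw n(2) by (auto simp: generic_def)
    obtain r f1 f2 where r: "r > 0" and f: "continuous_on UNIV f1" "continuous_on UNIV f2"
      "\<forall>y\<in>ball w r. 0 < n \<bullet> y - c \<longrightarrow> pw p y = f1 y" "\<forall>y\<in>ball w r. n \<bullet> y - c < 0 \<longrightarrow> pw p y = f2 y"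
      "(f1 w - f2 w)\<^sup>2 \<le> face_energy p w" "f1 w \<noteq> f2 w \<longrightarrow> (\<exists>K\<in>T. w \<in> frontier K)"
      using values_across_face[of p, OF pc Pp(1) n(2,1) gw] by blast
    have off: "n \<bullet> (x + s *\<^sub>R ?e) - c = (s - z) * (n \<bullet> ?e)" for s
      using wc by (simp add: w_def inner_add_right algebra_simps)
    have inb: "x + s *\<^sub>R ?e \<in> ball w r" if "\<bar>s - z\<bar> < r" for s
    proof -
      have "w - (x + s *\<^sub>R ?e) = (z - s) *\<^sub>R ?e" by (simp add: w_def algebra_simps)
      then have "dist w (x + s *\<^sub>R ?e) = \<bar>z - s\<bar>" by (simp add: dist_norm)
      then show ?thesis using that by (simp add: abs_minus_commute)
    qed
    have lim: "((\<lambda>s. f (x + s *\<^sub>R ?e)) \<longlongrightarrow> f w) (at z within S)" if "continuous_on UNIV f" for f :: "real^3 \<Rightarrow> real" and S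
    proof -
      have "continuous_on UNIV (\<lambda>s. f (x + s *\<^sub>R ?e))"
        by (intro continuous_on_compose2[OF that] continuous_intros) auto
      then have "((\<lambda>s. f (x + s *\<^sub>R ?e)) \<longlongrightarrow> f (x + z *\<^sub>R ?e)) (at z)"
        by (simp add: continuous_on_eq_continuous_at isCont_def)
      then show ?thesis unfolding w_def by (rule tendsto_within_subset) auto
    qed
    have hk: "\<exists>K\<in>T. P \<in> H K \<and> w \<in> frontier K" if ne12: "f1 w \<noteq> f2 w"
    proof -
      obtain K where K: "K \<in> T" "w \<in> frontier K" using f(6) ne12 by blast
      then obtain Q where Q: "Q \<in> H K" "w \<in> Q" using frontier_H by blast
      then have "Q \<in> planes" using K by (auto simp: planes_def)
      then have "Q = P" using gw Q by (auto simp: generic_def)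
      then show ?thesis using K Q by blast
    qed
    have ev: "eventually (\<lambda>s. f s = h s) (at_left z)" if "\<And>s. \<bar>s - z\<bar> < r \<Longrightarrow> s < z \<Longrightarrow> f s = h s" for f h :: "real \<Rightarrow> real"
      unfolding eventually_at_left_field using r that by (intro exI[of _ "z - r"]) auto
    have ev': "eventually (\<lambda>s. f s = h s) (at_right z)" if "\<And>s. \<bar>s - z\<bar> < r \<Longrightarrow> z < s \<Longrightarrow> f s = h s" for f h :: "real \<Rightarrow> real"
      unfolding eventually_at_right_field using r that by (intro exI[of _ "z + r"]) auto
    show ?thesis
    proof (cases "0 < n \<bullet> ?e")
      case True
      have "((\<lambda>s. pw p (x + s *\<^sub>R ?e)) \<longlongrightarrow> f2 w) (at_left z)"
      proof (rule Lim_transform_eventually[OF lim[OF f(2)] ev])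
        fix s assume s: "\<bar>s - z\<bar> < r" "s < z"
        then show "f2 (x + s *\<^sub>R ?e) = pw p (x + s *\<^sub>R ?e)"
          using f(4) inb[OF s(1)] off[of s] mult_neg_pos[of "s - z" "n \<bullet> ?e"] True by simp
      qed
      moreover have "((\<lambda>s. pw p (x + s *\<^sub>R ?e)) \<longlongrightarrow> f1 w) (at_right z)"
      proof (rule Lim_transform_eventually[OF lim[OF f(1)] ev'])
        fix s assume s: "\<bar>s - z\<bar> < r" "z < s"
        show "f1 (x + s *\<^sub>R ?e) = pw p (x + s *\<^sub>R ?e)"
        proof -
          have "0 < n \<bullet> (x + s *\<^sub>R ?e) - c" unfolding off using s True by simp
          then show ?thesis using f(3) inb[OF s(1)] by simp
        qed
      qed
      ultimately show ?thesis using f(5) hk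
        by (intro exI[of _ "f2 w"] exI[of _ "f1 w - f2 w"]) (auto simp: z_def[symmetric] w_def[symmetric])
    next
      case False
      then have neg: "n \<bullet> ?e < 0" using ne by simp
      have "((\<lambda>s. pw p (x + s *\<^sub>R ?e)) \<longlongrightarrow> f1 w) (at_left z)"
      proof (rule Lim_transform_eventually[OF lim[OF f(1)] ev])
        fix s assume s: "\<bar>s - z\<bar> < r" "s < z"
        then show "f1 (x + s *\<^sub>R ?e) = pw p (x + s *\<^sub>R ?e)"
          using f(3) inb[OF s(1)] off[of s] mult_neg_neg[of "s - z" "n \<bullet> ?e"] neg by simp
      qed
      moreover have "((\<lambda>s. pw p (x + s *\<^sub>R ?e)) \<longlongrightarrow> f2 w) (at_right z)"
      proof (rule Lim_transform_eventually[OF lim[OF f(2)] ev'])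
        fix s assume s: "\<bar>s - z\<bar> < r" "z < s"
        then show "f2 (x + s *\<^sub>R ?e) = pw p (x + s *\<^sub>R ?e)"
          using f(4) inb[OF s(1)] off[of s] mult_pos_neg[of "s - z" "n \<bullet> ?e"] neg by simp
      qed
      ultimately show ?thesis using f(5) hk
        by (intro exI[of _ "f1 w"] exI[of _ "f2 w - f1 w"]) (auto simp: z_def[symmetric] w_def[symmetric] power2_commute)
    qed
  qed
  then obtain lo J where J: "\<And>P. P \<in> transversal i \<Longrightarrow> ((\<lambda>s. pw p (x + s *\<^sub>R ?e)) \<longlongrightarrow> lo P) (at_left (hit i P x)) \<and>
     ((\<lambda>s. pw p (x + s *\<^sub>R ?e)) \<longlongrightarrow> lo P + J P) (at_right (hit i P x)) \<and>
     (J P)\<^sup>2 \<le> face_energy p (x + hit i P x *\<^sub>R ?e) \<and> (J P \<noteq> 0 \<longrightarrow> (\<exists>K\<in>T. P \<in> H K \<and> x + hit i P x *\<^sub>R ?e \<in> frontier K))"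
    by metis
  define A where "A = {P\<in>transversal i. 0 < hit i P x \<and> hit i P x < t}"
  have Af: "finite A" using finite_transversal by (simp add: A_def)
  have inj: "inj_on (\<lambda>P. hit i P x) A"
    using g unfolding generic_line_def inj_on_def A_def by blast
  \<comment> \<open>On a generic line distinct planes have distinct hits, so a plane can be
    recovered from its hit and the sum over parameters becomes a sum over planes.\<close>
  define src where "src = inv_into A (\<lambda>P. hit i P x)"
  have src: "src (hit i P x) = P" if "P \<in> A" for P unfolding src_def using inv_into_f_f[OF inj that] .
  define Z where "Z = (\<lambda>P. hit i P x) ` A"
  have "((\<lambda>s. dpw i p (x + s *\<^sub>R ?e)) has_integral
      (pw p (x + t *\<^sub>R ?e) - pw p (x + 0 *\<^sub>R ?e) - (\<Sum>z\<in>Z. J (src z)))) {0..t}"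
  proof (rule jump_fundamental_theorem[where lo = "\<lambda>z. lo (src z)"])
    show "finite Z" "Z \<subseteq> {0<..<t}" using Af by (auto simp: Z_def A_def)
    show "0 \<le> t" using t by simp
    show "((\<lambda>s. pw p (x + s *\<^sub>R ?e)) \<longlongrightarrow> lo (src z)) (at_left z)"
      "((\<lambda>s. pw p (x + s *\<^sub>R ?e)) \<longlongrightarrow> lo (src z) + J (src z)) (at_right z)" if "z \<in> Z" for z
      using that J src by (auto simp: Z_def A_def)
    fix s assume s: "s \<in> {0..t}" "s \<notin> Z"
    have "x + s *\<^sub>R ?e \<notin> P" if P: "P \<in> planes" for P
    proof (cases "P \<in> transversal i")
      case True
      have "x + 0 *\<^sub>R ?e \<notin> P" "x + t *\<^sub>R ?e \<notin> P" using g P by (auto simp: generic_line_def)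
      then have "hit i P x \<noteq> 0" "hit i P x \<noteq> t" using hit_iff[OF True, of x] by metis+
      then show ?thesis using hit_iff[OF True, of x s] s True by (auto simp: Z_def A_def)
    next
      case False
      then show ?thesis using parallel_iff[OF P False, of x s] g P by (auto simp: generic_line_def)
    qed
    then have off: "x + s *\<^sub>R ?e \<notin> frontier K" if "K \<in> T" for K using off_planes_off_skeleton that by blast
    show "((\<lambda>s. pw p (x + s *\<^sub>R ?e)) has_real_derivative dpw i p (x + s *\<^sub>R ?e)) (at s)"
    proof -
      have "pw p differentiable (at (x + s *\<^sub>R ?e))" "partial_deriv i (pw p) (x + s *\<^sub>R ?e) = dpw i p (x + s *\<^sub>R ?e)"
        using pw_differentiable[OF p, of "x + s *\<^sub>R ?e"] off by blast+
      then show ?thesis using line_derivative[of "pw p" x s i] by simp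
    qed
  qed
  moreover have "(\<Sum>z\<in>Z. J (src z)) = (\<Sum>P\<in>A. J P)"
    unfolding Z_def by (simp add: sum.reindex[OF inj] src)
  ultimately have HI: "((\<lambda>s. dpw i p (x + s *\<^sub>R ?e)) has_integral (pw p (x + t *\<^sub>R ?e) - pw p x - (\<Sum>P\<in>A. J P))) {0..t}"
    by simp
  \<comment> \<open>The fundamental theorem yields a gauge integral; uniqueness identifies it with
    the Lebesgue integral used for Fubini.\<close>
  have "((\<lambda>s. indicator {0..t} s * dpw i p (x + s *\<^sub>R ?e)) has_integral (LINT s|lborel. indicator {0..t} s * dpw i p (x + s *\<^sub>R ?e))) UNIV"
    by (rule has_integral_integral_lborel[OF integrable_bcs[OF line_integrand[OF bcs_dpw[OF p]]]])
  moreover have "(\<lambda>s. indicator {0..t} s * dpw i p (x + s *\<^sub>R ?e)) = (\<lambda>s. if s \<in> {0..t} then dpw i p (x + s *\<^sub>R ?e) else 0)"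
    by (auto simp: indicator_def)
  ultimately have "((\<lambda>s. dpw i p (x + s *\<^sub>R ?e)) has_integral (LINT s|lborel. indicator {0..t} s * dpw i p (x + s *\<^sub>R ?e))) {0..t}"
    by (simp only: has_integral_restrict_UNIV)
  then have "(LINT s|lborel. indicator {0..t} s * dpw i p (x + s *\<^sub>R ?e)) = pw p (x + t *\<^sub>R ?e) - pw p x - (\<Sum>P\<in>A. J P)"
    using HI has_integral_unique by blast
  then show ?thesis using J unfolding A_def by (intro exI[of _ J]) auto
qed

definition crossing_energy :: "3 \<Rightarrow> real \<Rightarrow> ((real^3) set \<Rightarrow> real^3 \<Rightarrow> real) \<Rightarrow> (real^3) set \<Rightarrow> real^3 \<Rightarrow> real" where
  "crossing_energy i t p P x = indicator {0<..<t} (hit i P x) * face_energy p (x + hit i P x *\<^sub>R axis i 1)"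

lemma bcs_crossing_energy:
  assumes p: "C1_pieces p" and P: "P \<in> transversal i"
  shows "bcs (crossing_energy i t p P)"
proof -
  have b: "bcs (face_energy p)" using C1_pieces_continuous[OF p] by (intro bcs_face_energy)
  obtain B where B: "\<And>x. \<bar>face_energy p x\<bar> \<le> B" using b by (auto simp: bcs_def)
  obtain R where R: "{x. face_energy p x \<noteq> 0} \<subseteq> cball 0 R" using b bounded_subset_cball_0[of "{x. face_energy p x \<noteq> 0}"] by (auto simp: bcs_def)
  have mh: "hit i P \<in> borel_measurable borel"
    unfolding hit_def crossing_def[abs_def] using P
    by (intro borel_measurable_continuous_onI continuous_intros) (auto simp: transversal_def)
  show ?thesis
  proof (rule bcsI)
    have "(\<lambda>x. x + hit i P x *\<^sub>R axis i 1) \<in> borel \<rightarrow>\<^sub>M borel"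
      using mh by (intro borel_measurable_add borel_measurable_scaleR) auto
    from measurable_compose[OF this bcs_measurable[OF b]]
    show "crossing_energy i t p P \<in> borel_measurable borel"
      unfolding crossing_energy_def[abs_def]
      by (intro borel_measurable_times measurable_compose[OF mh, of "indicator {0<..<t}"]) auto
    show "\<bar>crossing_energy i t p P x\<bar> \<le> B" for x
      using B[of 0] B[of "x + hit i P x *\<^sub>R axis i 1"] by (auto simp: crossing_energy_def indicator_def)
    show "bounded (cball (0::real^3) (R + \<bar>t\<bar>))" by simp
    fix x assume x: "x \<notin> cball (0::real^3) (R + \<bar>t\<bar>)"
    show "crossing_energy i t p P x = 0"
    proof (rule ccontr)
      assume "crossing_energy i t p P x \<noteq> 0"
      then have h: "0 < hit i P x" "hit i P x < t" and "face_energy p (x + hit i P x *\<^sub>R axis i 1) \<noteq> 0"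
        by (auto simp: crossing_energy_def indicator_def split: if_splits)
      then have "norm (x + hit i P x *\<^sub>R axis i 1) \<le> R" using R by auto
      moreover have "norm (hit i P x *\<^sub>R (axis i 1 :: real^3)) \<le> \<bar>t\<bar>" using h by simp
      ultimately have "norm x \<le> R + \<bar>t\<bar>"
        using norm_triangle_ineq4[of "x + hit i P x *\<^sub>R axis i 1" "hit i P x *\<^sub>R axis i 1"] by simp
      then show False using x by simp
    qed
  qed
qed

lemma crossing_energy_nonneg: "0 \<le> crossing_energy i t p P x"
  by (simp add: crossing_energy_def face_energy_nonneg)

lemma crossing_energy_integral:
  assumes p: "C1_pieces p" and P: "P \<in> transversal i" and t: "0 \<le> t"
  shows "(LINT x|lborel. crossing_energy i t p P x) \<le> t * (LINT s|lborel. face_energy p (plane_param P s))"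
proof -
  have Pp: "is_plane P" "plane_normal P \<bullet> axis i 1 \<noteq> 0" using P plane_planes by (auto simp: transversal_def)
  have b: "bcs (face_energy p)" using C1_pieces_continuous[OF p] by (intro bcs_face_energy)
  have "ennreal (LINT x|lborel. crossing_energy i t p P x) = (\<integral>\<^sup>+x. ennreal (crossing_energy i t p P x) \<partial>lborel)"
    by (intro nn_integral_eq_integral[symmetric] integrable_bcs bcs_crossing_energy p P) (simp add: crossing_energy_nonneg)
  also have "\<dots> = (\<integral>\<^sup>+x. indicator {0<..<t} (hit i P x) * ennreal (face_energy p (x + hit i P x *\<^sub>R axis i 1)) \<partial>lborel)"
    by (intro nn_integral_cong) (auto simp: crossing_energy_def indicator_def)
  also have "\<dots> \<le> ennreal t * (\<integral>\<^sup>+s. ennreal (face_energy p (plane_param P s)) \<partial>lborel)"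
    unfolding hit_def
    by (rule nn_integral_crossing_le[OF Pp(1) plane_repr[OF Pp(1)] _ Pp(2) _ t])
      (use bcs_measurable[OF b] in auto)
  also have "(\<integral>\<^sup>+s. ennreal (face_energy p (plane_param P s)) \<partial>lborel) = ennreal (LINT s|lborel. face_energy p (plane_param P s))"
    by (intro nn_integral_eq_integral integrable_bcs bcs_plane_param[OF b Pp(1)]) (simp add: face_energy_nonneg)
  also have "ennreal t * ennreal (LINT s|lborel. face_energy p (plane_param P s)) = ennreal (t * (LINT s|lborel. face_energy p (plane_param P s)))"
    using t by (simp add: ennreal_mult face_energy_nonneg)
  finally show ?thesis using t by (simp add: face_energy_nonneg)
qed

lemma transversal_planes: "transversal i \<subseteq> planes"
  by (auto simp: transversal_def)

lemma sum_crossing_energy: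
  assumes "C1_pieces p" "0 \<le> t"
  shows "(\<Sum>P\<in>transversal i. LINT x|lborel. crossing_energy i t p P x) \<le> t * jump_energy p"
proof -
  have "(\<Sum>P\<in>transversal i. LINT x|lborel. crossing_energy i t p P x) \<le> (\<Sum>P\<in>transversal i. t * (LINT s|lborel. face_energy p (plane_param P s)))"
    using assms by (intro sum_mono crossing_energy_integral) auto
  also have "\<dots> \<le> (\<Sum>P\<in>planes. t * (LINT s|lborel. face_energy p (plane_param P s)))"
    using assms(2) by (intro sum_mono2 finite_planes transversal_planes) (auto simp: face_energy_nonneg)
  finally show ?thesis by (simp add: jump_energy_def sum_distrib_left)
qed

text \<open>A mesh plane extends through the whole domain, but jumps occur on it only at the
  frontier of its own cells. Requiring such a frontier nearby is what makes the count independent of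
  the mesh.\<close>

definition near_planes :: "real^3 \<Rightarrow> real \<Rightarrow> (real^3) set set" where
  "near_planes x \<delta> = {P \<in> planes. \<exists>K\<in>T. P \<in> H K \<and> frontier K \<inter> cball x \<delta> \<noteq> {}}"

lemma line_energy:
  fixes D :: "real^3 \<Rightarrow> real"
  assumes "bcs D" "0 \<le> t"
  shows "integrable lborel (\<lambda>x. LINT s|lborel. indicator {0..t} s * (D (x + s *\<^sub>R e))\<^sup>2)"
    "(LINT x|lborel. LINT s|lborel. indicator {0..t} s * (D (x + s *\<^sub>R e))\<^sup>2) = t * sqn D"
proof -
  let ?H = "\<lambda>(s, x). indicator {0..t::real} s * (D (x + s *\<^sub>R e))\<^sup>2"
  have "bcs ?H" by (rule bcs_line_product[OF bcs_power2[OF assms(1)]])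
  then have iH: "integrable (lborel \<Otimes>\<^sub>M lborel) ?H" using integrable_bcs by (simp add: lborel_prod)
  show "integrable lborel (\<lambda>x. LINT s|lborel. indicator {0..t} s * (D (x + s *\<^sub>R e))\<^sup>2)"
    by (rule lborel_pair.integrable_snd[OF iH])
  have "(LINT x|lborel. LINT s|lborel. indicator {0..t} s * (D (x + s *\<^sub>R e))\<^sup>2)
     = (LINT s|lborel. LINT x|lborel. indicator {0..t} s * (D (x + s *\<^sub>R e))\<^sup>2)"
    by (rule lborel_pair.Fubini_integral[OF iH])
  also have "\<dots> = (LINT s|lborel. indicator {0..t} s * sqn D)"
    using sqn_shift[OF bcs_measurable[OF assms(1)]] by (simp add: sqn_def)
  also have "\<dots> = t * sqn D" using assms(2) by simp
  finally show "(LINT x|lborel. LINT s|lborel. indicator {0..t} s * (D (x + s *\<^sub>R e))\<^sup>2) = t * sqn D" .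
qed

text \<open>At most \<open>M\<close> crossings of a line segment carry a jump, so the jumps may be squared termwise.\<close>
lemma increment_estimate:
  assumes p: "C1_pieces p" and t: "0 < t" "t \<le> \<delta>" and M: "\<And>x. card (near_planes x \<delta>) \<le> M"
  shows "sqn (\<lambda>x. pw p (x + t *\<^sub>R axis i 1) - pw p x) \<le> 2 * t\<^sup>2 * sqn (dpw i p) + 2 * real M * t * jump_energy p"
proof -
  let ?e = "axis i 1 :: real^3"
  define L where "L = (\<lambda>x. LINT s|lborel. indicator {0..t} s * (dpw i p (x + s *\<^sub>R ?e))\<^sup>2)"
  have bd: "bcs (dpw i p)" using bcs_dpw[OF p] .
  have iL: "integrable lborel L" "(LINT x|lborel. L x) = t * sqn (dpw i p)"
    unfolding L_def using line_energy[OF bd, of t] t by auto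
  let ?c = "crossing_energy i t p"
  have ic: "integrable lborel (?c P)" if "P \<in> transversal i" for P
    using that by (intro integrable_bcs bcs_crossing_energy p)
  have point: "AE x in lborel. (pw p (x + t *\<^sub>R ?e) - pw p x)\<^sup>2 \<le> 2 * t * L x + 2 * real M * (\<Sum>P\<in>transversal i. ?c P x)"
    using generic_line_AE[of i t]
  proof eventually_elim
    fix x assume g: "generic_line i t x"
    define I where "I = (LINT s|lborel. indicator {0..t} s * dpw i p (x + s *\<^sub>R ?e))"
    define A where "A = {P\<in>transversal i. 0 < hit i P x \<and> hit i P x < t}"
    obtain J where J: "\<And>P. P \<in> transversal i \<Longrightarrow> (J P)\<^sup>2 \<le> face_energy p (x + hit i P x *\<^sub>R ?e)"
       "\<And>P. P \<in> transversal i \<Longrightarrow> J P \<noteq> 0 \<Longrightarrow> \<exists>K\<in>T. P \<in> H K \<and> x + hit i P x *\<^sub>R ?e \<in> frontier K"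
       "pw p (x + t *\<^sub>R ?e) - pw p x = I + (\<Sum>P\<in>A. J P)"
      using increment_identity[OF p g t(1)] unfolding I_def A_def by blast
    have Af: "finite A" "A \<subseteq> transversal i" using finite_transversal by (auto simp: A_def)
    have "I\<^sup>2 = (LINT s|lborel. indicator {0..t} s * (indicator {0..t} s * dpw i p (x + s *\<^sub>R ?e)))\<^sup>2"
      unfolding I_def by (intro arg_cong[where f = "\<lambda>z. z\<^sup>2"] Bochner_Integration.integral_cong) (auto simp: indicator_def)
    also have "\<dots> \<le> (LINT s|lborel. (indicator {0..t} s :: real)\<^sup>2) * (LINT s|lborel. (indicator {0..t} s * dpw i p (x + s *\<^sub>R ?e))\<^sup>2)"
    proof (rule sqint_Cauchy_Schwarz)
      have "indicator {0..t} \<in> borel_measurable (borel :: real measure)" by (intro borel_measurable_indicator) auto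
      then have "bcs (indicator {0..t} :: real \<Rightarrow> real)"
        by (rule bcsI[where B = 1, OF _ _ bounded_cbox[of 0 t]]) (auto simp: indicator_def)
      from integrable_bcs[OF bcs_power2[OF this]] bcs_measurable[OF this]
      show "indicator {0..t} \<in> sqint (lborel :: real measure)" by (simp add: sqint_def)
      show "(\<lambda>s. indicator {0..t} s * dpw i p (x + s *\<^sub>R ?e)) \<in> sqint lborel"
        using integrable_bcs[OF bcs_power2[OF line_integrand[OF bd]]] bcs_measurable[OF line_integrand[OF bd]]
        by (simp add: sqint_def)
    qed
    also have "(LINT s|lborel. (indicator {0..t} s :: real)\<^sup>2) = t"
    proof -
      have "(\<lambda>s. (indicator {0..t} s :: real)\<^sup>2) = indicator {0..t}" by (auto simp: indicator_def)
      then show ?thesis using t by simp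
    qed
    also have "(LINT s|lborel. (indicator {0..t} s * dpw i p (x + s *\<^sub>R ?e))\<^sup>2) = L x"
      unfolding L_def by (intro Bochner_Integration.integral_cong) (auto simp: indicator_def)
    finally have I2: "I\<^sup>2 \<le> t * L x" .
    \<comment> \<open>The segment may cross arbitrarily many planes; only those with a nonzero jump
      are confined to \<open>near_planes x \<delta>\<close>.\<close>
    define A' where "A' = {P\<in>A. J P \<noteq> 0}"
    have "A' \<subseteq> near_planes x \<delta>"
    proof
      fix P assume P: "P \<in> A'"
      then have Pt: "P \<in> transversal i" "0 < hit i P x" "hit i P x < t" "J P \<noteq> 0" by (auto simp: A'_def A_def)
      obtain K where K: "K \<in> T" "P \<in> H K" "x + hit i P x *\<^sub>R ?e \<in> frontier K" using J(2)[OF Pt(1,4)] by blast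
      moreover have "x + hit i P x *\<^sub>R ?e \<in> cball x \<delta>" using Pt t by (simp add: dist_norm)
      ultimately show "P \<in> near_planes x \<delta>" using Pt(1) transversal_planes unfolding near_planes_def by blast
    qed
    then have "card A' \<le> card (near_planes x \<delta>)" using finite_planes by (intro card_mono) (auto simp: near_planes_def)
    then have cA: "card A' \<le> M" using M[of x] by linarith
    have "(\<Sum>P\<in>A. J P) = (\<Sum>P\<in>A'. J P)" unfolding A'_def using Af by (intro sum.mono_neutral_right) auto
    then have "(\<Sum>P\<in>A. J P)\<^sup>2 \<le> real (card A') * (\<Sum>P\<in>A'. (J P)\<^sup>2)" using square_sum_le[of A' J] Af by (simp add: A'_def)
    also have "\<dots> \<le> real M * (\<Sum>P\<in>A'. (J P)\<^sup>2)" using cA by (intro mult_right_mono sum_nonneg) auto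
    also have "(\<Sum>P\<in>A'. (J P)\<^sup>2) \<le> (\<Sum>P\<in>A'. ?c P x)"
      using J(1) by (intro sum_mono) (auto simp: A'_def A_def crossing_energy_def)
    also have "\<dots> \<le> (\<Sum>P\<in>transversal i. ?c P x)"
      using finite_transversal by (intro sum_mono2) (auto simp: A'_def A_def crossing_energy_nonneg)
    finally have S2: "(\<Sum>P\<in>A. J P)\<^sup>2 \<le> real M * (\<Sum>P\<in>transversal i. ?c P x)" by (simp add: mult_left_mono)
    have "(I + S)\<^sup>2 \<le> 2 * I\<^sup>2 + 2 * S\<^sup>2" for S
    proof -
      have "0 \<le> (I - S)\<^sup>2" by simp
      then show ?thesis by (simp add: power2_eq_square algebra_simps)
    qed
    from this[of "\<Sum>P\<in>A. J P"] show "(pw p (x + t *\<^sub>R ?e) - pw p x)\<^sup>2 \<le> 2 * t * L x + 2 * real M * (\<Sum>P\<in>transversal i. ?c P x)"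
      using I2 S2 unfolding J(3) by linarith
  qed
  have iR: "integrable lborel (\<lambda>x. 2 * t * L x + 2 * real M * (\<Sum>P\<in>transversal i. ?c P x))"
    using iL ic by auto
  have bp: "bcs (pw p)" using C1_pieces_continuous[OF p] by (rule bcs_pw)
  have "sqn (\<lambda>x. pw p (x + t *\<^sub>R ?e) - pw p x) \<le> (LINT x|lborel. 2 * t * L x + 2 * real M * (\<Sum>P\<in>transversal i. ?c P x))"
    unfolding sqn_def by (rule integral_mono_AE[OF _ iR point]) (intro integrable_bcs bcs_power2 bcs_diff bcs_shift bp)
  also have "\<dots> = 2 * t * (LINT x|lborel. L x) + 2 * real M * (\<Sum>P\<in>transversal i. LINT x|lborel. ?c P x)"
    using iL(1) ic by simp
  also have "\<dots> \<le> 2 * t * (t * sqn (dpw i p)) + 2 * real M * (t * jump_energy p)"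
    using sum_crossing_energy[OF p] t iL(2) by (intro add_mono mult_left_mono) auto
  finally show ?thesis by (simp add: power2_eq_square mult.assoc)
qed

lemma tmod_pw:
  assumes p: "C1_pieces p" and \<delta>: "0 < \<delta>" and M: "\<And>x. card (near_planes x \<delta>) \<le> M"
  shows "tmod (pw p) \<delta> (2 * \<delta>\<^sup>2 * (\<Sum>i\<in>UNIV. sqn (dpw i p)) + 2 * real M * \<delta> * jump_energy p)"
  unfolding tmod_def
proof (intro allI impI)
  fix i t assume t: "\<bar>t\<bar> \<le> \<delta>"
  let ?e = "axis i 1 :: real^3"
  let ?A = "2 * \<delta>\<^sup>2 * (\<Sum>i\<in>UNIV. sqn (dpw i p)) + 2 * real M * \<delta> * jump_energy p"
  have A0: "0 \<le> ?A" using \<delta> jump_energy_nonneg by (intro add_nonneg_nonneg mult_nonneg_nonneg sum_nonneg) auto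
  have bp: "bcs (pw p)" using C1_pieces_continuous[OF p] by (rule bcs_pw)
  have pos: "sqn (\<lambda>x. pw p (x + s *\<^sub>R ?e) - pw p x) \<le> ?A" if s: "0 < s" "s \<le> \<delta>" for s
  proof -
    have "sqn (\<lambda>x. pw p (x + s *\<^sub>R ?e) - pw p x) \<le> 2 * s\<^sup>2 * sqn (dpw i p) + 2 * real M * s * jump_energy p"
      by (rule increment_estimate[OF p s M])
    also have "\<dots> \<le> 2 * \<delta>\<^sup>2 * (\<Sum>i\<in>UNIV. sqn (dpw i p)) + 2 * real M * \<delta> * jump_energy p"
      using s jump_energy_nonneg[of p] by (intro add_mono mult_mono member_le_sum power_mono) auto
    finally show ?thesis .
  qed
  consider "t = 0" | "0 < t" | "t < 0" by linarith
  then show "sqn (\<lambda>x. pw p (x + t *\<^sub>R ?e) - pw p x) \<le> ?A"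
  proof cases
    case 1
    then show ?thesis using A0 by (simp add: sqn_def)
  next
    case 2
    then show ?thesis using pos t by simp
  next
    case 3
    \<comment> \<open>Translation invariance turns a backward step into a forward one.\<close>
    have "sqn (\<lambda>x. pw p (x + t *\<^sub>R ?e) - pw p x) = sqn (\<lambda>x. pw p (x + (-t) *\<^sub>R ?e + t *\<^sub>R ?e) - pw p (x + (-t) *\<^sub>R ?e))"
      by (rule sqn_shift[of "\<lambda>x. pw p (x + t *\<^sub>R ?e) - pw p x", symmetric, OF bcs_measurable[OF bcs_diff[OF bcs_shift[OF bp] bp]]])
    also have "\<dots> = sqn (\<lambda>x. pw p (x + (-t) *\<^sub>R ?e) - pw p x)" by (simp add: sqn_def power2_commute)
    also have "\<dots> \<le> ?A" using 3 t by (intro pos) auto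
    finally show ?thesis .
  qed
qed

text \<open>The integrals of the nonnegative crossing energies sum to at most
  \<open>t * jump_energy p\<close>, so each crossing energy, and with it each jump met by the
  segment, vanishes for almost every starting point.\<close>

lemma zero_jump_increments:
  assumes p: "C1_pieces p" and z: "jump_energy p = 0" and t: "0 < t"
  shows "AE x in lborel. pw p (x + t *\<^sub>R axis i 1) - pw p x = (LINT s|lborel. indicator {0..t} s * dpw i p (x + s *\<^sub>R axis i 1))"
proof -
  let ?c = "crossing_energy i t p"
  have ic: "integrable lborel (?c P)" if "P \<in> transversal i" for P
    using that by (intro integrable_bcs bcs_crossing_energy p)
  have ge: "0 \<le> (LINT x|lborel. ?c P x)" for P by (simp add: crossing_energy_nonneg)
  have "(\<Sum>P\<in>transversal i. LINT x|lborel. ?c P x) \<le> 0" using sum_crossing_energy[OF p, of t i] z t by simp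
  then have "(\<Sum>P\<in>transversal i. LINT x|lborel. ?c P x) = 0" using ge by (simp add: antisym sum_nonneg)
  then have "(LINT x|lborel. ?c P x) = 0" if "P \<in> transversal i" for P
    using that ge finite_transversal by (simp add: sum_nonneg_eq_0_iff)
  then have "AE x in lborel. ?c P x = 0" if "P \<in> transversal i" for P
    using integral_nonneg_eq_0_iff_AE[OF ic[OF that]] that by (simp add: crossing_energy_nonneg)
  then have "AE x in lborel. \<forall>P\<in>transversal i. ?c P x = 0"
    using finite_transversal by (subst AE_finite_all) auto
  with generic_line_AE[of i t] show ?thesis
  proof eventually_elim
    fix x assume g: "generic_line i t x" and c: "\<forall>P\<in>transversal i. ?c P x = 0"
    obtain J where J: "\<And>P. P \<in> transversal i \<Longrightarrow> (J P)\<^sup>2 \<le> face_energy p (x + hit i P x *\<^sub>R axis i 1)"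
       "pw p (x + t *\<^sub>R axis i 1) - pw p x = (LINT s|lborel. indicator {0..t} s * dpw i p (x + s *\<^sub>R axis i 1))
         + (\<Sum>P\<in>{P\<in>transversal i. 0 < hit i P x \<and> hit i P x < t}. J P)"
      using increment_identity[OF p g t] by blast
    have "J P = 0" if "P \<in> transversal i" "0 < hit i P x" "hit i P x < t" for P
      using J(1)[OF that(1)] c that by (auto simp: crossing_energy_def)
    then have "(\<Sum>P\<in>{P\<in>transversal i. 0 < hit i P x \<and> hit i P x < t}. J P) = 0" by (intro sum.neutral) auto
    then show "pw p (x + t *\<^sub>R axis i 1) - pw p x = (LINT s|lborel. indicator {0..t} s * dpw i p (x + s *\<^sub>R axis i 1))"
      using J(2) by simp
  qed
qed

text \<open>Multiplication by \<psi> creates no jumps, so the increments of the product are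
  integrals of its cellwise derivative; integrated over space they give 0.\<close>

lemma zero_jump_weak_derivative:
  assumes p: "C1_pieces p" and z: "jump_energy p = 0" and \<psi>: "test_function \<Omega>' \<psi>"
  shows "(LINT x|lborel. pw p x * partial_deriv i \<psi> x) = - (LINT x|lborel. dpw i p x * \<psi> x)"
proof -
  note ds = smooth_differentiable[OF test_function_smooth[OF \<psi>]]
  define q where "q = (\<lambda>K x. p K x * \<psi> x)"
  have pd: "partial_deriv m (q K) x = p K x * partial_deriv m \<psi> x + partial_deriv m (p K) x * \<psi> x" if "K \<in> T" for K x m
    unfolding q_def using p that by (intro partial_deriv_mult ds) (auto simp: C1_pieces_def)
  have q: "C1_pieces q"
    unfolding C1_pieces_def
  proof (intro ballI conjI allI)
    fix K assume K: "K \<in> T"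
    show "q K differentiable (at x)" for x
      unfolding q_def using p K ds by (intro differentiable_mult) (auto simp: C1_pieces_def)
    have "partial_deriv m (q K) = (\<lambda>x. p K x * partial_deriv m \<psi> x + partial_deriv m (p K) x * \<psi> x)" for m
      using pd[OF K] by auto
    then show "continuous_on UNIV (partial_deriv m (q K))" for m
      using p K C1_pieces_continuous[OF p K] test_function_continuous[OF \<psi>] test_function_continuous[OF test_function_partial[OF \<psi>]]
      by (auto simp: C1_pieces_def intro!: continuous_intros)
  qed
  have pwq: "pw q x = pw p x * \<psi> x" for x by (simp add: pw_def q_def sum_distrib_right mult.assoc)
  have dpwq: "dpw i q x = pw p x * partial_deriv i \<psi> x + dpw i p x * \<psi> x" for x
  proof -
    have "dpw i q x = (\<Sum>K\<in>T. indicator K x * p K x * partial_deriv i \<psi> x + indicator K x * partial_deriv i (p K) x * \<psi> x)"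
      unfolding dpw_def pw_def by (intro sum.cong) (auto simp: pd algebra_simps)
    then show ?thesis by (simp add: dpw_def pw_def sum.distrib sum_distrib_right)
  qed
  have fe: "face_energy q w = (\<psi> w)\<^sup>2 * face_energy p w" for w
  proof -
    have "(q K w - q K' w)\<^sup>2 = (\<psi> w)\<^sup>2 * (p K w - p K' w)\<^sup>2" for K K'
      by (simp add: q_def flip: left_diff_distrib) (simp add: power_mult_distrib)
    moreover have "(q K w)\<^sup>2 = (\<psi> w)\<^sup>2 * (p K w)\<^sup>2" for K by (simp add: q_def power_mult_distrib)
    ultimately show ?thesis
      by (simp add: face_energy_def distrib_left sum_distrib_left mult.left_commute)
  qed
  have zP: "(LINT s|lborel. face_energy p (plane_param P s)) = 0" if "P \<in> planes" for P
    using z that finite_planes unfolding jump_energy_def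
    by (subst (asm) sum_nonneg_eq_0_iff) (auto simp: face_energy_nonneg)
  have "jump_energy q = 0"
    unfolding jump_energy_def
  proof (intro sum.neutral ballI)
    fix P assume P: "P \<in> planes"
    have "integrable lborel (\<lambda>s. face_energy p (plane_param P s))"
      using C1_pieces_continuous[OF p] by (intro integrable_bcs bcs_plane_param bcs_face_energy plane_planes P)
    then have "AE s in lborel. face_energy p (plane_param P s) = 0"
      using zP[OF P] integral_nonneg_eq_0_iff_AE[of lborel "\<lambda>s. face_energy p (plane_param P s)"] by (simp add: face_energy_nonneg)
    then have "AE s in lborel. face_energy q (plane_param P s) = 0" by eventually_elim (simp add: fe)
    then show "(LINT s|lborel. face_energy q (plane_param P s)) = 0" by (rule integral_eq_zero_AE)
  qed
  then have "AE x in lborel. pw q (x + 1 *\<^sub>R axis i 1) - pw q x = (LINT s|lborel. indicator {0..1} s * dpw i q (x + s *\<^sub>R axis i 1))"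
    by (intro zero_jump_increments q) auto
  then have "(LINT x|lborel. dpw i q x) = 0"
    using C1_pieces_continuous[OF q] by (intro integral_zero_from_increments[of "pw q" "dpw i q" "axis i 1"] bcs_pw bcs_dpw q) auto
  moreover have "integrable lborel (\<lambda>x. pw p x * partial_deriv i \<psi> x)" "integrable lborel (\<lambda>x. dpw i p x * \<psi> x)"
    using C1_pieces_continuous[OF p]
    by (intro integrable_bcs bcs_prod bcs_pw bcs_dpw p test_function_bcs[OF \<psi>] test_function_bcs[OF test_function_partial[OF \<psi>]]; simp)+
  ultimately show ?thesis unfolding dpwq by simp
qed

end

section \<open>Escape vectors of a Lipschitz domain\<close>

lemma finite_positive_lower_bound:
  fixes d :: "'a \<Rightarrow> real"
  assumes "finite A" "\<And>a. a \<in> A \<Longrightarrow> 0 < d a"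
  shows "\<exists>m>0. \<forall>a\<in>A. m \<le> d a"
  using assms
proof (induction A rule: finite_induct)
  case empty
  then show ?case by (intro exI[of _ 1]) auto
next
  case (insert a A)
  then obtain m where "m > 0" "\<forall>a\<in>A. m \<le> d a" by auto
  then show ?case using insert.prems[of a] by (intro exI[of _ "min m (d a)"]) auto
qed

text \<open>Within \<delta> of \<open>x\<close> there is a point \<open>z\<close> below the graph.
  From \<open>z\<close> to \<open>x\<close> the height rises by at most \<delta> and the graph
  varies by at most \<open>L * \<delta>\<close>, so descending by \<open>(L + 1) * \<delta>\<close>
  reaches the complement.\<close>

lemma lipschitz_local_escape:
  assumes dom: "bounded_lipschitz_domain \<Omega>" and x0: "x0 \<in> frontier \<Omega>"
  shows "\<exists>w s. 0 < s \<and> (\<forall>\<delta> x. 0 < \<delta> \<and> \<delta> \<le> s \<and> x \<in> ball x0 s \<and> infdist x (- \<Omega>) < \<delta> \<longrightarrow> x - \<delta> *\<^sub>R w \<notin> \<Omega>)"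
proof -
  obtain e g L r where e: "norm e = 1" and r: "0 < r" and g: "L-lipschitz_on {z. e \<bullet> z = 0} g"
    and iff: "\<And>y. y \<in> ball x0 r \<Longrightarrow> y \<in> \<Omega> \<longleftrightarrow> g (y - (e \<bullet> y) *\<^sub>R e) < e \<bullet> y"
    using dom x0 unfolding bounded_lipschitz_domain_def by metis
  have L: "0 \<le> L" using g by (simp add: lipschitz_on_def)
  have ee: "e \<bullet> e = 1" using e by (simp add: norm_eq_1)
  have ne: "- \<Omega> \<noteq> {}" using dom not_bounded_UNIV unfolding bounded_lipschitz_domain_def by (metis Compl_empty_eq double_complement)
  define A where "A = L + 1"
  have A: "1 \<le> A" using L by (simp add: A_def)
  \<comment> \<open>With \<delta> at most \<open>s\<close>, both \<open>z\<close> and the shifted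
    point stay within \<open>r / 2\<close> of \<open>x0\<close>, inside the ball where the graph
    describes the domain.\<close>
  define s where "s = r / (4 * A)"
  have s: "0 < s" "s * A = r / 4" using r A by (auto simp: s_def)
  have s4: "s \<le> r / 4" using mult_left_mono[OF A less_imp_le[OF s(1)]] s(2) by simp
  have "x - \<delta> *\<^sub>R (A *\<^sub>R e) \<notin> \<Omega>" if \<delta>: "0 < \<delta>" "\<delta> \<le> s" and x: "x \<in> ball x0 s" "infdist x (- \<Omega>) < \<delta>" for \<delta> x
  proof -
    have "\<exists>z\<in>- \<Omega>. dist x z < \<delta>"
    proof (rule ccontr)
      assume "\<not> (\<exists>z\<in>- \<Omega>. dist x z < \<delta>)"
      then have "\<delta> \<le> infdist x (- \<Omega>)" unfolding infdist_def using ne by (auto intro!: cINF_greatest simp: not_less)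
      then show False using x by simp
    qed
    then obtain z where z: "z \<notin> \<Omega>" "dist x z < \<delta>" by auto
    have "dist x0 z < s + \<delta>" using x(1) z(2) dist_triangle[of x0 z x] by simp
    then have "z \<in> ball x0 r" using s4 \<delta> r by auto
    then have ez: "e \<bullet> z \<le> g (z - (e \<bullet> z) *\<^sub>R e)" using iff z(1) by force
    define y where "y = x - \<delta> *\<^sub>R (A *\<^sub>R e)"
    have "dist x y = \<delta> * A" using \<delta> A e by (simp add: y_def dist_norm)
    also have "\<dots> \<le> s * A" using \<delta> A by (intro mult_right_mono) auto
    finally have "dist x y \<le> r / 4" using s(2) by simp
    then have yb: "y \<in> ball x0 r" using x(1) dist_triangle[of x0 y x] s4 r by auto
    have ey: "e \<bullet> y = e \<bullet> x - \<delta> * A" using ee by (simp add: y_def inner_diff_right)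
    have py: "y - (e \<bullet> y) *\<^sub>R e = x - (e \<bullet> x) *\<^sub>R e" unfolding ey by (simp add: y_def algebra_simps)
    have "dist (g (z - (e \<bullet> z) *\<^sub>R e)) (g (x - (e \<bullet> x) *\<^sub>R e)) \<le> L * dist (z - (e \<bullet> z) *\<^sub>R e) (x - (e \<bullet> x) *\<^sub>R e)"
      using ee by (intro lipschitz_onD[OF g]) (auto simp: inner_diff_right)
    also have "dist (z - (e \<bullet> z) *\<^sub>R e) (x - (e \<bullet> x) *\<^sub>R e) \<le> dist z x"
    proof -
      define v where "v = z - x"
      have "z - (e \<bullet> z) *\<^sub>R e - (x - (e \<bullet> x) *\<^sub>R e) = v - (e \<bullet> v) *\<^sub>R e" by (simp add: v_def inner_diff_right algebra_simps)
      moreover have "(norm (v - (e \<bullet> v) *\<^sub>R e))\<^sup>2 = (norm v)\<^sup>2 - (e \<bullet> v)\<^sup>2"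
        unfolding power2_norm_eq_inner using ee by (simp add: inner_diff inner_commute power2_eq_square)
      then have "(norm (v - (e \<bullet> v) *\<^sub>R e))\<^sup>2 \<le> (norm v)\<^sup>2" by simp
      then have "norm (v - (e \<bullet> v) *\<^sub>R e) \<le> norm v" by (rule power2_le_imp_le) simp
      ultimately have "norm (z - (e \<bullet> z) *\<^sub>R e - (x - (e \<bullet> x) *\<^sub>R e)) \<le> norm v" by (simp only:)
      then show ?thesis by (simp only: dist_norm v_def)
    qed
    finally have "g (z - (e \<bullet> z) *\<^sub>R e) \<le> g (x - (e \<bullet> x) *\<^sub>R e) + L * dist z x"
      using L by (auto simp: dist_real_def mult_left_mono)
    moreover have "L * dist z x \<le> L * \<delta>" using z(2) L by (intro mult_left_mono) (auto simp: dist_commute)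
    moreover have "e \<bullet> x \<le> e \<bullet> z + \<delta>"
    proof -
      have "e \<bullet> (x - z) \<le> norm e * norm (x - z)" by (rule norm_cauchy_schwarz)
      then show ?thesis using e z(2) by (simp add: inner_diff_right dist_norm)
    qed
    ultimately have "e \<bullet> x \<le> g (x - (e \<bullet> x) *\<^sub>R e) + L * \<delta> + \<delta>" using ez by linarith
    moreover have "\<delta> * A = L * \<delta> + \<delta>" by (simp add: A_def distrib_left mult.commute)
    ultimately have "e \<bullet> x - \<delta> * A \<le> g (x - (e \<bullet> x) *\<^sub>R e)" by linarith
    then have "e \<bullet> y \<le> g (y - (e \<bullet> y) *\<^sub>R e)" by (subst py, subst ey)
    then show ?thesis using iff[OF yb] by (simp add: y_def)
  qed
  then show ?thesis using s(1) by (intro exI[of _ "A *\<^sub>R e"] exI[of _ s]) blast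
qed

text \<open>Compactness of the frontier leaves finitely many local directions for small \<delta>;
  for large \<delta> a single long vector suffices because the domain is bounded.\<close>

lemma lipschitz_escape_vectors:
  assumes dom: "bounded_lipschitz_domain \<Omega>"
  shows "\<exists>V. escape_vectors \<Omega> V"
proof -
  have O: "open \<Omega>" "bounded \<Omega>" using dom by (auto simp: bounded_lipschitz_domain_def)
  have ne: "- \<Omega> \<noteq> {}" using O(2) not_bounded_UNIV by (metis Compl_empty_eq double_complement)
  have "\<forall>x0\<in>frontier \<Omega>. \<exists>w s. 0 < s \<and> (\<forall>\<delta> x. 0 < \<delta> \<and> \<delta> \<le> s \<and> x \<in> ball x0 s \<and> infdist x (- \<Omega>) < \<delta> \<longrightarrow> x - \<delta> *\<^sub>R w \<notin> \<Omega>)"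
    using lipschitz_local_escape[OF dom] by blast
  then obtain w s where ws: "\<And>x0. x0 \<in> frontier \<Omega> \<Longrightarrow> 0 < s x0"
    "\<And>x0 \<delta> x. x0 \<in> frontier \<Omega> \<Longrightarrow> 0 < \<delta> \<Longrightarrow> \<delta> \<le> s x0 \<Longrightarrow> x \<in> ball x0 (s x0) \<Longrightarrow> infdist x (- \<Omega>) < \<delta> \<Longrightarrow> x - \<delta> *\<^sub>R w x0 \<notin> \<Omega>"
    by metis
  have comp: "compact (frontier \<Omega>)" using O(2) by (rule compact_frontier_bounded)
  have cov: "frontier \<Omega> \<subseteq> (\<Union>x0\<in>frontier \<Omega>. ball x0 (s x0 / 2))" using ws(1) by force
  obtain C where C: "C \<subseteq> frontier \<Omega>" "finite C" "frontier \<Omega> \<subseteq> (\<Union>x0\<in>C. ball x0 (s x0 / 2))"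
    by (rule compactE_image[OF comp _ cov]) auto
  obtain m where m: "m > 0" "\<And>x0. x0 \<in> C \<Longrightarrow> m \<le> s x0 / 2"
    using finite_positive_lower_bound[OF C(2), of "\<lambda>x0. s x0 / 2"] ws(1) C(1) by (metis half_gt_zero subsetD)
  obtain R where R: "\<Omega> \<subseteq> cball 0 R" using bounded_subset_cball_0[OF O(2)] .
  \<comment> \<open>For \<delta> larger than \<open>m\<close> the shift is longer than
    \<open>2 * \<bar>R\<bar> + 1\<close>, hence longer than the diameter of the ball containing the
    domain.\<close>
  define v1 where "v1 = ((2 * \<bar>R\<bar> + 1) / m) *\<^sub>R (axis 1 1 :: real^3)"
  have "escape_vectors \<Omega> (insert v1 (w ` C))"
    unfolding escape_vectors_def
  proof (intro conjI allI impI ballI)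
    show "finite (insert v1 (w ` C))" using C by simp
    fix \<delta> x assume \<delta>: "0 < \<delta>" and x: "x \<in> \<Omega>" "infdist x (- \<Omega>) < \<delta>"
    show "\<exists>v\<in>insert v1 (w ` C). x - \<delta> *\<^sub>R v \<notin> \<Omega>"
    proof (cases "\<delta> \<le> m")
      case False
      have "x - \<delta> *\<^sub>R v1 \<notin> \<Omega>"
      proof
        assume "x - \<delta> *\<^sub>R v1 \<in> \<Omega>"
        then have "norm (x - \<delta> *\<^sub>R v1) \<le> R" "norm x \<le> R" using R x by auto
        then have "norm (\<delta> *\<^sub>R v1) \<le> R + R" using norm_triangle_ineq4[of x "x - \<delta> *\<^sub>R v1"] by simp
        moreover have "norm (\<delta> *\<^sub>R v1) = (\<delta> / m) * (2 * \<bar>R\<bar> + 1)" using \<delta> m by (simp add: v1_def)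
        moreover have "1 * (2 * \<bar>R\<bar> + 1) \<le> (\<delta> / m) * (2 * \<bar>R\<bar> + 1)" using False m by (intro mult_right_mono) auto
        ultimately show False by simp
      qed
      then show ?thesis by blast
    next
      case True
      have "\<exists>z\<in>- \<Omega>. dist x z < \<delta>"
      proof (rule ccontr)
        assume "\<not> (\<exists>z\<in>- \<Omega>. dist x z < \<delta>)"
        then have "\<delta> \<le> infdist x (- \<Omega>)" unfolding infdist_def using ne by (auto intro!: cINF_greatest simp: not_less)
        then show False using x by simp
      qed
      then obtain z where z: "z \<notin> \<Omega>" "dist x z < \<delta>" by auto
      \<comment> \<open>The segment to a nearby point of the complement meets the frontier, which
        puts \<open>x\<close> into one of the covering balls; halving their radii leaves room for
        \<delta>.\<close>
      have "closed_segment x z \<inter> frontier \<Omega> \<noteq> {}"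
        by (rule connected_Int_frontier) (use x z in auto)
      then obtain y where y: "y \<in> closed_segment x z" "y \<in> frontier \<Omega>" by blast
      have yx: "dist x y < \<delta>" using dist_in_closed_segment[OF y(1)] z(2) by (simp add: dist_commute)
      obtain x0 where x0: "x0 \<in> C" "y \<in> ball x0 (s x0 / 2)" using C(3) y(2) by blast
      have "m \<le> s x0 / 2" using m(2)[OF x0(1)] .
      then have "x \<in> ball x0 (s x0)" "\<delta> \<le> s x0" using x0(2) yx True m(1) dist_triangle[of x0 x y] by (auto simp: dist_commute)
      then have "x - \<delta> *\<^sub>R w x0 \<notin> \<Omega>" using ws(2)[of x0 \<delta> x] C(1) x0(1) \<delta> x by blast
      then show ?thesis using x0 by blast
    qed
  qed
  then show ?thesis by blast
qed

section \<open>Quasi-uniform meshes and the inverse estimate\<close>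

text \<open>A predicate on the constant, so that the constant can be fixed before the mesh.\<close>

definition inverse_constant :: "nat \<Rightarrow> real \<Rightarrow> real \<Rightarrow> bool" where
  "inverse_constant k \<rho> C \<longleftrightarrow> 0 \<le> C \<and> (\<forall>p\<in>Q_polys k. \<forall>a d x m. 0 < d \<longrightarrow> x \<in> cball a d \<longrightarrow>
     (p x)\<^sup>2 \<le> C / d^3 * (LINT x|lebesgue_on (ball a (\<rho> * d)). (p x)\<^sup>2) \<and>
     (partial_deriv m p x)\<^sup>2 \<le> C / d^5 * (LINT x|lebesgue_on (ball a (\<rho> * d)). (p x)\<^sup>2))"

lemma inverse_constant_exists: "0 < \<rho> \<Longrightarrow> \<exists>C. inverse_constant k \<rho> C"
  unfolding inverse_constant_def by (rule Q_polys_inverse_estimate)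

locale fem_mesh = poly_mesh +
  fixes \<rho> :: real and N :: nat
  assumes rho_pos: "0 < \<rho>"
    and inner_ball: "K \<in> T \<Longrightarrow> \<exists>x. ball x (\<rho> * diameter K) \<subseteq> K"
    and card_H: "K \<in> T \<Longrightarrow> card (H K) \<le> N"
    and quasi: "K \<in> T \<Longrightarrow> \<rho> * mesh_size T \<le> diameter K"
begin

abbreviation "h \<equiv> mesh_size T"

lemma diameter_le_h: "K \<in> T \<Longrightarrow> diameter K \<le> h"
  unfolding mesh_size_def using finite_T by simp

lemma diameter_pos: assumes "K \<in> T" shows "0 < diameter K"
proof -
  obtain x e where x: "e > 0" "ball x e \<subseteq> K"
    using cell_nonempty[OF assms] cell_open[OF assms] open_contains_ball by blast
  define y where "y = x + (e / 2) *\<^sub>R (axis 1 1 :: real^3)"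
  have d: "dist x y = e / 2" using x by (simp add: y_def dist_norm)
  then have "x \<in> K" "y \<in> K" using x by auto
  then have "dist x y \<le> diameter K" using diameter_bounded_bound[OF cell_bounded[OF assms]] by blast
  then show ?thesis using d x by simp
qed

lemma h_pos: "0 < h"
proof -
  obtain K where "K \<in> T" using T_nonempty by blast
  then show ?thesis using diameter_pos[of K] diameter_le_h[of K] by linarith
qed

definition center :: "(real^3) set \<Rightarrow> real^3" where
  "center K = (SOME x. ball x (\<rho> * diameter K) \<subseteq> K)"

lemma center_ball: "K \<in> T \<Longrightarrow> ball (center K) (\<rho> * diameter K) \<subseteq> K"
  unfolding center_def by (rule someI_ex[OF inner_ball])

lemma center_in: "K \<in> T \<Longrightarrow> center K \<in> K"
  using center_ball[of K] diameter_pos[of K] rho_pos by auto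

lemma closure_cell_cball: assumes "K \<in> T" "x \<in> closure K" shows "closure K \<subseteq> cball x (diameter K)"
proof
  fix y assume "y \<in> closure K"
  then have "dist x y \<le> diameter (closure K)"
    using diameter_bounded_bound[OF bounded_closure[OF cell_bounded[OF assms(1)]]] assms(2) by blast
  then show "y \<in> cball x (diameter K)" using diameter_closure[OF cell_bounded[OF assms(1)]] by simp
qed

lemma closure_cell_center: "K \<in> T \<Longrightarrow> closure K \<subseteq> cball (center K) (diameter K)"
  using closure_cell_cball center_in closure_subset by blast

definition near_cells :: "real^3 \<Rightarrow> (real^3) set set" where
  "near_cells x = {K \<in> T. closure K \<inter> cball x h \<noteq> {}}"

text \<open>The ratio of the volumes of balls of radius \<open>3 * h\<close> and
  \<open>\<rho>\<^sup>2 * h\<close>. It depends on \<rho> alone, so the final constant can be formed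
  before a mesh is given.\<close>

definition cell_count :: nat where
  "cell_count = nat \<lfloor>27 / \<rho>^6\<rfloor>"

text \<open>Volume counting: the disjoint cells near \<open>x\<close> contain balls of radius \<open>\<rho>\<^sup>2 h\<close> inside a ball of radius \<open>3 h\<close>.\<close>
lemma card_near_cells: "card (near_cells x) \<le> cell_count"
proof -
  have fin: "finite (near_cells x)" using finite_T by (simp add: near_cells_def)
  define r where "r = \<rho>\<^sup>2 * h"
  have r: "0 < r" using rho_pos h_pos by (simp add: r_def)
  have sub: "ball (center K) r \<subseteq> K" if "K \<in> T" for K
  proof -
    have "r \<le> \<rho> * diameter K" using mult_left_mono[OF quasi[OF that], of \<rho>] rho_pos by (simp add: r_def power2_eq_square mult.assoc)
    then show ?thesis using center_ball[OF that] by force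
  qed
  have sub3: "K \<subseteq> ball x (3 * h)" if nc: "K \<in> near_cells x" for K
  proof
    fix y assume y: "y \<in> K"
    obtain z where z: "K \<in> T" "z \<in> closure K" "dist x z \<le> h" using nc by (auto simp: near_cells_def)
    have "y \<in> closure K" using y closure_subset by blast
    then have "dist z y \<le> diameter K" using closure_cell_cball[OF z(1,2)] by auto
    then show "y \<in> ball x (3 * h)" using diameter_le_h[OF z(1)] z(3) dist_triangle[of x y z] h_pos by simp
  qed
  have "real (card (near_cells x)) * measure lborel (ball (0::real^3) r) = (\<Sum>K\<in>near_cells x. measure lborel (ball (center K) r))"
    using r by (simp add: content_ball)
  also have "\<dots> = measure lborel (\<Union>K\<in>near_cells x. ball (center K) r)"
  proof (rule measure_finite_Union[symmetric, OF fin])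
    show "disjoint_family_on (\<lambda>K. ball (center K) r) (near_cells x)"
      unfolding disjoint_family_on_def
    proof (intro ballI impI)
      fix K K' assume K: "K \<in> near_cells x" "K' \<in> near_cells x" "K \<noteq> K'"
      then have "K \<inter> K' = {}" using cells_disjoint by (auto simp: near_cells_def)
      moreover have "ball (center K) r \<subseteq> K" "ball (center K') r \<subseteq> K'" using sub K by (auto simp: near_cells_def)
      ultimately show "ball (center K) r \<inter> ball (center K') r = {}" by blast
    qed
    show "emeasure lborel (ball (center K) r) \<noteq> \<infinity>" for K using emeasure_bounded_finite[of "ball (center K) r"] by simp
  qed auto
  also have "\<dots> \<le> measure lborel (ball x (3 * h))"
  proof (rule measure_mono_fmeasurable)
    show "(\<Union>K\<in>near_cells x. ball (center K) r) \<subseteq> ball x (3 * h)" using sub sub3 by (fastforce simp: near_cells_def)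
    show "(\<Union>K\<in>near_cells x. ball (center K) r) \<in> sets lborel" by (simp add: borel_open open_UN)
    show "ball x (3 * h) \<in> fmeasurable lborel" using emeasure_bounded_finite[of "ball x (3 * h)"] by (simp add: fmeasurable_def)
  qed
  finally have "real (card (near_cells x)) * (unit_ball_vol 3 * r^3) \<le> unit_ball_vol 3 * (3 * h)^3"
    using r h_pos by (simp add: content_ball)
  moreover have "0 < unit_ball_vol (3::real)" by simp
  ultimately have "real (card (near_cells x)) * r^3 \<le> (3 * h)^3" by (simp add: mult.left_commute)
  then have "real (card (near_cells x)) * \<rho>^6 * h^3 \<le> 27 * h^3"
    by (simp add: r_def power_mult_distrib mult.assoc flip: power_mult)
  then have "real (card (near_cells x)) * \<rho>^6 \<le> 27" using h_pos by simp
  then have "real (card (near_cells x)) \<le> 27 / \<rho>^6" using rho_pos by (simp add: pos_le_divide_eq)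
  then show ?thesis unfolding cell_count_def by (simp add: le_nat_floor)
qed

lemma card_near_planes: "card (near_planes x h) \<le> cell_count * N"
proof -
  have "near_planes x h \<subseteq> (\<Union>K\<in>near_cells x. H K)"
    by (auto simp: near_planes_def near_cells_def frontier_def)
  moreover have fin: "finite (near_cells x)" using finite_T by (simp add: near_cells_def)
  moreover have "finite (\<Union>K\<in>near_cells x. H K)" using fin finite_H by (auto simp: near_cells_def)
  ultimately have "card (near_planes x h) \<le> card (\<Union>K\<in>near_cells x. H K)" by (intro card_mono)
  also have "\<dots> \<le> (\<Sum>K\<in>near_cells x. card (H K))" using fin by (rule card_UN_le)
  also have "\<dots> \<le> (\<Sum>K\<in>near_cells x. N)" using card_H by (intro sum_mono) (auto simp: near_cells_def)
  also have "\<dots> = card (near_cells x) * N" by simp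
  also have "\<dots> \<le> cell_count * N" using card_near_cells by (intro mult_right_mono) auto
  finally show ?thesis .
qed

section \<open>Energy and inverse estimate\<close>

definition energy :: "((real^3) set \<Rightarrow> real^3 \<Rightarrow> real) \<Rightarrow> real" where
  "energy p = (\<Sum>i\<in>UNIV. sqn (dpw i p)) + jump_energy p / h"

lemma energy_H1h: "C1_pieces p \<Longrightarrow> (H1h_norm \<Omega> T (pw p))\<^sup>2 = energy p" "C1_pieces p \<Longrightarrow> 0 \<le> H1h_norm \<Omega> T (pw p)"
  using H1h_norm_sq[of p] h_pos by (auto simp: energy_def)

text \<open>At the scale \<open>h\<close> the two parts \<open>h^2 * gradient\<close> and
  \<open>h * jump\<close> of the modulus balance exactly as they do in the norm.\<close>

lemma tmod_energy:
  assumes "C1_pieces p"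
  shows "tmod (pw p) h ((2 + 2 * real (cell_count * N)) * h\<^sup>2 * energy p)"
proof -
  let ?M = "real (cell_count * N)" and ?S = "\<Sum>i\<in>UNIV. sqn (dpw i p)" and ?J = "jump_energy p"
  have S: "0 \<le> ?S" by (simp add: sum_nonneg)
  have J: "0 \<le> ?J" by (rule jump_energy_nonneg)
  have "2 * h\<^sup>2 * ?S + 2 * ?M * h * ?J \<le> (2 + 2 * ?M) * h\<^sup>2 * energy p"
  proof -
    have "(2 + 2 * ?M) * h\<^sup>2 * energy p = (2 * h\<^sup>2 * ?S + 2 * ?M * h * ?J) + (2 * ?M * h\<^sup>2 * ?S + 2 * h * ?J)"
      using h_pos unfolding energy_def by (simp add: field_simps power2_eq_square)
    moreover have "0 \<le> 2 * ?M * h\<^sup>2 * ?S + 2 * h * ?J" using S J h_pos by simp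
    ultimately show ?thesis by linarith
  qed
  then show ?thesis
    using tmod_pw[OF assms h_pos card_near_planes] unfolding tmod_def by (meson order_trans)
qed

lemma face_energy_diff: "face_energy (\<lambda>K x. p K x - q K x) z \<le> 2 * face_energy p z + 2 * face_energy q z"
proof -
  have sq: "(a - b)\<^sup>2 \<le> 2 * a\<^sup>2 + 2 * b\<^sup>2" for a b :: real
  proof -
    have "0 \<le> (a + b)\<^sup>2" by simp
    then show ?thesis by (simp add: power2_eq_square algebra_simps)
  qed
  let ?I = "\<lambda>K K'. indicator (frontier K \<inter> frontier K') z :: real" and ?B = "\<lambda>K. indicator (frontier K \<inter> frontier \<Omega>) z :: real"
  have "(\<Sum>K\<in>T. \<Sum>K'\<in>T - {K}. ?I K K' * ((p K z - q K z) - (p K' z - q K' z))\<^sup>2)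
    \<le> (\<Sum>K\<in>T. \<Sum>K'\<in>T - {K}. 2 * (?I K K' * (p K z - p K' z)\<^sup>2) + 2 * (?I K K' * (q K z - q K' z)\<^sup>2))"
  proof (intro sum_mono)
    fix K K'
    have "?I K K' * ((p K z - p K' z) - (q K z - q K' z))\<^sup>2 \<le> ?I K K' * (2 * (p K z - p K' z)\<^sup>2 + 2 * (q K z - q K' z)\<^sup>2)"
      by (intro mult_left_mono sq) auto
    then show "?I K K' * ((p K z - q K z) - (p K' z - q K' z))\<^sup>2 \<le> 2 * (?I K K' * (p K z - p K' z)\<^sup>2) + 2 * (?I K K' * (q K z - q K' z)\<^sup>2)"
      by (simp add: algebra_simps)
  qed
  moreover have "(\<Sum>K\<in>T. ?B K * (p K z - q K z)\<^sup>2) \<le> (\<Sum>K\<in>T. 2 * (?B K * (p K z)\<^sup>2) + 2 * (?B K * (q K z)\<^sup>2))"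
  proof (intro sum_mono)
    fix K
    have "?B K * (p K z - q K z)\<^sup>2 \<le> ?B K * (2 * (p K z)\<^sup>2 + 2 * (q K z)\<^sup>2)" by (intro mult_left_mono sq) auto
    then show "?B K * (p K z - q K z)\<^sup>2 \<le> 2 * (?B K * (p K z)\<^sup>2) + 2 * (?B K * (q K z)\<^sup>2)" by (simp add: algebra_simps)
  qed
  ultimately show ?thesis
    unfolding face_energy_def by (simp add: sum.distrib sum_distrib_left[symmetric])
qed

lemma C1_pieces_diff: "C1_pieces p \<Longrightarrow> C1_pieces q \<Longrightarrow> C1_pieces (\<lambda>K x. p K x - q K x)"
  and dpw_diff: "C1_pieces p \<Longrightarrow> C1_pieces q \<Longrightarrow> dpw i (\<lambda>K x. p K x - q K x) x = dpw i p x - dpw i q x"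
proof -
  assume p: "C1_pieces p" and q: "C1_pieces q"
  have pd: "partial_deriv i (\<lambda>x. p K x - q K x) x = partial_deriv i (p K) x - partial_deriv i (q K) x" if "K \<in> T" for K x i
    using p q that
    by (subst partial_deriv_eq[OF has_derivative_diff[OF differentiable_has_derivative differentiable_has_derivative]])
      (auto simp: C1_pieces_def partial_deriv_def)
  show "C1_pieces (\<lambda>K x. p K x - q K x)"
    using p q unfolding C1_pieces_def
  proof (intro ballI conjI allI)
    fix K i assume K: "K \<in> T"
    have "partial_deriv i (\<lambda>x. p K x - q K x) = (\<lambda>x. partial_deriv i (p K) x - partial_deriv i (q K) x)" using pd[OF K] by auto
    then show "continuous_on UNIV (partial_deriv i (\<lambda>x. p K x - q K x))"
      using p q K by (auto simp: C1_pieces_def intro!: continuous_intros)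
  qed auto
  show "dpw i (\<lambda>K x. p K x - q K x) x = dpw i p x - dpw i q x"
    unfolding dpw_def pw_def by (simp add: pd right_diff_distrib sum_subtractf)
qed

lemma sqn_diff:
  assumes "bcs f" "bcs g" shows "sqn (\<lambda>x. f x - g x) \<le> 2 * sqn f + 2 * sqn g"
  using sqn_add[OF assms(1) bcs_cmult[OF assms(2), of "-1"]] by (simp add: sqn_def)

lemma energy_diff:
  assumes p: "C1_pieces p" and q: "C1_pieces q"
  shows "energy (\<lambda>K x. p K x - q K x) \<le> 2 * energy p + 2 * energy q"
proof -
  have "(\<Sum>i\<in>UNIV. sqn (dpw i (\<lambda>K x. p K x - q K x))) \<le> (\<Sum>i\<in>UNIV. 2 * sqn (dpw i p) + 2 * sqn (dpw i q))"
    by (intro sum_mono) (simp add: dpw_diff[OF p q, abs_def] sqn_diff bcs_dpw p q)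
  moreover have "jump_energy (\<lambda>K x. p K x - q K x) \<le> 2 * jump_energy p + 2 * jump_energy q"
  proof -
    have i: "integrable lborel (\<lambda>s. face_energy f (plane_param P s))" if "C1_pieces f" "P \<in> planes" for f P
      using C1_pieces_continuous[OF that(1)] that by (intro integrable_bcs bcs_plane_param bcs_face_energy plane_planes)
    have "jump_energy (\<lambda>K x. p K x - q K x) \<le> (\<Sum>P\<in>planes. LINT s|lborel. 2 * face_energy p (plane_param P s) + 2 * face_energy q (plane_param P s))"
      unfolding jump_energy_def using i p q C1_pieces_diff[OF p q] face_energy_diff
      by (intro sum_mono integral_mono) auto
    also have "\<dots> = 2 * jump_energy p + 2 * jump_energy q"
      unfolding jump_energy_def using i p q by (simp add: sum.distrib sum_distrib_left)
    finally show ?thesis .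
  qed
  then have "jump_energy (\<lambda>K x. p K x - q K x) / h \<le> (2 * jump_energy p + 2 * jump_energy q) / h"
    using h_pos by (intro divide_right_mono) auto
  ultimately show ?thesis
    unfolding energy_def by (simp add: sum.distrib sum_distrib_left[symmetric] add_divide_distrib)
qed

text \<open>The frontier lies in a ball of radius \<open>h\<close>, which bounds its area in one
  plane. A mesh plane outside \<open>H K\<close> meets the frontier only at points that also lie on
  another mesh plane, hence in a null set.\<close>

lemma plane_frontier_area:
  assumes K: "K \<in> T" and P: "P \<in> planes"
  shows "(LINT s|lborel. indicator (frontier K) (plane_param P s)) \<le> (if P \<in> H K then 16 * h\<^sup>2 else 0)"
    "integrable lborel (\<lambda>s. indicator (frontier K) (plane_param P s) :: real)"
proof -
  note Pp = plane_planes[OF P]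
  have "bcs (\<lambda>z. indicator (frontier K \<inter> UNIV) z * (\<lambda>_. 1 :: real) z)" by (intro bcs_face_piece K) auto
  then have b: "bcs (indicator (frontier K) :: real^3 \<Rightarrow> real)" by simp
  show i: "integrable lborel (\<lambda>s. indicator (frontier K) (plane_param P s) :: real)"
    by (intro integrable_bcs bcs_plane_param b Pp)
  show "(LINT s|lborel. indicator (frontier K) (plane_param P s)) \<le> (if P \<in> H K then 16 * h\<^sup>2 else 0)"
  proof (cases "P \<in> H K")
    case True
    let ?S = "{s. plane_param P s \<in> cball (center K) h}"
    have cl: "closed ?S" using closed_vimage[OF closed_cball continuous_plane_param[OF Pp]] by (simp add: vimage_def)
    have em: "emeasure lborel ?S \<le> ennreal (16 * h\<^sup>2)" by (rule plane_param_ball_measure[OF Pp])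
    then have fin: "emeasure lborel ?S < \<infinity>" by (simp add: order_le_less_trans[OF _ ennreal_less_top])
    have "frontier K \<subseteq> cball (center K) h"
      using closure_cell_center[OF K] diameter_le_h[OF K] by (force simp: frontier_def)
    then have "(LINT s|lborel. indicator (frontier K) (plane_param P s)) \<le> (LINT s|lborel. indicator ?S s :: real)"
    proof (intro integral_mono i)
      show "integrable lborel (indicator ?S :: _ \<Rightarrow> real)" using cl fin by (intro integrable_real_indicator) auto
    qed (auto simp: indicator_def)
    also have "\<dots> = measure lborel ?S" using cl by simp
    also have "\<dots> \<le> 16 * h\<^sup>2" using em by (simp add: measure_def enn2real_leI)
    finally show ?thesis using True by simp
  next
    case False
    have "AE s in lborel. indicator (frontier K) (plane_param P s) = (0::real)"
      using generic_AE[OF P]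
    proof eventually_elim
      fix s assume g: "generic P (plane_param P s)"
      have "plane_param P s \<notin> frontier K"
      proof
        assume "plane_param P s \<in> frontier K"
        then obtain Q where "Q \<in> H K" "plane_param P s \<in> Q" using frontier_H[OF K] by blast
        then show False using g False K by (auto simp: generic_def planes_def)
      qed
      then show "indicator (frontier K) (plane_param P s) = (0::real)" by simp
    qed
    then have "(LINT s|lborel. indicator (frontier K) (plane_param P s) :: real) = 0" by (rule integral_eq_zero_AE)
    then show ?thesis using False by simp
  qed
qed

lemma frontier_count: "(\<Sum>K\<in>T. indicator (frontier K) z) \<le> real cell_count"
proof -
  have "(\<Sum>K\<in>T. indicator (frontier K) z :: real) = real (card {K\<in>T. z \<in> frontier K})"
    using finite_T by (simp add: indicator_def sum.If_cases Int_def)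
  also have "card {K\<in>T. z \<in> frontier K} \<le> card (near_cells z)"
    using finite_T h_pos by (intro card_mono) (auto simp: near_cells_def frontier_def)
  also have "\<dots> \<le> cell_count" by (rule card_near_cells)
  finally show ?thesis by simp
qed

text \<open>First the three partial derivatives, then the faces: number of cells meeting at a point,
  area of a cell boundary, squared pointwise bound. Only \<rho>, \<open>N\<close> and
  \<open>C\<close> enter.\<close>

definition inverse_factor :: "real \<Rightarrow> real" where
  "inverse_factor C = 3 * (unit_ball_vol 3 * (C / \<rho>^5)) + (2 * real cell_count + 1) * (16 * real N) * (C / \<rho>^3)"

lemma inverse_factor_nonneg: "0 \<le> C \<Longrightarrow> 0 \<le> inverse_factor C"
  using rho_pos by (simp add: inverse_factor_def)

text \<open>Pointwise bounds on the closed cell by the L2 norm on its inscribed ball serve both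
  inside and on faces. Volume \<open>h^3\<close> times \<open>h^(-5)\<close> for squared
  derivatives, and area \<open>h^2\<close> times \<open>h^(-3)\<close> for squared values with the
  weight 1/h, both give \<open>h^(-2)\<close>.\<close>

lemma inverse_estimate:
  assumes C: "inverse_constant k \<rho> C" and p: "\<And>K. K \<in> T \<Longrightarrow> p K \<in> Q_polys k"
  shows "energy p \<le> inverse_factor C / h\<^sup>2 * sqn (pw p)"
proof -
  have C0: "0 \<le> C" using C by (simp add: inverse_constant_def)
  have pc: "continuous_on UNIV (p K)" if "K \<in> T" for K using Q_polys_continuous[OF p[OF that]] .
  define I where "I = (\<lambda>K. LINT x|lborel. indicator K x * (p K x)\<^sup>2)"
  have bI: "bcs (\<lambda>x. indicator K x * (p K x)\<^sup>2)" if "K \<in> T" for K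
    using that cell_bounded cell_open pc by (intro bcs_indicator_continuous continuous_intros) auto
  have I0: "0 \<le> I K" for K by (simp add: I_def)
  have sumI: "(\<Sum>K\<in>T. I K) = sqn (pw p)"
  proof -
    have "(\<Sum>K\<in>T. I K) = (LINT x|lborel. (\<Sum>K\<in>T. indicator K x * (p K x)\<^sup>2))"
      unfolding I_def using bI by (intro Bochner_Integration.integral_sum[symmetric] integrable_bcs)
    also have "\<dots> = sqn (pw p)"
      unfolding sqn_def
    proof (intro Bochner_Integration.integral_cong refl)
      fix x
      have "(\<Sum>K\<in>T. indicator K x * (p K x)\<^sup>2) = pw (\<lambda>K x. (p K x)\<^sup>2) x" by (simp add: pw_def)
      also have "\<dots> = (pw p x)\<^sup>2" using pw_cell pw_outside by (cases "x \<in> \<Union>T") auto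
      finally show "(\<Sum>K\<in>T. indicator K x * (p K x)\<^sup>2) = (pw p x)\<^sup>2" .
    qed
    finally show ?thesis .
  qed
  have ballI: "(LINT x|lebesgue_on (ball (center K) (\<rho> * diameter K)). (p K x)\<^sup>2) \<le> I K" if K: "K \<in> T" for K
  proof -
    have m: "(\<lambda>x. (p K x)\<^sup>2) \<in> borel_measurable borel"
      using pc[OF K] by (intro borel_measurable_continuous_onI continuous_intros)
    have "(LINT x|lebesgue_on (ball (center K) (\<rho> * diameter K)). (p K x)\<^sup>2) = (LINT x|lborel. indicator (ball (center K) (\<rho> * diameter K)) x * (p K x)\<^sup>2)"
      using m by (intro integral_lebesgue_on_borel) auto
    also have "\<dots> \<le> I K"
      unfolding I_def using center_ball[OF K] integrable_bcs[OF bI[OF K]]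
      by (intro integral_mono') (auto simp: indicator_def)
    finally show ?thesis .
  qed
  have dp: "0 < diameter K" "\<rho> * h \<le> diameter K" "0 < \<rho> * h" if "K \<in> T" for K
    using diameter_pos[OF that] quasi[OF that] rho_pos h_pos by auto
  \<comment> \<open>Quasi-uniformity replaces the cell diameter by \<open>\<rho> * h\<close> in the
    denominators.\<close>
  have est: "(p K x)\<^sup>2 \<le> C / (\<rho> * h)^3 * I K" "(partial_deriv m (p K) x)\<^sup>2 \<le> C / (\<rho> * h)^5 * I K"
    if K: "K \<in> T" and x: "x \<in> closure K" for K x m
  proof -
    let ?B = "LINT x|lebesgue_on (ball (center K) (\<rho> * diameter K)). (p K x)\<^sup>2"
    have B0: "0 \<le> ?B" by simp
    have xc: "x \<in> cball (center K) (diameter K)" using closure_cell_center[OF K] x by blast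
    have e: "(p K x)\<^sup>2 \<le> C / diameter K^3 * ?B" "(partial_deriv m (p K) x)\<^sup>2 \<le> C / diameter K^5 * ?B"
      using C p[OF K] xc dp(1)[OF K] unfolding inverse_constant_def by blast+
    have "C / diameter K^n \<le> C / (\<rho> * h)^n" for n
      using dp[OF K] C0 by (intro divide_left_mono power_mono mult_pos_pos) auto
    then have m: "C / diameter K^n * ?B \<le> C / (\<rho> * h)^n * I K" for n
      using ballI[OF K] B0 C0 dp(3)[OF K] by (intro mult_mono) auto
    show "(p K x)\<^sup>2 \<le> C / (\<rho> * h)^3 * I K" "(partial_deriv m (p K) x)\<^sup>2 \<le> C / (\<rho> * h)^5 * I K"
      using e m[of 3] m[of 5] by linarith+
  qed
  have grad: "sqn (dpw m p) \<le> unit_ball_vol 3 * (C / \<rho>^5) / h\<^sup>2 * sqn (pw p)" for m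
  proof -
    have bq: "bcs (\<lambda>x. indicator K x * (partial_deriv m (p K) x)\<^sup>2)" if "K \<in> T" for K
      using that cell_bounded cell_open Q_polys_continuous_partial[OF p] by (intro bcs_indicator_continuous continuous_intros) auto
    have "sqn (dpw m p) = (LINT x|lborel. (\<Sum>K\<in>T. indicator K x * (partial_deriv m (p K) x)\<^sup>2))"
      unfolding sqn_def
    proof (intro Bochner_Integration.integral_cong refl)
      fix x
      have "(\<Sum>K\<in>T. indicator K x * (partial_deriv m (p K) x)\<^sup>2) = pw (\<lambda>K x. (partial_deriv m (p K) x)\<^sup>2) x" by (simp add: pw_def)
      also have "\<dots> = (dpw m p x)\<^sup>2" using pw_cell pw_outside by (cases "x \<in> \<Union>T") (auto simp: dpw_def)
      finally show "(dpw m p x)\<^sup>2 = (\<Sum>K\<in>T. indicator K x * (partial_deriv m (p K) x)\<^sup>2)" by simp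
    qed
    also have "\<dots> = (\<Sum>K\<in>T. LINT x|lborel. indicator K x * (partial_deriv m (p K) x)\<^sup>2)"
      using bq by (intro Bochner_Integration.integral_sum integrable_bcs)
    also have "\<dots> \<le> (\<Sum>K\<in>T. unit_ball_vol 3 * h^3 * (C / (\<rho> * h)^5 * I K))"
    proof (intro sum_mono)
      fix K assume K: "K \<in> T"
      let ?S = "cball (center K) h"
      have KS: "K \<subseteq> ?S" using closure_cell_center[OF K] diameter_le_h[OF K] closure_subset[of K] by force
      have "(LINT x|lborel. indicator K x * (partial_deriv m (p K) x)\<^sup>2) \<le> (LINT x|lborel. indicator ?S x * (C / (\<rho> * h)^5 * I K))"
      proof (intro integral_mono')
        show "integrable lborel (\<lambda>x. indicator ?S x * (C / (\<rho> * h)^5 * I K))"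
          by (intro integrable_bcs bcs_indicator_continuous) auto
        fix x
        have "(partial_deriv m (p K) x)\<^sup>2 \<le> C / (\<rho> * h)^5 * I K" if "x \<in> K"
          using est(2)[OF K, of x m] that closure_subset by blast
        moreover have "0 \<le> C / (\<rho> * h)^5 * I K" using C0 rho_pos h_pos I0 by simp
        ultimately show "indicator K x * (partial_deriv m (p K) x)\<^sup>2 \<le> indicator ?S x * (C / (\<rho> * h)^5 * I K)"
          "0 \<le> indicator ?S x * (C / (\<rho> * h)^5 * I K)" using KS by (auto simp: indicator_def)
      qed
      also have "\<dots> = measure lborel ?S * (C / (\<rho> * h)^5 * I K)" by simp
      also have "measure lborel ?S = unit_ball_vol 3 * h^3" using h_pos by (simp add: content_cball)
      finally show "(LINT x|lborel. indicator K x * (partial_deriv m (p K) x)\<^sup>2) \<le> unit_ball_vol 3 * h^3 * (C / (\<rho> * h)^5 * I K)" .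
    qed
    also have "\<dots> = unit_ball_vol 3 * h^3 * (C / (\<rho> * h)^5) * sqn (pw p)" by (simp add: sumI[symmetric] sum_distrib_left mult.assoc)
    also have "unit_ball_vol 3 * h^3 * (C / (\<rho> * h)^5) = unit_ball_vol 3 * (C / \<rho>^5) / h\<^sup>2"
      using h_pos rho_pos by (simp add: power_mult_distrib field_simps eval_nat_numeral)
    finally show ?thesis .
  qed
  define S where "S = (\<lambda>K. C / (\<rho> * h)^3 * I K)"
  have S0: "0 \<le> S K" for K using C0 rho_pos h_pos I0 by (simp add: S_def)
  \<comment> \<open>At most \<open>cell_count\<close> frontiers meet at \<open>z\<close>, so the
    double sum over pairs is at most \<open>4 * cell_count\<close> times a single sum; half of this
    plus 1 for the boundary traces is the factor.\<close>
  have face: "face_energy p z \<le> (2 * real cell_count + 1) * (\<Sum>K\<in>T. indicator (frontier K) z * S K)" for z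
  proof -
    let ?i = "\<lambda>K. indicator (frontier K) z :: real"
    have pK: "(p K z)\<^sup>2 \<le> S K" if "K \<in> T" "z \<in> frontier K" for K
      using est(1)[OF that(1)] that(2) unfolding S_def frontier_def by blast
    have "(\<Sum>K\<in>T. \<Sum>K'\<in>T - {K}. indicator (frontier K \<inter> frontier K') z * (p K z - p K' z)\<^sup>2)
       \<le> (\<Sum>K\<in>T. \<Sum>K'\<in>T. ?i K * ?i K' * (2 * S K + 2 * S K'))"
    proof (rule sum_mono)
      fix K assume K: "K \<in> T"
      have "(\<Sum>K'\<in>T - {K}. indicator (frontier K \<inter> frontier K') z * (p K z - p K' z)\<^sup>2) \<le> (\<Sum>K'\<in>T - {K}. ?i K * ?i K' * (2 * S K + 2 * S K'))"
      proof (rule sum_mono)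
        fix K' assume K': "K' \<in> T - {K}"
        have "(p K z - p K' z)\<^sup>2 \<le> 2 * (p K z)\<^sup>2 + 2 * (p K' z)\<^sup>2"
        proof -
          have "0 \<le> (p K z + p K' z)\<^sup>2" by simp
          then show ?thesis by (simp add: power2_eq_square algebra_simps)
        qed
        then show "indicator (frontier K \<inter> frontier K') z * (p K z - p K' z)\<^sup>2 \<le> ?i K * ?i K' * (2 * S K + 2 * S K')"
          using pK[of K] pK[of K'] K K' by (cases "z \<in> frontier K \<and> z \<in> frontier K'") auto
      qed
      also have "\<dots> \<le> (\<Sum>K'\<in>T. ?i K * ?i K' * (2 * S K + 2 * S K'))"
        using finite_T S0 by (intro sum_mono2) auto
      finally show "(\<Sum>K'\<in>T - {K}. indicator (frontier K \<inter> frontier K') z * (p K z - p K' z)\<^sup>2) \<le> (\<Sum>K'\<in>T. ?i K * ?i K' * (2 * S K + 2 * S K'))" .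
    qed
    also have "\<dots> = 2 * ((\<Sum>K\<in>T. ?i K * S K) * (\<Sum>K\<in>T. ?i K)) + 2 * ((\<Sum>K\<in>T. ?i K) * (\<Sum>K\<in>T. ?i K * S K))"
      unfolding sum_product by (simp add: sum.distrib sum_distrib_left algebra_simps)
    also have "\<dots> = 4 * ((\<Sum>K\<in>T. ?i K) * (\<Sum>K\<in>T. ?i K * S K))" by simp
    also have "\<dots> \<le> 4 * (real cell_count * (\<Sum>K\<in>T. ?i K * S K))"
      using S0 by (intro mult_left_mono mult_right_mono frontier_count sum_nonneg) auto
    finally have 1: "(\<Sum>K\<in>T. \<Sum>K'\<in>T - {K}. indicator (frontier K \<inter> frontier K') z * (p K z - p K' z)\<^sup>2)
       \<le> 4 * (real cell_count * (\<Sum>K\<in>T. ?i K * S K))" .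
    have 2: "(\<Sum>K\<in>T. indicator (frontier K \<inter> frontier \<Omega>) z * (p K z)\<^sup>2) \<le> (\<Sum>K\<in>T. ?i K * S K)"
      using pK S0 by (intro sum_mono) (auto simp: indicator_def)
    show ?thesis unfolding face_energy_def using 1 2 by (simp add: algebra_simps)
  qed
  have ij: "integrable lborel (\<lambda>s. face_energy p (plane_param P s))" if "P \<in> planes" for P
    using that pc by (intro integrable_bcs bcs_plane_param bcs_face_energy plane_planes)
  have "jump_energy p \<le> (\<Sum>P\<in>planes. (2 * real cell_count + 1) * (\<Sum>K\<in>T. (LINT s|lborel. indicator (frontier K) (plane_param P s)) * S K))"
    unfolding jump_energy_def
  proof (rule sum_mono)
    fix P assume P: "P \<in> planes"
    have i: "integrable lborel (\<lambda>s. indicator (frontier K) (plane_param P s) * S K)" if "K \<in> T" for K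
      using plane_frontier_area(2)[OF that P] by simp
    have "(LINT s|lborel. face_energy p (plane_param P s)) \<le> (LINT s|lborel. (2 * real cell_count + 1) * (\<Sum>K\<in>T. indicator (frontier K) (plane_param P s) * S K))"
      using i by (intro integral_mono ij P face) auto
    also have "\<dots> = (2 * real cell_count + 1) * (\<Sum>K\<in>T. (LINT s|lborel. indicator (frontier K) (plane_param P s)) * S K)"
      using i by (simp add: Bochner_Integration.integral_sum)
    finally show "(LINT s|lborel. face_energy p (plane_param P s)) \<le> (2 * real cell_count + 1) * (\<Sum>K\<in>T. (LINT s|lborel. indicator (frontier K) (plane_param P s)) * S K)" .
  qed
  also have "\<dots> = (2 * real cell_count + 1) * (\<Sum>K\<in>T. (\<Sum>P\<in>planes. LINT s|lborel. indicator (frontier K) (plane_param P s)) * S K)"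
    by (simp add: sum_distrib_left[symmetric] sum_distrib_right sum.swap[of _ planes])
  also have "\<dots> \<le> (2 * real cell_count + 1) * (\<Sum>K\<in>T. (16 * real N * h\<^sup>2) * S K)"
  proof (intro mult_left_mono sum_mono mult_right_mono S0)
    fix K assume K: "K \<in> T"
    have sub: "H K \<subseteq> planes" using K by (auto simp: planes_def)
    have "(\<Sum>P\<in>planes. LINT s|lborel. indicator (frontier K) (plane_param P s) :: real) \<le> (\<Sum>P\<in>planes. if P \<in> H K then 16 * h\<^sup>2 else 0)"
      by (intro sum_mono plane_frontier_area K)
    also have "\<dots> = (\<Sum>P\<in>H K. 16 * h\<^sup>2)" using sub finite_planes by (simp add: sum.If_cases Int_absorb1)
    also have "\<dots> = real (card (H K)) * (16 * h\<^sup>2)" by simp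
    also have "\<dots> \<le> real N * (16 * h\<^sup>2)" using card_H[OF K] by (intro mult_right_mono) auto
    finally show "(\<Sum>P\<in>planes. LINT s|lborel. indicator (frontier K) (plane_param P s) :: real) \<le> 16 * real N * h\<^sup>2" by simp
  qed auto
  also have "\<dots> = (2 * real cell_count + 1) * (16 * real N * h\<^sup>2) * (C / (\<rho> * h)^3) * sqn (pw p)"
    by (simp add: S_def sumI[symmetric] sum_distrib_left mult.assoc)
  finally have "jump_energy p / h \<le> ((2 * real cell_count + 1) * (16 * real N * h\<^sup>2) * (C / (\<rho> * h)^3) * sqn (pw p)) / h"
    using h_pos by (intro divide_right_mono) auto
  also have "\<dots> = (2 * real cell_count + 1) * (16 * real N) * (C / \<rho>^3) / h\<^sup>2 * sqn (pw p)"
  proof -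
    define X where "X = C / (\<rho> * h)^3"
    have X: "(h\<^sup>2 * X) / h = C / \<rho>^3 / h\<^sup>2"
      using h_pos rho_pos unfolding X_def by (simp add: power_mult_distrib field_simps eval_nat_numeral)
    have "(a * (b * h\<^sup>2) * X * s) / h = a * b * ((h\<^sup>2 * X) / h) * s" for a b s by (simp add: mult_ac)
    then show ?thesis unfolding X_def[symmetric] X by simp
  qed
  finally have jump: "jump_energy p / h \<le> (2 * real cell_count + 1) * (16 * real N) * (C / \<rho>^3) / h\<^sup>2 * sqn (pw p)" .
  have "(\<Sum>m\<in>(UNIV::3 set). sqn (dpw m p)) \<le> (\<Sum>m\<in>(UNIV::3 set). unit_ball_vol 3 * (C / \<rho>^5) / h\<^sup>2 * sqn (pw p))"
    by (intro sum_mono grad)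
  then have "(\<Sum>m\<in>(UNIV::3 set). sqn (dpw m p)) \<le> 3 * (unit_ball_vol 3 * (C / \<rho>^5)) / h\<^sup>2 * sqn (pw p)" by simp
  then show ?thesis using jump unfolding energy_def inverse_factor_def add_divide_distrib distrib_right by linarith
qed

section \<open>Finite element spaces and projections\<close>

lemma C1_pieces_Q: "(\<And>K. K \<in> T \<Longrightarrow> p K \<in> Q_polys k) \<Longrightarrow> C1_pieces p"
  unfolding C1_pieces_def using Q_polys_differentiable Q_polys_continuous_partial by blast

lemma V_space_repr:
  assumes "q \<in> V_space k T"
  obtains p where "\<And>K. K \<in> T \<Longrightarrow> p K \<in> Q_polys k" "q = pw p" "C1_pieces p"
proof -
  have "\<forall>K\<in>T. \<exists>p\<in>Q_polys k. \<forall>x\<in>K. q x = p x" using assms by (simp add: V_space_def)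
  then obtain p where p: "\<And>K. K \<in> T \<Longrightarrow> p K \<in> Q_polys k" "\<And>K x. K \<in> T \<Longrightarrow> x \<in> K \<Longrightarrow> q x = p K x" by metis
  have "q x = pw p x" for x
  proof (cases "x \<in> \<Union>T")
    case True
    then show ?thesis using p(2) pw_cell by auto
  next
    case False
    then show ?thesis using assms pw_outside by (simp add: V_space_def)
  qed
  then have "q = pw p" by blast
  moreover have "C1_pieces p" by (rule C1_pieces_Q) (rule p(1))
  ultimately show thesis using p(1) by (intro that[of p])
qed

lemma pw_V_space:
  assumes "\<And>K. K \<in> T \<Longrightarrow> p K \<in> Q_polys k" shows "pw p \<in> V_space k T"
  unfolding V_space_def using assms pw_cell pw_outside by auto

lemma lin_set_V: "lin_set (V_space k T)"
  unfolding lin_set_def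
proof (intro conjI ballI allI)
  show "(\<lambda>_. 0) \<in> V_space k T"
    using lin_set_zero[OF lin_set_Q_polys] by (force simp: V_space_def)
  fix f g a assume "f \<in> V_space k T" "g \<in> V_space k T"
  then obtain p q where p: "\<And>K. K \<in> T \<Longrightarrow> p K \<in> Q_polys k" "f = pw p" and q: "\<And>K. K \<in> T \<Longrightarrow> q K \<in> Q_polys k" "g = pw q"
    using V_space_repr by metis
  have "(\<lambda>x. f x + a * g x) = pw (\<lambda>K x. p K x + a * q K x)" by (auto simp: p q pw_comb)
  also have "\<dots> \<in> V_space k T" using p q lin_set_comb[OF lin_set_Q_polys] by (intro pw_V_space) blast
  finally show "(\<lambda>x. f x + a * g x) \<in> V_space k T" .
qed

lemma V_space_bcs: "q \<in> V_space k T \<Longrightarrow> bcs q"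
  using V_space_repr C1_pieces_continuous bcs_pw by metis

lemma V_space_L2: "q \<in> V_space k T \<Longrightarrow> q \<in> L2_space \<Omega>"
  by (intro bcs_L2 open_dom bounded_dom V_space_bcs)

lemma V_space_off_dom: "q \<in> V_space k T \<Longrightarrow> x \<notin> \<Omega> \<Longrightarrow> q x = 0"
  using Sup_least[of T \<Omega>, OF cell_subset] unfolding V_space_def by blast

lemma L2_inner_dom:
  assumes "bcs f" "bcs g" "\<And>x. x \<notin> \<Omega> \<Longrightarrow> f x = 0"
  shows "L2_inner \<Omega> f g = (LINT x|lborel. f x * g x)"
proof -
  have "L2_inner \<Omega> f g = (LINT x|lborel. indicator \<Omega> x * (f x * g x))"
    using assms by (intro L2_inner_lborel open_dom bcs_measurable)
  also have "(\<lambda>x. indicator \<Omega> x * (f x * g x)) = (\<lambda>x. f x * g x)" by (intro ext) (auto simp: indicator_def assms(3))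
  finally show ?thesis .
qed

lemma L2_norm_sqn: "bcs f \<Longrightarrow> (\<And>x. x \<notin> \<Omega> \<Longrightarrow> f x = 0) \<Longrightarrow> (L2_norm \<Omega> f)\<^sup>2 = sqn f"
  unfolding L2_norm_sq_inner unfolding sqn_def power2_eq_square by (rule L2_inner_dom)

lemma L2_norm_le_sqn: assumes "bcs f" shows "L2_norm \<Omega> f \<le> sqrt (sqn f)"
proof (rule real_le_rsqrt)
  have "(L2_norm \<Omega> f)\<^sup>2 = (LINT x|lborel. indicator \<Omega> x * (f x * f x))"
    unfolding L2_norm_sq_inner using assms by (intro L2_inner_lborel open_dom bcs_measurable)
  also have "\<dots> \<le> sqn f"
    unfolding sqn_def using assms
    by (intro integral_mono') (auto simp: indicator_def power2_eq_square intro: integrable_bcs bcs_prod)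
  finally show "(L2_norm \<Omega> f)\<^sup>2 \<le> sqn f" .
qed

lemma V_space_zero:
  assumes "q \<in> V_space k T" "sqn q = 0"
  shows "q = (\<lambda>_. 0)"
proof -
  obtain p where p: "\<And>K. K \<in> T \<Longrightarrow> p K \<in> Q_polys k" "q = pw p" "C1_pieces p"
    by (rule V_space_repr[OF assms(1)], rule that) auto
  have bq: "bcs q" using V_space_bcs[OF assms(1)] .
  have "q x = 0" if K: "K \<in> T" "x \<in> K" for K x
  proof -
    have mp: "(\<lambda>x. (p K x)\<^sup>2) \<in> borel_measurable borel"
      using C1_pieces_continuous[OF p(3) K(1)] by (intro borel_measurable_continuous_onI continuous_intros)
    have bp: "bcs (\<lambda>x. indicator K x * (p K x)\<^sup>2)"
      using K cell_bounded cell_open C1_pieces_continuous[OF p(3)] by (intro bcs_indicator_continuous continuous_intros) auto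
    have eq: "(LINT x|lebesgue_on K. (p K x)\<^sup>2) = (LINT x|lborel. indicator K x * (p K x)\<^sup>2)"
      "integrable (lebesgue_on K) (\<lambda>x. (p K x)\<^sup>2)"
      using integral_lebesgue_on_borel[of K, OF _ mp] cell_open[OF K(1)] integrable_bcs[OF bp] by auto
    have "(LINT x|lborel. indicator K x * (p K x)\<^sup>2) \<le> sqn q"
      unfolding sqn_def using integrable_bcs[OF bcs_power2[OF bq]] pw_cell[OF K(1)] p(2)
      by (intro integral_mono') (auto simp: indicator_def)
    then have "(LINT x|lebesgue_on K. (p K x)\<^sup>2) = 0" using eq(1) assms(2) by (simp add: antisym)
    then have "p K x = 0"
      using continuous_square_integral_zero[OF cell_open[OF K(1)] continuous_on_subset[OF C1_pieces_continuous[OF p(3) K(1)]] eq(2)] K by auto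
    then show ?thesis using p(2) pw_cell[OF K] by simp
  qed
  moreover have "q x = 0" if "x \<notin> \<Union>T" for x using assms(1) that by (simp add: V_space_def)
  ultimately show ?thesis by (intro ext) blast
qed

definition realize :: "nat \<Rightarrow> ((real^3) set \<times> nat \<times> nat \<times> nat \<Rightarrow> real) \<Rightarrow> real^3 \<Rightarrow> real" where
  "realize k c = pw (\<lambda>K. qpoly k (\<lambda>t. c (K, t)))"

lemma realize_comb: "realize k (\<lambda>t. c t + a * d t) x = realize k c x + a * realize k d x"
proof -
  have "qpoly k (\<lambda>t. c (K, t) + a * d (K, t)) = (\<lambda>x. qpoly k (\<lambda>t. c (K, t)) x + a * qpoly k (\<lambda>t. d (K, t)) x)" for K
    by (intro ext qpoly_comb)
  then show ?thesis unfolding realize_def by (simp add: pw_comb[symmetric])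
qed

text \<open>Functions are parametrized by their coefficients, which provides the finite set of evaluation
  functionals.\<close>
lemma V_space_riesz:
  assumes W: "lin_set W" "W \<subseteq> V_space k T" and B: "semi_inner_on W B"
    and F: "linear_form_on W F" "\<And>w. w \<in> W \<Longrightarrow> B w w = 0 \<Longrightarrow> F w = 0"
  shows "\<exists>p\<in>W. \<forall>w\<in>W. B p w = F w"
proof -
  define X where "X = T \<times> {..k} \<times> {..k} \<times> {..k}"
  define W' where "W' = {c. (\<forall>t. t \<notin> X \<longrightarrow> c t = 0) \<and> realize k c \<in> W}"
  have rc: "realize k (\<lambda>t. c t + a * d t) = (\<lambda>x. realize k c x + a * realize k d x)" for c d a
    by (auto simp: realize_comb)
  have r0: "realize k (\<lambda>_. 0) = (\<lambda>_. 0)" by (auto simp: realize_def pw_def qpoly_def)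
  have lin: "lin_set W'"
    unfolding lin_set_def W'_def using lin_set_zero[OF W(1)] lin_set_comb[OF W(1)] by (auto simp: rc r0)
  have onto: "\<exists>c\<in>W'. realize k c = w" if w: "w \<in> W" for w
  proof -
    obtain p where p: "\<And>K. K \<in> T \<Longrightarrow> p K \<in> Q_polys k" "w = pw p" using V_space_repr w W(2) by (metis subsetD)
    have "\<forall>K\<in>T. \<exists>c. p K = qpoly k c" using p(1) by (auto simp: Q_polys_eq)
    then obtain c where c: "\<And>K. K \<in> T \<Longrightarrow> p K = qpoly k (c K)" by metis
    define d where "d = (\<lambda>(K, t). if (K, t) \<in> X then c K t else 0)"
    have "realize k d = w"
    proof
      fix x
      have "qpoly k (\<lambda>t. d (K, t)) x = p K x" if "K \<in> T" for K
        unfolding c[OF that] qpoly_def using that by (auto simp: d_def X_def intro!: sum.cong)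
      then show "realize k d x = w x" by (simp add: realize_def p(2) pw_def)
    qed
    then show ?thesis using w by (intro bexI[of _ d]) (auto simp: W'_def d_def)
  qed
  have "\<exists>c\<in>W'. \<forall>d\<in>W'. B (realize k c) (realize k d) = F (realize k d)"
  proof (rule finite_dim_riesz[where X = X and F = "\<lambda>d. F (realize k d)" and B = "\<lambda>c d. B (realize k c) (realize k d)", OF _ lin])
    show "finite X" using finite_T by (simp add: X_def)
    show "w = (\<lambda>_. 0)" if "w \<in> W'" "\<And>x. x \<in> X \<Longrightarrow> w x = 0" for w
    proof
      fix t show "w t = 0" using that(1) that(2)[of t] unfolding W'_def by (cases "t \<in> X") blast+
    qed
    show "semi_inner_on W' (\<lambda>c d. B (realize k c) (realize k d))"
      using B unfolding semi_inner_on_def W'_def by (simp add: rc)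
    show "linear_form_on W' (\<lambda>d. F (realize k d))"
      using F(1) unfolding linear_form_on_def W'_def by (simp add: rc)
    show "F (realize k w) = 0" if "w \<in> W'" "B (realize k w) (realize k w) = 0" for w
      using F(2) that by (simp add: W'_def)
  qed
  then obtain c where c: "c \<in> W'" "\<And>d. d \<in> W' \<Longrightarrow> B (realize k c) (realize k d) = F (realize k d)" by blast
  have "B (realize k c) w = F w" if w: "w \<in> W" for w
  proof -
    obtain d where "d \<in> W'" "realize k d = w" using onto[OF w] by blast
    then show ?thesis using c(2) by blast
  qed
  moreover have "realize k c \<in> W" using c(1) by (simp add: W'_def)
  ultimately show ?thesis by blast
qed

text \<open>Justifies the definite description. Existence comes from the Riesz argument; uniqueness
  as functions and not merely as classes holds because an element of \<open>V_space\<close> of norm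
  zero vanishes on the open cells and is 0 elsewhere by definition.\<close>

lemma L2_projection_spec:
  assumes W: "lin_set W" "W \<subseteq> V_space k T" and q: "q \<in> L2_space \<Omega>"
  shows "L2_projection \<Omega> W q \<in> W" "\<And>w. w \<in> W \<Longrightarrow> L2_inner \<Omega> (\<lambda>x. q x - L2_projection \<Omega> W q x) w = 0"
proof -
  have WL: "W \<subseteq> L2_space \<Omega>" using W(2) V_space_L2 by blast
  have "\<exists>p\<in>W. \<forall>w\<in>W. L2_inner \<Omega> p w = L2_inner \<Omega> q w"
  proof (rule V_space_riesz[OF W])
    show "semi_inner_on W (L2_inner \<Omega>)" by (rule semi_inner_mono[OF semi_inner_L2 WL])
    show "linear_form_on W (L2_inner \<Omega> q)"
      unfolding linear_form_on_def using semi_inner_right[OF lin_set_L2 semi_inner_L2 _ _ q] WL by blast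
    fix w assume w: "w \<in> W" "L2_inner \<Omega> w w = 0"
    then have "L2_norm \<Omega> w = 0" by (simp add: L2_norm_def)
    then show "L2_inner \<Omega> q w = 0" using L2_inner_le[OF q, of w] w WL by auto
  qed
  then obtain p where p: "p \<in> W" "\<And>w. w \<in> W \<Longrightarrow> L2_inner \<Omega> p w = L2_inner \<Omega> q w" by blast
  have ex1: "\<exists>!p. p \<in> W \<and> (\<forall>w\<in>W. L2_inner \<Omega> (\<lambda>x. q x - p x) w = 0)"
  proof (rule ex1I[of _ p])
    show "p \<in> W \<and> (\<forall>w\<in>W. L2_inner \<Omega> (\<lambda>x. q x - p x) w = 0)"
    proof (intro conjI ballI p(1))
      fix w assume w: "w \<in> W"
      then show "L2_inner \<Omega> (\<lambda>x. q x - p x) w = 0" using L2_inner_comb(3)[OF q, of p w] p WL by auto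
    qed
    fix p' assume p': "p' \<in> W \<and> (\<forall>w\<in>W. L2_inner \<Omega> (\<lambda>x. q x - p' x) w = 0)"
    define d where "d = (\<lambda>x. p' x - p x)"
    have d: "d \<in> W" unfolding d_def using lin_set_diff[OF W(1)] p p' by blast
    have L: "p \<in> L2_space \<Omega>" "p' \<in> L2_space \<Omega>" "d \<in> L2_space \<Omega>" using p p' d WL by auto
    have "L2_inner \<Omega> d d = L2_inner \<Omega> p' d - L2_inner \<Omega> p d" unfolding d_def[abs_def] using L2_inner_comb(3)[OF L(2,1,3)] by (simp add: d_def)
    moreover have "L2_inner \<Omega> p' d = L2_inner \<Omega> q d" using p' d L2_inner_comb(3)[OF q L(2,3)] by auto
    ultimately have "L2_inner \<Omega> d d = 0" using p(2)[OF d] by simp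
    moreover have dV: "d \<in> V_space k T" using d W(2) by blast
    ultimately have "sqn d = 0"
      using L2_norm_sqn[OF V_space_bcs[OF dV] V_space_off_dom[OF dV]] by (simp add: L2_norm_sq_inner)
    then have "d = (\<lambda>_. 0)" using V_space_zero d W(2) by blast
    then show "p' = p" unfolding d_def by (metis (no_types, lifting) eq_iff_diff_eq_0 ext)
  qed
  from theI'[OF ex1] show "L2_projection \<Omega> W q \<in> W" "\<And>w. w \<in> W \<Longrightarrow> L2_inner \<Omega> (\<lambda>x. q x - L2_projection \<Omega> W q x) w = 0"
    unfolding L2_projection_def by blast+
qed

lemma L2_projection_best:
  assumes W: "lin_set W" "W \<subseteq> V_space k T" and q: "q \<in> V_space k T" and w: "w \<in> W"
  shows "sqn (\<lambda>x. q x - L2_projection \<Omega> W q x) \<le> sqn (\<lambda>x. q x - w x)"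
proof -
  define P where "P = L2_projection \<Omega> W q"
  have P: "P \<in> W" "\<And>v. v \<in> W \<Longrightarrow> L2_inner \<Omega> (\<lambda>x. q x - P x) v = 0"
    using L2_projection_spec[OF W V_space_L2[OF q]] by (auto simp: P_def)
  define a where "a = (\<lambda>x. q x - P x)"
  define b where "b = (\<lambda>x. P x - w x)"
  have bW: "b \<in> W" unfolding b_def using lin_set_diff[OF W(1)] P w by blast
  have aV: "a \<in> V_space k T" unfolding a_def using lin_set_diff[OF lin_set_V] q P(1) W(2) by blast
  have bV: "b \<in> V_space k T" using bW W(2) by blast
  have cV: "(\<lambda>x. q x - w x) \<in> V_space k T" using lin_set_diff[OF lin_set_V] q w W(2) by blast
  have ab: "L2_inner \<Omega> a b = 0" using P(2)[OF bW] by (simp add: a_def)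
  have "L2_inner \<Omega> (\<lambda>x. a x + 1 * b x) (\<lambda>x. a x + 1 * b x) = L2_inner \<Omega> a a + 2 * 1 * L2_inner \<Omega> a b + 1\<^sup>2 * L2_inner \<Omega> b b"
    by (rule semi_inner_expand[OF lin_set_L2 semi_inner_L2 V_space_L2[OF aV] V_space_L2[OF bV]])
  moreover have "(\<lambda>x. a x + 1 * b x) = (\<lambda>x. q x - w x)" by (auto simp: a_def b_def)
  ultimately have "(L2_norm \<Omega> (\<lambda>x. q x - w x))\<^sup>2 = (L2_norm \<Omega> a)\<^sup>2 + (L2_norm \<Omega> b)\<^sup>2"
    by (simp add: L2_norm_sq_inner ab)
  then have "(L2_norm \<Omega> a)\<^sup>2 \<le> (L2_norm \<Omega> (\<lambda>x. q x - w x))\<^sup>2" by simp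
  then have "sqn a \<le> sqn (\<lambda>x. q x - w x)"
    using L2_norm_sqn[OF V_space_bcs[OF aV] V_space_off_dom[OF aV]] L2_norm_sqn[OF V_space_bcs[OF cV] V_space_off_dom[OF cV]] by simp
  then show ?thesis by (simp add: a_def P_def)
qed

text \<open>Write \<open>P\<close> as \<open>q\<close> minus the error. The inverse estimate costs
  \<open>h^(-2)\<close> on the squared error, which the bound \<open>err\<close> provides; the two
  2s come from \<open>energy_diff\<close>.\<close>

lemma stability_from_L2_error:
  assumes C: "inverse_constant k \<rho> C" and q: "q \<in> V_space k T" and P: "P \<in> V_space k T"
    and err: "sqn (\<lambda>x. q x - P x) \<le> D * h\<^sup>2 * (H1h_norm \<Omega> T q)\<^sup>2"
  shows "H1h_norm \<Omega> T P \<le> sqrt (2 + 2 * (inverse_factor C * D)) * H1h_norm \<Omega> T q"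
proof -
  obtain p where p: "\<And>K. K \<in> T \<Longrightarrow> p K \<in> Q_polys k" "q = pw p" "C1_pieces p"
    by (rule V_space_repr[OF q], rule that) auto
  obtain p' where p': "\<And>K. K \<in> T \<Longrightarrow> p' K \<in> Q_polys k" "P = pw p'" "C1_pieces p'"
    by (rule V_space_repr[OF P], rule that) auto
  define d where "d = (\<lambda>K x. p K x - p' K x)"
  have dQ: "d K \<in> Q_polys k" if "K \<in> T" for K unfolding d_def using lin_set_diff[OF lin_set_Q_polys] p(1) p'(1) that by blast
  have dC: "C1_pieces d" by (rule C1_pieces_Q[OF dQ])
  have "pw d = (\<lambda>x. q x - P x)" by (auto simp: d_def p(2) p'(2) pw_def right_diff_distrib sum_subtractf)
  moreover have "energy d \<le> inverse_factor C / h\<^sup>2 * sqn (pw d)" by (rule inverse_estimate[OF C]) (rule dQ)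
  ultimately have "energy d \<le> inverse_factor C / h\<^sup>2 * sqn (\<lambda>x. q x - P x)" by simp
  also have "\<dots> \<le> inverse_factor C / h\<^sup>2 * (D * h\<^sup>2 * (H1h_norm \<Omega> T q)\<^sup>2)"
    using err inverse_factor_nonneg[of C] C by (intro mult_left_mono) (auto simp: inverse_constant_def)
  also have "\<dots> = inverse_factor C * D * energy p" using h_pos energy_H1h[OF p(3)] p(2) by simp
  finally have ed: "energy d \<le> inverse_factor C * D * energy p" .
  have "(\<lambda>K x. p K x - d K x) = p'" by (auto simp: d_def)
  then have "energy p' \<le> 2 * energy p + 2 * energy d" using energy_diff[OF p(3) dC] by simp
  also have "\<dots> \<le> (2 + 2 * (inverse_factor C * D)) * energy p" using ed by (simp add: distrib_right)
  finally have "energy p' \<le> (2 + 2 * (inverse_factor C * D)) * energy p" .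
  then have "sqrt (energy p') \<le> sqrt (2 + 2 * (inverse_factor C * D)) * sqrt (energy p)"
    by (metis real_sqrt_le_mono real_sqrt_mult)
  moreover have "H1h_norm \<Omega> T P = sqrt (energy p')" "H1h_norm \<Omega> T q = sqrt (energy p)"
    using energy_H1h[OF p(3)] energy_H1h[OF p'(3)] p(2) p'(2) by (metis real_sqrt_unique)+
  ultimately show ?thesis by simp
qed

lemma frontier_trace: "K \<in> T \<Longrightarrow> C1_pieces p \<Longrightarrow> z \<in> frontier K \<Longrightarrow> cell_trace K (pw p) z = p K z"
  by (rule cell_trace_pw) (auto simp: C1_pieces_continuous frontier_def)

section \<open>Spaces with zero trace and the discontinuous projection\<close>

lemma lin_set_V0: "lin_set (V0_space k \<Omega> T)"
  unfolding lin_set_def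
proof (intro conjI ballI allI)
  have "(\<lambda>_. 0) \<in> V_space k T" by (rule lin_set_zero[OF lin_set_V])
  moreover have "cell_trace K (\<lambda>_. 0) z = 0" if "K \<in> T" "z \<in> frontier K" for K z
  proof -
    have "C1_pieces (\<lambda>_ _. 0)" by (auto simp: C1_pieces_def)
    moreover have "pw (\<lambda>_ _. 0) = (\<lambda>_. 0)" by (auto simp: pw_def)
    ultimately show ?thesis using frontier_trace[of K "\<lambda>_ _. 0" z] that by simp
  qed
  ultimately show "(\<lambda>_. 0) \<in> V0_space k \<Omega> T" by (auto simp: V0_space_def surface_AE_def intro!: AE_I2)
  fix f g a assume fg: "f \<in> V0_space k \<Omega> T" "g \<in> V0_space k \<Omega> T"
  then have V: "f \<in> V_space k T" "g \<in> V_space k T" by (auto simp: V0_space_def)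
  obtain p where p: "\<And>K. K \<in> T \<Longrightarrow> p K \<in> Q_polys k" "f = pw p" "C1_pieces p"
    by (rule V_space_repr[OF V(1)], rule that) auto
  obtain q where q: "\<And>K. K \<in> T \<Longrightarrow> q K \<in> Q_polys k" "g = pw q" "C1_pieces q"
    by (rule V_space_repr[OF V(2)], rule that) auto
  let ?r = "\<lambda>K x. p K x + a * q K x"
  have rQ: "?r K \<in> Q_polys k" if "K \<in> T" for K using lin_set_comb[OF lin_set_Q_polys p(1)[OF that] q(1)[OF that]] .
  have r: "(\<lambda>x. f x + a * g x) = pw ?r" by (auto simp: p q pw_comb)
  have "surface_AE (frontier K \<inter> frontier \<Omega>) (\<lambda>x. cell_trace K (\<lambda>x. f x + a * g x) x = 0)" if K: "K \<in> T" for K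
    unfolding surface_AE_def
  proof (intro allI impI)
    fix P assume "is_plane P"
    then have "AE x in plane_measure P. x \<in> frontier K \<inter> frontier \<Omega> \<longrightarrow> cell_trace K f x = 0"
      "AE x in plane_measure P. x \<in> frontier K \<inter> frontier \<Omega> \<longrightarrow> cell_trace K g x = 0"
      using fg K by (auto simp: V0_space_def surface_AE_def)
    then show "AE x in plane_measure P. x \<in> frontier K \<inter> frontier \<Omega> \<longrightarrow> cell_trace K (\<lambda>x. f x + a * g x) x = 0"
    proof eventually_elim
      fix x assume 1: "x \<in> frontier K \<inter> frontier \<Omega> \<longrightarrow> cell_trace K f x = 0" "x \<in> frontier K \<inter> frontier \<Omega> \<longrightarrow> cell_trace K g x = 0"
      show "x \<in> frontier K \<inter> frontier \<Omega> \<longrightarrow> cell_trace K (\<lambda>x. f x + a * g x) x = 0"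
        using 1 frontier_trace[OF K p(3)] frontier_trace[OF K q(3)] frontier_trace[OF K C1_pieces_Q[OF rQ]]
        unfolding r by (simp add: p(2) q(2))
    qed
  qed
  then show "(\<lambda>x. f x + a * g x) \<in> V0_space k \<Omega> T"
    using lin_set_comb[OF lin_set_V V] by (simp add: V0_space_def)
qed

lemma V0_V: "V0_space k \<Omega> T \<subseteq> V_space k T" by (auto simp: V0_space_def)

lemma S0_V: "S0_space k \<Omega> T \<subseteq> V_space k T" by (auto simp: V0_space_def S0_space_def)

lemma lin_set_S0: "lin_set (S0_space k \<Omega> T)"
  unfolding lin_set_def
proof (intro conjI ballI allI)
  have "continuous_on (closure \<Omega>) (\<lambda>_. 0 :: real)" by simp
  then show "(\<lambda>_. 0) \<in> S0_space k \<Omega> T"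
    using lin_set_zero[OF lin_set_V0[of k]] unfolding S0_space_def by (auto intro!: exI[of _ "\<lambda>_. 0"])
  fix f g a assume fg: "f \<in> S0_space k \<Omega> T" "g \<in> S0_space k \<Omega> T"
  obtain f' where f': "continuous_on (closure \<Omega>) f'" "\<forall>x\<in>\<Union>T. f x = f' x" using fg unfolding S0_space_def by blast
  obtain g' where g': "continuous_on (closure \<Omega>) g'" "\<forall>x\<in>\<Union>T. g x = g' x" using fg unfolding S0_space_def by blast
  have "(\<lambda>x. f x + a * g x) \<in> V0_space k \<Omega> T" using lin_set_comb[OF lin_set_V0] fg by (auto simp: S0_space_def)
  moreover have "continuous_on (closure \<Omega>) (\<lambda>x. f' x + a * g' x)" using f' g' by (intro continuous_intros)
  moreover have "\<forall>x\<in>\<Union>T. f x + a * g x = f' x + a * g' x" using f' g' by simp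
  ultimately show "(\<lambda>x. f x + a * g x) \<in> S0_space k \<Omega> T" unfolding S0_space_def by blast
qed

text \<open>On closed cells the pieces agree with the common continuous extension, so interior jumps
  vanish everywhere; boundary traces vanish for almost every parameter of each plane.\<close>

lemma S0_jump_energy:
  assumes w: "pw p \<in> S0_space k \<Omega> T" and p: "C1_pieces p"
  shows "jump_energy p = 0"
proof -
  obtain f where f: "continuous_on (closure \<Omega>) f" "\<And>x. x \<in> \<Union>T \<Longrightarrow> pw p x = f x"
    using w unfolding S0_space_def by blast
  have eq: "p K z = f z" if K: "K \<in> T" "z \<in> closure K" for K z
  proof -
    have "closure K \<subseteq> closure \<Omega>" using cell_subset[OF K(1)] by (rule closure_mono)
    then have "continuous_on (closure K) (\<lambda>x. p K x - f x)"
      using continuous_on_subset[OF f(1)] continuous_on_subset[OF C1_pieces_continuous[OF p K(1)]] by (intro continuous_intros) auto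
    moreover have "p K x - f x = 0" if "x \<in> K" for x using f(2)[of x] pw_cell[OF K(1) that, of p] K(1) that by auto
    ultimately have "p K z - f z = 0" using continuous_constant_on_closure[of K "\<lambda>x. p K x - f x" 0 z] K(2) by auto
    then show ?thesis by simp
  qed
  show ?thesis
    unfolding jump_energy_def
  proof (intro sum.neutral ballI)
    fix P assume P: "P \<in> planes"
    have "AE s in lborel. \<forall>K\<in>T. plane_param P s \<in> frontier K \<inter> frontier \<Omega> \<longrightarrow> cell_trace K (pw p) (plane_param P s) = 0"
    proof (subst AE_finite_all[OF finite_T], rule ballI)
      fix K assume K: "K \<in> T"
      have "AE x in plane_measure P. x \<in> frontier K \<inter> frontier \<Omega> \<longrightarrow> cell_trace K (pw p) x = 0"
        using w K plane_planes[OF P] by (auto simp: S0_space_def V0_space_def surface_AE_def)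
      note ae = this[unfolded plane_measure_eq]
      have mm: "plane_param P \<in> lborel \<rightarrow>\<^sub>M borel" using plane_param_measurable[OF plane_planes[OF P]] by simp
      from AE_distrD[OF mm ae]
      show "AE s in lborel. plane_param P s \<in> frontier K \<inter> frontier \<Omega> \<longrightarrow> cell_trace K (pw p) (plane_param P s) = 0" .
    qed
    then have "AE s in lborel. face_energy p (plane_param P s) = 0"
    proof eventually_elim
      fix s assume b: "\<forall>K\<in>T. plane_param P s \<in> frontier K \<inter> frontier \<Omega> \<longrightarrow> cell_trace K (pw p) (plane_param P s) = 0"
      have "indicator (frontier K \<inter> frontier K') (plane_param P s) * (p K (plane_param P s) - p K' (plane_param P s))\<^sup>2 = 0"
        if "K \<in> T" "K' \<in> T" for K K'
        using eq[OF that(1), of "plane_param P s"] eq[OF that(2), of "plane_param P s"] by (auto simp: indicator_def frontier_def)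
      moreover have "indicator (frontier K \<inter> frontier \<Omega>) (plane_param P s) * (p K (plane_param P s))\<^sup>2 = 0" if "K \<in> T" for K
        using b that frontier_trace[OF that p] by (auto simp: indicator_def)
      ultimately show "face_energy p (plane_param P s) = 0" unfolding face_energy_def by (simp add: sum.neutral)
    qed
    then show "(LINT s|lborel. face_energy p (plane_param P s)) = 0" by (rule integral_eq_zero_AE)
  qed
qed

text \<open>Constant pieces have no gradient and conforming functions have no jumps. This settles
  the projection for \<beta> = 0 and \<open>k = 0\<close>.\<close>

lemma S0_degree_0:
  assumes "w \<in> S0_space 0 \<Omega> T"
  shows "H1h_norm \<Omega> T w = 0"
proof -
  obtain p where p: "\<And>K. K \<in> T \<Longrightarrow> p K \<in> Q_polys 0" "w = pw p" "C1_pieces p" using V_space_repr assms S0_V by blast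
  have "partial_deriv i (p K) x = 0" if K: "K \<in> T" for i K x
  proof -
    obtain c where "p K = qpoly 0 c" using p(1)[OF K] by (auto simp: Q_polys_eq)
    then show ?thesis by (simp add: partial_deriv_qpoly)
  qed
  then have "dpw i p = (\<lambda>_. 0)" for i by (auto simp: dpw_def pw_def)
  then have "energy p = 0" using S0_jump_energy[of p 0] assms p by (simp add: energy_def sqn_def)
  then show ?thesis using energy_H1h[OF p(3)] p(2) by simp
qed

lemma discontinuous_L2_error:
  assumes C1: "\<And>f \<delta> A. bcs f \<Longrightarrow> (\<And>x. x \<notin> \<Omega> \<Longrightarrow> f x = 0) \<Longrightarrow> 0 < \<delta> \<Longrightarrow> tmod f \<delta> A \<Longrightarrow>
      sqn (\<lambda>x. indicator {x. infdist x (- \<Omega>) < 4 * \<delta>} x * f x) \<le> C1 * A"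
    and q: "q \<in> V_space k T"
  shows "sqn (\<lambda>x. q x - L2_projection \<Omega> (V0_space k \<Omega> T) q x)
     \<le> C1 * (2 + 2 * real (cell_count * N)) * h\<^sup>2 * (H1h_norm \<Omega> T q)\<^sup>2"
proof -
  obtain p where p: "\<And>K. K \<in> T \<Longrightarrow> p K \<in> Q_polys k" "q = pw p" "C1_pieces p"
    by (rule V_space_repr[OF q], rule that) auto
  \<comment> \<open>The competitor for the best approximation: all cells that touch the boundary are
    emptied. Their points are within one diameter of the complement, hence in the strip of width
    \<open>4 * h\<close>.\<close>
  define p' where "p' = (\<lambda>K. if frontier K \<inter> frontier \<Omega> = {} then p K else (\<lambda>_. 0))"
  have p'Q: "p' K \<in> Q_polys k" if "K \<in> T" for K using p(1)[OF that] lin_set_zero[OF lin_set_Q_polys] by (simp add: p'_def)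
  have p'C: "C1_pieces p'" by (rule C1_pieces_Q[OF p'Q])
  have "surface_AE (frontier K \<inter> frontier \<Omega>) (\<lambda>x. cell_trace K (pw p') x = 0)" if K: "K \<in> T" for K
    unfolding surface_AE_def using frontier_trace[OF K p'C] by (auto simp: p'_def intro!: AE_I2)
  then have wV0: "pw p' \<in> V0_space k \<Omega> T" using pw_V_space[OF p'Q] by (simp add: V0_space_def)
  let ?s = "\<lambda>x. indicator {x. infdist x (- \<Omega>) < 4 * h} x * q x"
  have bq: "bcs q" by (rule V_space_bcs[OF q])
  have bs: "bcs ?s"
  proof (rule bcs_mult(2)[OF bq, where C = 1])
    show "indicator {x. infdist x (- \<Omega>) < 4 * h} \<in> borel_measurable borel"
      by (intro borel_measurable_indicator open_infdist_less)
  qed (auto simp: indicator_def)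
  have "sqn (\<lambda>x. q x - L2_projection \<Omega> (V0_space k \<Omega> T) q x) \<le> sqn (\<lambda>x. q x - pw p' x)"
    by (rule L2_projection_best[OF lin_set_V0 V0_V q wV0])
  also have "\<dots> \<le> sqn ?s"
  proof (rule sqn_mono[OF bs])
    fix x
    show "(q x - pw p' x)\<^sup>2 \<le> (?s x)\<^sup>2"
    proof (cases "x \<in> \<Union>T")
      case False
      then show ?thesis by (simp add: p(2) pw_outside)
    next
      case True
      then obtain K where K: "K \<in> T" "x \<in> K" by blast
      show ?thesis
      proof (cases "frontier K \<inter> frontier \<Omega> = {}")
        case True
        then show ?thesis using pw_cell[OF K] by (simp add: p(2) p'_def)
      next
        case False
        then obtain y where y: "y \<in> frontier K" "y \<in> frontier \<Omega>" by blast
        have "y \<in> - \<Omega>" using y(2) open_dom by (auto simp: frontier_def interior_open)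
        then have "infdist x (- \<Omega>) \<le> dist x y" by (rule infdist_le)
        also have "\<dots> \<le> diameter K"
        proof -
          have "x \<in> closure K" "y \<in> closure K" using K(2) y(1) closure_subset[of K] by (auto simp: frontier_def)
          then show ?thesis using closure_cell_cball[OF K(1), of x] by auto
        qed
        also have "\<dots> < 4 * h" using diameter_le_h[OF K(1)] h_pos by simp
        finally show ?thesis using pw_cell[OF K] False by (simp add: p(2) p'_def)
      qed
    qed
  qed
  also have "\<dots> \<le> C1 * ((2 + 2 * real (cell_count * N)) * h\<^sup>2 * energy p)"
    using tmod_energy[OF p(3)] p(2) V_space_off_dom[OF q] by (intro C1 bq h_pos) auto
  finally show ?thesis using energy_H1h[OF p(3)] p(2) by (simp add: mult.assoc)
qed

end

section \<open>Weak solutions of the Poisson problem\<close>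

lemma semi_inner_abs_le:
  assumes "lin_set W" "semi_inner_on W B" "f \<in> W" "g \<in> W"
  shows "\<bar>B f g\<bar> \<le> sqrt (B f f) * sqrt (B g g)"
  using real_sqrt_le_mono[OF semi_inner_Cauchy_Schwarz[OF assms]] by (simp add: real_sqrt_mult)

text \<open>Vector fields are encoded as scalar functions of a component and a point, so that the facts on
  linear sets of real functions apply to them.\<close>
definition vec_L2 :: "(real^3) set \<Rightarrow> (3 \<times> (real^3) \<Rightarrow> real) set" where
  "vec_L2 \<Omega> = {F. \<forall>i. (\<lambda>x. F (i, x)) \<in> L2_space \<Omega>}"

definition vec_inner :: "(real^3) set \<Rightarrow> (3 \<times> (real^3) \<Rightarrow> real) \<Rightarrow> (3 \<times> (real^3) \<Rightarrow> real) \<Rightarrow> real" where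
  "vec_inner \<Omega> F G = (\<Sum>i\<in>UNIV. L2_inner \<Omega> (\<lambda>x. F (i, x)) (\<lambda>x. G (i, x)))"

lemma lin_set_vec: "lin_set (vec_L2 \<Omega>)"
  using lin_set_zero[OF lin_set_L2] lin_set_comb[OF lin_set_L2] unfolding lin_set_def vec_L2_def by simp

lemma semi_inner_vec: "semi_inner_on (vec_L2 \<Omega>) (vec_inner \<Omega>)"
  unfolding semi_inner_on_def
proof (intro conjI ballI allI)
  fix F G K a assume "F \<in> vec_L2 \<Omega>" "G \<in> vec_L2 \<Omega>" "K \<in> vec_L2 \<Omega>"
  then show "vec_inner \<Omega> (\<lambda>x. F x + a * G x) K = vec_inner \<Omega> F K + a * vec_inner \<Omega> G K"
    by (simp add: vec_inner_def vec_L2_def L2_inner_comb sum.distrib sum_distrib_left)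
next
  fix F G show "vec_inner \<Omega> F G = vec_inner \<Omega> G F" unfolding vec_inner_def by (simp add: L2_inner_commute)
  show "0 \<le> vec_inner \<Omega> F F" unfolding vec_inner_def L2_norm_sq_inner[symmetric] by (simp add: sum_nonneg)
qed

lemmas vec_inner_right = semi_inner_right[OF lin_set_vec semi_inner_vec]
lemmas vec_inner_sym = semi_inner_sym[OF semi_inner_vec]
lemmas vec_inner_le = semi_inner_abs_le[OF lin_set_vec semi_inner_vec]

lemma vec_inner_diff_right:
  "F \<in> vec_L2 \<Omega> \<Longrightarrow> G \<in> vec_L2 \<Omega> \<Longrightarrow> K \<in> vec_L2 \<Omega> \<Longrightarrow>
    vec_inner \<Omega> K (\<lambda>x. F x - G x) = vec_inner \<Omega> K F - vec_inner \<Omega> K G"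
  using vec_inner_right[of F \<Omega> G K "-1"] by simp

definition wgrad :: "(real^3) set \<Rightarrow> (real^3 \<Rightarrow> real) \<Rightarrow> 3 \<times> (real^3) \<Rightarrow> real" where
  "wgrad \<Omega> v = (\<lambda>(i, x). weak_partial \<Omega> i v x)"

definition pgrad :: "(real^3 \<Rightarrow> real) \<Rightarrow> 3 \<times> (real^3) \<Rightarrow> real" where
  "pgrad f = (\<lambda>(i, x). partial_deriv i f x)"

lemma wgrad_vec_L2: "v \<in> H1_space \<Omega> \<Longrightarrow> wgrad \<Omega> v \<in> vec_L2 \<Omega>"
  using weak_partial_spec by (auto simp: vec_L2_def wgrad_def)

lemma pgrad_vec_L2: "open \<Omega> \<Longrightarrow> bounded \<Omega> \<Longrightarrow> test_function \<Omega> \<psi> \<Longrightarrow> pgrad \<psi> \<in> vec_L2 \<Omega>"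
  using test_function_L2[OF _ _ test_function_partial] by (auto simp: vec_L2_def pgrad_def)

lemma H1_0_H1: "v \<in> H1_0_space \<Omega> \<Longrightarrow> v \<in> H1_space \<Omega>" by (simp add: H1_0_space_def)

lemma H1_L2: "v \<in> H1_space \<Omega> \<Longrightarrow> v \<in> L2_space \<Omega>" by (simp add: H1_space_def)

lemma vec_inner_integral:
  assumes "F \<in> vec_L2 \<Omega>" "G \<in> vec_L2 \<Omega>"
  shows "vec_inner \<Omega> F G = (LINT x|lebesgue_on \<Omega>. (\<Sum>i\<in>UNIV. F (i, x) * G (i, x)))"
  unfolding vec_inner_def L2_inner_def using assms
  by (intro Bochner_Integration.integral_sum[symmetric] sqint_prod) (auto simp: vec_L2_def L2_space_sqint)

definition weak_solution :: "(real^3) set \<Rightarrow> (real^3 \<Rightarrow> real) \<Rightarrow> (real^3 \<Rightarrow> real) \<Rightarrow> bool" where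
  "weak_solution \<Omega> g z \<longleftrightarrow> z \<in> H1_0_space \<Omega> \<and>
     (\<forall>w\<in>H1_0_space \<Omega>. vec_inner \<Omega> (wgrad \<Omega> z) (wgrad \<Omega> w) = L2_inner \<Omega> g w)"

lemma inverse_laplacian_weak_solution:
  assumes "inverse_dirichlet_laplacian \<Omega> S" "g \<in> L2_space \<Omega>"
  shows "weak_solution \<Omega> g (S g)"
proof -
  have z: "S g \<in> H1_0_space \<Omega>"
    and eq: "\<And>w. w \<in> H1_0_space \<Omega> \<Longrightarrow>
      (LINT x|lebesgue_on \<Omega>. weak_gradient \<Omega> (S g) x \<bullet> weak_gradient \<Omega> w x) = L2_inner \<Omega> g w"
    using assms unfolding inverse_dirichlet_laplacian_def by blast+
  have "vec_inner \<Omega> (wgrad \<Omega> (S g)) (wgrad \<Omega> w) = L2_inner \<Omega> g w" if w: "w \<in> H1_0_space \<Omega>" for w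
    unfolding eq[OF w, symmetric]
    by (subst vec_inner_integral[OF wgrad_vec_L2[OF H1_0_H1[OF z]] wgrad_vec_L2[OF H1_0_H1[OF w]]])
      (simp add: wgrad_def weak_gradient_def inner_vec_def)
  then show ?thesis using z by (simp add: weak_solution_def)
qed

lemma weak_solution_test:
  assumes dom: "open \<Omega>" "bounded \<Omega>" and z: "weak_solution \<Omega> g z" and \<psi>: "test_function \<Omega> \<psi>"
  shows "vec_inner \<Omega> (wgrad \<Omega> z) (pgrad \<psi>) = L2_inner \<Omega> g \<psi>"
proof -
  have \<psi>0: "\<psi> \<in> H1_0_space \<Omega>" by (rule test_function_H1_0[OF dom \<psi>])
  have L: "weak_partial \<Omega> i z \<in> L2_space \<Omega>" "weak_partial \<Omega> i \<psi> \<in> L2_space \<Omega>" "partial_deriv i \<psi> \<in> L2_space \<Omega>" for i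
    using weak_partial_spec[OF H1_0_H1] z \<psi>0 test_function_L2[OF dom test_function_partial[OF \<psi>]]
    by (auto simp: weak_solution_def)
  have "L2_inner \<Omega> (weak_partial \<Omega> i z) (partial_deriv i \<psi>) = L2_inner \<Omega> (weak_partial \<Omega> i z) (weak_partial \<Omega> i \<psi>)" for i
    using L[of i] weak_partial_test_function[OF dom \<psi>, of i]
    by (intro L2_inner_cong_AE) (auto simp: L2_space_def)
  then have "vec_inner \<Omega> (wgrad \<Omega> z) (pgrad \<psi>) = vec_inner \<Omega> (wgrad \<Omega> z) (wgrad \<Omega> \<psi>)"
    by (simp add: vec_inner_def wgrad_def pgrad_def)
  then show ?thesis using z \<psi>0 by (simp add: weak_solution_def)
qed

lemma le_of_small_error:
  fixes x y c h :: real
  assumes "0 < h" "\<And>\<delta>. 0 < \<delta> \<Longrightarrow> \<delta> \<le> h \<Longrightarrow> x \<le> y + c * \<delta>"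
  shows "x \<le> y"
proof (rule tendsto_lowerbound)
  show "((\<lambda>\<delta>. y + c * \<delta>) \<longlongrightarrow> y) (at_right 0)" by (auto intro!: tendsto_eq_intros)
  show "\<forall>\<^sub>F \<delta> in at_right 0. x \<le> y + c * \<delta>"
    using assms eventually_at_right_less[of 0] eventually_at_right_field[of "\<lambda>\<delta>. \<delta> \<le> h" 0]
    by (auto simp: eventually_at_right_field intro!: exI[of _ h])
qed simp

lemma AE_lebesgue_on_of_lborel:
  assumes "open \<Omega>" "AE x in lborel. P x"
  shows "AE x in lebesgue_on \<Omega>. P x"
proof -
  have "AE x in lebesgue. P x" by (rule AE_completion[OF assms(2)])
  then show ?thesis using assms(1) by (subst AE_restrict_space_iff) auto
qed

text \<open>Completeness of Lebesgue measure. Needed since the integrand in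
  \<open>conforming_approximation\<close> contains unspecified classical gradients on the
  skeleton.\<close>

lemma measurable_cong_AE_lebesgue_on:
  fixes f g :: "real^3 \<Rightarrow> real"
  assumes "open \<Omega>" "g \<in> borel_measurable (lebesgue_on \<Omega>)" "AE x in lebesgue_on \<Omega>. f x = g x"
  shows "f \<in> borel_measurable (lebesgue_on \<Omega>)"
proof -
  have S: "\<Omega> \<in> sets lebesgue" using assms(1) by simp
  have "AE x in lebesgue. x \<in> \<Omega> \<longrightarrow> f x = g x" using assms(3) S by (subst (asm) AE_restrict_space_iff) auto
  then obtain Z where Z: "Z \<in> null_sets lebesgue" "{x. \<not> (x \<in> \<Omega> \<longrightarrow> f x = g x)} \<subseteq> Z"
    by (auto simp: eventually_ae_filter)
  show ?thesis
  proof (rule borel_measurable_lebesgue_on_preimage_borel[OF S, THEN iffD2], intro allI impI)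
    fix X :: "real set" assume X: "X \<in> sets borel"
    have 1: "{x \<in> \<Omega>. g x \<in> X} \<in> sets lebesgue"
      using assms(2) X by (simp add: borel_measurable_lebesgue_on_preimage_borel[OF S])
    have 2: "{x \<in> \<Omega>. f x \<in> X} \<inter> Z \<in> sets lebesgue"
      using null_sets_completion_subset[of "{x \<in> \<Omega>. f x \<in> X} \<inter> Z" Z lborel] Z(1) by (auto simp: null_sets_def)
    have "{x \<in> \<Omega>. f x \<in> X} = ({x \<in> \<Omega>. g x \<in> X} - Z) \<union> ({x \<in> \<Omega>. f x \<in> X} \<inter> Z)" using Z(2) by auto
    moreover have "\<dots> \<in> sets lebesgue" by (intro sets.Un sets.Diff 1 2 null_setsD2[OF Z(1)])
    ultimately show "{x \<in> \<Omega>. f x \<in> X} \<in> sets lebesgue" by (rule ssubst)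
  qed
qed

definition smoothing_constant :: "(real^3) set \<Rightarrow> real \<Rightarrow> bool" where
  "smoothing_constant \<Omega> C \<longleftrightarrow> 0 \<le> C \<and> (\<forall>f \<delta> A. bcs f \<longrightarrow> (\<forall>x. x \<notin> \<Omega> \<longrightarrow> f x = 0) \<longrightarrow> 0 < \<delta> \<longrightarrow> tmod f \<delta> A \<longrightarrow>
      (\<exists>\<psi>. test_function \<Omega> \<psi> \<and> sqn (\<lambda>x. \<psi> x - f x) \<le> C * A \<and> (\<forall>m. sqn (partial_deriv m \<psi>) \<le> C * A / \<delta>\<^sup>2)))"

lemma smoothing_constantD:
  "smoothing_constant \<Omega> C \<Longrightarrow> bcs f \<Longrightarrow> \<forall>x. x \<notin> \<Omega> \<longrightarrow> f x = 0 \<Longrightarrow> 0 < \<delta> \<Longrightarrow> tmod f \<delta> A \<Longrightarrow>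
    \<exists>\<psi>. test_function \<Omega> \<psi> \<and> sqn (\<lambda>x. \<psi> x - f x) \<le> C * A \<and> (\<forall>m. sqn (partial_deriv m \<psi>) \<le> C * A / \<delta>\<^sup>2)"
  unfolding smoothing_constant_def by blast

context fem_mesh begin

text \<open>The cellwise gradient is set to 0 off the open cells, where \<open>partial_deriv\<close>
  of a discontinuous function is unspecified.\<close>

definition cgrad :: "(real^3 \<Rightarrow> real) \<Rightarrow> 3 \<times> (real^3) \<Rightarrow> real" where
  "cgrad w = (\<lambda>(i, x). if x \<in> \<Union>T then partial_deriv i w x else 0)"

lemma cgrad_pw: "cgrad (pw p) (i, x) = dpw i p x"
proof (cases "x \<in> \<Union>T")
  case True
  then show ?thesis using partial_deriv_pw by (auto simp: cgrad_def)
next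
  case False
  then show ?thesis by (simp add: cgrad_def dpw_def pw_outside)
qed

lemma dpw_L2: "C1_pieces p \<Longrightarrow> dpw i p \<in> L2_space \<Omega>"
  by (intro bcs_L2 open_dom bounded_dom bcs_dpw)

lemma cgrad_pw_vec_L2: "C1_pieces p \<Longrightarrow> cgrad (pw p) \<in> vec_L2 \<Omega>"
  by (simp add: vec_L2_def cgrad_pw dpw_L2)

lemma cgrad_vec_L2:
  assumes "w \<in> V_space k T" shows "cgrad w \<in> vec_L2 \<Omega>"
proof -
  obtain p where p: "\<And>K. K \<in> T \<Longrightarrow> p K \<in> Q_polys k" "w = pw p" "C1_pieces p"
    by (rule V_space_repr[OF assms], rule that) auto
  show ?thesis unfolding p(2) by (rule cgrad_pw_vec_L2[OF p(3)])
qed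

lemma cgrad_comb:
  assumes "f \<in> V_space k T" "g \<in> V_space k T"
  shows "cgrad (\<lambda>x. f x + a * g x) = (\<lambda>t. cgrad f t + a * cgrad g t)"
proof -
  obtain p where p: "\<And>K. K \<in> T \<Longrightarrow> p K \<in> Q_polys k" "f = pw p" "C1_pieces p"
    by (rule V_space_repr[OF assms(1)], rule that) auto
  obtain q where q: "\<And>K. K \<in> T \<Longrightarrow> q K \<in> Q_polys k" "g = pw q" "C1_pieces q"
    by (rule V_space_repr[OF assms(2)], rule that) auto
  have "partial_deriv i (\<lambda>x. p K x + a * q K x) x = partial_deriv i (p K) x + a * partial_deriv i (q K) x"
    if K: "K \<in> T" for i K x
  proof -
    have "(p K has_derivative frechet_derivative (p K) (at x)) (at x)" "(q K has_derivative frechet_derivative (q K) (at x)) (at x)"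
      using p(3) q(3) K by (auto simp: C1_pieces_def differentiable_has_derivative)
    from partial_deriv_eq[OF has_derivative_add[OF this(1) has_derivative_mult_right[OF this(2), of a]]]
    show ?thesis by (simp add: partial_deriv_def)
  qed
  then have d: "dpw i (\<lambda>K x. p K x + a * q K x) x = dpw i p x + a * dpw i q x" for i x
    unfolding dpw_def pw_comb[symmetric] unfolding pw_def by (intro sum.cong) auto
  have e: "(\<lambda>x. f x + a * g x) = pw (\<lambda>K x. p K x + a * q K x)" by (auto simp: p(2) q(2) pw_comb)
  show ?thesis
  proof
    fix t :: "3 \<times> (real^3)"
    obtain i x where "t = (i, x)" by (cases t)
    then show "cgrad (\<lambda>x. f x + a * g x) t = cgrad f t + a * cgrad g t"
      unfolding e unfolding p(2) q(2) by (simp add: cgrad_pw d)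
  qed
qed

lemma cgrad_diff:
  assumes "f \<in> V_space k T" "g \<in> V_space k T"
  shows "cgrad (\<lambda>x. f x - g x) = (\<lambda>t. cgrad f t - cgrad g t)"
  using cgrad_comb[OF assms, of "-1"] by simp

text \<open>Test functions approximate a piecewise smooth function without jumps in \<open>L\<^sup>2\<close> and stay bounded
  in \<open>H\<^sup>1\<close>, hence they converge weakly in \<open>H\<^sup>1\<close>.\<close>
lemma green_pw:
  assumes E: "smoothing_constant \<Omega> C"
    and z: "weak_solution \<Omega> g z" "g \<in> L2_space \<Omega>"
    and p: "C1_pieces p" "jump_energy p = 0"
  shows "vec_inner \<Omega> (wgrad \<Omega> z) (cgrad (pw p)) = L2_inner \<Omega> g (pw p)"
proof -
  define G where "G = (\<Sum>i\<in>UNIV. sqn (dpw i p))"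
  have G0: "0 \<le> G" by (simp add: G_def sum_nonneg)
  have Gi: "sqn (dpw i p) \<le> G" for i unfolding G_def by (intro member_le_sum) auto
  \<comment> \<open>Bounds the L2 norm of each component of the difference between the gradients of
    the smoothed function and of \<open>pw p\<close>, independently of \<delta>.\<close>
  define K where "K = sqrt (2 * (2 * C * G) + 2 * G)"
  define a where "a = vec_inner \<Omega> (wgrad \<Omega> z) (cgrad (pw p)) - L2_inner \<Omega> g (pw p)"
  have bw: "bcs (pw p)" by (intro bcs_pw C1_pieces_continuous p)
  have wL: "pw p \<in> L2_space \<Omega>" by (intro bcs_L2 open_dom bounded_dom bw)
  have zH: "z \<in> H1_0_space \<Omega>" using z(1) by (simp add: weak_solution_def)
  have zL: "weak_partial \<Omega> i z \<in> L2_space \<Omega>" for i using weak_partial_spec[OF H1_0_H1[OF zH]] by blast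
  note L2d = lin_set_diff[OF lin_set_L2]
  have bound: "\<bar>a\<bar> \<le> 0 + 3 * K * \<epsilon>" if \<epsilon>: "0 < \<epsilon>" for \<epsilon>
  proof -
    \<comment> \<open>A smooth substitute for \<open>z\<close>, so that derivatives can be moved
      from the merely bounded difference \<open>D\<close> onto it.\<close>
    obtain \<zeta> where \<zeta>: "test_function \<Omega> \<zeta>" "\<And>i. L2_norm \<Omega> (\<lambda>x. weak_partial \<Omega> i z x - partial_deriv i \<zeta> x) < \<epsilon>"
      using H1_0_space_approx[OF open_dom bounded_dom zH \<epsilon>] by blast
    have \<zeta>L: "partial_deriv i \<zeta> \<in> L2_space \<Omega>" "partial_deriv i (partial_deriv i \<zeta>) \<in> L2_space \<Omega>" for i
      using test_function_L2[OF open_dom bounded_dom] test_function_partial \<zeta>(1) by blast+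
    \<comment> \<open>Collects what multiplies the L2 error of smoothing. It depends on \<zeta> and
      thus on \<epsilon>, but not on \<delta>: first \<delta> tends to 0, then \<epsilon>.\<close>
    define R where "R = ((\<Sum>i\<in>UNIV. L2_norm \<Omega> (partial_deriv i (partial_deriv i \<zeta>))) + L2_norm \<Omega> g) * sqrt (2 * C * G)"
    have "\<bar>a\<bar> \<le> 3 * K * \<epsilon> + R * \<delta>" if \<delta>: "0 < \<delta>" "\<delta> \<le> h" for \<delta>
    proof -
      have "card (near_planes x \<delta>) \<le> cell_count * N" for x
      proof -
        have "near_planes x \<delta> \<subseteq> near_planes x h" unfolding near_planes_def using \<delta>(2) subset_cball[OF \<delta>(2), of x] by blast
        moreover have "finite (near_planes x h)" using finite_planes by (simp add: near_planes_def)
        ultimately show ?thesis using card_near_planes[of x] card_mono by (meson order_trans)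
      qed
      \<comment> \<open>Without jumps the modulus is quadratic in \<delta>, so the smoothed function
        has L2 error of order \<delta> and gradients bounded uniformly in \<delta>.\<close>
      from tmod_pw[OF p(1) \<delta>(1) this] have tm: "tmod (pw p) \<delta> (2 * \<delta>\<^sup>2 * G)" by (simp add: p(2) G_def)
      obtain \<psi> where \<psi>: "test_function \<Omega> \<psi>" "sqn (\<lambda>x. \<psi> x - pw p x) \<le> C * (2 * \<delta>\<^sup>2 * G)"
          "\<And>m. sqn (partial_deriv m \<psi>) \<le> C * (2 * \<delta>\<^sup>2 * G) / \<delta>\<^sup>2"
        using smoothing_constantD[OF E bw _ \<delta>(1) tm] pw_off_dom by blast
      have \<psi>L: "\<psi> \<in> L2_space \<Omega>" "partial_deriv i \<psi> \<in> L2_space \<Omega>" for i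
        using test_function_L2[OF open_dom bounded_dom] test_function_partial \<psi>(1) by blast+
      have b\<psi>: "bcs \<psi>" "bcs (partial_deriv i \<psi>)" for i using test_function_bcs test_function_partial \<psi>(1) by blast+
      define D where "D = (\<lambda>i x. partial_deriv i \<psi> x - dpw i p x)"
      define d where "d = (\<lambda>x. \<psi> x - pw p x)"
      have DL: "D i \<in> L2_space \<Omega>" for i unfolding D_def using L2d[OF \<psi>L(2) dpw_L2[OF p(1)]] .
      have dL: "d \<in> L2_space \<Omega>" unfolding d_def using L2d[OF \<psi>L(1) wL] .
      have dn: "L2_norm \<Omega> d \<le> sqrt (2 * C * G) * \<delta>"
      proof -
        have "L2_norm \<Omega> d \<le> sqrt (sqn d)" unfolding d_def by (intro L2_norm_le_sqn bcs_diff b\<psi> bw)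
        also have "\<dots> \<le> sqrt (2 * C * G * \<delta>\<^sup>2)" using \<psi>(2) by (simp add: d_def mult_ac)
        also have "\<dots> = sqrt (2 * C * G) * \<delta>" using \<delta>(1) by (simp add: real_sqrt_mult)
        finally show ?thesis .
      qed
      have Dn: "L2_norm \<Omega> (D i) \<le> K" for i
      proof -
        have "L2_norm \<Omega> (D i) \<le> sqrt (sqn (D i))" unfolding D_def by (intro L2_norm_le_sqn bcs_diff b\<psi> bcs_dpw p)
        also have "sqn (D i) \<le> 2 * sqn (partial_deriv i \<psi>) + 2 * sqn (dpw i p)"
          unfolding D_def by (intro sqn_diff b\<psi> bcs_dpw p)
        also have "\<dots> \<le> 2 * (2 * C * G) + 2 * G" using \<psi>(3)[of i] Gi[of i] \<delta>(1) by (simp add: mult_ac)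
        finally show ?thesis by (simp add: K_def)
      qed
      \<comment> \<open>Integration by parts for the test function and, by the absence of jumps, for
        \<open>pw p\<close> trades \<open>D\<close> for the L2-small \<open>d\<close>.\<close>
      have t2: "L2_inner \<Omega> (partial_deriv i \<zeta>) (D i) = - L2_inner \<Omega> (partial_deriv i (partial_deriv i \<zeta>)) d" for i
      proof -
        have t: "test_function \<Omega> (partial_deriv i \<zeta>)" by (rule test_function_partial[OF \<zeta>(1)])
        have tt: "test_function \<Omega> (partial_deriv i (partial_deriv i \<zeta>))" by (rule test_function_partial[OF t])
        have "L2_inner \<Omega> \<psi> (partial_deriv i (partial_deriv i \<zeta>)) = - L2_inner \<Omega> (partial_deriv i \<psi>) (partial_deriv i \<zeta>)"
          using test_function_has_weak_partial[OF open_dom bounded_dom \<psi>(1), of i] t by (simp add: has_weak_partial_def)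
        moreover have "L2_inner \<Omega> (pw p) (partial_deriv i (partial_deriv i \<zeta>)) = - L2_inner \<Omega> (dpw i p) (partial_deriv i \<zeta>)"
        proof -
          have "L2_inner \<Omega> (pw p) (partial_deriv i (partial_deriv i \<zeta>)) = (LINT x|lborel. pw p x * partial_deriv i (partial_deriv i \<zeta>) x)"
            by (intro L2_inner_dom bw test_function_bcs[OF tt] pw_off_dom)
          also have "\<dots> = - (LINT x|lborel. dpw i p x * partial_deriv i \<zeta> x)" by (rule zero_jump_weak_derivative[OF p t])
          also have "(LINT x|lborel. dpw i p x * partial_deriv i \<zeta> x) = L2_inner \<Omega> (dpw i p) (partial_deriv i \<zeta>)"
            unfolding dpw_def by (intro L2_inner_dom[symmetric] test_function_bcs[OF t] pw_off_dom bcs_dpw[OF p(1), unfolded dpw_def])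
          finally show ?thesis .
        qed
        ultimately show ?thesis
          using L2_inner_comb(3)[OF \<psi>L(1) wL \<zeta>L(2)[of i]] L2_inner_comb(3)[OF \<psi>L(2)[of i] dpw_L2[OF p(1), of i] \<zeta>L(1)[of i]]
          by (simp add: D_def d_def L2_inner_commute[of _ _ "\<lambda>x. \<psi> x - pw p x"] L2_inner_commute[of _ _ "\<lambda>x. partial_deriv i \<psi> x - dpw i p x"])
      qed
      define e where "e = (\<lambda>i x. weak_partial \<Omega> i z x - partial_deriv i \<zeta> x)"
      have eL: "e i \<in> L2_space \<Omega>" for i unfolding e_def using L2d[OF zL \<zeta>L(1)] .
      have e: "L2_inner \<Omega> (weak_partial \<Omega> i z) (D i) = L2_inner \<Omega> (e i) (D i) - L2_inner \<Omega> (partial_deriv i (partial_deriv i \<zeta>)) d" for i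
        using L2_inner_comb(3)[OF zL[of i] \<zeta>L(1)[of i] DL[of i]] t2[of i] by (simp add: e_def)
      have a1: "a = L2_inner \<Omega> g d - (\<Sum>i\<in>UNIV. L2_inner \<Omega> (weak_partial \<Omega> i z) (D i))"
      proof -
        have "L2_inner \<Omega> (weak_partial \<Omega> i z) (D i) = L2_inner \<Omega> (weak_partial \<Omega> i z) (partial_deriv i \<psi>) - L2_inner \<Omega> (weak_partial \<Omega> i z) (dpw i p)" for i
          unfolding D_def using L2_inner_comb(3)[OF \<psi>L(2)[of i] dpw_L2[OF p(1), of i] zL[of i]] by (simp add: L2_inner_commute)
        then have "(\<Sum>i\<in>UNIV. L2_inner \<Omega> (weak_partial \<Omega> i z) (D i)) = vec_inner \<Omega> (wgrad \<Omega> z) (pgrad \<psi>) - vec_inner \<Omega> (wgrad \<Omega> z) (cgrad (pw p))"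
          by (simp add: vec_inner_def wgrad_def pgrad_def cgrad_pw sum_subtractf)
        moreover have "vec_inner \<Omega> (wgrad \<Omega> z) (pgrad \<psi>) = L2_inner \<Omega> g \<psi>"
          by (rule weak_solution_test[OF open_dom bounded_dom z(1) \<psi>(1)])
        moreover have "L2_inner \<Omega> g d = L2_inner \<Omega> g \<psi> - L2_inner \<Omega> g (pw p)"
          unfolding d_def using L2_inner_comb(3)[OF \<psi>L(1) wL z(2)] by (simp add: L2_inner_commute)
        ultimately show ?thesis by (simp add: a_def)
      qed
      have i1: "\<bar>L2_inner \<Omega> (weak_partial \<Omega> i z) (D i)\<bar> \<le> K * \<epsilon> + L2_norm \<Omega> (partial_deriv i (partial_deriv i \<zeta>)) * L2_norm \<Omega> d" for i
      proof -
        have "\<bar>L2_inner \<Omega> (e i) (D i)\<bar> \<le> L2_norm \<Omega> (e i) * L2_norm \<Omega> (D i)" by (rule L2_inner_le[OF eL DL])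
        also have "\<dots> \<le> \<epsilon> * K" using \<zeta>(2)[of i] Dn[of i] \<epsilon> by (intro mult_mono) (auto simp: e_def)
        finally show ?thesis using L2_inner_le[OF \<zeta>L(2)[of i] dL] e[of i] by (simp add: mult.commute)
      qed
      have "\<bar>a\<bar> \<le> \<bar>L2_inner \<Omega> g d\<bar> + (\<Sum>i\<in>UNIV. \<bar>L2_inner \<Omega> (weak_partial \<Omega> i z) (D i)\<bar>)"
        unfolding a1 using sum_abs[of "\<lambda>i. L2_inner \<Omega> (weak_partial \<Omega> i z) (D i)" UNIV] by linarith
      also have "\<dots> \<le> L2_norm \<Omega> g * L2_norm \<Omega> d + (\<Sum>i\<in>UNIV. K * \<epsilon> + L2_norm \<Omega> (partial_deriv i (partial_deriv i \<zeta>)) * L2_norm \<Omega> d)"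
        by (intro add_mono sum_mono i1 L2_inner_le z dL)
      also have "\<dots> = 3 * K * \<epsilon> + ((\<Sum>i\<in>UNIV. L2_norm \<Omega> (partial_deriv i (partial_deriv i \<zeta>))) + L2_norm \<Omega> g) * L2_norm \<Omega> d"
        by (simp add: sum.distrib sum_distrib_right distrib_right)
      also have "\<dots> \<le> 3 * K * \<epsilon> + ((\<Sum>i\<in>UNIV. L2_norm \<Omega> (partial_deriv i (partial_deriv i \<zeta>))) + L2_norm \<Omega> g) * (sqrt (2 * C * G) * \<delta>)"
        by (intro add_left_mono mult_left_mono dn) (simp add: sum_nonneg)
      finally show ?thesis by (simp add: R_def mult.assoc)
    qed
    from le_of_small_error[OF h_pos this] show ?thesis by simp
  qed
  have "\<bar>a\<bar> \<le> 0" by (rule le_of_small_error[OF zero_less_one]) (rule bound)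
  then show ?thesis by (simp add: a_def)
qed

end

section \<open>Ritz projection and duality\<close>

abbreviation vec_norm :: "(real^3) set \<Rightarrow> (3 \<times> (real^3) \<Rightarrow> real) \<Rightarrow> real" where
  "vec_norm \<Omega> F \<equiv> sqrt (vec_inner \<Omega> F F)"

lemma H2_norm_nonneg: "0 \<le> H2_norm \<Omega> v" by (simp add: H2_norm_def sum_nonneg)

context fem_mesh begin

lemma cells_AE: "AE x in lebesgue_on \<Omega>. x \<in> \<Union>T"
proof -
  have "AE x in lborel. \<forall>P\<in>planes. x + 0 \<notin> P"
    using plane_AE[OF plane_planes] by (subst AE_finite_all[OF finite_planes]) blast
  then have "AE x in lborel. x \<in> \<Union>T \<or> x \<notin> closure \<Omega>"
  proof eventually_elim
    fix x assume "\<forall>P\<in>planes. x + 0 \<notin> P"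
    then show "x \<in> \<Union>T \<or> x \<notin> closure \<Omega>" by (intro off_skeleton_cases off_planes_off_skeleton) auto
  qed
  from AE_lebesgue_on_of_lborel[OF open_dom this] AE_space[of "lebesgue_on \<Omega>"]
  show ?thesis by eventually_elim (use closure_subset[of \<Omega>] in auto)
qed

lemma conforming_vec:
  assumes conf: "conforming_approximation \<gamma> k \<Omega> T" and v: "v \<in> H2_space \<Omega>" "v \<in> H1_0_space \<Omega>"
  obtains w where "w \<in> S0_space k \<Omega> T" "vec_norm \<Omega> (\<lambda>t. wgrad \<Omega> v t - cgrad w t) \<le> \<gamma> * h * H2_norm \<Omega> v"
proof -
  obtain w where w: "w \<in> S0_space k \<Omega> T"
    "sqrt (LINT x|lebesgue_on \<Omega>. (norm (weak_gradient \<Omega> v x - gradient w x))\<^sup>2) \<le> \<gamma> * h * H2_norm \<Omega> v"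
    using conf v unfolding conforming_approximation_def by blast
  define F where "F = (\<lambda>t. wgrad \<Omega> v t - cgrad w t)"
  have F: "F \<in> vec_L2 \<Omega>"
    unfolding F_def using lin_set_diff[OF lin_set_vec wgrad_vec_L2[OF H1_0_H1[OF v(2)]] cgrad_vec_L2] w(1) S0_V by blast
  have ae: "AE x in lebesgue_on \<Omega>. (norm (weak_gradient \<Omega> v x - gradient w x))\<^sup>2 = (\<Sum>i\<in>UNIV. F (i, x) * F (i, x))"
    using cells_AE
  proof eventually_elim
    fix x assume "x \<in> \<Union>T"
    then show "(norm (weak_gradient \<Omega> v x - gradient w x))\<^sup>2 = (\<Sum>i\<in>UNIV. F (i, x) * F (i, x))"
      unfolding norm_vec3_sq by (simp add: F_def wgrad_def cgrad_def weak_gradient_def gradient_def power2_eq_square)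
  qed
  have m: "(\<lambda>x. \<Sum>i\<in>UNIV. F (i, x) * F (i, x)) \<in> borel_measurable (lebesgue_on \<Omega>)"
    using F by (intro borel_measurable_sum borel_measurable_times) (auto simp: vec_L2_def L2_space_def)
  have "(LINT x|lebesgue_on \<Omega>. (norm (weak_gradient \<Omega> v x - gradient w x))\<^sup>2) = vec_inner \<Omega> F F"
    unfolding vec_inner_integral[OF F F]
    by (intro integral_cong_AE measurable_cong_AE_lebesgue_on[OF open_dom m ae] m ae)
  then show thesis using w by (intro that[of w]) (simp_all add: F_def)
qed

text \<open>Projection in the gradient form, obtained from the Riesz argument without a Poincare
  inequality. By Pythagoras it is at least as good as the approximation that
  \<open>conforming_vec\<close> provides.\<close>

lemma ritz_projection:
  assumes conf: "conforming_approximation \<gamma> k \<Omega> T" and v: "v \<in> H2_space \<Omega>" "v \<in> H1_0_space \<Omega>"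
  obtains u where "u \<in> S0_space k \<Omega> T"
    "\<And>w. w \<in> S0_space k \<Omega> T \<Longrightarrow> vec_inner \<Omega> (\<lambda>t. wgrad \<Omega> v t - cgrad u t) (cgrad w) = 0"
    "vec_norm \<Omega> (\<lambda>t. wgrad \<Omega> v t - cgrad u t) \<le> \<gamma> * h * H2_norm \<Omega> v"
proof -
  let ?S = "S0_space k \<Omega> T"
  have vL: "wgrad \<Omega> v \<in> vec_L2 \<Omega>" by (rule wgrad_vec_L2[OF H1_0_H1[OF v(2)]])
  have SV: "w \<in> V_space k T" if "w \<in> ?S" for w using that S0_V by blast
  have cL: "cgrad w \<in> vec_L2 \<Omega>" if "w \<in> ?S" for w by (rule cgrad_vec_L2[OF SV[OF that]])
  have cc: "cgrad (\<lambda>x. f x + a * g x) = (\<lambda>t. cgrad f t + a * cgrad g t)" if "f \<in> ?S" "g \<in> ?S" for f g a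
    by (rule cgrad_comb[OF SV[OF that(1)] SV[OF that(2)]])
  have "\<exists>u\<in>?S. \<forall>w\<in>?S. vec_inner \<Omega> (cgrad u) (cgrad w) = vec_inner \<Omega> (wgrad \<Omega> v) (cgrad w)"
  proof (rule V_space_riesz[OF lin_set_S0 S0_V, where B = "\<lambda>u w. vec_inner \<Omega> (cgrad u) (cgrad w)" and F = "\<lambda>w. vec_inner \<Omega> (wgrad \<Omega> v) (cgrad w)"])
    show "semi_inner_on ?S (\<lambda>u w. vec_inner \<Omega> (cgrad u) (cgrad w))"
      unfolding semi_inner_on_def
      using cL by (auto simp: cc semi_inner_left[OF semi_inner_vec] vec_inner_sym semi_inner_ge0[OF semi_inner_vec])
    show "linear_form_on ?S (\<lambda>w. vec_inner \<Omega> (wgrad \<Omega> v) (cgrad w))"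
      unfolding linear_form_on_def using cL vL by (simp add: cc vec_inner_right)
    fix w assume w: "w \<in> ?S" "vec_inner \<Omega> (cgrad w) (cgrad w) = 0"
    then show "vec_inner \<Omega> (wgrad \<Omega> v) (cgrad w) = 0" using vec_inner_le[OF vL cL[OF w(1)]] by simp
  qed
  then obtain u where u: "u \<in> ?S" "\<And>w. w \<in> ?S \<Longrightarrow> vec_inner \<Omega> (cgrad u) (cgrad w) = vec_inner \<Omega> (wgrad \<Omega> v) (cgrad w)" by blast
  define D where "D = (\<lambda>t. wgrad \<Omega> v t - cgrad u t)"
  have DL: "D \<in> vec_L2 \<Omega>" unfolding D_def by (rule lin_set_diff[OF lin_set_vec vL cL[OF u(1)]])
  have orth: "vec_inner \<Omega> D (cgrad w) = 0" if w: "w \<in> ?S" for w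
    using semi_inner_left[OF semi_inner_vec vL cL[OF u(1)] cL[OF w], of "-1"] u(2)[OF w] by (simp add: D_def)
  obtain w where w: "w \<in> ?S" "vec_norm \<Omega> (\<lambda>t. wgrad \<Omega> v t - cgrad w t) \<le> \<gamma> * h * H2_norm \<Omega> v"
    by (rule conforming_vec[OF conf v])
  define d where "d = (\<lambda>x. u x - w x)"
  have dS: "d \<in> ?S" unfolding d_def by (rule lin_set_diff[OF lin_set_S0 u(1) w(1)])
  have cd: "cgrad d = (\<lambda>t. cgrad u t - cgrad w t)" unfolding d_def by (rule cgrad_diff[OF SV[OF u(1)] SV[OF w(1)]])
  have "vec_inner \<Omega> (\<lambda>t. D t + 1 * cgrad d t) (\<lambda>t. D t + 1 * cgrad d t)
      = vec_inner \<Omega> D D + 2 * 1 * vec_inner \<Omega> D (cgrad d) + 1\<^sup>2 * vec_inner \<Omega> (cgrad d) (cgrad d)"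
    by (rule semi_inner_expand[OF lin_set_vec semi_inner_vec DL cL[OF dS]])
  moreover have "(\<lambda>t. D t + 1 * cgrad d t) = (\<lambda>t. wgrad \<Omega> v t - cgrad w t)" by (simp add: cd D_def)
  ultimately have "vec_inner \<Omega> D D \<le> vec_inner \<Omega> (\<lambda>t. wgrad \<Omega> v t - cgrad w t) (\<lambda>t. wgrad \<Omega> v t - cgrad w t)"
    using orth[OF dS] semi_inner_ge0[OF semi_inner_vec cL[OF dS]] by simp
  then have "vec_norm \<Omega> D \<le> \<gamma> * h * H2_norm \<Omega> v" using w(2) real_sqrt_le_mono by (meson order_trans)
  then show thesis using u(1) orth unfolding D_def by (intro that[of u])
qed

text \<open>The Aubin--Nitsche duality argument, used twice: it makes the Ritz error of second order in \<open>L\<^sup>2\<close>,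
  which turns orthogonality of the right-hand side to the finite element space into smallness of the
  solution in \<open>H\<^sup>1\<close>.\<close>
lemma orthogonal_solution_gradient:
  assumes E: "smoothing_constant \<Omega> C" and conf: "conforming_approximation \<gamma> k \<Omega> T"
    and S: "inverse_dirichlet_laplacian \<Omega> S"
    and reg: "\<And>q. q \<in> L2_space \<Omega> \<Longrightarrow> S q \<in> H2_space \<Omega> \<and> H2_norm \<Omega> (S q) \<le> c * L2_norm \<Omega> q"
    and r: "r \<in> L2_space \<Omega>" "\<And>w. w \<in> S0_space k \<Omega> T \<Longrightarrow> L2_inner \<Omega> r w = 0"
  shows "vec_norm \<Omega> (wgrad \<Omega> (S r)) \<le> \<bar>\<gamma>\<bar> * \<bar>c\<bar> * h * L2_norm \<Omega> r"
proof -
  define \<kappa> where "\<kappa> = \<bar>\<gamma>\<bar> * \<bar>c\<bar> * h"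
  have \<kappa>: "0 \<le> \<kappa>" using h_pos by (simp add: \<kappa>_def)
  have rb: "\<gamma> * h * H2_norm \<Omega> (S q) \<le> \<kappa> * L2_norm \<Omega> q" if q: "q \<in> L2_space \<Omega>" for q
  proof -
    have "c * L2_norm \<Omega> q \<le> \<bar>c\<bar> * L2_norm \<Omega> q" by (intro mult_right_mono) auto
    then have "H2_norm \<Omega> (S q) \<le> \<bar>c\<bar> * L2_norm \<Omega> q" using reg[OF q] by linarith
    moreover have "\<gamma> * h \<le> \<bar>\<gamma>\<bar> * h" using h_pos by (intro mult_right_mono) auto
    ultimately have "\<gamma> * h * H2_norm \<Omega> (S q) \<le> \<bar>\<gamma>\<bar> * h * (\<bar>c\<bar> * L2_norm \<Omega> q)"
      using H2_norm_nonneg[of \<Omega> "S q"] h_pos by (intro mult_mono) auto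
    then show ?thesis by (simp add: \<kappa>_def mult_ac)
  qed
  have ws: "weak_solution \<Omega> q (S q)" if "q \<in> L2_space \<Omega>" for q by (rule inverse_laplacian_weak_solution[OF S that])
  have H10: "S q \<in> H1_0_space \<Omega>" if "q \<in> L2_space \<Omega>" for q using ws[OF that] by (simp add: weak_solution_def)
  have H2: "S q \<in> H2_space \<Omega>" if "q \<in> L2_space \<Omega>" for q using reg[OF that] by blast
  define v where "v = S r"
  obtain u where u: "u \<in> S0_space k \<Omega> T"
    "\<And>w. w \<in> S0_space k \<Omega> T \<Longrightarrow> vec_inner \<Omega> (\<lambda>t. wgrad \<Omega> v t - cgrad u t) (cgrad w) = 0"
    "vec_norm \<Omega> (\<lambda>t. wgrad \<Omega> v t - cgrad u t) \<le> \<gamma> * h * H2_norm \<Omega> v"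
    by (rule ritz_projection[OF conf H2[OF r(1)] H10[OF r(1)]], rule that) (auto simp: v_def)
  define e where "e = (\<lambda>x. v x - u x)"
  have vH: "v \<in> H1_0_space \<Omega>" unfolding v_def by (rule H10[OF r(1)])
  have vL: "v \<in> L2_space \<Omega>" by (rule H1_L2[OF H1_0_H1[OF vH]])
  have uV: "u \<in> V_space k T" using u(1) S0_V by blast
  have uL: "u \<in> L2_space \<Omega>" by (rule V_space_L2[OF uV])
  have eL: "e \<in> L2_space \<Omega>" unfolding e_def by (rule lin_set_diff[OF lin_set_L2 vL uL])
  \<comment> \<open>The dual problem with the Ritz error itself as right-hand side.\<close>
  define z where "z = S e"
  obtain y where y: "y \<in> S0_space k \<Omega> T"
    "\<And>w. w \<in> S0_space k \<Omega> T \<Longrightarrow> vec_inner \<Omega> (\<lambda>t. wgrad \<Omega> z t - cgrad y t) (cgrad w) = 0"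
    "vec_norm \<Omega> (\<lambda>t. wgrad \<Omega> z t - cgrad y t) \<le> \<gamma> * h * H2_norm \<Omega> z"
    by (rule ritz_projection[OF conf H2[OF eL] H10[OF eL]], rule that) (auto simp: z_def)
  have gL: "wgrad \<Omega> v \<in> vec_L2 \<Omega>" "wgrad \<Omega> z \<in> vec_L2 \<Omega>" "cgrad u \<in> vec_L2 \<Omega>" "cgrad y \<in> vec_L2 \<Omega>"
    using wgrad_vec_L2[OF H1_0_H1] vH H10[OF eL] cgrad_vec_L2[OF subsetD[OF S0_V]] u(1) y(1) by (auto simp: z_def)
  define D where "D = (\<lambda>t. wgrad \<Omega> v t - cgrad u t)"
  define D' where "D' = (\<lambda>t. wgrad \<Omega> z t - cgrad y t)"
  have DL: "D \<in> vec_L2 \<Omega>" "D' \<in> vec_L2 \<Omega>" unfolding D_def D'_def using lin_set_diff[OF lin_set_vec] gL by blast+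
  obtain p where p: "\<And>K. K \<in> T \<Longrightarrow> p K \<in> Q_polys k" "u = pw p" "C1_pieces p"
    by (rule V_space_repr[OF uV], rule that) auto
  \<comment> \<open>\<open>green_pw\<close> tests the dual solution with \<open>u\<close>;
    orthogonality of \<open>D\<close> to conforming gradients then allows \<open>y\<close> to be
    subtracted, which makes both factors of first order in \<open>h\<close>.\<close>
  have "L2_inner \<Omega> e e = vec_inner \<Omega> D' D"
  proof -
    have "L2_inner \<Omega> e e = L2_inner \<Omega> e v - L2_inner \<Omega> e u"
      using L2_inner_comb(3)[OF vL uL eL] by (simp add: e_def L2_inner_commute)
    moreover have "vec_inner \<Omega> (wgrad \<Omega> z) (wgrad \<Omega> v) = L2_inner \<Omega> e v"
      using ws[OF eL] vH by (simp add: weak_solution_def z_def)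
    moreover have "vec_inner \<Omega> (wgrad \<Omega> z) (cgrad u) = L2_inner \<Omega> e u"
      unfolding p(2) z_def by (rule green_pw[OF E ws[OF eL] eL p(3) S0_jump_energy[OF u(1)[unfolded p(2)] p(3)]])
    ultimately have "L2_inner \<Omega> e e = vec_inner \<Omega> (wgrad \<Omega> z) D"
      unfolding D_def using vec_inner_diff_right[OF gL(1,3,2)] by simp
    moreover have "vec_inner \<Omega> D' D = vec_inner \<Omega> (wgrad \<Omega> z) D - vec_inner \<Omega> (cgrad y) D"
      unfolding D'_def using semi_inner_left[OF semi_inner_vec gL(2,4) DL(1), of "-1"] by simp
    moreover have "vec_inner \<Omega> (cgrad y) D = 0"
      using u(2)[OF y(1)] vec_inner_sym[OF gL(4) DL(1)] by (simp add: D_def)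
    ultimately show ?thesis by simp
  qed
  then have "(L2_norm \<Omega> e)\<^sup>2 \<le> vec_norm \<Omega> D' * vec_norm \<Omega> D"
    using vec_inner_le[OF DL(2,1)] by (simp add: L2_norm_sq_inner)
  also have "\<dots> \<le> (\<kappa> * L2_norm \<Omega> e) * (\<kappa> * L2_norm \<Omega> r)"
  proof (intro mult_mono)
    show "vec_norm \<Omega> D' \<le> \<kappa> * L2_norm \<Omega> e" using y(3) rb[OF eL] by (simp add: D'_def z_def)
    show "vec_norm \<Omega> D \<le> \<kappa> * L2_norm \<Omega> r" using u(3) rb[OF r(1)] by (simp add: D_def v_def)
  qed (use \<kappa> semi_inner_ge0[OF semi_inner_vec DL(1)] in auto)
  finally have "L2_norm \<Omega> e * L2_norm \<Omega> e \<le> (\<kappa>\<^sup>2 * L2_norm \<Omega> r) * L2_norm \<Omega> e"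
    by (simp add: power2_eq_square mult_ac)
  then have en: "L2_norm \<Omega> e \<le> \<kappa>\<^sup>2 * L2_norm \<Omega> r"
    using L2_norm_nonneg[of \<Omega> e] by (cases "L2_norm \<Omega> e = 0") (auto simp: mult_le_cancel_right order_antisym_conv)
  \<comment> \<open>Because \<open>r\<close> is orthogonal to \<open>u\<close>, the energy of
    \<open>v\<close> equals the product of \<open>r\<close> with the Ritz error, which is of second
    order in L2.\<close>
  have "vec_inner \<Omega> (wgrad \<Omega> v) (wgrad \<Omega> v) = L2_inner \<Omega> r v"
    using ws[OF r(1)] vH by (simp add: weak_solution_def v_def)
  also have "\<dots> = L2_inner \<Omega> r e"
    using L2_inner_comb(3)[OF vL uL r(1)] r(2)[OF u(1)] by (simp add: e_def L2_inner_commute)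
  also have "\<dots> \<le> L2_norm \<Omega> r * L2_norm \<Omega> e" using L2_inner_le[OF r(1) eL] by simp
  also have "\<dots> \<le> L2_norm \<Omega> r * (\<kappa>\<^sup>2 * L2_norm \<Omega> r)" by (intro mult_left_mono en) simp
  also have "\<dots> = (\<kappa> * L2_norm \<Omega> r)\<^sup>2" by (simp add: power2_eq_square mult_ac)
  finally have "vec_norm \<Omega> (wgrad \<Omega> v) \<le> \<kappa> * L2_norm \<Omega> r" using \<kappa> by (intro real_le_lsqrt) auto
  then show ?thesis by (simp add: \<kappa>_def v_def)
qed

text \<open>In the factor, 1 stems from the smoothing error, and the other summand from pairing the
  two gradients: the \<open>h\<close> from \<open>orthogonal_solution_gradient\<close> cancels the
  1/h in the gradient of \<psi>, and sqrt 3 counts its components.\<close>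

lemma continuous_L2_error:
  assumes E: "smoothing_constant \<Omega> C" and conf: "conforming_approximation \<gamma> k \<Omega> T"
    and S: "inverse_dirichlet_laplacian \<Omega> S"
    and reg: "\<And>q. q \<in> L2_space \<Omega> \<Longrightarrow> S q \<in> H2_space \<Omega> \<and> H2_norm \<Omega> (S q) \<le> c * L2_norm \<Omega> q"
    and q: "q \<in> V_space k T"
  shows "sqn (\<lambda>x. q x - L2_projection \<Omega> (S0_space k \<Omega> T) q x)
    \<le> C * (2 + 2 * real (cell_count * N)) * (1 + \<bar>\<gamma>\<bar> * \<bar>c\<bar> * sqrt 3)\<^sup>2 * h\<^sup>2 * (H1h_norm \<Omega> T q)\<^sup>2"
proof -
  define P where "P = L2_projection \<Omega> (S0_space k \<Omega> T) q"
  define r where "r = (\<lambda>x. q x - P x)"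
  define \<kappa> where "\<kappa> = \<bar>\<gamma>\<bar> * \<bar>c\<bar>"
  have qL: "q \<in> L2_space \<Omega>" by (rule V_space_L2[OF q])
  have P: "P \<in> S0_space k \<Omega> T" "\<And>w. w \<in> S0_space k \<Omega> T \<Longrightarrow> L2_inner \<Omega> r w = 0"
    using L2_projection_spec[OF lin_set_S0 S0_V qL] by (auto simp: P_def r_def)
  have PV: "P \<in> V_space k T" using P(1) S0_V by blast
  have rV: "r \<in> V_space k T" unfolding r_def by (rule lin_set_diff[OF lin_set_V q PV])
  have rL: "r \<in> L2_space \<Omega>" and PL: "P \<in> L2_space \<Omega>" using V_space_L2 rV PV by auto
  have rs: "(L2_norm \<Omega> r)\<^sup>2 = sqn r" by (rule L2_norm_sqn[OF V_space_bcs[OF rV] V_space_off_dom[OF rV]])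
  obtain p where p: "\<And>K. K \<in> T \<Longrightarrow> p K \<in> Q_polys k" "q = pw p" "C1_pieces p"
    by (rule V_space_repr[OF q], rule that) auto
  define A where "A = (2 + 2 * real (cell_count * N)) * h\<^sup>2 * energy p"
  have bq: "bcs q" by (rule V_space_bcs[OF q])
  have tm: "tmod q h A" using tmod_energy[OF p(3)] by (simp add: A_def p(2))
  obtain \<psi> where \<psi>: "test_function \<Omega> \<psi>" "sqn (\<lambda>x. \<psi> x - q x) \<le> C * A" "\<And>m. sqn (partial_deriv m \<psi>) \<le> C * A / h\<^sup>2"
    using smoothing_constantD[OF E bq _ h_pos tm] V_space_off_dom[OF q] by blast
  have CA: "0 \<le> C * A" using \<psi>(2) sqn_nonneg order_trans by blast
  have \<psi>L: "\<psi> \<in> L2_space \<Omega>" by (rule test_function_L2[OF open_dom bounded_dom \<psi>(1)])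
  have dL: "(\<lambda>x. \<psi> x - q x) \<in> L2_space \<Omega>" by (rule lin_set_diff[OF lin_set_L2 \<psi>L qL])
  have d: "L2_norm \<Omega> (\<lambda>x. \<psi> x - q x) \<le> sqrt (C * A)"
  proof -
    have "L2_norm \<Omega> (\<lambda>x. \<psi> x - q x) \<le> sqrt (sqn (\<lambda>x. \<psi> x - q x))"
      by (intro L2_norm_le_sqn bcs_diff test_function_bcs[OF \<psi>(1)] bq)
    also have "\<dots> \<le> sqrt (C * A)" using \<psi>(2) by simp
    finally show ?thesis .
  qed
  have g\<psi>: "vec_norm \<Omega> (pgrad \<psi>) \<le> sqrt 3 * sqrt (C * A) / h"
  proof -
    have "vec_inner \<Omega> (pgrad \<psi>) (pgrad \<psi>) = (\<Sum>i\<in>UNIV. (L2_norm \<Omega> (partial_deriv i \<psi>))\<^sup>2)"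
      by (simp add: vec_inner_def pgrad_def L2_norm_sq_inner)
    also have "\<dots> = (\<Sum>i\<in>UNIV. sqn (partial_deriv i \<psi>))"
      using test_function_partial[OF \<psi>(1)] by (intro sum.cong refl L2_norm_sqn test_function_bcs) (auto intro: test_function_outside)
    also have "\<dots> \<le> (\<Sum>i\<in>(UNIV::3 set). C * A / h\<^sup>2)" by (intro sum_mono \<psi>(3))
    also have "\<dots> = 3 * (C * A) / h\<^sup>2" by simp
    finally have "vec_norm \<Omega> (pgrad \<psi>) \<le> sqrt (3 * (C * A) / h\<^sup>2)" by simp
    also have "\<dots> = sqrt 3 * sqrt (C * A) / h" using h_pos by (simp add: real_sqrt_divide real_sqrt_mult)
    finally show ?thesis .
  qed
  have ws: "weak_solution \<Omega> r (S r)" by (rule inverse_laplacian_weak_solution[OF S rL])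
  have wL: "wgrad \<Omega> (S r) \<in> vec_L2 \<Omega>" using ws wgrad_vec_L2[OF H1_0_H1] by (auto simp: weak_solution_def)
  \<comment> \<open>The projection is itself conforming, hence orthogonal to the error.\<close>
  have "L2_inner \<Omega> r r = L2_inner \<Omega> r q"
    using L2_inner_comb(3)[OF qL PL rL] P(2)[OF P(1)] by (simp add: r_def L2_inner_commute)
  also have "\<dots> = L2_inner \<Omega> r \<psi> - L2_inner \<Omega> r (\<lambda>x. \<psi> x - q x)"
    using L2_inner_comb(3)[OF \<psi>L qL rL] by (simp add: L2_inner_commute)
  also have "L2_inner \<Omega> r \<psi> = vec_inner \<Omega> (wgrad \<Omega> (S r)) (pgrad \<psi>)"
    by (rule weak_solution_test[OF open_dom bounded_dom ws \<psi>(1), symmetric])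
  also have "\<dots> - L2_inner \<Omega> r (\<lambda>x. \<psi> x - q x)
      \<le> vec_norm \<Omega> (wgrad \<Omega> (S r)) * vec_norm \<Omega> (pgrad \<psi>) + L2_norm \<Omega> r * L2_norm \<Omega> (\<lambda>x. \<psi> x - q x)"
    using vec_inner_le[OF wL pgrad_vec_L2[OF open_dom bounded_dom \<psi>(1)]] L2_inner_le[OF rL dL] by linarith
  also have "\<dots> \<le> (\<kappa> * h * L2_norm \<Omega> r) * (sqrt 3 * sqrt (C * A) / h) + L2_norm \<Omega> r * sqrt (C * A)"
  proof (intro add_mono mult_mono mult_left_mono g\<psi> d)
    show "vec_norm \<Omega> (wgrad \<Omega> (S r)) \<le> \<kappa> * h * L2_norm \<Omega> r"
      unfolding \<kappa>_def by (rule orthogonal_solution_gradient[OF E conf S reg rL P(2)])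
    show "0 \<le> vec_norm \<Omega> (pgrad \<psi>)"
      using semi_inner_ge0[OF semi_inner_vec pgrad_vec_L2[OF open_dom bounded_dom \<psi>(1)]] by simp
  qed (use h_pos in \<open>auto simp: \<kappa>_def\<close>)
  also have "\<dots> = (1 + \<kappa> * sqrt 3) * sqrt (C * A) * L2_norm \<Omega> r" using h_pos by (simp add: field_simps)
  finally have "L2_norm \<Omega> r * L2_norm \<Omega> r \<le> (1 + \<kappa> * sqrt 3) * sqrt (C * A) * L2_norm \<Omega> r"
    by (simp add: L2_norm_sq_inner[symmetric] power2_eq_square)
  moreover have \<kappa>0: "0 \<le> 1 + \<kappa> * sqrt 3" by (simp add: \<kappa>_def)
  ultimately have "L2_norm \<Omega> r \<le> (1 + \<kappa> * sqrt 3) * sqrt (C * A)"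
    using CA L2_norm_nonneg[of \<Omega> r] by (cases "L2_norm \<Omega> r = 0") (auto simp: mult_le_cancel_right simp del: L2_norm_nonneg)
  then have "sqn r \<le> ((1 + \<kappa> * sqrt 3) * sqrt (C * A))\<^sup>2" unfolding rs[symmetric] by (intro power_mono) auto
  also have "\<dots> = (1 + \<kappa> * sqrt 3)\<^sup>2 * (C * A)" using CA by (simp add: power_mult_distrib)
  also have "\<dots> = C * (2 + 2 * real (cell_count * N)) * (1 + \<bar>\<gamma>\<bar> * \<bar>c\<bar> * sqrt 3)\<^sup>2 * h\<^sup>2 * energy p"
    by (simp add: A_def \<kappa>_def mult_ac)
  finally show ?thesis using energy_H1h[OF p(3)] by (simp add: r_def P_def p(2))
qed

end

theorem lemma3p5:
  fixes \<Omega> :: "(real^3) set" and k N :: nat and \<rho> \<gamma> :: real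
  assumes "bounded_lipschitz_domain \<Omega>"
    and "H2_regular \<Omega>"
    and "0 < \<rho>"
  shows "\<exists>C>0. \<forall>T. polyhedral_mesh \<Omega> T \<and> shape_regular \<rho> N T \<and> quasi_uniform \<rho> T \<longrightarrow>
           (\<forall>\<beta>\<in>{0, 1}. (\<beta> = 0 \<and> 1 \<le> k \<longrightarrow> conforming_approximation \<gamma> k \<Omega> T) \<longrightarrow>
             (\<forall>q\<in>V_space k T. H1h_norm \<Omega> T (S_proj \<beta> k \<Omega> T q) \<le> C * H1h_norm \<Omega> T q))"
proof -
  have dom: "open \<Omega>" "bounded \<Omega>" "\<Omega> \<noteq> {}" using assms(1) by (auto simp: bounded_lipschitz_domain_def)
  obtain V where V: "escape_vectors \<Omega> V" using lipschitz_escape_vectors[OF assms(1)] by blast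
  obtain C1 where C1: "\<forall>f \<delta> A. bcs f \<longrightarrow> (\<forall>x. x \<notin> \<Omega> \<longrightarrow> f x = 0) \<longrightarrow> 0 < \<delta> \<longrightarrow> tmod f \<delta> A \<longrightarrow>
      sqn (\<lambda>x. indicator {x. infdist x (- \<Omega>) < 4 * \<delta>} x * f x) \<le> C1 * A"
    using strip_bound[OF V] by blast
  obtain CE where CE: "smoothing_constant \<Omega> CE"
    using test_function_approx[OF V dom(1,2)] unfolding smoothing_constant_def by blast
  obtain CI where CI: "inverse_constant k \<rho> CI" using inverse_constant_exists[OF assms(3)] by blast
  obtain S c where S: "inverse_dirichlet_laplacian \<Omega> S"
    and reg: "\<And>q. q \<in> L2_space \<Omega> \<Longrightarrow> S q \<in> H2_space \<Omega> \<and> H2_norm \<Omega> (S q) \<le> c * L2_norm \<Omega> q"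
    using assms(2) unfolding H2_regular_def by blast
  \<comment> \<open>The locale constants are applied to \<rho> and \<open>N\<close> outside any
    mesh, which is what makes the bound uniform in the mesh.\<close>
  define M where "M = 2 + 2 * real (fem_mesh.cell_count \<rho> * N)"
  define F where "F = fem_mesh.inverse_factor \<rho> N CI"
  define D1 where "D1 = sqrt (2 + 2 * (F * (C1 * M)))"
  define D0 where "D0 = sqrt (2 + 2 * (F * (CE * M * (1 + \<bar>\<gamma>\<bar> * \<bar>c\<bar> * sqrt 3)\<^sup>2)))"
  \<comment> \<open>The absolute values make \<open>C\<close> positive and an upper bound for 0,
    \<open>D0\<close> and \<open>D1\<close>, the factors of the three cases below.\<close>
  define C where "C = 1 + \<bar>D0\<bar> + \<bar>D1\<bar>"
  have "H1h_norm \<Omega> T (S_proj \<beta> k \<Omega> T q) \<le> C * H1h_norm \<Omega> T q"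
    if T: "polyhedral_mesh \<Omega> T" "shape_regular \<rho> N T" "quasi_uniform \<rho> T" and \<beta>: "\<beta> \<in> {0, 1 :: nat}"
      and conf: "\<beta> = 0 \<and> 1 \<le> k \<longrightarrow> conforming_approximation \<gamma> k \<Omega> T" and q: "q \<in> V_space k T" for T \<beta> q
  proof -
    have "\<forall>K\<in>T. \<exists>\<H>. finite \<H> \<and> card \<H> \<le> N \<and> (\<forall>P\<in>\<H>. is_plane P) \<and> frontier K \<subseteq> \<Union>\<H>"
      using T(2) unfolding shape_regular_def by blast
    then obtain H where H: "\<forall>K\<in>T. finite (H K) \<and> card (H K) \<le> N \<and> (\<forall>P\<in>H K. is_plane P) \<and> frontier K \<subseteq> \<Union>(H K)"
      by (rule bchoice[THEN exE])
    interpret fem_mesh \<Omega> T H \<rho> N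
      using dom T H assms(3) by unfold_locales (auto simp: shape_regular_def quasi_uniform_def)
    have n0: "0 \<le> H1h_norm \<Omega> T q"
    proof -
      obtain p where p: "\<And>K. K \<in> T \<Longrightarrow> p K \<in> Q_polys k" "q = pw p" "C1_pieces p"
        by (rule V_space_repr[OF q], rule that) auto
      show ?thesis unfolding p(2) by (rule energy_H1h(2)[OF p(3)])
    qed
    have qL: "q \<in> L2_space \<Omega>" by (rule V_space_L2[OF q])
    have P0: "L2_projection \<Omega> (S0_space k \<Omega> T) q \<in> S0_space k \<Omega> T" by (rule L2_projection_spec(1)[OF lin_set_S0 S0_V qL])
    have P1: "L2_projection \<Omega> (V0_space k \<Omega> T) q \<in> V_space k T"
      using L2_projection_spec(1)[OF lin_set_V0 V0_V qL] V0_V by blast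
    consider "\<beta> = 1" | "\<beta> = 0" "k = 0" | "\<beta> = 0" "1 \<le> k" using \<beta> by force
    then have "\<exists>D\<in>{0, D0, D1}. H1h_norm \<Omega> T (S_proj \<beta> k \<Omega> T q) \<le> D * H1h_norm \<Omega> T q"
    proof cases
      case 1
      have "sqn (\<lambda>x. q x - L2_projection \<Omega> (V0_space k \<Omega> T) q x) \<le> C1 * (2 + 2 * real (cell_count * N)) * h\<^sup>2 * (H1h_norm \<Omega> T q)\<^sup>2"
        by (rule discontinuous_L2_error[OF _ q]) (use C1 in blast)
      from stability_from_L2_error[OF CI q P1 this] 1 show ?thesis by (simp add: S_proj_def D1_def F_def M_def)
    next
      case 2
      then show ?thesis using S0_degree_0 P0 by (simp add: S_proj_def)
    next
      case 3
      then have "conforming_approximation \<gamma> k \<Omega> T" using conf by blast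
      from stability_from_L2_error[OF CI q subsetD[OF S0_V P0] continuous_L2_error[OF CE this S reg q]] 3
      show ?thesis by (simp add: S_proj_def D0_def F_def M_def)
    qed
    then obtain D where D: "D \<in> {0, D0, D1}" "H1h_norm \<Omega> T (S_proj \<beta> k \<Omega> T q) \<le> D * H1h_norm \<Omega> T q" by blast
    note D(2)
    also have "D * H1h_norm \<Omega> T q \<le> C * H1h_norm \<Omega> T q"
      using D(1) n0 by (intro mult_right_mono) (auto simp: C_def)
    finally show ?thesis .
  qed
  moreover have "0 < C" by (simp add: C_def add_pos_nonneg)
  ultimately show ?thesis by blast
qed

end
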